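(* Let $\mathcal{C}$ be a Krull--Schmidt cluster category with a maximally mutable cluster-tilting subcategory $\mathcal{T}$. Then for every rigid object $X\in\mathcal{C}\setminus\mathcal{T}$ (i.e. $X\notin\mathcal{T}$ and $\operatorname{Ext}^1_{\mathcal{C}}(X,X)=0$) for which the $\mathcal{A}$-cluster character $\mathrm{CC}_{\mathcal{A}}^{\mathcal{T}}(X)$ is defined, $\mathrm{CC}_{\mathcal{A}}^{\mathcal{T}}(X)$ is proper Laurent in $\mathbb{K}[[\mathsf{K}_0(\mathcal{T})]]$ with respect to the basis $\{[T]:T\in\operatorname{indec}\mathcal{T}\}$; that is, every exponent $v\in\mathsf{K}_0(\mathcal{T})$ of a monomial $a^v$ occurring with non-zero coefficient in $\mathrm{CC}_{\mathcal{A}}^{\mathcal{T}}(X)$ has a negative coefficient at $[T]$ for at least one $T\in\operatorname{indec}\mathcal{T}$.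
   Context: $\mathbb{K}$ is a perfect field; categories are additive and $\mathbb{K}$-linear; $\operatorname{indec}\mathcal{A}$ is a set of representatives of the isomorphism classes of indecomposable objects of $\mathcal{A}$. Cluster categories. Extriangulated categories are those of Nakaoka--Palu: they carry a bifunctor $\operatorname{Ext}^1$, and each element of $\operatorname{Ext}^1_{\mathcal{C}}(X,Y)$ is realised by a conflation $Y\to E\to X$ (an inflation followed by a deflation). Exact categories, and triangulated categories with $\operatorname{Ext}^1(X,Y)=\operatorname{Hom}(X,\Sigma Y)$, are examples. An object $P$ is projective if $\operatorname{Ext}^1(P,-)=0$ and injective if $\operatorname{Ext}^1(-,P)=0$; $\mathcal{C}$ is Frobenius if it has enough projectives and enough injectives and these coincide. For a full additively closed subcategory $\mathcal{P}$ of projective-injectives, the additive quotient $\mathcal{C}/\mathcal{P}$ is extriangulated with $\operatorname{Ext}^1_{\mathcal{C}/\mathcal{P}}=\operatorname{Ext}^1_{\mathcal{C}}$ and conflations the images of those of $\mathcal{C}$; $\mathcal{C}$ is algebraic if it is equivalent, as an extriangulated category, to such a quotient $\mathcal{E}/\mathcal{P}$ of an exact category $\mathcal{E}$. If $\mathcal{C}$ is Frobenius, $\underline{\mathcal{C}}$ denotes its quotient by all projectives, which is triangulated with suspension $\Sigma$. A right $\mathcal{T}$-approximation of $X$ is a map $T_0\to X$ with $T_0\in\mathcal{T}$ through which every map from an object of $\mathcal{T}$ to $X$ factors; left approximations are dual. A full subcategory $\mathcal{T}\subseteq\mathcal{C}$ is cluster-tilting if $\mathcal{T}=\{X:\operatorname{Ext}^1(T,X)=0\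 \forall T\in\mathcal{T}\}=\{X:\operatorname{Ext}^1(X,T)=0\ \forall T\in\mathcal{T}\}$ and every object of $\mathcal{C}$ has a left $\mathcal{T}$-approximation which is an inflation and a right $\mathcal{T}$-approximation which is a deflation. A cluster category is an idempotent complete algebraic Frobenius extriangulated category $\mathcal{C}$ having a cluster-tilting subcategory and such that $\underline{\mathcal{C}}$ is Hom-finite and $2$-Calabi--Yau (functorially $\operatorname{Hom}(X,Y)\cong\operatorname{Hom}_{\mathbb{K}}(\operatorname{Hom}(Y,\Sigma^2X),\mathbb{K})$). $\underline{\mathcal{T}}$ is the image of $\mathcal{T}$ in $\underline{\mathcal{C}}$. Mutation. For $T\in\operatorname{indec}\mathcal{T}$, $\mathcal{T}\setminus T$ is the additively closed subcategory with indecomposables $\operatorname{indec}\mathcal{T}\setminus\{T\}$. $T$ is mutable in $\mathcal{T}$ if there is an indecomposable $T^*\not\cong T$ such that $\operatorname{add}(\mathcal{T}\setminus T\cup\{T^*\})$ is cluster-tilting and there are non-split conflations $T^*\to T^+\to T$ and $T\to T^-\to T^*$ in which $T^+\to T$ and $T\to T^-$ are right and left $(\mathcal{T}\setminus T)$-approximations. $\mathcal{T}$ is maximally mutable if all its non-projective indecomposables are mutable. Index, coindex, $\beta$. $\mathsf{K}_0(\mathcal{T})$ is the Grothendieck group of $\mathcal{T}$ with its split exact structure. For $X\in\mathcal{C}$ there are conflations $K\to R\to X$ and $X\to L\to C$ with $K,R,L,C\in\mathcal{T}$; put $\operatorname{ind}_{\mathcal{C}}^{\mathcal{T}}[X]=[R]-[K]$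 and $\operatorname{coind}_{\mathcal{C}}^{\mathcal{T}}[X]=[L]-[C]$ in $\mathsf{K}_0(\mathcal{T})$ (independent of choices). A $\mathcal{T}$-module is a contravariant $\mathbb{K}$-linear functor $\mathcal{T}\to\operatorname{Mod}\mathbb{K}$ (a $\underline{\mathcal{T}}$-module is one vanishing on projectives); $\operatorname{fd}$ denotes those with finite-dimensional values, non-zero on only finitely many indecomposables. $\mathsf{E}^{\mathcal{T}}X=\operatorname{Ext}^1_{\mathcal{C}}(-,X)|_{\mathcal{T}}$, a $\underline{\mathcal{T}}$-module with finite-dimensional values. For $\mathcal{T}$ maximally mutable every $M\in\operatorname{fd}\underline{\mathcal{T}}$ is isomorphic to some $\mathsf{E}^{\mathcal{T}}X$, and $\beta_{\mathcal{T}}\colon\mathsf{K}_0(\operatorname{fd}\underline{\mathcal{T}})\to\mathsf{K}_0(\mathcal{T})$ is the well-defined homomorphism with $\beta_{\mathcal{T}}[\mathsf{E}^{\mathcal{T}}X]=\operatorname{coind}_{\mathcal{C}}^{\mathcal{T}}[X]-\operatorname{ind}_{\mathcal{C}}^{\mathcal{T}}[X]$. Cluster character. It is assumed that $\mathbb{K}$ admits an Euler--Poincaré characteristic and one is fixed: a function $\chi$ from proper algebraic varieties over $\mathbb{K}$ to $\mathbb{Z}$ with $\chi(\mathbb{A}^n)=1$, $\chi(U)=\chi(V_1)+\chi(V_2)$ when $U=V_1\sqcup V_2$ with $V_i$ constructible, and $\chi(U)=c\,\chi(V)$ for surjective constructible $f\colon U\to V$ all of whose fibres have characteristic $c$. $\mathrm{Gr}_{[L]}(M)$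 is the projective variety parametrising submodules $L'\leq M$ with $[L']=[L]\in\mathsf{K}_0(\operatorname{fd}\underline{\mathcal{T}})$. $\mathbb{K}[[\mathsf{K}_0(\mathcal{T})]]$ is the space of possibly infinite linear combinations of symbols $a^v$, $v\in\mathsf{K}_0(\mathcal{T})$. If $\mathsf{E}^{\mathcal{T}}X\in\operatorname{fd}\underline{\mathcal{T}}$ or $\ker\beta_{\mathcal{T}}$ has finite rank, the $\mathcal{A}$-cluster character of $X$ is defined by \[\mathrm{CC}_{\mathcal{A}}^{\mathcal{T}}(X)=a^{\operatorname{ind}_{\mathcal{C}}^{\mathcal{T}}[X]}\sum_{[L]\in\mathsf{K}_0(\operatorname{fd}\underline{\mathcal{T}})}\chi(\mathrm{Gr}_{[L]}(\mathsf{E}^{\mathcal{T}}X))\,a^{\beta_{\mathcal{T}}[L]}\in\mathbb{K}[[\mathsf{K}_0(\mathcal{T})]].\] *)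

theory Defs
  imports
    "HOL-Algebra.Free_Abelian_Groups"
    "HOL-Algebra.Generated_Groups"
    "HOL-Algebra.Algebraic_Closure_Type"
    "HOL-Library.Function_Algebras"
    "HOL-Library.Nat_Bijection"
    "Jordan_Normal_Form.Determinant"
begin

no_notation Polynomials.var (\<open>X\<index>\<close>)

section \<open>Linear algebra on subspaces of a vector space\<close>

text \<open>Vector spaces which occur as values (Hom-spaces, \<open>Ext\<close>-spaces, values of modules) are
  subspaces of a type on which the field acts through an explicit scalar multiplication.\<close>

abbreviation subsp :: "('k::field \<Rightarrow> 'v::ab_group_add \<Rightarrow> 'v) \<Rightarrow> 'v set \<Rightarrow> bool" where
  "subsp \<equiv> Modules.module.subspace"

abbreviation vspan :: "('k::field \<Rightarrow> 'v::ab_group_add \<Rightarrow> 'v) \<Rightarrow> 'v set \<Rightarrow> 'v set" where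
  "vspan \<equiv> Modules.module.span"

definition is_basis :: "('k::field \<Rightarrow> 'v::ab_group_add \<Rightarrow> 'v) \<Rightarrow> 'v set \<Rightarrow> 'v set \<Rightarrow> bool" where
  "is_basis s B V \<longleftrightarrow> B \<subseteq> V \<and> \<not> Modules.module.dependent s B \<and> V \<subseteq> vspan s B"

definition fin_dim :: "('k::field \<Rightarrow> 'v::ab_group_add \<Rightarrow> 'v) \<Rightarrow> 'v set \<Rightarrow> bool" where
  "fin_dim s V \<longleftrightarrow> (\<exists>B. finite B \<and> B \<subseteq> V \<and> V \<subseteq> vspan s B)"

definition semilinear_on ::
  "('k \<Rightarrow> 'f) \<Rightarrow> ('k::field \<Rightarrow> 'v::ab_group_add \<Rightarrow> 'v) \<Rightarrow> 'v set \<Rightarrow>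
   ('f::field \<Rightarrow> 'w::ab_group_add \<Rightarrow> 'w) \<Rightarrow> 'w set \<Rightarrow> ('v \<Rightarrow> 'w) \<Rightarrow> bool" where
  "semilinear_on emb s V t W \<phi> \<longleftrightarrow>
     (\<forall>x\<in>V. \<phi> x \<in> W) \<and> (\<forall>x\<in>V. \<forall>y\<in>V. \<phi> (x + y) = \<phi> x + \<phi> y) \<and>
     (\<forall>a. \<forall>x\<in>V. \<phi> (s a x) = t (emb a) (\<phi> x))"

abbreviation linear_map_on ::
  "('k::field \<Rightarrow> 'v::ab_group_add \<Rightarrow> 'v) \<Rightarrow> 'v set \<Rightarrow>
   ('k \<Rightarrow> 'w::ab_group_add \<Rightarrow> 'w) \<Rightarrow> 'w set \<Rightarrow> ('v \<Rightarrow> 'w) \<Rightarrow> bool" where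
  "linear_map_on \<equiv> semilinear_on id"

text \<open>Every irreducible polynomial is separable.\<close>

definition perfect_field :: "'k::field itself \<Rightarrow> bool" where
  "perfect_field _ \<longleftrightarrow> (\<forall>p::'k poly. irreducible p \<longrightarrow> coprime p (pderiv p))"


section \<open>Additive linear categories\<close>

text \<open>\<open>g \<cdot> f\<close> is ``first \<open>f\<close>, then \<open>g\<close>''. \<open>Ext C Z A\<close> is $\operatorname{Ext}^1(Z,A)$; \<open>push C a\<close>
  and \<open>pull C c\<close> are its covariant and contravariant actions; \<open>Real C A B Z d x y\<close> says that
  $A \xrightarrow{x} B \xrightarrow{y} Z$ realises \<open>d \<in> Ext C Z A\<close>.\<close>

record ('k, 'o, 'm, 'e) extri =
  Ob :: "'o set"
  Hom :: "'o \<Rightarrow> 'o \<Rightarrow> 'm set"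
  idm :: "'o \<Rightarrow> 'm"
  cmp :: "'m \<Rightarrow> 'm \<Rightarrow> 'm" (infixl "\<cdot>\<index>" 70)
  scal :: "'k \<Rightarrow> 'm \<Rightarrow> 'm"
  Ext :: "'o \<Rightarrow> 'o \<Rightarrow> 'e set"
  push :: "'m \<Rightarrow> 'e \<Rightarrow> 'e"
  pull :: "'m \<Rightarrow> 'e \<Rightarrow> 'e"
  escal :: "'k \<Rightarrow> 'e \<Rightarrow> 'e"
  Real :: "'o \<Rightarrow> 'o \<Rightarrow> 'o \<Rightarrow> 'e \<Rightarrow> 'm \<Rightarrow> 'm \<Rightarrow> bool"

definition opp :: "('k, 'o, 'm, 'e) extri \<Rightarrow> ('k, 'o, 'm, 'e) extri" where
  "opp C = \<lparr> Ob = Ob C, Hom = (\<lambda>X Y. Hom C Y X), idm = idm C, cmp = (\<lambda>g f. f \<cdot>\<^bsub>C\<^esub> g),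
     scal = scal C, Ext = (\<lambda>Z A. Ext C A Z), push = pull C, pull = push C, escal = escal C,
     Real = (\<lambda>A B Z d x y. Real C Z B A d y x) \<rparr>"

text \<open>\<open>\<iota>\<close> and \<open>\<pi>\<close> are the inclusions and projections exhibiting \<open>Z\<close> as the direct sum of the list
  \<open>Xs\<close>; for \<open>Xs = []\<close> this says that \<open>Z\<close> is a zero object.\<close>

definition direct_sum_via ::
  "('k, 'o, 'm::ab_group_add, 'e) extri \<Rightarrow> 'o list \<Rightarrow> 'o \<Rightarrow> (nat \<Rightarrow> 'm) \<Rightarrow> (nat \<Rightarrow> 'm) \<Rightarrow> bool" where
  "direct_sum_via C Xs Z \<iota> \<pi> \<longleftrightarrow> set Xs \<subseteq> Ob C \<and> Z \<in> Ob C \<and>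
     (\<forall>i<length Xs. \<iota> i \<in> Hom C (Xs ! i) Z \<and> \<pi> i \<in> Hom C Z (Xs ! i)) \<and>
     (\<forall>i<length Xs. \<forall>j<length Xs. \<pi> i \<cdot>\<^bsub>C\<^esub> \<iota> j = (if i = j then idm C (Xs ! i) else 0)) \<and>
     (\<Sum>i<length Xs. \<iota> i \<cdot>\<^bsub>C\<^esub> \<pi> i) = idm C Z"

definition direct_sum ::
  "('k, 'o, 'm::ab_group_add, 'e) extri \<Rightarrow> 'o list \<Rightarrow> 'o \<Rightarrow> bool" where
  "direct_sum C Xs Z \<longleftrightarrow> (\<exists>\<iota> \<pi>. direct_sum_via C Xs Z \<iota> \<pi>)"

text \<open>Since composition and the actions on \<open>Ext\<close> do not mention objects, arrows (and extensions)
  must determine their end points; the vector space structure is shared, so this is required for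
  non-zero elements only. It is a normalisation which every category satisfies up to isomorphism.\<close>

locale additive_category =
  fixes C :: "('k::field, 'o, 'm::ab_group_add, 'e::ab_group_add) extri" (structure)
  assumes hom_vector_space: "vector_space (scal C)"
    and hom_subspace: "\<lbrakk>X \<in> Ob C; Y \<in> Ob C\<rbrakk> \<Longrightarrow> subsp (scal C) (Hom C X Y)"
    and hom_disjoint: "\<lbrakk>X \<in> Ob C; Y \<in> Ob C; X' \<in> Ob C; Y' \<in> Ob C;
        f \<in> Hom C X Y; f \<in> Hom C X' Y'; f \<noteq> 0\<rbrakk> \<Longrightarrow> X = X' \<and> Y = Y'"
    and id_in: "X \<in> Ob C \<Longrightarrow> idm C X \<in> Hom C X X"
    and comp_in: "\<lbrakk>X \<in> Ob C; Y \<in> Ob C; Z \<in> Ob C; f \<in> Hom C X Y; g \<in> Hom C Y Z\<rbrakk>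
        \<Longrightarrow> g \<cdot> f \<in> Hom C X Z"
    and comp_id_right: "\<lbrakk>X \<in> Ob C; Y \<in> Ob C; f \<in> Hom C X Y\<rbrakk> \<Longrightarrow> f \<cdot> idm C X = f"
    and comp_id_left: "\<lbrakk>X \<in> Ob C; Y \<in> Ob C; f \<in> Hom C X Y\<rbrakk> \<Longrightarrow> idm C Y \<cdot> f = f"
    and comp_assoc: "\<lbrakk>W \<in> Ob C; X \<in> Ob C; Y \<in> Ob C; Z \<in> Ob C;
        f \<in> Hom C W X; g \<in> Hom C X Y; h \<in> Hom C Y Z\<rbrakk> \<Longrightarrow> h \<cdot> (g \<cdot> f) = (h \<cdot> g) \<cdot> f"
    and comp_linear_right: "\<lbrakk>X \<in> Ob C; Y \<in> Ob C; Z \<in> Ob C; g \<in> Hom C Y Z\<rbrakk>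
        \<Longrightarrow> linear_map_on (scal C) (Hom C X Y) (scal C) (Hom C X Z) (\<lambda>f. g \<cdot> f)"
    and comp_linear_left: "\<lbrakk>X \<in> Ob C; Y \<in> Ob C; Z \<in> Ob C; f \<in> Hom C X Y\<rbrakk>
        \<Longrightarrow> linear_map_on (scal C) (Hom C Y Z) (scal C) (Hom C X Z) (\<lambda>g. g \<cdot> f)"
    and direct_sums: "set Xs \<subseteq> Ob C \<Longrightarrow> \<exists>Z. direct_sum C Xs Z"

definition is_iso :: "('k, 'o, 'm, 'e) extri \<Rightarrow> 'o \<Rightarrow> 'o \<Rightarrow> 'm \<Rightarrow> bool" where
  "is_iso C X Y f \<longleftrightarrow> f \<in> Hom C X Y \<and>
     (\<exists>g\<in>Hom C Y X. g \<cdot>\<^bsub>C\<^esub> f = idm C X \<and> f \<cdot>\<^bsub>C\<^esub> g = idm C Y)"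

definition isomorphic :: "('k, 'o, 'm, 'e) extri \<Rightarrow> 'o \<Rightarrow> 'o \<Rightarrow> bool" where
  "isomorphic C X Y \<longleftrightarrow> (\<exists>f. is_iso C X Y f)"

definition indecomposable :: "('k, 'o, 'm::ab_group_add, 'e) extri \<Rightarrow> 'o \<Rightarrow> bool" where
  "indecomposable C X \<longleftrightarrow> X \<in> Ob C \<and> idm C X \<noteq> 0 \<and>
     (\<forall>A B. direct_sum C [A, B] X \<longrightarrow> idm C A = 0 \<or> idm C B = 0)"

text \<open>\<open>I\<close> is a set of representatives of the isomorphism classes of indecomposables of the full
  subcategory on \<open>S\<close>.\<close>

definition indec_representatives ::
  "('k, 'o, 'm::ab_group_add, 'e) extri \<Rightarrow> 'o set \<Rightarrow> 'o set \<Rightarrow> bool" where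
  "indec_representatives C S I \<longleftrightarrow> I \<subseteq> {X\<in>S. indecomposable C X} \<and>
     (\<forall>X\<in>S. indecomposable C X \<longrightarrow> (\<exists>!Y. Y \<in> I \<and> isomorphic C X Y))"

definition idempotent_complete :: "('k, 'o, 'm::ab_group_add, 'e) extri \<Rightarrow> bool" where
  "idempotent_complete C \<longleftrightarrow>
     (\<forall>X\<in>Ob C. \<forall>e\<in>Hom C X X. e \<cdot>\<^bsub>C\<^esub> e = e \<longrightarrow>
        (\<exists>Y\<in>Ob C. \<exists>r\<in>Hom C X Y. \<exists>s\<in>Hom C Y X. r \<cdot>\<^bsub>C\<^esub> s = idm C Y \<and> s \<cdot>\<^bsub>C\<^esub> r = e))"

definition local_endomorphism_ring :: "('k, 'o, 'm::ab_group_add, 'e) extri \<Rightarrow> 'o \<Rightarrow> bool" where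
  "local_endomorphism_ring C X \<longleftrightarrow> idm C X \<noteq> 0 \<and>
     (\<forall>f\<in>Hom C X X. is_iso C X X f \<or> is_iso C X X (idm C X - f))"

definition krull_schmidt :: "('k, 'o, 'm::ab_group_add, 'e) extri \<Rightarrow> bool" where
  "krull_schmidt C \<longleftrightarrow>
     (\<forall>X\<in>Ob C. \<exists>Xs. direct_sum C Xs X \<and> (\<forall>Y\<in>set Xs. local_endomorphism_ring C Y))"

text \<open>Full additively closed subcategories (closed under finite direct sums and summands, hence
  under isomorphism) are given by their sets of objects.\<close>

definition additively_closed ::
  "('k, 'o, 'm::ab_group_add, 'e) extri \<Rightarrow> 'o set \<Rightarrow> bool" where
  "additively_closed C S \<longleftrightarrow> S \<subseteq> Ob C \<and>
     (\<forall>Xs Z. direct_sum C Xs Z \<longrightarrow> (Z \<in> S \<longleftrightarrow> set Xs \<subseteq> S))"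

definition add_closure ::
  "('k, 'o, 'm::ab_group_add, 'e) extri \<Rightarrow> 'o set \<Rightarrow> 'o set" where
  "add_closure C S =
     {X\<in>Ob C. \<exists>Xs Y Z. set Xs \<subseteq> S \<and> direct_sum C Xs Z \<and> direct_sum C [X, Y] Z}"

text \<open>The ideal of morphisms factoring through \<open>P\<close>; the Hom-spaces of the additive quotient
  $\mathcal{C}/\mathcal{P}$ are \<open>Hom C X Y\<close> modulo \<open>factoring C P X Y\<close>.\<close>

definition factoring ::
  "('k, 'o, 'm, 'e) extri \<Rightarrow> 'o set \<Rightarrow> 'o \<Rightarrow> 'o \<Rightarrow> 'm set" where
  "factoring C P X Y = {h \<cdot>\<^bsub>C\<^esub> g | g h Q. Q \<in> P \<and> g \<in> Hom C X Q \<and> h \<in> Hom C Q Y}"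


section \<open>Extriangulated categories\<close>

text \<open>The axioms of Nakaoka and Palu; the axioms marked ``op'' are obtained from \<open>opp C\<close>.\<close>

definition ET3 :: "('k, 'o, 'm, 'e) extri \<Rightarrow> bool" where
  "ET3 C \<longleftrightarrow> (\<forall>A B Z d x y A' B' Z' d' x' y' a b.
     Real C A B Z d x y \<longrightarrow> Real C A' B' Z' d' x' y' \<longrightarrow>
     a \<in> Hom C A A' \<longrightarrow> b \<in> Hom C B B' \<longrightarrow> b \<cdot>\<^bsub>C\<^esub> x = x' \<cdot>\<^bsub>C\<^esub> a \<longrightarrow>
     (\<exists>c\<in>Hom C Z Z'. c \<cdot>\<^bsub>C\<^esub> y = y' \<cdot>\<^bsub>C\<^esub> b \<and> push C a d = pull C c d'))"

definition ET4 :: "('k, 'o, 'm, 'e) extri \<Rightarrow> bool" where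
  "ET4 C \<longleftrightarrow> (\<forall>A B D X F \<delta> f f' \<delta>' g g'.
     Real C A B D \<delta> f f' \<longrightarrow> Real C B X F \<delta>' g g' \<longrightarrow>
     (\<exists>E d e \<delta>'' h'. E \<in> Ob C \<and> d \<in> Hom C D E \<and> e \<in> Hom C E F \<and>
        Real C A X E \<delta>'' (g \<cdot>\<^bsub>C\<^esub> f) h' \<and>
        h' \<cdot>\<^bsub>C\<^esub> g = d \<cdot>\<^bsub>C\<^esub> f' \<and> e \<cdot>\<^bsub>C\<^esub> h' = g' \<and>
        Real C D E F (push C f' \<delta>') d e \<and>
        pull C d \<delta>'' = \<delta> \<and>
        push C f \<delta>'' = pull C e \<delta>'))"

locale extriangulated_category = additive_category +
  assumes ext_vector_space: "vector_space (escal C)"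
    and ext_subspace: "\<lbrakk>Z \<in> Ob C; A \<in> Ob C\<rbrakk> \<Longrightarrow> subsp (escal C) (Ext C Z A)"
    and ext_disjoint: "\<lbrakk>Z \<in> Ob C; A \<in> Ob C; Z' \<in> Ob C; A' \<in> Ob C;
        d \<in> Ext C Z A; d \<in> Ext C Z' A'; d \<noteq> 0\<rbrakk> \<Longrightarrow> Z = Z' \<and> A = A'"
    and push_linear: "\<lbrakk>Z \<in> Ob C; A \<in> Ob C; A' \<in> Ob C; a \<in> Hom C A A'\<rbrakk>
        \<Longrightarrow> linear_map_on (escal C) (Ext C Z A) (escal C) (Ext C Z A') (push C a)"
    and pull_linear: "\<lbrakk>Z \<in> Ob C; Z' \<in> Ob C; A \<in> Ob C; c \<in> Hom C Z' Z\<rbrakk>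
        \<Longrightarrow> linear_map_on (escal C) (Ext C Z A) (escal C) (Ext C Z' A) (pull C c)"
    and push_linear_arrow: "\<lbrakk>Z \<in> Ob C; A \<in> Ob C; A' \<in> Ob C; d \<in> Ext C Z A\<rbrakk>
        \<Longrightarrow> linear_map_on (scal C) (Hom C A A') (escal C) (Ext C Z A') (\<lambda>a. push C a d)"
    and pull_linear_arrow: "\<lbrakk>Z \<in> Ob C; Z' \<in> Ob C; A \<in> Ob C; d \<in> Ext C Z A\<rbrakk>
        \<Longrightarrow> linear_map_on (scal C) (Hom C Z' Z) (escal C) (Ext C Z' A) (\<lambda>c. pull C c d)"
    and push_id: "\<lbrakk>Z \<in> Ob C; A \<in> Ob C; d \<in> Ext C Z A\<rbrakk> \<Longrightarrow> push C (idm C A) d = d"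
    and pull_id: "\<lbrakk>Z \<in> Ob C; A \<in> Ob C; d \<in> Ext C Z A\<rbrakk> \<Longrightarrow> pull C (idm C Z) d = d"
    and push_comp: "\<lbrakk>Z \<in> Ob C; A \<in> Ob C; A' \<in> Ob C; A'' \<in> Ob C; d \<in> Ext C Z A;
        a \<in> Hom C A A'; a' \<in> Hom C A' A''\<rbrakk> \<Longrightarrow> push C (a' \<cdot> a) d = push C a' (push C a d)"
    and pull_comp: "\<lbrakk>Z \<in> Ob C; Z' \<in> Ob C; Z'' \<in> Ob C; A \<in> Ob C; d \<in> Ext C Z A;
        c \<in> Hom C Z' Z; c' \<in> Hom C Z'' Z'\<rbrakk> \<Longrightarrow> pull C (c \<cdot> c') d = pull C c' (pull C c d)"
    and push_pull: "\<lbrakk>Z \<in> Ob C; Z' \<in> Ob C; A \<in> Ob C; A' \<in> Ob C; d \<in> Ext C Z A;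
        a \<in> Hom C A A'; c \<in> Hom C Z' Z\<rbrakk> \<Longrightarrow> push C a (pull C c d) = pull C c (push C a d)"
    and real_in: "Real C A B Z d x y \<Longrightarrow> A \<in> Ob C \<and> B \<in> Ob C \<and> Z \<in> Ob C \<and>
        d \<in> Ext C Z A \<and> x \<in> Hom C A B \<and> y \<in> Hom C B Z"
    and real_exists: "\<lbrakk>Z \<in> Ob C; A \<in> Ob C; d \<in> Ext C Z A\<rbrakk> \<Longrightarrow> \<exists>B x y. Real C A B Z d x y"
    and real_class: "\<lbrakk>Real C A B Z d x y; B' \<in> Ob C; x' \<in> Hom C A B'; y' \<in> Hom C B' Z\<rbrakk>
        \<Longrightarrow> Real C A B' Z d x' y' \<longleftrightarrow> (\<exists>b. is_iso C B B' b \<and> b \<cdot> x = x' \<and> y' \<cdot> b = y)"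
    and real_morphism: "\<lbrakk>Real C A B Z d x y; Real C A' B' Z' d' x' y';
        a \<in> Hom C A A'; c \<in> Hom C Z Z'; push C a d = pull C c d'\<rbrakk>
        \<Longrightarrow> \<exists>b\<in>Hom C B B'. b \<cdot> x = x' \<cdot> a \<and> y' \<cdot> b = c \<cdot> y"
    and real_zero: "direct_sum_via C [A, Z] B \<iota> \<pi> \<Longrightarrow> Real C A B Z 0 (\<iota> 0) (\<pi> 1)"
    and real_sum: "\<lbrakk>Real C A B Z d x y; Real C A' B' Z' d' x' y';
        direct_sum_via C [A, A'] A'' \<iota>A \<pi>A; direct_sum_via C [B, B'] B'' \<iota>B \<pi>B;
        direct_sum_via C [Z, Z'] Z'' \<iota>Z \<pi>Z\<rbrakk>
        \<Longrightarrow> Real C A'' B'' Z''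
              (push C (\<iota>A 0) (pull C (\<pi>Z 0) d) + push C (\<iota>A 1) (pull C (\<pi>Z 1) d'))
              (\<iota>B 0 \<cdot> x \<cdot> \<pi>A 0 + \<iota>B 1 \<cdot> x' \<cdot> \<pi>A 1)
              (\<iota>Z 0 \<cdot> y \<cdot> \<pi>B 0 + \<iota>Z 1 \<cdot> y' \<cdot> \<pi>B 1)"
    and ET3: "ET3 C" and ET3_op: "ET3 (opp C)"
    and ET4: "ET4 C" and ET4_op: "ET4 (opp C)"

definition conflation :: "('k, 'o, 'm, 'e) extri \<Rightarrow> 'o \<Rightarrow> 'o \<Rightarrow> 'o \<Rightarrow> 'm \<Rightarrow> 'm \<Rightarrow> bool" where
  "conflation C A B Z x y \<longleftrightarrow> (\<exists>d. Real C A B Z d x y)"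

definition inflation :: "('k, 'o, 'm, 'e) extri \<Rightarrow> 'o \<Rightarrow> 'o \<Rightarrow> 'm \<Rightarrow> bool" where
  "inflation C A B x \<longleftrightarrow> (\<exists>Z y. conflation C A B Z x y)"

definition deflation :: "('k, 'o, 'm, 'e) extri \<Rightarrow> 'o \<Rightarrow> 'o \<Rightarrow> 'm \<Rightarrow> bool" where
  "deflation C B Z y \<longleftrightarrow> (\<exists>A x. conflation C A B Z x y)"

definition projectives :: "('k, 'o, 'm, 'e::zero) extri \<Rightarrow> 'o set" where
  "projectives C = {P\<in>Ob C. \<forall>X\<in>Ob C. Ext C P X = {0}}"

definition injectives :: "('k, 'o, 'm, 'e::zero) extri \<Rightarrow> 'o set" where
  "injectives C = {P\<in>Ob C. \<forall>X\<in>Ob C. Ext C X P = {0}}"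

definition frobenius :: "('k, 'o, 'm, 'e::zero) extri \<Rightarrow> bool" where
  "frobenius C \<longleftrightarrow>
     (\<forall>X\<in>Ob C. \<exists>P\<in>projectives C. \<exists>y. deflation C P X y) \<and>
     (\<forall>X\<in>Ob C. \<exists>J\<in>injectives C. \<exists>x. inflation C X J x) \<and>
     projectives C = injectives C"


section \<open>Exact categories and algebraic extriangulated categories\<close>

definition is_kernel :: "('k, 'o, 'm::zero, 'e) extri \<Rightarrow> 'o \<Rightarrow> 'o \<Rightarrow> 'o \<Rightarrow> 'm \<Rightarrow> 'm \<Rightarrow> bool" where
  "is_kernel C A B Z x y \<longleftrightarrow> y \<cdot>\<^bsub>C\<^esub> x = 0 \<and>
     (\<forall>W\<in>Ob C. \<forall>f\<in>Hom C W B. y \<cdot>\<^bsub>C\<^esub> f = 0 \<longrightarrow> (\<exists>!g. g \<in> Hom C W A \<and> x \<cdot>\<^bsub>C\<^esub> g = f))"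

definition is_pushout ::
  "('k, 'o, 'm, 'e) extri \<Rightarrow> 'o \<Rightarrow> 'o \<Rightarrow> 'o \<Rightarrow> 'm \<Rightarrow> 'm \<Rightarrow> 'm \<Rightarrow> 'm \<Rightarrow> bool" where
  "is_pushout C B A' B' x a x' b \<longleftrightarrow>
     B' \<in> Ob C \<and> x' \<in> Hom C A' B' \<and> b \<in> Hom C B B' \<and> b \<cdot>\<^bsub>C\<^esub> x = x' \<cdot>\<^bsub>C\<^esub> a \<and>
     (\<forall>W\<in>Ob C. \<forall>f\<in>Hom C A' W. \<forall>g\<in>Hom C B W. g \<cdot>\<^bsub>C\<^esub> x = f \<cdot>\<^bsub>C\<^esub> a \<longrightarrow>
        (\<exists>!h. h \<in> Hom C B' W \<and> h \<cdot>\<^bsub>C\<^esub> x' = f \<and> h \<cdot>\<^bsub>C\<^esub> b = g))"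

text \<open>One half of Quillen's axioms; the other half is the same for \<open>opp E\<close>.\<close>

definition quillen_half :: "('k, 'o, 'm::zero, 'e) extri \<Rightarrow> bool" where
  "quillen_half E \<longleftrightarrow>
     (\<forall>A B Z x y. conflation E A B Z x y \<longrightarrow> is_kernel E A B Z x y) \<and>
     (\<forall>A\<in>Ob E. inflation E A A (idm E A)) \<and>
     (\<forall>A B D x x'. inflation E A B x \<longrightarrow> inflation E B D x' \<longrightarrow>
        inflation E A D (x' \<cdot>\<^bsub>E\<^esub> x)) \<and>
     (\<forall>A B A' x a. inflation E A B x \<longrightarrow> A' \<in> Ob E \<longrightarrow> a \<in> Hom E A A' \<longrightarrow>
        (\<exists>B' x' b. is_pushout E B A' B' x a x' b \<and> inflation E A' B' x'))"

text \<open>An exact category, viewed as an extriangulated category: the conflations form an exact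
  structure in the sense of Quillen, and \<open>Ext C Z A\<close> is in bijection with the equivalence
  classes of conflations from \<open>A\<close> to \<open>Z\<close>.\<close>

definition exact_category ::
  "('k::field, 'o, 'm::ab_group_add, 'e::ab_group_add) extri \<Rightarrow> bool" where
  "exact_category E \<longleftrightarrow> extriangulated_category E \<and>
     quillen_half E \<and> quillen_half (opp E) \<and>
     (\<forall>A B Z x y A' B' Z' x' y' a b c.
        conflation E A B Z x y \<longrightarrow> A' \<in> Ob E \<longrightarrow> B' \<in> Ob E \<longrightarrow> Z' \<in> Ob E \<longrightarrow>
        x' \<in> Hom E A' B' \<longrightarrow> y' \<in> Hom E B' Z' \<longrightarrow>
        is_iso E A A' a \<longrightarrow> is_iso E B B' b \<longrightarrow> is_iso E Z Z' c \<longrightarrow>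
        b \<cdot>\<^bsub>E\<^esub> x = x' \<cdot>\<^bsub>E\<^esub> a \<longrightarrow> c \<cdot>\<^bsub>E\<^esub> y = y' \<cdot>\<^bsub>E\<^esub> b \<longrightarrow> conflation E A' B' Z' x' y') \<and>
     (\<forall>A B Z x y d d'. Real E A B Z d x y \<longrightarrow> Real E A B Z d' x y \<longrightarrow> d = d')"

text \<open>A linear functor out of $\mathcal{E}/\mathcal{P}$ is a linear functor \<open>(F, \<Phi>)\<close> out of
  $\mathcal{E}$ which kills the morphisms factoring through \<open>P\<close>. Together with a natural
  isomorphism \<open>\<Gamma>\<close> of $\operatorname{Ext}^1$-bifunctors compatible with the realisations, it is an
  equivalence of extriangulated categories from $\mathcal{E}/\mathcal{P}$ to $\mathcal{C}$ if it is
  fully faithful on $\mathcal{E}/\mathcal{P}$ and dense.\<close>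

definition quotient_equivalence ::
  "('k::field, 'o2, 'm2::ab_group_add, 'e2::ab_group_add) extri \<Rightarrow> 'o2 set \<Rightarrow>
   ('k, 'o, 'm::ab_group_add, 'e::ab_group_add) extri \<Rightarrow>
   ('o2 \<Rightarrow> 'o) \<Rightarrow> ('m2 \<Rightarrow> 'm) \<Rightarrow> ('e2 \<Rightarrow> 'e) \<Rightarrow> bool" where
  "quotient_equivalence E P C F \<Phi> \<Gamma> \<longleftrightarrow>
     (\<forall>X\<in>Ob E. F X \<in> Ob C \<and> \<Phi> (idm E X) = idm C (F X)) \<and>
     (\<forall>X\<in>Ob E. \<forall>Y\<in>Ob E.
        linear_map_on (scal E) (Hom E X Y) (scal C) (Hom C (F X) (F Y)) \<Phi>) \<and>
     (\<forall>X\<in>Ob E. \<forall>Y\<in>Ob E. \<forall>Z\<in>Ob E. \<forall>f\<in>Hom E X Y. \<forall>g\<in>Hom E Y Z.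
        \<Phi> (g \<cdot>\<^bsub>E\<^esub> f) = \<Phi> g \<cdot>\<^bsub>C\<^esub> \<Phi> f) \<and>
     (\<forall>X\<in>Ob E. \<forall>Y\<in>Ob E. \<Phi> ` Hom E X Y = Hom C (F X) (F Y)) \<and>
     (\<forall>X\<in>Ob E. \<forall>Y\<in>Ob E. \<forall>f\<in>Hom E X Y. \<Phi> f = 0 \<longleftrightarrow> f \<in> factoring E P X Y) \<and>
     (\<forall>Y\<in>Ob C. \<exists>X\<in>Ob E. isomorphic C (F X) Y) \<and>
     (\<forall>Z\<in>Ob E. \<forall>A\<in>Ob E. bij_betw \<Gamma> (Ext E Z A) (Ext C (F Z) (F A)) \<and>
        linear_map_on (escal E) (Ext E Z A) (escal C) (Ext C (F Z) (F A)) \<Gamma>) \<and>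
     (\<forall>Z\<in>Ob E. \<forall>A\<in>Ob E. \<forall>A'\<in>Ob E. \<forall>d\<in>Ext E Z A. \<forall>a\<in>Hom E A A'.
        \<Gamma> (push E a d) = push C (\<Phi> a) (\<Gamma> d)) \<and>
     (\<forall>Z\<in>Ob E. \<forall>Z'\<in>Ob E. \<forall>A\<in>Ob E. \<forall>d\<in>Ext E Z A. \<forall>c\<in>Hom E Z' Z.
        \<Gamma> (pull E c d) = pull C (\<Phi> c) (\<Gamma> d)) \<and>
     (\<forall>A B Z d x y. Real E A B Z d x y \<longrightarrow> Real C (F A) (F B) (F Z) (\<Gamma> d) (\<Phi> x) (\<Phi> y))"

text \<open>The argument of type \<open>itself\<close> fixes the types in which the exact category lives.\<close>

definition algebraic_extri ::
  "('o2 \<times> 'm2::ab_group_add \<times> 'e2::ab_group_add) itself \<Rightarrow>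
   ('k::field, 'o, 'm::ab_group_add, 'e::ab_group_add) extri \<Rightarrow> bool" where
  "algebraic_extri _ C \<longleftrightarrow> (\<exists>(E :: ('k, 'o2, 'm2, 'e2) extri) P F \<Phi> \<Gamma>.
     exact_category E \<and> additively_closed E P \<and> P \<subseteq> projectives E \<inter> injectives E \<and>
     quotient_equivalence E P C F \<Phi> \<Gamma>)"


section \<open>Cluster categories\<close>

abbreviation null :: "('k, 'o, 'm, 'e::zero) extri \<Rightarrow> 'o \<Rightarrow> 'o \<Rightarrow> 'm set" where
  "null C \<equiv> factoring C (projectives C)"

definition stably_hom_finite ::
  "('k::field, 'o, 'm::ab_group_add, 'e::zero) extri \<Rightarrow> bool" where
  "stably_hom_finite C \<longleftrightarrow> (\<forall>X\<in>Ob C. \<forall>Y\<in>Ob C.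
     \<exists>B. finite B \<and> B \<subseteq> Hom C X Y \<and> Hom C X Y \<subseteq> vspan (scal C) (B \<union> null C X Y))"

text \<open>The suspension of the stable category: conflations
  $X \to J \to \Sigma X$ with \<open>J\<close> injective, realising \<open>\<epsilon> X\<close>, are chosen, and the class of
  \<open>h\<close> is $\Sigma$ of the class of \<open>f\<close> if \<open>(f, h)\<close> is a morphism \<open>\<epsilon> X \<rightarrow> \<epsilon> Y\<close> of extensions.\<close>

definition suspension ::
  "('k, 'o, 'm, 'e::zero) extri \<Rightarrow> ('o \<Rightarrow> 'o) \<Rightarrow> ('o \<Rightarrow> 'e) \<Rightarrow> bool" where
  "suspension C \<Sigma> \<epsilon> \<longleftrightarrow> (\<forall>X\<in>Ob C. \<exists>J\<in>injectives C. \<exists>x y. Real C X J (\<Sigma> X) (\<epsilon> X) x y)"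

definition suspends ::
  "('k, 'o, 'm, 'e) extri \<Rightarrow> ('o \<Rightarrow> 'o) \<Rightarrow> ('o \<Rightarrow> 'e) \<Rightarrow> 'o \<Rightarrow> 'o \<Rightarrow> 'm \<Rightarrow> 'm \<Rightarrow> bool" where
  "suspends C \<Sigma> \<epsilon> X Y f h \<longleftrightarrow>
     h \<in> Hom C (\<Sigma> X) (\<Sigma> Y) \<and> push C f (\<epsilon> X) = pull C h (\<epsilon> Y)"

text \<open>The isomorphism $\operatorname{Hom}(X,Y) \to
  \operatorname{Hom}_{\mathbb{K}}(\operatorname{Hom}(Y,\Sigma^2X),\mathbb{K})$ of the stable category
  is $f \mapsto$ \<open>\<beta> X Y f\<close>; it is induced by a pairing on \<open>Hom\<close>-spaces of \<open>C\<close> which vanishes on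
  morphisms factoring through projectives. The last two clauses are naturality in \<open>Y\<close> and \<open>X\<close>.\<close>

definition stably_2_calabi_yau ::
  "('k::field, 'o, 'm::ab_group_add, 'e::zero) extri \<Rightarrow> bool" where
  "stably_2_calabi_yau C \<longleftrightarrow> (\<exists>\<Sigma> \<epsilon> (\<beta> :: 'o \<Rightarrow> 'o \<Rightarrow> 'm \<Rightarrow> 'm \<Rightarrow> 'k). suspension C \<Sigma> \<epsilon> \<and>
     (\<forall>X\<in>Ob C. \<forall>Y\<in>Ob C. let H = Hom C X Y; H' = Hom C Y (\<Sigma> (\<Sigma> X)) in
        (\<forall>f\<in>H. linear_map_on (scal C) H' (*) UNIV (\<lambda>g. \<beta> X Y f g)) \<and>
        (\<forall>g\<in>H'. linear_map_on (scal C) H (*) UNIV (\<lambda>f. \<beta> X Y f g)) \<and>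
        (\<forall>f\<in>H. \<forall>g\<in>null C Y (\<Sigma> (\<Sigma> X)). \<beta> X Y f g = 0) \<and>
        (\<forall>f\<in>H. (\<forall>g\<in>H'. \<beta> X Y f g = 0) \<longleftrightarrow> f \<in> null C X Y) \<and>
        (\<forall>\<phi>. linear_map_on (scal C) H' (*) UNIV \<phi> \<longrightarrow> (\<forall>g\<in>null C Y (\<Sigma> (\<Sigma> X)). \<phi> g = 0) \<longrightarrow>
           (\<exists>f\<in>H. \<forall>g\<in>H'. \<beta> X Y f g = \<phi> g))) \<and>
     (\<forall>X\<in>Ob C. \<forall>Y\<in>Ob C. \<forall>Y'\<in>Ob C. \<forall>u\<in>Hom C Y Y'. \<forall>f\<in>Hom C X Y. \<forall>g\<in>Hom C Y' (\<Sigma> (\<Sigma> X)).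
        \<beta> X Y' (u \<cdot>\<^bsub>C\<^esub> f) g = \<beta> X Y f (g \<cdot>\<^bsub>C\<^esub> u)) \<and>
     (\<forall>X\<in>Ob C. \<forall>X'\<in>Ob C. \<forall>Y\<in>Ob C. \<forall>v\<in>Hom C X' X. \<forall>f\<in>Hom C X Y. \<forall>g\<in>Hom C Y (\<Sigma> (\<Sigma> X')).
        \<forall>v1 v2. suspends C \<Sigma> \<epsilon> X' X v v1 \<longrightarrow> suspends C \<Sigma> \<epsilon> (\<Sigma> X') (\<Sigma> X) v1 v2 \<longrightarrow>
          \<beta> X' Y (f \<cdot>\<^bsub>C\<^esub> v) g = \<beta> X Y f (v2 \<cdot>\<^bsub>C\<^esub> g)))"

definition right_approximation ::
  "('k, 'o, 'm, 'e) extri \<Rightarrow> 'o set \<Rightarrow> 'o \<Rightarrow> 'o \<Rightarrow> 'm \<Rightarrow> bool" where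
  "right_approximation C T T0 X p \<longleftrightarrow> T0 \<in> T \<and> p \<in> Hom C T0 X \<and>
     (\<forall>T'\<in>T. \<forall>g\<in>Hom C T' X. \<exists>h\<in>Hom C T' T0. p \<cdot>\<^bsub>C\<^esub> h = g)"

definition left_approximation ::
  "('k, 'o, 'm, 'e) extri \<Rightarrow> 'o set \<Rightarrow> 'o \<Rightarrow> 'o \<Rightarrow> 'm \<Rightarrow> bool" where
  "left_approximation C T X T0 i \<longleftrightarrow> T0 \<in> T \<and> i \<in> Hom C X T0 \<and>
     (\<forall>T'\<in>T. \<forall>g\<in>Hom C X T'. \<exists>h\<in>Hom C T0 T'. h \<cdot>\<^bsub>C\<^esub> i = g)"

definition cluster_tilting :: "('k, 'o, 'm, 'e::zero) extri \<Rightarrow> 'o set \<Rightarrow> bool" where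
  "cluster_tilting C T \<longleftrightarrow>
     T = {X\<in>Ob C. \<forall>T'\<in>T. Ext C T' X = {0}} \<and>
     T = {X\<in>Ob C. \<forall>T'\<in>T. Ext C X T' = {0}} \<and>
     (\<forall>X\<in>Ob C. \<exists>L i. left_approximation C T X L i \<and> inflation C X L i) \<and>
     (\<forall>X\<in>Ob C. \<exists>R p. right_approximation C T R X p \<and> deflation C R X p)"

definition cluster_category ::
  "('o2 \<times> 'm2::ab_group_add \<times> 'e2::ab_group_add) itself \<Rightarrow>
   ('k::field, 'o, 'm::ab_group_add, 'e::ab_group_add) extri \<Rightarrow> bool" where
  "cluster_category ty C \<longleftrightarrow> extriangulated_category C \<and> idempotent_complete C \<and>
     algebraic_extri ty C \<and> frobenius C \<and> (\<exists>T. cluster_tilting C T) \<and>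
     stably_hom_finite C \<and> stably_2_calabi_yau C"


section \<open>Mutation\<close>

definition split_conflation ::
  "('k, 'o, 'm, 'e) extri \<Rightarrow> 'o \<Rightarrow> 'o \<Rightarrow> 'o \<Rightarrow> 'm \<Rightarrow> 'm \<Rightarrow> bool" where
  "split_conflation C A B Z x y \<longleftrightarrow> conflation C A B Z x y \<and>
     (\<exists>s\<in>Hom C Z B. y \<cdot>\<^bsub>C\<^esub> s = idm C Z)"

text \<open>\<open>I\<close> is a set of representatives of the indecomposables of the cluster-tilting subcategory, so
  that \<open>add_closure C (I - {T})\<close> is $\mathcal{T} \setminus T$.\<close>

definition mutable_in ::
  "('k, 'o, 'm::ab_group_add, 'e::zero) extri \<Rightarrow> 'o set \<Rightarrow> 'o \<Rightarrow> bool" where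
  "mutable_in C I T \<longleftrightarrow> (let U = add_closure C (I - {T}) in
     \<exists>T'. indecomposable C T' \<and> \<not> isomorphic C T' T \<and>
       cluster_tilting C (add_closure C (U \<union> {T'})) \<and>
       (\<exists>P x p. conflation C T' P T x p \<and> \<not> split_conflation C T' P T x p \<and>
          right_approximation C U P T p) \<and>
       (\<exists>N i y. conflation C T N T' i y \<and> \<not> split_conflation C T N T' i y \<and>
          left_approximation C U T N i))"

definition maximally_mutable ::
  "('k, 'o, 'm::ab_group_add, 'e::zero) extri \<Rightarrow> 'o set \<Rightarrow> bool" where
  "maximally_mutable C I \<longleftrightarrow> (\<forall>T\<in>I. T \<notin> projectives C \<longrightarrow> mutable_in C I T)"


section \<open>Grothendieck groups, index and coindex\<close>

text \<open>The Grothendieck group on a class \<open>S\<close> of objects with short exact sequences \<open>E\<close>. Its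
  elements are cosets of formal integral combinations.\<close>

definition K0_relations ::
  "'a set \<Rightarrow> ('a \<times> 'a \<times> 'a) set \<Rightarrow> ('a \<Rightarrow>\<^sub>0 int) set" where
  "K0_relations S E = generate (free_Abelian_group S)
     {frag_of B - frag_of A - frag_of Z | A B Z. (A, B, Z) \<in> E}"

definition K0 :: "'a set \<Rightarrow> ('a \<times> 'a \<times> 'a) set \<Rightarrow> ('a \<Rightarrow>\<^sub>0 int) set monoid" where
  "K0 S E = free_Abelian_group S Mod K0_relations S E"

definition K0_class ::
  "'a set \<Rightarrow> ('a \<times> 'a \<times> 'a) set \<Rightarrow> ('a \<Rightarrow>\<^sub>0 int) \<Rightarrow> ('a \<Rightarrow>\<^sub>0 int) set" where
  "K0_class S E c = K0_relations S E #>\<^bsub>free_Abelian_group S\<^esub> c"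

definition split_sequences ::
  "('k, 'o, 'm::ab_group_add, 'e) extri \<Rightarrow> 'o set \<Rightarrow> ('o \<times> 'o \<times> 'o) set" where
  "split_sequences C T = {(A, B, Z). A \<in> T \<and> B \<in> T \<and> Z \<in> T \<and> direct_sum C [A, Z] B}"

abbreviation K0T ::
  "('k, 'o, 'm::ab_group_add, 'e) extri \<Rightarrow> 'o set \<Rightarrow> ('o \<Rightarrow>\<^sub>0 int) set monoid" where
  "K0T C T \<equiv> K0 T (split_sequences C T)"

abbreviation K0T_class ::
  "('k, 'o, 'm::ab_group_add, 'e) extri \<Rightarrow> 'o set \<Rightarrow> ('o \<Rightarrow>\<^sub>0 int) \<Rightarrow> ('o \<Rightarrow>\<^sub>0 int) set" where
  "K0T_class C T \<equiv> K0_class T (split_sequences C T)"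

definition ind ::
  "('k, 'o, 'm::ab_group_add, 'e) extri \<Rightarrow> 'o set \<Rightarrow> 'o \<Rightarrow> ('o \<Rightarrow>\<^sub>0 int) set" where
  "ind C T X = (SOME v. \<exists>K R x y. K \<in> T \<and> R \<in> T \<and> conflation C K R X x y \<and>
     v = K0T_class C T (frag_of R - frag_of K))"

definition coind ::
  "('k, 'o, 'm::ab_group_add, 'e) extri \<Rightarrow> 'o set \<Rightarrow> 'o \<Rightarrow> ('o \<Rightarrow>\<^sub>0 int) set" where
  "coind C T X = (SOME v. \<exists>L D x y. L \<in> T \<and> D \<in> T \<and> conflation C X L D x y \<and>
     v = K0T_class C T (frag_of L - frag_of D))"

text \<open>The coefficients of \<open>v\<close> with respect to the basis given by the classes of the elements of
  \<open>I\<close>: the unique representative of the coset \<open>v\<close> which involves elements of \<open>I\<close> only.\<close>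

definition basis_coefficients :: "'o set \<Rightarrow> ('o \<Rightarrow>\<^sub>0 int) set \<Rightarrow> 'o \<Rightarrow>\<^sub>0 int" where
  "basis_coefficients I v = (THE c. c \<in> v \<and> Poly_Mapping.keys c \<subseteq> I)"


section \<open>Modules\<close>

text \<open>For a field embedding \<open>emb\<close> of $\mathbb{K}$ into \<open>'f\<close>, contravariant $\mathbb{K}$-linear
  functors from the full subcategory \<open>T\<close> to vector spaces over \<open>'f\<close>; ordinary \<open>T\<close>-modules are the
  case where \<open>emb\<close> is the identity. For \<open>f \<in> Hom C X Y\<close>, the map \<open>Act M f\<close> goes from \<open>Val M Y\<close> to
  \<open>Val M X\<close>.\<close>

record ('o, 'm, 'v) tmod =
  Val :: "'o \<Rightarrow> 'v set"
  Act :: "'m \<Rightarrow> 'v \<Rightarrow> 'v"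

definition is_module ::
  "('k::field, 'o, 'm::ab_group_add, 'e) extri \<Rightarrow> 'o set \<Rightarrow> ('k \<Rightarrow> 'f) \<Rightarrow>
   ('f::field \<Rightarrow> 'v::ab_group_add \<Rightarrow> 'v) \<Rightarrow> ('o, 'm, 'v) tmod \<Rightarrow> bool" where
  "is_module C T emb s M \<longleftrightarrow> vector_space s \<and>
     (\<forall>X\<in>T. subsp s (Val M X)) \<and>
     (\<forall>X\<in>T. \<forall>Y\<in>T. \<forall>f\<in>Hom C X Y. linear_map_on s (Val M Y) s (Val M X) (Act M f)) \<and>
     (\<forall>X\<in>T. \<forall>Y\<in>T. \<forall>v\<in>Val M Y.
        semilinear_on emb (scal C) (Hom C X Y) s (Val M X) (\<lambda>f. Act M f v)) \<and>
     (\<forall>X\<in>T. \<forall>v\<in>Val M X. Act M (idm C X) v = v) \<and>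
     (\<forall>X\<in>T. \<forall>Y\<in>T. \<forall>Z\<in>T. \<forall>f\<in>Hom C X Y. \<forall>g\<in>Hom C Y Z. \<forall>v\<in>Val M Z.
        Act M (g \<cdot>\<^bsub>C\<^esub> f) v = Act M f (Act M g v))"

text \<open>$\operatorname{fd}\underline{\mathcal{T}}$.\<close>

definition is_fd_module ::
  "('k::field, 'o, 'm::ab_group_add, 'e::zero) extri \<Rightarrow> 'o set \<Rightarrow> 'o set \<Rightarrow> ('k \<Rightarrow> 'f) \<Rightarrow>
   ('f::field \<Rightarrow> 'v::ab_group_add \<Rightarrow> 'v) \<Rightarrow> ('o, 'm, 'v) tmod \<Rightarrow> bool" where
  "is_fd_module C T I emb s M \<longleftrightarrow> is_module C T emb s M \<and>
     (\<forall>P\<in>T \<inter> projectives C. Val M P = {0}) \<and>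
     (\<forall>X\<in>T. fin_dim s (Val M X)) \<and>
     finite {X\<in>I. Val M X \<noteq> {0}}"

definition module_hom ::
  "('k, 'o, 'm, 'e) extri \<Rightarrow> 'o set \<Rightarrow>
   ('f::field \<Rightarrow> 'v::ab_group_add \<Rightarrow> 'v) \<Rightarrow> ('o, 'm, 'v) tmod \<Rightarrow>
   ('f \<Rightarrow> 'w::ab_group_add \<Rightarrow> 'w) \<Rightarrow> ('o, 'm, 'w) tmod \<Rightarrow> ('o \<Rightarrow> 'v \<Rightarrow> 'w) \<Rightarrow> bool" where
  "module_hom C T s M t N \<alpha> \<longleftrightarrow>
     (\<forall>X\<in>T. linear_map_on s (Val M X) t (Val N X) (\<alpha> X)) \<and>
     (\<forall>X\<in>T. \<forall>Y\<in>T. \<forall>f\<in>Hom C X Y. \<forall>v\<in>Val M Y. \<alpha> X (Act M f v) = Act N f (\<alpha> Y v))"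

definition module_isomorphic ::
  "('k, 'o, 'm, 'e) extri \<Rightarrow> 'o set \<Rightarrow>
   ('f::field \<Rightarrow> 'v::ab_group_add \<Rightarrow> 'v) \<Rightarrow> ('o, 'm, 'v) tmod \<Rightarrow>
   ('f \<Rightarrow> 'w::ab_group_add \<Rightarrow> 'w) \<Rightarrow> ('o, 'm, 'w) tmod \<Rightarrow> bool" where
  "module_isomorphic C T s M t N \<longleftrightarrow>
     (\<exists>\<alpha>. module_hom C T s M t N \<alpha> \<and> (\<forall>X\<in>T. bij_betw (\<alpha> X) (Val M X) (Val N X)))"

definition short_exact ::
  "('k, 'o, 'm, 'e) extri \<Rightarrow> 'o set \<Rightarrow> ('f::field \<Rightarrow> 'v::ab_group_add \<Rightarrow> 'v) \<Rightarrow>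
   ('o, 'm, 'v) tmod \<Rightarrow> ('o, 'm, 'v) tmod \<Rightarrow> ('o, 'm, 'v) tmod \<Rightarrow> bool" where
  "short_exact C T s L M N \<longleftrightarrow>
     (\<exists>\<alpha> \<gamma>. module_hom C T s L s M \<alpha> \<and> module_hom C T s M s N \<gamma> \<and>
       (\<forall>X\<in>T. inj_on (\<alpha> X) (Val L X) \<and> \<gamma> X ` Val M X = Val N X \<and>
          \<alpha> X ` Val L X = {v\<in>Val M X. \<gamma> X v = 0}))"

text \<open>Every module with finite-dimensional values is isomorphic to one whose values are subspaces
  of the space of sequences, so the latter suffice to form
  $\mathsf{K}_0(\operatorname{fd}\underline{\mathcal{T}})$.\<close>

definition seq_scale :: "'f::field \<Rightarrow> (nat \<Rightarrow> 'f) \<Rightarrow> nat \<Rightarrow> 'f" where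
  "seq_scale a v = (\<lambda>i. a * v i)"

definition fd_modules ::
  "('k::field, 'o, 'm::ab_group_add, 'e::zero) extri \<Rightarrow> 'o set \<Rightarrow> 'o set \<Rightarrow> ('k \<Rightarrow> 'f::field) \<Rightarrow>
   ('o, 'm, nat \<Rightarrow> 'f) tmod set" where
  "fd_modules C T I emb = {M. is_fd_module C T I emb seq_scale M}"

definition fd_sequences ::
  "('k::field, 'o, 'm::ab_group_add, 'e::zero) extri \<Rightarrow> 'o set \<Rightarrow> 'o set \<Rightarrow> ('k \<Rightarrow> 'f::field) \<Rightarrow>
   (('o, 'm, nat \<Rightarrow> 'f) tmod \<times> ('o, 'm, nat \<Rightarrow> 'f) tmod \<times> ('o, 'm, nat \<Rightarrow> 'f) tmod) set" where
  "fd_sequences C T I emb = {(L, M, N). L \<in> fd_modules C T I emb \<and> M \<in> fd_modules C T I emb \<and>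
     N \<in> fd_modules C T I emb \<and> short_exact C T seq_scale L M N}"

abbreviation K0fd ::
  "('k::field, 'o, 'm::ab_group_add, 'e::zero) extri \<Rightarrow> 'o set \<Rightarrow> 'o set \<Rightarrow> ('k \<Rightarrow> 'f::field) \<Rightarrow>
   (('o, 'm, nat \<Rightarrow> 'f) tmod \<Rightarrow>\<^sub>0 int) set monoid" where
  "K0fd C T I emb \<equiv> K0 (fd_modules C T I emb) (fd_sequences C T I emb)"

definition fd_class ::
  "('k::field, 'o, 'm::ab_group_add, 'e::zero) extri \<Rightarrow> 'o set \<Rightarrow> 'o set \<Rightarrow> ('k \<Rightarrow> 'f::field) \<Rightarrow>
   ('f \<Rightarrow> 'v::ab_group_add \<Rightarrow> 'v) \<Rightarrow> ('o, 'm, 'v) tmod \<Rightarrow>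
   (('o, 'm, nat \<Rightarrow> 'f) tmod \<Rightarrow>\<^sub>0 int) set" where
  "fd_class C T I emb s M = (SOME v. \<exists>N\<in>fd_modules C T I emb.
     module_isomorphic C T s M seq_scale N \<and>
     v = K0_class (fd_modules C T I emb) (fd_sequences C T I emb) (frag_of N))"

definition E_module :: "('k, 'o, 'm, 'e) extri \<Rightarrow> 'o \<Rightarrow> ('o, 'm, 'e) tmod" where
  "E_module C X = \<lparr> Val = (\<lambda>T. Ext C T X), Act = pull C \<rparr>"

definition beta ::
  "('k::field, 'o, 'm::ab_group_add, 'e::ab_group_add) extri \<Rightarrow> 'o set \<Rightarrow> 'o set \<Rightarrow>
   (('o, 'm, nat \<Rightarrow> 'k) tmod \<Rightarrow>\<^sub>0 int) set \<Rightarrow> ('o \<Rightarrow>\<^sub>0 int) set" where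
  "beta C T I = (SOME b. b \<in> hom (K0fd C T I id) (K0T C T) \<and>
     (\<forall>X\<in>Ob C. is_fd_module C T I id (escal C) (E_module C X) \<longrightarrow>
        b (fd_class C T I id (escal C) (E_module C X)) =
          coind C T X \<otimes>\<^bsub>K0T C T\<^esub> inv\<^bsub>K0T C T\<^esub> ind C T X))"


section \<open>Varieties and Euler--Poincare characteristics\<close>

text \<open>Varieties over a field are described by their points over an algebraic closure \<open>'f\<close>; \<open>k\<close> is
  the subfield over which they are defined. All varieties needed are constructible subsets of
  projective spaces. The affine space of dimension \<open>n\<close> consists of the sequences supported on
  \<open>{..<n}\<close>.\<close>

definition affine_space :: "nat \<Rightarrow> (nat \<Rightarrow> 'f::field) set" where
  "affine_space n = {v. \<forall>i\<ge>n. v i = 0}"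

inductive_set poly_functions :: "'f::field set \<Rightarrow> nat \<Rightarrow> ((nat \<Rightarrow> 'f) \<Rightarrow> 'f) set"
  for k :: "'f set" and n :: nat where
  const: "a \<in> k \<Longrightarrow> (\<lambda>v. a) \<in> poly_functions k n"
| coord: "i < n \<Longrightarrow> (\<lambda>v. v i) \<in> poly_functions k n"
| plus: "\<lbrakk>p \<in> poly_functions k n; q \<in> poly_functions k n\<rbrakk> \<Longrightarrow> (\<lambda>v. p v + q v) \<in> poly_functions k n"
| times: "\<lbrakk>p \<in> poly_functions k n; q \<in> poly_functions k n\<rbrakk> \<Longrightarrow> (\<lambda>v. p v * q v) \<in> poly_functions k n"

inductive_set constructible :: "'f::field set \<Rightarrow> nat \<Rightarrow> (nat \<Rightarrow> 'f) set set"
  for k :: "'f set" and n :: nat where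
  locus: "p \<in> poly_functions k n \<Longrightarrow> {v \<in> affine_space n. p v = 0} \<in> constructible k n"
| compl: "A \<in> constructible k n \<Longrightarrow> affine_space n - A \<in> constructible k n"
| union: "\<lbrakk>A \<in> constructible k n; B \<in> constructible k n\<rbrakk> \<Longrightarrow> A \<union> B \<in> constructible k n"

text \<open>A point of projective space is a line with the origin removed. A projective space with \<open>n\<close>
  homogeneous coordinates is contained in the one with \<open>n + 1\<close> homogeneous coordinates.\<close>

definition proj_point :: "(nat \<Rightarrow> 'f::field) \<Rightarrow> (nat \<Rightarrow> 'f) set" where
  "proj_point v = {seq_scale a v | a. a \<noteq> 0}"

definition projective_space :: "nat \<Rightarrow> (nat \<Rightarrow> 'f::field) set set" where
  "projective_space n = {proj_point v | v. v \<in> affine_space n \<and> v \<noteq> 0}"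

definition proj_constructible :: "'f::field set \<Rightarrow> nat \<Rightarrow> (nat \<Rightarrow> 'f) set set \<Rightarrow> bool" where
  "proj_constructible k n U \<longleftrightarrow> U \<subseteq> projective_space n \<and> \<Union>U \<in> constructible k n"

text \<open>A map is constructible if its graph is.\<close>

definition constructible_map ::
  "'f::field set \<Rightarrow> nat \<Rightarrow> (nat \<Rightarrow> 'f) set set \<Rightarrow> nat \<Rightarrow> ((nat \<Rightarrow> 'f) set \<Rightarrow> (nat \<Rightarrow> 'f) set) \<Rightarrow> bool"
  where
  "constructible_map k n U m f \<longleftrightarrow>
     {w \<in> affine_space (n + m). \<exists>P\<in>U. (\<lambda>i. if i < n then w i else 0) \<in> P \<and> (\<lambda>i. w (i + n)) \<in> f P}
       \<in> constructible k (n + m)"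

text \<open>In the last clause the fibres are geometric fibres; those over points which are not rational
  over \<open>k\<close> are not defined over \<open>k\<close>, but \<open>\<chi>\<close> has a value there too.\<close>

definition euler_poincare ::
  "'f::field set \<Rightarrow> ((nat \<Rightarrow> 'f) set set \<Rightarrow> int) \<Rightarrow> bool" where
  "euler_poincare k \<chi> \<longleftrightarrow>
     (\<forall>n. \<chi> {proj_point v | v. v \<in> affine_space (Suc n) \<and> v 0 \<noteq> 0} = 1) \<and>
     (\<forall>n U V. proj_constructible k n U \<longrightarrow> proj_constructible k n V \<longrightarrow> U \<inter> V = {} \<longrightarrow>
        \<chi> (U \<union> V) = \<chi> U + \<chi> V) \<and>
     (\<forall>n m U V f c. proj_constructible k n U \<longrightarrow> proj_constructible k m V \<longrightarrow> f ` U = V \<longrightarrow>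
        constructible_map k n U m f \<longrightarrow> (\<forall>Q\<in>V. \<chi> {P\<in>U. f P = Q} = c) \<longrightarrow> \<chi> U = c * \<chi> V)"


section \<open>Quiver Grassmannians\<close>

text \<open>\<open>(N, \<eta>)\<close> is the extension of scalars of \<open>M\<close> along \<open>emb\<close>.\<close>

definition scalar_extension ::
  "('k::field, 'o, 'm::ab_group_add, 'e) extri \<Rightarrow> 'o set \<Rightarrow> ('k \<Rightarrow> 'f::field) \<Rightarrow>
   ('k \<Rightarrow> 'v::ab_group_add \<Rightarrow> 'v) \<Rightarrow> ('o, 'm, 'v) tmod \<Rightarrow>
   ('o, 'm, nat \<Rightarrow> 'f) tmod \<Rightarrow> ('o \<Rightarrow> 'v \<Rightarrow> nat \<Rightarrow> 'f) \<Rightarrow> bool" where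
  "scalar_extension C T emb s M N \<eta> \<longleftrightarrow>
     is_module C T id s M \<and> is_module C T emb seq_scale N \<and>
     (\<forall>X\<in>T. semilinear_on emb s (Val M X) seq_scale (Val N X) (\<eta> X) \<and>
        (\<exists>B. is_basis s B (Val M X) \<and> inj_on (\<eta> X) B \<and>
           is_basis seq_scale (\<eta> X ` B) (Val N X))) \<and>
     (\<forall>X\<in>T. \<forall>Y\<in>T. \<forall>f\<in>Hom C X Y. \<forall>v\<in>Val M Y. \<eta> X (Act M f v) = Act N f (\<eta> Y v))"

text \<open>The geometric points of $\mathrm{Gr}_\gamma(M)$, where \<open>N\<close> is the extension of scalars of \<open>M\<close>:
  submodules of \<open>N\<close> (given by their values) whose class is the image of \<open>\<gamma>\<close> under extension of
  scalars. The submodules of \<open>M\<close> of class \<open>\<gamma>\<close> correspond to the rational points, and if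
  $\mathbb{K}$ is algebraically closed these are all points.\<close>

definition grassmannian_points ::
  "('k::field, 'o, 'm::ab_group_add, 'e::zero) extri \<Rightarrow> 'o set \<Rightarrow> 'o set \<Rightarrow> ('k \<Rightarrow> 'f::field) \<Rightarrow>
   ('o, 'm, nat \<Rightarrow> 'f) tmod \<Rightarrow> (('o, 'm, nat \<Rightarrow> 'k) tmod \<Rightarrow>\<^sub>0 int) set \<Rightarrow>
   ('o \<Rightarrow> (nat \<Rightarrow> 'f) set) set" where
  "grassmannian_points C T I emb N \<gamma> =
     {W. (\<forall>X\<in>T. W X \<subseteq> Val N X) \<and> is_fd_module C T I emb seq_scale \<lparr>Val = W, Act = Act N\<rparr> \<and>
        (\<exists>L L' \<eta>. L \<in> fd_modules C T I id \<and> fd_class C T I id seq_scale L = \<gamma> \<and>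
           scalar_extension C T emb seq_scale L L' \<eta> \<and>
           fd_class C T I emb seq_scale \<lparr>Val = W, Act = Act N\<rparr> = fd_class C T I emb seq_scale L')}"

text \<open>The Pluecker coordinates, in increasing order of columns and indexed through
  \<open>set_encode\<close> by sets of columns, of a subspace \<open>V\<close> of the affine space of dimension \<open>n\<close>.\<close>

definition pluecker_vector :: "nat \<Rightarrow> (nat \<Rightarrow> 'f::field) list \<Rightarrow> nat \<Rightarrow> 'f" where
  "pluecker_vector n ws j =
     (if set_decode j \<subseteq> {..<n} \<and> card (set_decode j) = length ws
      then det (mat (length ws) (length ws)
        (\<lambda>(r, c). (ws ! r) (sorted_list_of_set (set_decode j) ! c)))
      else 0)"

definition pluecker :: "nat \<Rightarrow> (nat \<Rightarrow> 'f::field) set \<Rightarrow> (nat \<Rightarrow> 'f) set" where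
  "pluecker n V = proj_point (pluecker_vector n
     (SOME ws. distinct ws \<and> is_basis seq_scale (set ws) V))"

text \<open>A submodule \<open>W\<close> of \<open>N\<close> is encoded by the subspace $\bigoplus_X W(X)$ of
  $\bigoplus_X N(X)$, where \<open>X\<close> runs through the finitely many indecomposables in its support; \<open>bs\<close>
  lists a basis of the latter space.\<close>

definition total_space ::
  "('o \<times> (nat \<Rightarrow> 'f::field)) list \<Rightarrow> ('o \<Rightarrow> (nat \<Rightarrow> 'f) set) \<Rightarrow> (nat \<Rightarrow> 'f) set" where
  "total_space bs W = {w \<in> affine_space (length bs). \<forall>X\<in>fst ` set bs.
     (\<Sum>i | i < length bs \<and> fst (bs ! i) = X. seq_scale (w i) (snd (bs ! i))) \<in> W X}"

definition support :: "'o set \<Rightarrow> ('o \<Rightarrow> (nat \<Rightarrow> 'f::field) set) set \<Rightarrow> 'o set" where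
  "support I G = {X\<in>I. \<exists>W\<in>G. W X \<noteq> {0}}"

text \<open>The basis is chosen to be defined over $\mathbb{K}$, so that the Grassmannian is.\<close>

definition rational_basis ::
  "'o set \<Rightarrow> ('o, 'm, 'v) tmod \<Rightarrow> ('o, 'm, nat \<Rightarrow> 'f::field) tmod \<Rightarrow> ('o \<Rightarrow> 'v \<Rightarrow> nat \<Rightarrow> 'f) \<Rightarrow>
   ('o \<times> (nat \<Rightarrow> 'f)) list \<Rightarrow> bool" where
  "rational_basis S M N \<eta> bs \<longleftrightarrow> distinct bs \<and>
     (\<exists>B. set bs = Sigma S B \<and>
        (\<forall>X\<in>S. B X \<subseteq> \<eta> X ` Val M X \<and> is_basis seq_scale (B X) (Val N X)))"

definition quiver_grassmannian ::
  "('k::field, 'o, 'm::ab_group_add, 'e::zero) extri \<Rightarrow> 'o set \<Rightarrow> 'o set \<Rightarrow> ('k \<Rightarrow> 'f::field) \<Rightarrow>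
   ('k \<Rightarrow> 'v::ab_group_add \<Rightarrow> 'v) \<Rightarrow> ('o, 'm, 'v) tmod \<Rightarrow>
   (('o, 'm, nat \<Rightarrow> 'k) tmod \<Rightarrow>\<^sub>0 int) set \<Rightarrow> (nat \<Rightarrow> 'f) set set" where
  "quiver_grassmannian C T I emb s M \<gamma> =
     (let (N, \<eta>) = (SOME (N, \<eta>). scalar_extension C T emb s M N \<eta>);
          G = grassmannian_points C T I emb N \<gamma>;
          bs = (SOME bs. rational_basis (support I G) M N \<eta> bs)
      in (\<lambda>W. pluecker (length bs) (total_space bs W)) ` G)"


section \<open>The cluster character\<close>

definition finite_rank :: "('a, 'b) monoid_scheme \<Rightarrow> 'a set \<Rightarrow> bool" where
  "finite_rank G H \<longleftrightarrow> (\<exists>A. finite A \<and> A \<subseteq> H \<and>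
     (\<forall>x\<in>H. \<exists>n::nat. n > 0 \<and> x [^]\<^bsub>G\<^esub> n \<in> generate G A))"

definition CC_defined ::
  "('k::field, 'o, 'm::ab_group_add, 'e::ab_group_add) extri \<Rightarrow> 'o set \<Rightarrow> 'o set \<Rightarrow> 'o \<Rightarrow> bool" where
  "CC_defined C T I X \<longleftrightarrow>
     is_fd_module C T I id (escal C) (E_module C X) \<or>
     finite_rank (K0fd C T I id) (kernel (K0fd C T I id) (K0T C T) (beta C T I))"

text \<open>An element of $\mathbb{K}[[\mathsf{K}_0(\mathcal{T})]]$ is the function sending \<open>v\<close> to the
  coefficient of $a^v$. If the cluster character is defined, the sum is over a finite set.\<close>

definition CC ::
  "('k::field, 'o, 'm::ab_group_add, 'e::ab_group_add) extri \<Rightarrow> 'o set \<Rightarrow> 'o set \<Rightarrow>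
   ((nat \<Rightarrow> 'k alg_closure) set set \<Rightarrow> int) \<Rightarrow> 'o \<Rightarrow> ('o \<Rightarrow>\<^sub>0 int) set \<Rightarrow> 'k" where
  "CC C T I \<chi> X v =
     (let Gr = quiver_grassmannian C T I to_ac (escal C) (E_module C X) in
      \<Sum>\<gamma> | \<gamma> \<in> carrier (K0fd C T I id) \<and> \<chi> (Gr \<gamma>) \<noteq> 0 \<and>
            ind C T X \<otimes>\<^bsub>K0T C T\<^esub> beta C T I \<gamma> = v. of_int (\<chi> (Gr \<gamma>)))"

definition proper_laurent ::
  "('k, 'o, 'm::ab_group_add, 'e) extri \<Rightarrow> 'o set \<Rightarrow> 'o set \<Rightarrow>
   (('o \<Rightarrow>\<^sub>0 int) set \<Rightarrow> 'r::zero) \<Rightarrow> bool" where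
  "proper_laurent C T I F \<longleftrightarrow> (\<forall>v\<in>carrier (K0T C T). F v \<noteq> 0 \<longrightarrow>
     (\<exists>S\<in>I. Poly_Mapping.lookup (basis_coefficients I v) S < 0))"

end

theory Submission
  imports Defs
begin

text \<open>Let $W \subseteq \mathsf{E} Z$ be a submodule, and evaluate the dimension vector of \<open>W\<close> on the exponent
  $\operatorname{ind} Z + \beta[W]$. Choose $Y$ with $W \cong \mathsf{E} Y$. For a conflation $Y \to P \to Q$
  with \<open>P\<close>, \<open>Q\<close> in the cluster-tilting subcategory, 2-Calabi--Yau duality shows that the image of
  $\operatorname{Ext}^1(P,Y)$ in $\operatorname{Ext}^1(Y,Y)$ is its own annihilator, hence of half the
  dimension. By this and its dual, the coindex and the index of \<open>Y\<close> contribute the same, so $\beta[W]$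
  contributes $0$. For a conflation $K \to R \to Z$ with class \<open>d\<close> and \<open>K\<close>, \<open>R\<close> in the cluster-tilting
  subcategory, $\operatorname{ind} Z$ contributes $\dim W(R) - \dim W(K)$. As \<open>Z\<close> is rigid, $W(R) \to W(K)$
  is injective; it is not onto if $W \neq 0$, since pairing with \<open>d\<close> is a functional which kills the image of
  $\operatorname{Ext}^1(R,Z)$ but no non-zero submodule. So the value is negative, whereas dimension
  vectors have no negative entries. If $W = 0$, use the dimension vector of $\mathsf{E} Z$ instead.

  The existence of $\beta$ requires that the finite-dimensional modules are of the form $\mathsf{E} X$,
  which follows from mutability by induction on the dimension, and that the difference of coindex and
  index is additive on short exact sequences of such modules.\<close>

section \<open>Additive categories\<close>

text \<open>The overview treats \<open>W\<close> as a module over the ground field. In fact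
  \<open>W\<close> is a geometric point of the Grassmannian: a submodule of the scalar extension of
  E Z to the algebraic closure, which need not come from a submodule of E Z. So \<open>Y\<close>
  realises a module over the ground field whose scalar extension has the same class as
  \<open>W\<close>; only the dimension vector passes from \<open>W\<close> to \<open>Y\<close>,
  which suffices for the contribution of beta. The comparison of W(R) with W(K), however, must be
  made for \<open>W\<close> itself: elements are written as tensors whose scalars are linearly
  independent over the ground field, and this reduces injectivity and the use of the functional to
  extension classes in \<open>C\<close>.

  The half-dimension argument leaves a correction on either side, the dimension of the orbit of a
  resolving extension class under End(Y). The two corrections agree since both orbit maps have the
  same kernel, the endomorphisms that factor through \<open>T\<close>. Their common source End(Y)
  need not be finite-dimensional, so the ranks are compared directly and not through
  nullities.\<close>

definition arr :: "('k, 'o, 'm, 'e) extri \<Rightarrow> 'm \<Rightarrow> 'o \<Rightarrow> 'o \<Rightarrow> bool" where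
  "arr C f X Y \<longleftrightarrow> X \<in> Ob C \<and> Y \<in> Ob C \<and> f \<in> Hom C X Y"

text \<open>As in \<open>arr\<close>, membership is bundled with the fact that the end points are
  objects, which is the standing premise of the axioms; facts of this form chain without side
  conditions.\<close>

definition exte :: "('k, 'o, 'm, 'e) extri \<Rightarrow> 'e \<Rightarrow> 'o \<Rightarrow> 'o \<Rightarrow> bool" where
  "exte C d Z A \<longleftrightarrow> Z \<in> Ob C \<and> A \<in> Ob C \<and> d \<in> Ext C Z A"

text \<open>The two-term case of \<open>direct_sum_via\<close> without lists and index functions.
  The conditions are symmetric in injections and projections, so passing to \<open>opp C\<close>
  merely exchanges the two.\<close>

definition biprod ::
  "('k, 'o, 'm::ab_group_add, 'e) extri \<Rightarrow> 'o \<Rightarrow> 'o \<Rightarrow> 'o \<Rightarrow> 'm \<Rightarrow> 'm \<Rightarrow> 'm \<Rightarrow> 'm \<Rightarrow> bool" where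
  "biprod C A B S i j p q \<longleftrightarrow> arr C i A S \<and> arr C j B S \<and> arr C p S A \<and> arr C q S B \<and>
     p \<cdot>\<^bsub>C\<^esub> i = idm C A \<and> q \<cdot>\<^bsub>C\<^esub> j = idm C B \<and> p \<cdot>\<^bsub>C\<^esub> j = 0 \<and> q \<cdot>\<^bsub>C\<^esub> i = 0 \<and>
     i \<cdot>\<^bsub>C\<^esub> p + j \<cdot>\<^bsub>C\<^esub> q = idm C S"

text \<open>Taking opposites exchanges \<open>push\<close> with \<open>pull\<close> and reverses
  conflations. With these rules a lemma instantiated at \<open>opp C\<close> turns into its dual for
  \<open>C\<close>; the second halves of many pairs below arise in this way.\<close>

lemma opp_simps [simp]:
  "Ob (opp C) = Ob C" "Hom (opp C) X Y = Hom C Y X" "idm (opp C) = idm C"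
  "g \<cdot>\<^bsub>opp C\<^esub> f = f \<cdot>\<^bsub>C\<^esub> g" "scal (opp C) = scal C" "Ext (opp C) X Y = Ext C Y X"
  "push (opp C) = pull C" "pull (opp C) = push C" "escal (opp C) = escal C"
  "Real (opp C) A B Z d x y = Real C Z B A d y x"
  by (simp_all add: opp_def)

lemma opp_opp [simp]: "opp (opp C) = C"
  by (simp add: opp_def)

lemma arr_opp [simp]: "arr (opp C) f X Y = arr C f Y X"
  by (auto simp: arr_def)

lemma exte_opp [simp]: "exte (opp C) d X Y = exte C d Y X"
  by (auto simp: exte_def)

lemma biprod_opp [simp]: "biprod (opp C) A B S i j p q = biprod C A B S p q i j"
  by (auto simp: biprod_def)

lemma direct_sum_via_opp [simp]: "direct_sum_via (opp C) Xs Z \<iota> \<pi> = direct_sum_via C Xs Z \<pi> \<iota>"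
  unfolding direct_sum_via_def by (auto split: if_splits)

lemma direct_sum_opp [simp]: "direct_sum (opp C) Xs Z = direct_sum C Xs Z"
  unfolding direct_sum_def direct_sum_via_opp by blast

lemma conflation_opp [simp]: "conflation (opp C) A B Z x y = conflation C Z B A y x"
  by (simp add: conflation_def)

lemma is_iso_opp [simp]: "is_iso (opp C) X Y f = is_iso C Y X f"
  by (auto simp: is_iso_def)

lemma direct_sum_via_pair:
  "direct_sum_via C [A, B] S \<iota> \<pi> \<longleftrightarrow> biprod C A B S (\<iota> 0) (\<iota> 1) (\<pi> 0) (\<pi> 1)"
  unfolding direct_sum_via_def biprod_def arr_def
  by (auto simp: less_Suc_eq numeral_2_eq_2)

lemma biprod_via:
  "biprod C A B S i j p q \<Longrightarrow>
     direct_sum_via C [A, B] S (\<lambda>n. if n = 0 then i else j) (\<lambda>n. if n = 0 then p else q)"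
  by (simp add: direct_sum_via_pair)

lemma biprod_imp_direct_sum: "biprod C A B S i j p q \<Longrightarrow> direct_sum C [A, B] S"
  unfolding direct_sum_def by (intro exI, rule biprod_via)

lemma direct_sum_imp_biprod: "direct_sum C [A, B] S \<Longrightarrow> \<exists>i j p q. biprod C A B S i j p q"
  unfolding direct_sum_def direct_sum_via_pair by blast

context additive_category
begin

sublocale hom: vector_space "scal C"
  by (rule hom_vector_space)

lemma arr_comp: "arr C f X Y \<Longrightarrow> arr C g Y Z \<Longrightarrow> arr C (g \<cdot> f) X Z"
  unfolding arr_def using comp_in[of X Y Z f g] by simp

lemma arr_id: "X \<in> Ob C \<Longrightarrow> arr C (idm C X) X X"
  unfolding arr_def using id_in by simp

lemma arr_zero: "X \<in> Ob C \<Longrightarrow> Y \<in> Ob C \<Longrightarrow> arr C 0 X Y"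
  unfolding arr_def using hom.subspace_0[OF hom_subspace[of X Y]] by simp

lemma arr_add: "arr C f X Y \<Longrightarrow> arr C g X Y \<Longrightarrow> arr C (f + g) X Y"
  unfolding arr_def using hom.subspace_add[OF hom_subspace[of X Y]] by simp

lemma arr_diff: "arr C f X Y \<Longrightarrow> arr C g X Y \<Longrightarrow> arr C (f - g) X Y"
  unfolding arr_def using hom.subspace_diff[OF hom_subspace[of X Y]] by simp

lemma arr_neg: "arr C f X Y \<Longrightarrow> arr C (- f) X Y"
  unfolding arr_def using hom.subspace_neg[OF hom_subspace[of X Y]] by simp

lemma arr_scale: "arr C f X Y \<Longrightarrow> arr C (scal C a f) X Y"
  unfolding arr_def using hom.subspace_scale[OF hom_subspace[of X Y]] by simp

lemma arr_sum: "X \<in> Ob C \<Longrightarrow> Y \<in> Ob C \<Longrightarrow> (\<And>i. i \<in> S \<Longrightarrow> arr C (f i) X Y) \<Longrightarrow> arr C (sum f S) X Y"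
  unfolding arr_def using hom.subspace_sum[OF hom_subspace[of X Y], of S f] by simp

lemma arr_ob: "arr C f X Y \<Longrightarrow> X \<in> Ob C" "arr C f X Y \<Longrightarrow> Y \<in> Ob C"
  unfolding arr_def by auto

lemma arr_unique: "arr C f X Y \<Longrightarrow> arr C f X' Y' \<Longrightarrow> f \<noteq> 0 \<Longrightarrow> X = X' \<and> Y = Y'"
  unfolding arr_def using hom_disjoint[of X Y X' Y' f] by simp

lemma id_left: "arr C f X Y \<Longrightarrow> idm C Y \<cdot> f = f"
  unfolding arr_def using comp_id_left[of X Y f] by simp

lemma id_right: "arr C f X Y \<Longrightarrow> f \<cdot> idm C X = f"
  unfolding arr_def using comp_id_right[of X Y f] by simp

lemma assoc: "arr C f W X \<Longrightarrow> arr C g X Y \<Longrightarrow> arr C h Y Z \<Longrightarrow> (h \<cdot> g) \<cdot> f = h \<cdot> (g \<cdot> f)"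
  unfolding arr_def using comp_assoc[of W X Y Z f g h] by simp

lemma comp_add_right: "arr C f X Y \<Longrightarrow> arr C f' X Y \<Longrightarrow> arr C g Y Z \<Longrightarrow> g \<cdot> (f + f') = g \<cdot> f + g \<cdot> f'"
  unfolding arr_def using comp_linear_right[of X Y Z g] by (simp add: semilinear_on_def)

lemma comp_add_left: "arr C f X Y \<Longrightarrow> arr C g Y Z \<Longrightarrow> arr C g' Y Z \<Longrightarrow> (g + g') \<cdot> f = g \<cdot> f + g' \<cdot> f"
  unfolding arr_def using comp_linear_left[of X Y Z f] by (simp add: semilinear_on_def)

lemma comp_scale_right: "arr C f X Y \<Longrightarrow> arr C g Y Z \<Longrightarrow> g \<cdot> scal C a f = scal C a (g \<cdot> f)"
  unfolding arr_def using comp_linear_right[of X Y Z g] by (simp add: semilinear_on_def)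

lemma comp_zero_right: "X \<in> Ob C \<Longrightarrow> arr C g Y Z \<Longrightarrow> g \<cdot> 0 = 0"
  using comp_add_right[of 0 X Y 0 g Z] arr_zero arr_ob by force

lemma comp_zero_left: "Z \<in> Ob C \<Longrightarrow> arr C f X Y \<Longrightarrow> 0 \<cdot> f = 0"
  using comp_add_left[of f X Y 0 Z 0] arr_zero arr_ob by force

lemma comp_neg_right: "arr C f X Y \<Longrightarrow> arr C g Y Z \<Longrightarrow> g \<cdot> (- f) = - (g \<cdot> f)"
  using comp_add_right[of f X Y "-f" g Z] arr_neg comp_zero_right[of X g Y Z] arr_ob
  by (metis add.right_inverse add_eq_0_iff)

lemma comp_neg_left: "arr C f X Y \<Longrightarrow> arr C g Y Z \<Longrightarrow> (- g) \<cdot> f = - (g \<cdot> f)"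
  using comp_add_left[of f X Y g Z "-g"] arr_neg comp_zero_left[of Z f X Y] arr_ob
  by (metis add.right_inverse add_eq_0_iff)

lemma comp_diff_right: "arr C f X Y \<Longrightarrow> arr C f' X Y \<Longrightarrow> arr C g Y Z \<Longrightarrow> g \<cdot> (f - f') = g \<cdot> f - g \<cdot> f'"
  using comp_add_right[of f X Y "-f'" g Z] comp_neg_right arr_neg by simp

lemma comp_diff_left: "arr C f X Y \<Longrightarrow> arr C g Y Z \<Longrightarrow> arr C g' Y Z \<Longrightarrow> (g - g') \<cdot> f = g \<cdot> f - g' \<cdot> f"
  using comp_add_left[of f X Y g Z "-g'"] comp_neg_left arr_neg by simp

lemma comp_sum_right:
  assumes "X \<in> Ob C" "arr C g Y Z" "\<And>i. i \<in> S \<Longrightarrow> arr C (f i) X Y"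
  shows "g \<cdot> sum f S = (\<Sum>i\<in>S. g \<cdot> f i)"
  using assms(3)
proof (induction S rule: infinite_finite_induct)
  case (insert x S)
  then show ?case
    using comp_add_right[of "f x" X Y "sum f S" g Z] assms arr_sum[of X Y S f] arr_ob by auto
qed (use comp_zero_right[OF assms(1,2)] in auto)

lemma comp_sum_left:
  assumes "Z \<in> Ob C" "arr C f X Y" "\<And>i. i \<in> S \<Longrightarrow> arr C (g i) Y Z"
  shows "sum g S \<cdot> f = (\<Sum>i\<in>S. g i \<cdot> f)"
  using assms(3)
proof (induction S rule: infinite_finite_induct)
  case (insert x S)
  then show ?case
    using comp_add_left[of f X Y "g x" Z "sum g S"] assms arr_sum[of Y Z S g] arr_ob by auto
qed (use comp_zero_left[OF assms(1,2)] in auto)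

lemma opp_additive: "additive_category (opp C)"
proof
  fix X Y X' Y' f
  assume "X \<in> Ob (opp C)" "Y \<in> Ob (opp C)" "X' \<in> Ob (opp C)" "Y' \<in> Ob (opp C)"
    "f \<in> Hom (opp C) X Y" "f \<in> Hom (opp C) X' Y'" "f \<noteq> 0"
  then show "X = X' \<and> Y = Y'" using hom_disjoint[of Y X Y' X' f] by auto
qed (auto simp: hom_vector_space hom_subspace id_in comp_in comp_id_left comp_id_right comp_assoc
      comp_linear_left comp_linear_right direct_sums hom.scale_left_distrib hom.scale_right_distrib)

lemma biprod_exists:
  assumes "A \<in> Ob C" "B \<in> Ob C" shows "\<exists>S i j p q. biprod C A B S i j p q"
  using direct_sums[of "[A, B]"] direct_sum_imp_biprod[of C A B] assms by auto blast

lemma zero_object_exists: "\<exists>Z\<in>Ob C. idm C Z = 0"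
  using direct_sums[of "[]"] by (auto simp: direct_sum_def direct_sum_via_def)

lemma arr_to_zero: "idm C Y = 0 \<Longrightarrow> arr C f X Y \<Longrightarrow> f = 0"
  using id_left comp_zero_left arr_ob by metis

lemma biprod_swap: "biprod C A B S i j p q \<Longrightarrow> biprod C B A S j i q p"
  by (auto simp: biprod_def add.commute)

lemma biprodD:
  assumes "biprod C A B S i j p q"
  shows "arr C i A S" "arr C j B S" "arr C p S A" "arr C q S B" "p \<cdot> i = idm C A" "q \<cdot> j = idm C B"
    "p \<cdot> j = 0" "q \<cdot> i = 0" "i \<cdot> p + j \<cdot> q = idm C S"
    "A \<in> Ob C" "B \<in> Ob C" "S \<in> Ob C"
  using assms by (auto simp: biprod_def arr_def)

lemma biprod_zero:
  assumes "A \<in> Ob C" "Z \<in> Ob C" "idm C Z = 0"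
  shows "biprod C A Z A (idm C A) 0 (idm C A) 0"
  unfolding biprod_def
  using assms arr_zero arr_id id_left[OF arr_id] comp_zero_right[of Z "idm C A" A A]
    comp_zero_right[of A 0 A Z] comp_zero_left[of Z "idm C A" A A] comp_zero_left[of A 0 A Z]
    comp_zero_right[of Z 0 A Z] by auto

lemma biprod_map_out:
  assumes "biprod C A B S i j p q" "arr C f A Y" "arr C g B Y"
  shows "arr C (f \<cdot> p + g \<cdot> q) S Y" "(f \<cdot> p + g \<cdot> q) \<cdot> i = f" "(f \<cdot> p + g \<cdot> q) \<cdot> j = g"
proof -
  note b = biprodD[OF assms(1)]
  have fp: "arr C (f \<cdot> p) S Y" and gq: "arr C (g \<cdot> q) S Y"
    using arr_comp b assms by blast+
  show "arr C (f \<cdot> p + g \<cdot> q) S Y" using fp gq by (rule arr_add)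
  have Y: "Y \<in> Ob C" using arr_ob assms by blast
  show "(f \<cdot> p + g \<cdot> q) \<cdot> i = f"
    using comp_add_left[OF b(1) fp gq] assoc[OF b(1) b(3) assms(2)] assoc[OF b(1) b(4) assms(3)] b
      id_right[OF assms(2)] comp_zero_right[OF b(10) assms(3)] by simp
  show "(f \<cdot> p + g \<cdot> q) \<cdot> j = g"
    using comp_add_left[OF b(2) fp gq] assoc[OF b(2) b(3) assms(2)] assoc[OF b(2) b(4) assms(3)] b
      id_right[OF assms(3)] comp_zero_right[OF b(11) assms(2)] by simp
qed

lemma biprod_map_in:
  assumes "biprod C A B S i j p q" "arr C f Y A" "arr C g Y B"
  shows "arr C (i \<cdot> f + j \<cdot> g) Y S" "p \<cdot> (i \<cdot> f + j \<cdot> g) = f" "q \<cdot> (i \<cdot> f + j \<cdot> g) = g"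
proof -
  interpret op: additive_category "opp C" by (rule opp_additive)
  show "arr C (i \<cdot> f + j \<cdot> g) Y S" "p \<cdot> (i \<cdot> f + j \<cdot> g) = f" "q \<cdot> (i \<cdot> f + j \<cdot> g) = g"
    using op.biprod_map_out[of A B S p q i j f Y g] assms by auto
qed

lemma is_isoD:
  assumes "is_iso C X Y f" "X \<in> Ob C" "Y \<in> Ob C"
  shows "arr C f X Y" "\<exists>g. arr C g Y X \<and> g \<cdot> f = idm C X \<and> f \<cdot> g = idm C Y"
  using assms by (auto simp: is_iso_def arr_def)

lemma is_isoI:
  assumes "arr C f X Y" "arr C g Y X" "g \<cdot> f = idm C X" "f \<cdot> g = idm C Y"
  shows "is_iso C X Y f"
  using assms by (auto simp: is_iso_def arr_def)

lemma is_isoI':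
  assumes f: "arr C f X Y" and g: "arr C g Y X" and h: "arr C h Y X"
    and e: "g \<cdot> f = idm C X" "f \<cdot> h = idm C Y"
  shows "is_iso C X Y f"
proof -
  have "g = g \<cdot> (f \<cdot> h)" using e id_right[OF g] by simp
  also have "\<dots> = h" using assoc[OF h f g] e id_left[OF h] by simp
  finally show ?thesis using is_isoI[OF f g e(1)] e by simp
qed

lemma iso_id: "X \<in> Ob C \<Longrightarrow> is_iso C X X (idm C X)"
  using is_isoI arr_id id_left by metis

lemma iso_comp:
  assumes "is_iso C X Y f" "is_iso C Y Z g" "X \<in> Ob C" "Y \<in> Ob C" "Z \<in> Ob C"
  shows "is_iso C X Z (g \<cdot> f)"
proof -
  obtain f' where f: "arr C f X Y" "arr C f' Y X" "f' \<cdot> f = idm C X" "f \<cdot> f' = idm C Y"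
    using is_isoD assms by metis
  obtain g' where g: "arr C g Y Z" "arr C g' Z Y" "g' \<cdot> g = idm C Y" "g \<cdot> g' = idm C Z"
    using is_isoD assms by metis
  have "(f' \<cdot> g') \<cdot> (g \<cdot> f) = f' \<cdot> ((g' \<cdot> g) \<cdot> f)"
    using assoc[OF arr_comp[OF f(1) g(1)] g(2) f(2)] assoc[OF f(1) g(1) g(2)] by simp
  then have 1: "(f' \<cdot> g') \<cdot> (g \<cdot> f) = idm C X" using f g id_left by simp
  have "(g \<cdot> f) \<cdot> (f' \<cdot> g') = g \<cdot> ((f \<cdot> f') \<cdot> g')"
    using assoc[OF arr_comp[OF g(2) f(2)] f(1) g(1)] assoc[OF g(2) f(2) f(1)] by simp
  then have 2: "(g \<cdot> f) \<cdot> (f' \<cdot> g') = idm C Z" using f g id_left by simp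
  show ?thesis using is_isoI[OF arr_comp[OF f(1) g(1)] arr_comp[OF g(2) f(2)] 1 2] .
qed

lemma direct_sum_viaD:
  assumes "direct_sum_via C Xs Z \<iota> \<pi>"
  shows "Z \<in> Ob C" "i < length Xs \<Longrightarrow> Xs ! i \<in> Ob C"
    "i < length Xs \<Longrightarrow> arr C (\<iota> i) (Xs ! i) Z" "i < length Xs \<Longrightarrow> arr C (\<pi> i) Z (Xs ! i)"
    "i < length Xs \<Longrightarrow> j < length Xs \<Longrightarrow> \<pi> i \<cdot> \<iota> j = (if i = j then idm C (Xs ! i) else 0)"
    "(\<Sum>i<length Xs. \<iota> i \<cdot> \<pi> i) = idm C Z"
  using assms unfolding direct_sum_via_def arr_def by (auto simp: subset_iff)

lemma direct_sum_decompose: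
  assumes d: "direct_sum_via C Xs Z \<iota> \<pi>" and f: "arr C f Z Y"
  shows "f = (\<Sum>i<length Xs. (f \<cdot> \<iota> i) \<cdot> \<pi> i)"
proof -
  note b = direct_sum_viaD[OF d]
  have "f = f \<cdot> (\<Sum>i<length Xs. \<iota> i \<cdot> \<pi> i)" using b id_right[OF f] by simp
  also have "\<dots> = (\<Sum>i<length Xs. f \<cdot> (\<iota> i \<cdot> \<pi> i))"
    by (rule comp_sum_right[OF b(1) f]) (use arr_comp[OF b(4) b(3)] in simp)
  also have "\<dots> = (\<Sum>i<length Xs. (f \<cdot> \<iota> i) \<cdot> \<pi> i)"
    using assoc[OF b(4) b(3) f] by (intro sum.cong) auto
  finally show ?thesis .
qed

end

section \<open>Exact sequences in extriangulated categories\<close>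

context extriangulated_category
begin

sublocale ext: vector_space "escal C"
  by (rule ext_vector_space)

lemma exte_ob: "exte C d Z A \<Longrightarrow> Z \<in> Ob C" "exte C d Z A \<Longrightarrow> A \<in> Ob C"
  unfolding exte_def by auto

lemma exte_zero: "Z \<in> Ob C \<Longrightarrow> A \<in> Ob C \<Longrightarrow> exte C 0 Z A"
  unfolding exte_def using ext.subspace_0[OF ext_subspace[of Z A]] by simp

lemma exte_add: "exte C d Z A \<Longrightarrow> exte C e Z A \<Longrightarrow> exte C (d + e) Z A"
  unfolding exte_def using ext.subspace_add[OF ext_subspace[of Z A]] by simp

lemma exte_diff: "exte C d Z A \<Longrightarrow> exte C e Z A \<Longrightarrow> exte C (d - e) Z A"
  unfolding exte_def using ext.subspace_diff[OF ext_subspace[of Z A]] by simp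

lemma exte_neg: "exte C d Z A \<Longrightarrow> exte C (- d) Z A"
  unfolding exte_def using ext.subspace_neg[OF ext_subspace[of Z A]] by simp

lemma exte_scale: "exte C d Z A \<Longrightarrow> exte C (escal C a d) Z A"
  unfolding exte_def using ext.subspace_scale[OF ext_subspace[of Z A]] by simp

lemma exte_push: "exte C d Z A \<Longrightarrow> arr C a A A' \<Longrightarrow> exte C (push C a d) Z A'"
  unfolding exte_def arr_def using push_linear[of Z A A' a] by (simp add: semilinear_on_def)

lemma exte_pull: "exte C d Z A \<Longrightarrow> arr C c Z' Z \<Longrightarrow> exte C (pull C c d) Z' A"
  unfolding exte_def arr_def using pull_linear[of Z Z' A c] by (simp add: semilinear_on_def)

lemma push_add: "exte C d Z A \<Longrightarrow> exte C e Z A \<Longrightarrow> arr C a A A' \<Longrightarrow> push C a (d + e) = push C a d + push C a e"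
  unfolding exte_def arr_def using push_linear[of Z A A' a] by (simp add: semilinear_on_def)

lemma pull_add: "exte C d Z A \<Longrightarrow> exte C e Z A \<Longrightarrow> arr C c Z' Z \<Longrightarrow> pull C c (d + e) = pull C c d + pull C c e"
  unfolding exte_def arr_def using pull_linear[of Z Z' A c] by (simp add: semilinear_on_def)

lemma push_scale: "exte C d Z A \<Longrightarrow> arr C a A A' \<Longrightarrow> push C a (escal C r d) = escal C r (push C a d)"
  unfolding exte_def arr_def using push_linear[of Z A A' a] by (simp add: semilinear_on_def)

lemma push_add_arr: "exte C d Z A \<Longrightarrow> arr C a A A' \<Longrightarrow> arr C b A A' \<Longrightarrow> push C (a + b) d = push C a d + push C b d"
  unfolding exte_def arr_def using push_linear_arrow[of Z A A' d] by (simp add: semilinear_on_def)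

lemma pull_add_arr: "exte C d Z A \<Longrightarrow> arr C a Z' Z \<Longrightarrow> arr C b Z' Z \<Longrightarrow> pull C (a + b) d = pull C a d + pull C b d"
  unfolding exte_def arr_def using pull_linear_arrow[of Z Z' A d] by (simp add: semilinear_on_def)

lemma push_scale_arr: "exte C d Z A \<Longrightarrow> arr C a A A' \<Longrightarrow> push C (scal C r a) d = escal C r (push C a d)"
  unfolding exte_def arr_def using push_linear_arrow[of Z A A' d] by (simp add: semilinear_on_def)

lemma pull_scale_arr: "exte C d Z A \<Longrightarrow> arr C a Z' Z \<Longrightarrow> pull C (scal C r a) d = escal C r (pull C a d)"
  unfolding exte_def arr_def using pull_linear_arrow[of Z Z' A d] by (simp add: semilinear_on_def)

lemma pull_ext_id: "exte C d Z A \<Longrightarrow> pull C (idm C Z) d = d"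
  unfolding exte_def using pull_id[of Z A d] by simp

lemma push_ext_id: "exte C d Z A \<Longrightarrow> push C (idm C A) d = d"
  unfolding exte_def using push_id[of Z A d] by simp

lemma push_push: "exte C d Z A \<Longrightarrow> arr C a A A' \<Longrightarrow> arr C b A' A'' \<Longrightarrow> push C b (push C a d) = push C (b \<cdot> a) d"
  unfolding exte_def arr_def using push_comp[of Z A A' A'' d a b] by simp

lemma pull_pull: "exte C d Z A \<Longrightarrow> arr C c Z' Z \<Longrightarrow> arr C b Z'' Z' \<Longrightarrow> pull C b (pull C c d) = pull C (c \<cdot> b) d"
  unfolding exte_def arr_def using pull_comp[of Z Z' Z'' A d c b] by simp

lemma push_pull_commute: "exte C d Z A \<Longrightarrow> arr C a A A' \<Longrightarrow> arr C c Z' Z \<Longrightarrow> push C a (pull C c d) = pull C c (push C a d)"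
  unfolding exte_def arr_def using push_pull[of Z Z' A A' d a c] by simp

lemma push_zero: "Z \<in> Ob C \<Longrightarrow> arr C a A A' \<Longrightarrow> push C a 0 = 0"
  using push_add[of 0 Z A 0 a A'] exte_zero arr_ob by force

lemma pull_zero: "A \<in> Ob C \<Longrightarrow> arr C c Z' Z \<Longrightarrow> pull C c 0 = 0"
  using pull_add[of 0 Z A 0 c Z'] exte_zero arr_ob by force

lemma push_zero_arr: "exte C d Z A \<Longrightarrow> A' \<in> Ob C \<Longrightarrow> push C 0 d = 0"
  using push_add_arr[of d Z A 0 A' 0] arr_zero[of A A'] exte_ob by force

lemma pull_zero_arr: "exte C d Z A \<Longrightarrow> Z' \<in> Ob C \<Longrightarrow> pull C 0 d = 0"
  using pull_add_arr[of d Z A 0 Z' 0] arr_zero[of Z' Z] exte_ob by force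

lemma push_diff: "exte C d Z A \<Longrightarrow> exte C e Z A \<Longrightarrow> arr C a A A' \<Longrightarrow> push C a (d - e) = push C a d - push C a e"
  using push_add[of "d - e" Z A e a A'] exte_diff by (simp add: algebra_simps)

lemma push_diff_arr: "exte C d Z A \<Longrightarrow> arr C a A A' \<Longrightarrow> arr C b A A' \<Longrightarrow> push C (a - b) d = push C a d - push C b d"
  using push_add_arr[of d Z A "a - b" A' b] arr_diff by (simp add: algebra_simps)

lemma pull_diff_arr: "exte C d Z A \<Longrightarrow> arr C a Z' Z \<Longrightarrow> arr C b Z' Z \<Longrightarrow> pull C (a - b) d = pull C a d - pull C b d"
  using pull_add_arr[of d Z A "a - b" Z' b] arr_diff by (simp add: algebra_simps)

lemma RealD:
  assumes "Real C A B Z d x y"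
  shows "exte C d Z A" "arr C x A B" "arr C y B Z" "A \<in> Ob C" "B \<in> Ob C" "Z \<in> Ob C"
  using real_in[OF assms] by (auto simp: exte_def arr_def)

lemma realise: "exte C d Z A \<Longrightarrow> \<exists>B x y. Real C A B Z d x y"
  unfolding exte_def using real_exists by blast

lemma real_sum_biprod:
  assumes "Real C A B Z d x y" "Real C A' B' Z' d' x' y'"
    and "biprod C A A' A'' i j p q" "biprod C B B' B'' i1 j1 p1 q1" "biprod C Z Z' Z'' i2 j2 p2 q2"
  shows "Real C A'' B'' Z'' (push C i (pull C p2 d) + push C j (pull C q2 d'))
     (i1 \<cdot> x \<cdot> p + j1 \<cdot> x' \<cdot> q) (i2 \<cdot> y \<cdot> p1 + j2 \<cdot> y' \<cdot> q1)"
  using real_sum[OF assms(1,2) biprod_via[OF assms(3)] biprod_via[OF assms(4)] biprod_via[OF assms(5)]]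
  by simp

lemma real_split: "biprod C A Z B i j p q \<Longrightarrow> Real C A B Z 0 i q"
  using real_zero[OF biprod_via] by simp

lemma real_isoI:
  assumes R: "Real C A B Z d x y" and b: "is_iso C B B' b" "B' \<in> Ob C"
    and x': "arr C x' A B'" and y': "arr C y' B' Z" and e: "b \<cdot> x = x'" "y' \<cdot> b = y"
  shows "Real C A B' Z d x' y'"
  using real_class[OF R, of B' x' y'] assms by (auto simp: arr_def)

text \<open>The axioms are self-dual up to renaming. Work is needed for the class of realisations,
  where the isomorphism of middle terms has to be inverted, and for sums of realisations, where
  \<open>push\<close> and \<open>pull\<close> have to be commuted and compositions
  rebracketed.\<close>

lemma opp_extriangulated: "extriangulated_category (opp C)"
proof -
  interpret op: additive_category "opp C" by (rule opp_additive)
  show ?thesis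
  proof unfold_locales
    fix Z A Z' A' d
    assume "Z \<in> Ob (opp C)" "A \<in> Ob (opp C)" "Z' \<in> Ob (opp C)" "A' \<in> Ob (opp C)"
      "d \<in> Ext (opp C) Z A" "d \<in> Ext (opp C) Z' A'" "d \<noteq> 0"
    then show "Z = Z' \<and> A = A'" using ext_disjoint[of A Z A' Z' d] by auto
  next
    fix A B Z d x y B' x' y'
    assume "Real (opp C) A B Z d x y" "B' \<in> Ob (opp C)" "x' \<in> Hom (opp C) A B'" "y' \<in> Hom (opp C) B' Z"
    then have R: "Real C Z B A d y x" and B': "B' \<in> Ob C" and x': "arr C x' B' A" and y': "arr C y' Z B'"
      using RealD by (auto simp: arr_def)
    note r = RealD[OF R]
    have "Real C Z B' A d y' x' \<longleftrightarrow> (\<exists>b. is_iso C B B' b \<and> b \<cdot> y = y' \<and> x' \<cdot> b = x)"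
      using real_class[OF R B', of y' x'] x' y' by (auto simp: arr_def)
    also have "\<dots> \<longleftrightarrow> (\<exists>b. is_iso C B' B b \<and> x \<cdot> b = x' \<and> b \<cdot> y' = y)"
    proof
      assume "\<exists>b. is_iso C B B' b \<and> b \<cdot> y = y' \<and> x' \<cdot> b = x"
      then obtain b g where b: "arr C b B B'" "arr C g B' B" "g \<cdot> b = idm C B" "b \<cdot> g = idm C B'"
        "b \<cdot> y = y'" "x' \<cdot> b = x"
        using is_isoD r B' by metis
      have "x \<cdot> g = x'" using assoc[OF b(2) b(1) x'] b id_right[OF x'] by simp
      moreover have "g \<cdot> y' = y" using assoc[OF r(2) b(1) b(2)] b id_left[OF r(2)] by simp
      ultimately show "\<exists>b. is_iso C B' B b \<and> x \<cdot> b = x' \<and> b \<cdot> y' = y"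
        using is_isoI[OF b(2,1,4,3)] by blast
    next
      assume "\<exists>b. is_iso C B' B b \<and> x \<cdot> b = x' \<and> b \<cdot> y' = y"
      then obtain b g where b: "arr C b B' B" "arr C g B B'" "g \<cdot> b = idm C B'" "b \<cdot> g = idm C B"
        "b \<cdot> y' = y" "x \<cdot> b = x'"
        using is_isoD r B' by metis
      have "x' \<cdot> g = x" using assoc[OF b(2) b(1) r(3)] b id_right[OF r(3)] by simp
      moreover have "g \<cdot> y = y'" using assoc[OF y' b(1) b(2)] b id_left[OF y'] by simp
      ultimately show "\<exists>b. is_iso C B B' b \<and> b \<cdot> y = y' \<and> x' \<cdot> b = x"
        using is_isoI[OF b(2,1,4,3)] by blast
    qed
    finally show "Real (opp C) A B' Z d x' y' \<longleftrightarrow>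
        (\<exists>b. is_iso (opp C) B B' b \<and> b \<cdot>\<^bsub>opp C\<^esub> x = x' \<and> y' \<cdot>\<^bsub>opp C\<^esub> b = y)"
      by simp
  next
    fix A B Z d x y A' B' Z' d' x' y' a c
    assume "Real (opp C) A B Z d x y" "Real (opp C) A' B' Z' d' x' y'"
      "a \<in> Hom (opp C) A A'" "c \<in> Hom (opp C) Z Z'" "push (opp C) a d = pull (opp C) c d'"
    then show "\<exists>b\<in>Hom (opp C) B B'. b \<cdot>\<^bsub>opp C\<^esub> x = x' \<cdot>\<^bsub>opp C\<^esub> a \<and> y' \<cdot>\<^bsub>opp C\<^esub> b = c \<cdot>\<^bsub>opp C\<^esub> y"
      using real_morphism[of Z' B' A' d' y' x' Z B A d y x c a] by auto
  next
    fix A Z B \<iota> \<pi>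
    assume "direct_sum_via (opp C) [A, Z] B \<iota> \<pi>"
    then have "biprod C A Z B (\<pi> 0) (\<pi> 1) (\<iota> 0) (\<iota> 1)"
      by (simp add: direct_sum_via_pair)
    then show "Real (opp C) A B Z 0 (\<iota> 0) (\<pi> 1)"
      using real_split[OF biprod_swap] by simp
  next
    fix A B Z d x y A' B' Z' d' x' y' A'' \<iota>A \<pi>A B'' \<iota>B \<pi>B Z'' \<iota>Z \<pi>Z
    assume "Real (opp C) A B Z d x y" "Real (opp C) A' B' Z' d' x' y'"
      "direct_sum_via (opp C) [A, A'] A'' \<iota>A \<pi>A" "direct_sum_via (opp C) [B, B'] B'' \<iota>B \<pi>B"
      "direct_sum_via (opp C) [Z, Z'] Z'' \<iota>Z \<pi>Z"
    then have R: "Real C Z B A d y x" and R': "Real C Z' B' A' d' y' x'"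
      and a: "biprod C A A' A'' (\<pi>A 0) (\<pi>A 1) (\<iota>A 0) (\<iota>A 1)"
      and b: "biprod C B B' B'' (\<pi>B 0) (\<pi>B 1) (\<iota>B 0) (\<iota>B 1)"
      and z: "biprod C Z Z' Z'' (\<pi>Z 0) (\<pi>Z 1) (\<iota>Z 0) (\<iota>Z 1)"
      by (simp_all add: direct_sum_via_pair)
    note r = RealD[OF R] RealD[OF R']
    note ab = biprodD[OF a] biprodD[OF b] biprodD[OF z]
    have "push C (\<pi>Z 0) (pull C (\<iota>A 0) d) = pull C (\<iota>A 0) (push C (\<pi>Z 0) d)"
      "push C (\<pi>Z 1) (pull C (\<iota>A 1) d') = pull C (\<iota>A 1) (push C (\<pi>Z 1) d')"
      using push_pull_commute r ab by metis+
    moreover have "\<pi>B 0 \<cdot> y \<cdot> \<iota>Z 0 = \<pi>B 0 \<cdot> (y \<cdot> \<iota>Z 0)" "\<pi>B 1 \<cdot> y' \<cdot> \<iota>Z 1 = \<pi>B 1 \<cdot> (y' \<cdot> \<iota>Z 1)"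
      "\<pi>A 0 \<cdot> x \<cdot> \<iota>B 0 = \<pi>A 0 \<cdot> (x \<cdot> \<iota>B 0)" "\<pi>A 1 \<cdot> x' \<cdot> \<iota>B 1 = \<pi>A 1 \<cdot> (x' \<cdot> \<iota>B 1)"
      using assoc r ab by metis+
    ultimately show "Real (opp C) A'' B'' Z''
        (push (opp C) (\<iota>A 0) (pull (opp C) (\<pi>Z 0) d) + push (opp C) (\<iota>A 1) (pull (opp C) (\<pi>Z 1) d'))
        (\<iota>B 0 \<cdot>\<^bsub>opp C\<^esub> x \<cdot>\<^bsub>opp C\<^esub> \<pi>A 0 + \<iota>B 1 \<cdot>\<^bsub>opp C\<^esub> x' \<cdot>\<^bsub>opp C\<^esub> \<pi>A 1)
        (\<iota>Z 0 \<cdot>\<^bsub>opp C\<^esub> y \<cdot>\<^bsub>opp C\<^esub> \<pi>B 0 + \<iota>Z 1 \<cdot>\<^bsub>opp C\<^esub> y' \<cdot>\<^bsub>opp C\<^esub> \<pi>B 1)"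
      using real_sum_biprod[OF R R' z b a] by simp
  next
    fix Z A d
    assume "Z \<in> Ob (opp C)" "A \<in> Ob (opp C)" "d \<in> Ext (opp C) Z A"
    then show "\<exists>B x y. Real (opp C) A B Z d x y" using real_exists[of A Z d] by auto
  next
    show "ET3 (opp C)" "ET3 (opp (opp C))" "ET4 (opp C)" "ET4 (opp (opp C))"
      using ET3 ET3_op ET4 ET4_op by simp_all
  qed (auto simp: ext_subspace push_linear pull_linear push_linear_arrow pull_linear_arrow push_id
      pull_id push_comp pull_comp push_pull ext.scale_left_distrib ext.scale_right_distrib
      dest: real_in)
qed

lemma real_complete_right:
  assumes "Real C A B Z d x y" "Real C A' B' Z' d' x' y'" "arr C a A A'" "arr C b B B'" "b \<cdot> x = x' \<cdot> a"
  shows "\<exists>c. arr C c Z Z' \<and> c \<cdot> y = y' \<cdot> b \<and> push C a d = pull C c d'"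
proof -
  have "\<exists>c\<in>Hom C Z Z'. c \<cdot> y = y' \<cdot> b \<and> push C a d = pull C c d'"
    using ET3[unfolded ET3_def, rule_format, of A B Z d x y A' B' Z' d' x' y' a b] assms
    by (auto simp: arr_def)
  then show ?thesis using RealD(6)[OF assms(1)] RealD(6)[OF assms(2)] by (auto simp: arr_def)
qed

lemma real_complete_middle:
  assumes "Real C A B Z d x y" "Real C A' B' Z' d' x' y'" "arr C a A A'" "arr C c Z Z'"
    "push C a d = pull C c d'"
  shows "\<exists>b. arr C b B B' \<and> b \<cdot> x = x' \<cdot> a \<and> y' \<cdot> b = c \<cdot> y"
  using real_morphism[OF assms(1,2), of a c] assms(3-5) RealD(5)[OF assms(1)] RealD(5)[OF assms(2)]
  by (auto simp: arr_def)

lemma real_complete_left: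
  assumes "Real C A B Z d x y" "Real C A' B' Z' d' x' y'" "arr C b B B'" "arr C c Z Z'" "y' \<cdot> b = c \<cdot> y"
  shows "\<exists>a. arr C a A A' \<and> b \<cdot> x = x' \<cdot> a \<and> push C a d = pull C c d'"
proof -
  interpret op: extriangulated_category "opp C" by (rule opp_extriangulated)
  show ?thesis
    using op.real_complete_right[of Z' B' A' d' y' x' Z B A d y x c b] assms by auto
qed

text \<open>The octahedral axiom of the opposite category: deflations compose, and the kernel
  \<open>N\<close> of the composite is an extension of the kernel \<open>K\<close> of the second
  deflation by the kernel \<open>W\<close> of the first.\<close>

lemma deflation_octahedron:
  assumes "Real C K B Z \<delta> k y" "Real C W M B \<eta> u v"
  shows "\<exists>N d e \<epsilon> h. arr C d N K \<and> arr C e W N \<and> Real C N M Z \<epsilon> h (y \<cdot> v) \<and> v \<cdot> h = k \<cdot> d \<and>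
     h \<cdot> e = u \<and> Real C W N K (pull C k \<eta>) e d \<and> push C d \<epsilon> = \<delta> \<and> pull C y \<epsilon> = push C e \<eta>"
proof -
  have "Real (opp C) Z B K \<delta> y k" "Real (opp C) B M W \<eta> v u" using assms by simp_all
  then obtain N d e \<epsilon> h where N: "Real C N M Z \<epsilon> h (y \<cdot> v)" "v \<cdot> h = k \<cdot> d" "h \<cdot> e = u"
      "Real C W N K (pull C k \<eta>) e d" "push C d \<epsilon> = \<delta>" "pull C y \<epsilon> = push C e \<eta>"
    using ET4_op[unfolded ET4_def, rule_format, of Z B K \<delta> y k M W \<eta> v u] by auto
  then show ?thesis using RealD[OF N(4)] by blast
qed

section \<open>Lifting properties and the long exact sequences\<close>

lemma real_trivial:
  assumes "Z \<in> Ob C" "N0 \<in> Ob C" "idm C N0 = 0"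
  shows "Real C Z Z N0 0 (idm C Z) 0" "Real C N0 Z Z 0 0 (idm C Z)"
  using real_split[OF biprod_zero[OF assms]] real_split[OF biprod_swap[OF biprod_zero[OF assms]]] by auto

text \<open>The square with sides \<open>x\<close> and the identity of \<open>B\<close> is completed
  to a morphism into the trivial conflation on \<open>B\<close>, whose class is 0.\<close>

lemma real_push_zero:
  assumes R: "Real C A B Z d x y" shows "push C x d = 0"
proof -
  note r = RealD[OF R]
  obtain N0 where N0: "N0 \<in> Ob C" "idm C N0 = 0" using zero_object_exists by blast
  obtain c where c: "arr C c Z N0" "push C x d = pull C c 0"
    using real_complete_right[OF R real_trivial(1)[OF r(5) N0] r(2) arr_id[OF r(5)]] by auto
  then show ?thesis using pull_zero[OF r(5) c(1)] by simp
qed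

text \<open>Completing the pair of the zero map on \<open>A\<close> and the identity of
  \<open>Z\<close> gives a middle map into the trivial conflation ending in \<open>Z\<close>. This
  map has to be \<open>y\<close>, and on \<open>A\<close> it passes through a zero object.\<close>

lemma real_comp_zero:
  assumes R: "Real C A B Z d x y" shows "y \<cdot> x = 0"
proof -
  note r = RealD[OF R]
  obtain N0 where N0: "N0 \<in> Ob C" "idm C N0 = 0" using zero_object_exists by blast
  have "push C 0 d = pull C (idm C Z) 0"
    using push_zero_arr[OF r(1) N0(1)] pull_zero[OF N0(1) arr_id[OF r(6)]] by simp
  then obtain b where b: "arr C b B Z" "b \<cdot> x = 0 \<cdot> 0" "idm C Z \<cdot> b = idm C Z \<cdot> y"
    using real_complete_middle[OF R real_trivial(2)[OF r(6) N0] arr_zero[OF r(4) N0(1)] arr_id[OF r(6)]]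
    by auto
  then have "b = y" using id_left r by metis
  then show ?thesis using b comp_zero_left[OF r(6) arr_zero[OF r(4) N0(1)]] by simp
qed

text \<open>When the pushed class vanishes, \<open>f\<close> extends to a morphism into the split
  conflation on \<open>W\<close> and \<open>Z\<close>; projecting its middle component to
  \<open>W\<close> extends \<open>f\<close> along \<open>x\<close>.\<close>

lemma factor_inflation:
  assumes R: "Real C A B Z d x y" and f: "arr C f A W" "push C f d = 0"
  shows "\<exists>g. arr C g B W \<and> g \<cdot> x = f"
proof -
  note r = RealD[OF R]
  have W: "W \<in> Ob C" using arr_ob f by blast
  obtain S i j p q where S: "biprod C W Z S i j p q" using biprod_exists W r by blast
  note s = biprodD[OF S]
  have "push C f d = pull C (idm C Z) 0" using f pull_zero[OF W arr_id[OF r(6)]] by simp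
  then obtain b where b: "arr C b B S" "b \<cdot> x = i \<cdot> f"
    using real_complete_middle[OF R real_split[OF S] f(1) arr_id[OF r(6)]] by auto
  have "(p \<cdot> b) \<cdot> x = f"
    using assoc[OF r(2) b(1) s(3)] b(2) assoc[OF f(1) s(1,3)] s(5) id_left[OF f(1)] by simp
  then show ?thesis using arr_comp[OF b(1) s(3)] by blast
qed

lemma factor_deflation:
  assumes R: "Real C A B Z d x y" and f: "arr C f W Z" "pull C f d = 0"
  shows "\<exists>g. arr C g W B \<and> y \<cdot> g = f"
proof -
  interpret op: extriangulated_category "opp C" by (rule opp_extriangulated)
  show ?thesis using op.factor_inflation[of Z B A d y x f W] assms by auto
qed

lemma real_pull_zero:
  assumes R: "Real C A B Z d x y" shows "pull C y d = 0"
proof -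
  interpret op: extriangulated_category "opp C" by (rule opp_extriangulated)
  show ?thesis using op.real_push_zero[of Z B A d y x] assms by auto
qed

text \<open>Only existence is claimed: in an extriangulated category \<open>y\<close> is a weak
  cokernel of \<open>x\<close>, and the factorisation is in general not unique.\<close>

lemma factor_cokernel:
  assumes R: "Real C A B Z d x y" and f: "arr C f B W" "f \<cdot> x = 0"
  shows "\<exists>g. arr C g Z W \<and> g \<cdot> y = f"
proof -
  note r = RealD[OF R]
  have W: "W \<in> Ob C" using arr_ob f by blast
  obtain N0 where N0: "N0 \<in> Ob C" "idm C N0 = 0" using zero_object_exists by blast
  have "f \<cdot> x = 0 \<cdot> 0" using f comp_zero_left[OF W arr_zero[OF r(4) N0(1)]] by simp
  then obtain c where "arr C c Z W" "c \<cdot> y = idm C W \<cdot> f"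
    using real_complete_right[OF R real_trivial(2)[OF W N0] arr_zero[OF r(4) N0(1)] f(1)] by auto
  then show ?thesis using id_left[OF f(1)] by auto
qed

lemma factor_kernel:
  assumes R: "Real C A B Z d x y" and f: "arr C f W B" "y \<cdot> f = 0"
  shows "\<exists>g. arr C g W A \<and> x \<cdot> g = f"
proof -
  interpret op: extriangulated_category "opp C" by (rule opp_extriangulated)
  show ?thesis using op.factor_cokernel[of Z B A d y x f W] assms by auto
qed

text \<open>Exactness of Hom(A,W), Ext(Z,W), Ext(B,W) in the middle. Since \<open>e\<close> dies on
  \<open>B\<close>, the map \<open>y\<close> lifts along the deflation \<open>v\<close> that belongs
  to \<open>e\<close>; the induced map of kernels is the required \<open>f\<close>.\<close>

lemma ext_exact_push:
  assumes R: "Real C A B Z d x y" and e: "exte C e Z W" "pull C y e = 0"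
  shows "\<exists>f. arr C f A W \<and> push C f d = e"
proof -
  note r = RealD[OF R]
  obtain E u v where E: "Real C W E Z e u v" using realise[OF e(1)] by blast
  obtain g where g: "arr C g B E" "v \<cdot> g = y" using factor_deflation[OF E r(3) e(2)] by blast
  have "v \<cdot> g = idm C Z \<cdot> y" using g id_left[OF r(3)] by simp
  then show ?thesis
    using real_complete_left[OF R E g(1) arr_id[OF r(6)]] pull_ext_id[OF e(1)] by auto
qed

lemma ext_exact_pull:
  assumes R: "Real C A B Z d x y" and e: "exte C e W A" "push C x e = 0"
  shows "\<exists>f. arr C f W Z \<and> pull C f d = e"
proof -
  interpret op: extriangulated_category "opp C" by (rule opp_extriangulated)
  show ?thesis using op.ext_exact_push[of Z B A d y x e W] assms by auto
qed

text \<open>By the octahedral axiom the extension \<open>e\<close> of \<open>B\<close> contains an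
  extension \<open>N\<close> of \<open>A\<close> by \<open>W\<close> with class
  \<open>pull C x e\<close>. This class is zero, so \<open>W\<close> is a retract of
  \<open>N\<close>, and the retraction carries the class of \<open>N\<close> over \<open>Z\<close>
  to the required one.\<close>

lemma ext_exact_middle_pull:
  assumes R: "Real C A B Z d x y" and e: "exte C e B W" "pull C x e = 0"
  shows "\<exists>e'. exte C e' Z W \<and> pull C y e' = e"
proof -
  note r = RealD[OF R]
  have W: "W \<in> Ob C" using e exte_ob by blast
  obtain M u v where M: "Real C W M B e u v" using realise[OF e(1)] by blast
  obtain N d1 e1 \<epsilon> h where N: "arr C e1 W N" "Real C N M Z \<epsilon> h (y \<cdot> v)"
    "Real C W N A (pull C x e) e1 d1" "pull C y \<epsilon> = push C e1 e"
    using deflation_octahedron[OF R M] by blast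
  have "push C (idm C W) (pull C x e) = 0"
    using e push_ext_id[OF exte_pull[OF e(1) r(2)]] by simp
  then obtain \<rho> where \<rho>: "arr C \<rho> N W" "\<rho> \<cdot> e1 = idm C W"
    using factor_inflation[OF N(3) arr_id[OF W]] by blast
  note n = RealD[OF N(2)]
  have "pull C y (push C \<rho> \<epsilon>) = push C \<rho> (push C e1 e)"
    using push_pull_commute[OF n(1) \<rho>(1) r(3)] N(4) by simp
  also have "\<dots> = e" using push_push[OF e(1) N(1) \<rho>(1)] \<rho>(2) push_ext_id[OF e(1)] by simp
  finally show ?thesis using exte_push[OF n(1) \<rho>(1)] by blast
qed

lemma ext_exact_middle_push:
  assumes R: "Real C A B Z d x y" and e: "exte C e W B" "push C y e = 0"
  shows "\<exists>e'. exte C e' W A \<and> push C x e' = e"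
proof -
  interpret op: extriangulated_category "opp C" by (rule opp_extriangulated)
  show ?thesis using op.ext_exact_middle_pull[of Z B A d y x e W] assms by auto
qed

text \<open>One half of the five lemma. As kernels and cokernels are only weak, an inverse is built
  in two stages: \<open>g0\<close> lifts \<open>c' \<cdot> y'\<close> along \<open>y\<close>, and
  its error, which is killed by \<open>y'\<close>, factors through \<open>x'\<close> and is
  corrected by a term through \<open>A\<close>. The other half is the dual, and two one-sided
  inverses give an isomorphism.\<close>

lemma middle_right_inverse:
  assumes R: "Real C A B Z d x y" and R': "Real C A' B' Z' d' x' y'"
    and a: "is_iso C A A' a" and c: "is_iso C Z Z' c" and b: "arr C b B B'"
    and e: "b \<cdot> x = x' \<cdot> a" "y' \<cdot> b = c \<cdot> y" "push C a d = pull C c d'"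
  shows "\<exists>g. arr C g B' B \<and> b \<cdot> g = idm C B'"
proof -
  note r = RealD[OF R] and r' = RealD[OF R']
  obtain a' where a: "arr C a A A'" "arr C a' A' A" "a' \<cdot> a = idm C A" "a \<cdot> a' = idm C A'"
    using is_isoD[OF a] r r' by metis
  obtain c' where c: "arr C c Z Z'" "arr C c' Z' Z" "c' \<cdot> c = idm C Z" "c \<cdot> c' = idm C Z'"
    using is_isoD[OF c] r r' by metis
  have "d = push C a' (push C a d)" using push_push[OF r(1) a(1,2)] a push_ext_id[OF r(1)] by simp
  then have d: "d = pull C c (push C a' d')" using e push_pull_commute[OF r'(1) a(2) c(1)] by simp
  have "pull C (c' \<cdot> y') d = pull C y' (pull C c' d)" using pull_pull[OF r(1) c(2) r'(3)] by simp
  also have "pull C c' d = push C a' d'"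
    using d pull_pull[OF exte_push[OF r'(1) a(2)] c(1,2)] c pull_ext_id[OF exte_push[OF r'(1) a(2)]] by simp
  also have "pull C y' (push C a' d') = 0"
    using push_pull_commute[OF r'(1) a(2) r'(3)] real_pull_zero[OF R'] push_zero[OF r'(5) a(2)] by simp
  finally obtain g0 where g0: "arr C g0 B' B" "y \<cdot> g0 = c' \<cdot> y'"
    using factor_deflation[OF R arr_comp[OF r'(3) c(2)]] by blast
  have bg: "arr C (b \<cdot> g0) B' B'" using arr_comp[OF g0(1) b] .
  have "y' \<cdot> (b \<cdot> g0) = c \<cdot> (y \<cdot> g0)"
    using assoc[OF g0(1) b r'(3)] e assoc[OF g0(1) r(3) c(1)] by simp
  also have "\<dots> = y'" using g0 assoc[OF r'(3) c(2,1)] c id_left[OF r'(3)] by simp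
  finally have "y' \<cdot> (idm C B' - b \<cdot> g0) = 0"
    using comp_diff_right[OF arr_id[OF r'(5)] bg r'(3)] id_right[OF r'(3)] by simp
  then obtain h where h: "arr C h B' A'" "x' \<cdot> h = idm C B' - b \<cdot> g0"
    using factor_kernel[OF R' arr_diff[OF arr_id[OF r'(5)] bg]] by blast
  have xah: "arr C (x \<cdot> (a' \<cdot> h)) B' B" using arr_comp[OF arr_comp[OF h(1) a(2)] r(2)] .
  have "b \<cdot> (x \<cdot> (a' \<cdot> h)) = (x' \<cdot> a) \<cdot> (a' \<cdot> h)"
    using assoc[OF arr_comp[OF h(1) a(2)] r(2) b] e by simp
  also have "\<dots> = x' \<cdot> h"
    using assoc[OF arr_comp[OF h(1) a(2)] a(1) r'(2)] assoc[OF h(1) a(2,1)] a id_left[OF h(1)] by simp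
  finally have "b \<cdot> (g0 + x \<cdot> (a' \<cdot> h)) = idm C B'"
    using comp_add_right[OF g0(1) xah b] h(2) by simp
  then show ?thesis using arr_add[OF g0(1) xah] by blast
qed

lemma middle_iso:
  assumes R: "Real C A B Z d x y" and R': "Real C A' B' Z' d' x' y'"
    and a: "is_iso C A A' a" and c: "is_iso C Z Z' c" and b: "arr C b B B'"
    and e: "b \<cdot> x = x' \<cdot> a" "y' \<cdot> b = c \<cdot> y" "push C a d = pull C c d'"
  shows "is_iso C B B' b"
proof -
  interpret op: extriangulated_category "opp C" by (rule opp_extriangulated)
  obtain g where g: "arr C g B' B" "b \<cdot> g = idm C B'" using middle_right_inverse[OF assms] by blast
  obtain h where h: "arr C h B' B" "h \<cdot> b = idm C B"
    using op.middle_right_inverse[of Z' B' A' d' y' x' Z B A d y x c a b] assms by auto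
  show ?thesis using is_isoI'[OF b h(1) g(1) h(2) g(2)] .
qed

text \<open>A push-out along an isomorphism has an isomorphic middle term by the five lemma, so
  \<open>B\<close> itself realises the new class.\<close>

lemma real_push_iso:
  assumes R: "Real C A B Z d x y" and a: "is_iso C A A' a" "A' \<in> Ob C"
  shows "\<exists>x' y'. Real C A' B Z (push C a d) x' y'"
proof -
  note r = RealD[OF R]
  have a': "arr C a A A'" using is_isoD[OF a(1) r(4) a(2)] by blast
  obtain B' u v where R': "Real C A' B' Z (push C a d) u v" using realise exte_push[OF r(1) a'] by blast
  note r' = RealD[OF R']
  have e: "push C a d = pull C (idm C Z) (push C a d)" using pull_ext_id[OF r'(1)] by simp
  obtain b where b: "arr C b B B'" "b \<cdot> x = u \<cdot> a" "v \<cdot> b = idm C Z \<cdot> y"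
    using real_complete_middle[OF R R' a' arr_id[OF r(6)] e] by blast
  have "is_iso C B B' b" using middle_iso[OF R R' a(1) iso_id[OF r(6)] b e] .
  then obtain g where g: "arr C g B' B" "g \<cdot> b = idm C B" "b \<cdot> g = idm C B'"
    using is_isoD r r' by metis
  have "Real C A' B Z (push C a d) (g \<cdot> u) (v \<cdot> b)"
    using real_isoI[OF R' is_isoI[OF g(1) b(1) g(3,2)] r(5) arr_comp[OF r'(2) g(1)] arr_comp[OF b(1) r'(3)]]
      assoc[OF g(1) b(1) r'(3)] g id_right[OF r'(3)] by simp
  then show ?thesis by blast
qed

lemma real_middle_unique:
  assumes "Real C A B Z d x y" "Real C A B' Z d x' y'"
  shows "\<exists>b. is_iso C B B' b"
  using real_class[OF assms(1), of B' x' y'] RealD[OF assms(2)] assms(2) by (auto simp: arr_def)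

text \<open>The map with components \<open>p\<close> and \<open>r\<close> is the composite of the
  deflation formed by \<open>p\<close> and the identity of \<open>B\<close>, with values in the sum
  \<open>U\<close> of \<open>T\<close> and \<open>B\<close>, and the split deflation from
  \<open>U\<close> to \<open>T\<close> with components 1 and \<open>r\<close>. It serves to enlarge
  the source of a deflation by one more prescribed map.\<close>

lemma deflation_extend:
  assumes R: "Real C K A T d k p" and r: "arr C r B T" and S: "biprod C A B S i j s t"
  shows "\<exists>N \<epsilon> h. Real C N S T \<epsilon> h (p \<cdot> s + r \<cdot> t)"
proof -
  note R' = RealD[OF R] and S' = biprodD[OF S]
  obtain U i2 j2 s2 t2 where U: "biprod C T B U i2 j2 s2 t2" using biprod_exists[OF R'(6) S'(11)] by blast
  note U' = biprodD[OF U]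
  obtain N0 where N0: "N0 \<in> Ob C" "idm C N0 = 0" using zero_object_exists by blast
  have R1: "Real C K S U (push C (idm C K) (pull C s2 d) + push C 0 (pull C t2 0))
      (i \<cdot> k \<cdot> idm C K + j \<cdot> 0 \<cdot> 0) (i2 \<cdot> p \<cdot> s + j2 \<cdot> idm C B \<cdot> t)"
    using real_sum_biprod[OF R real_trivial(2)[OF S'(11) N0] biprod_zero[OF R'(4) N0] S U] .
  have j': "arr C (i2 \<cdot> r) B U" using arr_comp[OF r U'(1)] .
  have rt: "arr C (r \<cdot> t2) U T" using arr_comp[OF U'(4) r] .
  \<comment> \<open>A shear of the biproduct \<open>U\<close>: the second summand is embedded by the
    graph of \<open>- r\<close>, so that the first projection becomes the map with components 1 and
    \<open>r\<close>.\<close>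
  have U2: "biprod C T B U i2 (j2 - i2 \<cdot> r) (s2 + r \<cdot> t2) t2"
    unfolding biprod_def
  proof (intro conjI)
    show "arr C i2 T U" "arr C t2 U B" using U' by auto
    show "arr C (j2 - i2 \<cdot> r) B U" using arr_diff[OF U'(2) j'] .
    show "arr C (s2 + r \<cdot> t2) U T" using arr_add[OF U'(3) rt] .
    show "(s2 + r \<cdot> t2) \<cdot> i2 = idm C T"
      using comp_add_left[OF U'(1) U'(3) rt] assoc[OF U'(1,4) r] comp_zero_right[OF U'(10) r] U' by simp
    have "(s2 + r \<cdot> t2) \<cdot> (j2 - i2 \<cdot> r) = s2 \<cdot> (j2 - i2 \<cdot> r) + r \<cdot> (t2 \<cdot> (j2 - i2 \<cdot> r))"
      using comp_add_left[OF arr_diff[OF U'(2) j'] U'(3) rt] assoc[OF arr_diff[OF U'(2) j'] U'(4) r] by simp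
    moreover have s: "s2 \<cdot> (j2 - i2 \<cdot> r) = - r"
      using comp_diff_right[OF U'(2) j' U'(3)] assoc[OF r U'(1,3)] U' id_left[OF r] by simp
    moreover have t: "t2 \<cdot> (j2 - i2 \<cdot> r) = idm C B"
      using comp_diff_right[OF U'(2) j' U'(4)] assoc[OF r U'(1,4)] U' comp_zero_left[OF U'(11) r] by simp
    ultimately show "(s2 + r \<cdot> t2) \<cdot> (j2 - i2 \<cdot> r) = 0" using id_right[OF r] by simp
    show "t2 \<cdot> (j2 - i2 \<cdot> r) = idm C B" by (rule t)
    show "t2 \<cdot> i2 = 0" using U' by simp
    have "i2 \<cdot> (s2 + r \<cdot> t2) = i2 \<cdot> s2 + (i2 \<cdot> r) \<cdot> t2"
      using comp_add_right[OF U'(3) rt U'(1)] assoc[OF U'(4) r U'(1)] by simp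
    moreover have "(j2 - i2 \<cdot> r) \<cdot> t2 = j2 \<cdot> t2 - (i2 \<cdot> r) \<cdot> t2"
      using comp_diff_left[OF U'(4) U'(2) j'] .
    ultimately show "i2 \<cdot> (s2 + r \<cdot> t2) + (j2 - i2 \<cdot> r) \<cdot> t2 = idm C U" using U' by simp
  qed
  have R2: "Real C B U T 0 (j2 - i2 \<cdot> r) (s2 + r \<cdot> t2)"
    using real_split[OF biprod_swap[OF U2]] .
  have ps: "arr C (p \<cdot> s) S T" using arr_comp[OF S'(3) R'(3)] .
  have "i2 \<cdot> p \<cdot> s + j2 \<cdot> idm C B \<cdot> t = i2 \<cdot> (p \<cdot> s) + j2 \<cdot> t"
    using assoc[OF S'(3) R'(3) U'(1)] id_right[OF U'(2)] by simp
  moreover have "(s2 + r \<cdot> t2) \<cdot> (i2 \<cdot> (p \<cdot> s) + j2 \<cdot> t) = p \<cdot> s + r \<cdot> t"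
    using comp_add_left[OF biprod_map_in(1)[OF U ps S'(4)] U'(3) rt] biprod_map_in(2,3)[OF U ps S'(4)]
      assoc[OF biprod_map_in(1)[OF U ps S'(4)] U'(4) r] by simp
  ultimately show ?thesis using deflation_octahedron[OF R2 R1] by metis
qed

lemma ext_exists_push:
  assumes "Real C A B Z d x y" "exte C e Z W" "\<forall>e'. exte C e' B W \<longrightarrow> e' = 0"
  shows "\<exists>f. arr C f A W \<and> push C f d = e"
  using ext_exact_push[OF assms(1,2)] exte_pull[OF assms(2) RealD(3)[OF assms(1)]] assms(3) by blast

lemma ext_exists_pull:
  assumes "Real C A B Z d x y" "exte C e W A" "\<forall>e'. exte C e' W B \<longrightarrow> e' = 0"
  shows "\<exists>f. arr C f W Z \<and> pull C f d = e"
  using ext_exact_pull[OF assms(1,2)] exte_push[OF assms(2) RealD(2)[OF assms(1)]] assms(3) by blast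

end

section \<open>Dimensions of subspaces\<close>

context vector_space
begin

lemma fin_basis:
  assumes "subspace V" "fin_dim scale V"
  shows "\<exists>B. finite B \<and> B \<subseteq> V \<and> independent B \<and> span B = V \<and> card B = dim V"
proof -
  obtain A where A: "finite A" "A \<subseteq> V" "V \<subseteq> span A" using assms by (auto simp: fin_dim_def)
  obtain B where B: "B \<subseteq> V" "independent B" "V \<subseteq> span B" "card B = dim V"
    using basis_exists[of V] by blast
  have "finite B" using independent_span_bound[OF A(1) B(2)] B(1) A(3) by blast
  moreover have "span B = V" using B(1,3) assms(1) span_minimal by blast
  ultimately show ?thesis using B by blast
qed

lemma fin_dimI: "finite B \<Longrightarrow> B \<subseteq> V \<Longrightarrow> V \<subseteq> span B \<Longrightarrow> fin_dim scale V"
  unfolding fin_dim_def by blast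

lemma fin_dim_subspace:
  assumes U: "subspace U" "U \<subseteq> V" and V: "subspace V" "fin_dim scale V"
  shows "fin_dim scale U" "dim U \<le> dim V"
proof -
  obtain B where B: "finite B" "span B = V" "card B = dim V" using fin_basis[OF V] by blast
  obtain A where A: "A \<subseteq> U" "independent A" "U \<subseteq> span A" "card A = dim U"
    using basis_exists[of U] by blast
  have "A \<subseteq> span B" using A(1) U(2) B(2) by blast
  then have "finite A \<and> card A \<le> card B" using independent_span_bound[OF B(1) A(2)] by blast
  then show "fin_dim scale U" "dim U \<le> dim V" using A B fin_dimI by auto
qed

lemma fin_dim_extend_basis:
  assumes U: "subspace U" "U \<subseteq> V" and V: "subspace V" "fin_dim scale V"
  shows "\<exists>A B. A \<subseteq> B \<and> finite B \<and> A \<subseteq> U \<and> B \<subseteq> V \<and> independent B \<and> span A = U \<and> span B = V \<and>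
     card A = dim U \<and> card B = dim V"
proof -
  obtain A where A: "finite A" "A \<subseteq> U" "independent A" "span A = U" "card A = dim U"
    using fin_basis[OF U(1) fin_dim_subspace(1)[OF U V]] by blast
  obtain B where B: "A \<subseteq> B" "B \<subseteq> V" "independent B" "V \<subseteq> span B"
    using maximal_independent_subset_extend[of A V] A U by blast
  obtain B' where B': "finite B'" "span B' = V" using fin_basis[OF V] by blast
  have "finite B" using independent_span_bound[OF B'(1) B(3)] B(2) B'(2) by blast
  moreover have "span B = V" using B V(1) span_minimal by blast
  moreover have "card B = dim V" using B basis_card_eq_dim[of B V] by blast
  ultimately show ?thesis using A B by blast
qed

lemma subspace_eq_dim:
  assumes U: "subspace U" "U \<subseteq> V" and V: "subspace V" "fin_dim scale V" and d: "dim V \<le> dim U"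
  shows "U = V"
proof -
  obtain A B where AB: "A \<subseteq> B" "finite B" "span A = U" "span B = V" "card A = dim U" "card B = dim V"
    using fin_dim_extend_basis[OF U V] by blast
  have "A = B" using card_subset_eq[OF AB(2,1)] card_mono[OF AB(2,1)] AB d by simp
  then show ?thesis using AB by simp
qed

lemma dim_zero_iff:
  assumes V: "subspace V" "fin_dim scale V"
  shows "dim V = 0 \<longleftrightarrow> V = {0}"
proof
  assume "dim V = 0"
  then show "V = {0}"
    using fin_basis[OF V] by (metis card_0_eq span_empty)
next
  assume "V = {0}"
  then show "dim V = 0" using dim_span[of "{}"] dim_eq_card_independent[OF independent_empty] by simp
qed

lemma complement_exists:
  assumes U: "subspace U" "U \<subseteq> V" and V: "subspace V" "fin_dim scale V"
  shows "\<exists>U'. subspace U' \<and> U' \<subseteq> V \<and> dim U + dim U' = dim V \<and> (\<forall>v\<in>V. \<exists>u\<in>U. \<exists>u'\<in>U'. v = u + u')"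
proof -
  obtain A B where AB: "A \<subseteq> B" "finite B" "span A = U" "span B = V" "card A = dim U"
    "card B = dim V" "independent B" "B \<subseteq> V"
    using fin_dim_extend_basis[OF U V] by blast
  have "dim (span (B - A)) = card (B - A)"
    using dim_eq_card_independent independent_mono[OF AB(7)] dim_span by (metis Diff_subset)
  moreover have "card A + card (B - A) = card B"
    using AB by (metis card_Diff_subset card_mono finite_subset le_add_diff_inverse)
  moreover have "span (B - A) \<subseteq> V" using AB span_mono[of "B - A" B] by blast
  moreover have "\<exists>u\<in>U. \<exists>u'\<in>span (B - A). v = u + u'" if "v \<in> V" for v
  proof -
    have "v \<in> span (A \<union> (B - A))" using that AB(1,4) by (simp add: Un_absorb1 Un_Diff_cancel)
    then show ?thesis unfolding span_Un AB(3)[symmetric] by blast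
  qed
  ultimately show ?thesis using AB by (intro exI[of _ "span (B - A)"]) auto
qed

end

lemma linear_map_onD:
  assumes "linear_map_on s V t W \<phi>"
  shows "x \<in> V \<Longrightarrow> \<phi> x \<in> W" "x \<in> V \<Longrightarrow> y \<in> V \<Longrightarrow> \<phi> (x + y) = \<phi> x + \<phi> y" "x \<in> V \<Longrightarrow> \<phi> (s a x) = t a (\<phi> x)"
  using assms by (auto simp: semilinear_on_def)

context vector_space_pair
begin

lemma lin_zero:
  assumes "linear_map_on s1 V s2 W \<phi>" "vs1.subspace V" shows "\<phi> 0 = 0"
  using linear_map_onD(2)[OF assms(1), of 0 0] vs1.subspace_0[OF assms(2)] by simp

lemma lin_diff:
  assumes "linear_map_on s1 V s2 W \<phi>" "vs1.subspace V" "x \<in> V" "y \<in> V"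
  shows "\<phi> (x - y) = \<phi> x - \<phi> y"
  using linear_map_onD(2)[OF assms(1), of "x - y" y] vs1.subspace_diff[OF assms(2-4)] assms(4)
  by (simp add: algebra_simps)

lemma lin_sum:
  assumes "linear_map_on s1 V s2 W \<phi>" "vs1.subspace V" "\<And>i. i \<in> S \<Longrightarrow> f i \<in> V"
  shows "\<phi> (\<Sum>i\<in>S. s1 (c i) (f i)) = (\<Sum>i\<in>S. s2 (c i) (\<phi> (f i)))"
  using assms(3)
proof (induction S rule: infinite_finite_induct)
  case (insert x S)
  have "(\<Sum>i\<in>S. s1 (c i) (f i)) \<in> V" "s1 (c x) (f x) \<in> V"
    using insert(4) vs1.subspace_sum[OF assms(2), of S "\<lambda>i. s1 (c i) (f i)"]
      vs1.subspace_scale[OF assms(2)] by auto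
  then show ?case using insert linear_map_onD[OF assms(1)] by simp
qed (use lin_zero[OF assms(1,2)] in auto)

lemma lin_image_subspace:
  assumes "linear_map_on s1 V s2 W \<phi>" "vs1.subspace V"
  shows "vs2.subspace (\<phi> ` V)"
proof (rule vs2.subspaceI)
  show "0 \<in> \<phi> ` V" using lin_zero[OF assms] vs1.subspace_0[OF assms(2)] by force
next
  fix x y assume "x \<in> \<phi> ` V" "y \<in> \<phi> ` V"
  then obtain a b where ab: "a \<in> V" "b \<in> V" "x = \<phi> a" "y = \<phi> b" by blast
  then have "x + y = \<phi> (a + b)" using linear_map_onD(2)[OF assms(1)] by simp
  then show "x + y \<in> \<phi> ` V" using vs1.subspace_add[OF assms(2)] ab by blast
next
  fix c x assume "x \<in> \<phi> ` V"
  then obtain a where a: "a \<in> V" "x = \<phi> a" by blast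
  then have "s2 c x = \<phi> (s1 c a)" using linear_map_onD(3)[OF assms(1)] by simp
  then show "s2 c x \<in> \<phi> ` V" using vs1.subspace_scale[OF assms(2)] a by blast
qed

lemma lin_kernel_subspace:
  assumes "linear_map_on s1 V s2 W \<phi>" "vs1.subspace V"
  shows "vs1.subspace {x\<in>V. \<phi> x = 0}"
proof (rule vs1.subspaceI)
  show "0 \<in> {x\<in>V. \<phi> x = 0}" using lin_zero[OF assms] vs1.subspace_0[OF assms(2)] by simp
next
  fix x y assume "x \<in> {x\<in>V. \<phi> x = 0}" "y \<in> {x\<in>V. \<phi> x = 0}"
  then show "x + y \<in> {x\<in>V. \<phi> x = 0}"
    using linear_map_onD(2)[OF assms(1)] vs1.subspace_add[OF assms(2)] by simp
next
  fix c x assume "x \<in> {x\<in>V. \<phi> x = 0}"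
  then show "s1 c x \<in> {x\<in>V. \<phi> x = 0}"
    using linear_map_onD(3)[OF assms(1)] vs1.subspace_scale[OF assms(2)] by simp
qed

lemma lin_image_span:
  assumes "linear_map_on s1 V s2 W \<phi>" "vs1.subspace V" "finite B" "B \<subseteq> V" "V \<subseteq> vs1.span B"
  shows "\<phi> ` V \<subseteq> vs2.span (\<phi> ` B)"
proof
  fix y assume "y \<in> \<phi> ` V"
  then obtain x where x: "x \<in> V" "y = \<phi> x" by blast
  then obtain u where "x = (\<Sum>v\<in>B. s1 (u v) v)" using assms(5) vs1.span_finite[OF assms(3)] by auto
  then have "y = (\<Sum>v\<in>B. s2 (u v) (\<phi> v))" using lin_sum[OF assms(1,2), of B "\<lambda>v. v" u] x assms(4) by auto
  then show "y \<in> vs2.span (\<phi> ` B)"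
    using vs2.span_sum[of B "\<lambda>v. s2 (u v) (\<phi> v)"] vs2.span_scale[OF vs2.span_base] by auto
qed

lemma lin_image_fin_dim:
  assumes "linear_map_on s1 V s2 W \<phi>" "vs1.subspace V" "fin_dim s1 V"
  shows "fin_dim s2 (\<phi> ` V)"
proof -
  obtain B where B: "finite B" "B \<subseteq> V" "V \<subseteq> vs1.span B" using assms(3) by (auto simp: fin_dim_def)
  show ?thesis
    by (rule vs2.fin_dimI[OF finite_imageI[OF B(1)] image_mono[OF B(2)] lin_image_span[OF assms(1,2) B]])
qed

lemma lin_lift_independent:
  assumes lin: "linear_map_on s1 V s2 W \<phi>" and V: "vs1.subspace V" and D: "finite D" "D \<subseteq> V"
    and inj: "inj_on \<phi> D" and ind: "vs2.independent (\<phi> ` D)" and z: "(\<Sum>v\<in>D. s2 (u v) (\<phi> v)) = 0"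
  shows "\<forall>v\<in>D. u v = 0"
proof (rule ccontr)
  assume "\<not> (\<forall>v\<in>D. u v = 0)"
  then obtain v where v: "v \<in> D" "u v \<noteq> 0" by blast
  define w where "w = u \<circ> inv_into D \<phi>"
  have "(\<Sum>y\<in>\<phi> ` D. s2 (w y) y) = (\<Sum>v\<in>D. s2 (w (\<phi> v)) (\<phi> v))"
    using sum.reindex[OF inj, of "\<lambda>y. s2 (w y) y"] by (simp add: o_def)
  also have "\<dots> = 0" using z inj by (simp add: w_def)
  finally have "vs2.dependent (\<phi> ` D)"
    using v inj unfolding vs2.dependent_finite[OF finite_imageI[OF D(1)]] by (auto simp: w_def intro!: exI[of _ w])
  then show False using ind by simp
qed

text \<open>A basis of the kernel together with lifts of a basis of the image is a basis of
  \<open>V\<close>. Here \<open>\<phi>\<close> is linear on the subspace \<open>V\<close> only, not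
  on the whole type.\<close>

lemma rank_nullity:
  assumes lin: "linear_map_on s1 V s2 W \<phi>" and V: "vs1.subspace V" "fin_dim s1 V"
  shows "vs1.dim V = vs1.dim {x\<in>V. \<phi> x = 0} + vs2.dim (\<phi> ` V)"
proof -
  let ?K = "{x\<in>V. \<phi> x = 0}"
  obtain A where A: "finite A" "A \<subseteq> ?K" "vs1.independent A" "vs1.span A = ?K" "card A = vs1.dim ?K"
    using vs1.fin_basis[OF lin_kernel_subspace[OF lin V(1)]]
      vs1.fin_dim_subspace(1)[OF lin_kernel_subspace[OF lin V(1)] _ V] by blast
  obtain E where E: "finite E" "E \<subseteq> \<phi> ` V" "vs2.independent E" "vs2.span E = \<phi> ` V" "card E = vs2.dim (\<phi> ` V)"
    using vs2.fin_basis[OF lin_image_subspace[OF lin V(1)] lin_image_fin_dim[OF lin V]] by blast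
  obtain D where D: "D \<subseteq> V" "inj_on \<phi> D" "E = \<phi> ` D" using E(2) subset_image_inj by metis
  have fD: "finite D" using D E finite_imageD by blast
  have disj: "A \<inter> D = {}"
  proof (rule ccontr)
    assume "A \<inter> D \<noteq> {}"
    then have "0 \<in> E" using A D by force
    then show False using E(3) vs2.dependent_zero by blast
  qed
  have "vs1.independent (A \<union> D)"
  proof
    assume "vs1.dependent (A \<union> D)"
    then obtain u v where u: "v \<in> A \<union> D" "u v \<noteq> 0" "(\<Sum>x\<in>A \<union> D. s1 (u x) x) = 0"
      using vs1.dependent_finite[of "A \<union> D"] A(1) fD by auto
    have s: "(\<Sum>x\<in>A. s1 (u x) x) + (\<Sum>x\<in>D. s1 (u x) x) = 0"
      using u sum.union_disjoint[OF A(1) fD disj] by metis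
    have mem: "(\<Sum>x\<in>A. s1 (u x) x) \<in> vs1.span A" "(\<Sum>x\<in>D. s1 (u x) x) \<in> V"
      using vs1.span_sum[of A "\<lambda>x. s1 (u x) x" A] vs1.span_scale[OF vs1.span_base]
        vs1.subspace_sum[OF V(1), of D "\<lambda>x. s1 (u x) x", OF vs1.subspace_scale[OF V(1) subsetD[OF D(1)]]]
      by auto
    then have "\<phi> (\<Sum>x\<in>A. s1 (u x) x) = 0" "(\<Sum>x\<in>A. s1 (u x) x) \<in> V" using A by auto
    then have "\<phi> (\<Sum>x\<in>D. s1 (u x) x) = 0"
      using linear_map_onD(2)[OF lin, of "\<Sum>x\<in>A. s1 (u x) x" "\<Sum>x\<in>D. s1 (u x) x"] s mem lin_zero[OF lin V(1)] by simp
    then have "(\<Sum>x\<in>D. s2 (u x) (\<phi> x)) = 0" using lin_sum[OF lin V(1), of D "\<lambda>x. x" u, OF subsetD[OF D(1)]] by simp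
    then have uD: "\<forall>x\<in>D. u x = 0" using lin_lift_independent[OF lin V(1) fD D(1,2)] E(3) D(3) by blast
    then have "(\<Sum>x\<in>A. s1 (u x) x) = 0" using s by simp
    then have "\<forall>x\<in>A. u x = 0" using A(3) vs1.dependent_finite[OF A(1)] by blast
    then show False using u uD by blast
  qed
  moreover have "V \<subseteq> vs1.span (A \<union> D)"
  proof
    fix x assume x: "x \<in> V"
    then have "\<phi> x \<in> vs2.span E" using E by blast
    then obtain u where u: "\<phi> x = (\<Sum>y\<in>E. s2 (u y) y)" using vs2.span_finite[OF E(1)] by auto
    have "\<phi> x = (\<Sum>y\<in>D. s2 (u (\<phi> y)) (\<phi> y))" using u sum.reindex[OF D(2), of "\<lambda>y. s2 (u y) y"] D(3) by simp
    also have "\<dots> = \<phi> (\<Sum>y\<in>D. s1 (u (\<phi> y)) y)"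
      using lin_sum[OF lin V(1), of D "\<lambda>y. y" "\<lambda>y. u (\<phi> y)", OF subsetD[OF D(1)]] by simp
    finally have e: "\<phi> x = \<phi> (\<Sum>y\<in>D. s1 (u (\<phi> y)) y)" .
    have m: "(\<Sum>y\<in>D. s1 (u (\<phi> y)) y) \<in> V"
      using D(1) by (auto intro!: vs1.subspace_sum[OF V(1)] vs1.subspace_scale[OF V(1)])
    have "x - (\<Sum>y\<in>D. s1 (u (\<phi> y)) y) \<in> ?K"
      using lin_diff[OF lin V(1) x m] e vs1.subspace_diff[OF V(1) x m] by simp
    then have "x - (\<Sum>y\<in>D. s1 (u (\<phi> y)) y) \<in> vs1.span (A \<union> D)"
      using A(4) vs1.span_mono[of A "A \<union> D"] by blast
    moreover have "(\<Sum>y\<in>D. s1 (u (\<phi> y)) y) \<in> vs1.span (A \<union> D)"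
      using vs1.span_sum[of D "\<lambda>y. s1 (u (\<phi> y)) y" "A \<union> D"] vs1.span_scale[OF vs1.span_base] by auto
    ultimately show "x \<in> vs1.span (A \<union> D)" using vs1.span_add by fastforce
  qed
  moreover have "A \<union> D \<subseteq> V" using A D by blast
  ultimately have "card (A \<union> D) = vs1.dim V" using vs1.basis_card_eq_dim[of "A \<union> D" V] by blast
  then show ?thesis using A E D card_Un_disjoint[OF A(1) fD disj] card_image[OF D(2)] by simp
qed

lemma dim_injective_image:
  assumes lin: "linear_map_on s1 V s2 W \<phi>" and V: "vs1.subspace V" "fin_dim s1 V"
    and inj: "\<And>x. x \<in> V \<Longrightarrow> \<phi> x = 0 \<Longrightarrow> x = 0"
  shows "vs2.dim (\<phi> ` V) = vs1.dim V"
proof -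
  have "{x\<in>V. \<phi> x = 0} = {0}" using inj lin_zero[OF lin V(1)] vs1.subspace_0[OF V(1)] by auto
  then have "vs1.dim {x\<in>V. \<phi> x = 0} = 0"
    using vs1.dim_zero_iff[OF lin_kernel_subspace[OF lin V(1)]]
      vs1.fin_dim_subspace(1)[OF lin_kernel_subspace[OF lin V(1)] _ V] by auto
  then show ?thesis using rank_nullity[OF lin V] by simp
qed

end

text \<open>A basis of the image of \<open>\<phi>\<close> is lifted to \<open>V\<close> and stays
  independent under \<open>\<psi>\<close>. The space \<open>V\<close> may be infinite-dimensional,
  so nullities cannot be compared; in the application it is an endomorphism space, which is finite
  only modulo maps through projectives.\<close>

lemma dim_image_le_of_kernel:
  fixes s :: "'k::field \<Rightarrow> 'v::ab_group_add \<Rightarrow> 'v" and t1 :: "'k \<Rightarrow> 'w::ab_group_add \<Rightarrow> 'w"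
    and t2 :: "'k \<Rightarrow> 'x::ab_group_add \<Rightarrow> 'x"
  assumes vs: "vector_space s" "vector_space t1" "vector_space t2" and V: "subsp s V"
    and l1: "linear_map_on s V t1 W1 \<phi>" and l2: "linear_map_on s V t2 W2 \<psi>"
    and fd: "fin_dim t1 (\<phi> ` V)" "fin_dim t2 (\<psi> ` V)"
    and ker: "\<And>x. x \<in> V \<Longrightarrow> \<psi> x = 0 \<Longrightarrow> \<phi> x = 0"
  shows "vector_space.dim t1 (\<phi> ` V) \<le> vector_space.dim t2 (\<psi> ` V)"
proof -
  interpret p1: vector_space_pair s t1 using vs by (simp add: vector_space_pair_def)
  interpret p2: vector_space_pair s t2 using vs by (simp add: vector_space_pair_def)
  obtain E where E: "finite E" "E \<subseteq> \<phi> ` V" "p1.vs2.independent E" "card E = p1.vs2.dim (\<phi> ` V)"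
    using p1.vs2.fin_basis[OF p1.lin_image_subspace[OF l1 V] fd(1)] by blast
  obtain D where D: "D \<subseteq> V" "inj_on \<phi> D" "E = \<phi> ` D" using E(2) subset_image_inj by metis
  have fD: "finite D" using D E finite_imageD by blast
  have inj: "inj_on \<psi> D"
  proof
    fix x y assume xy: "x \<in> D" "y \<in> D" "\<psi> x = \<psi> y"
    then have m: "x - y \<in> V" using D p1.vs1.subspace_diff[OF V] by blast
    have "\<phi> (x - y) = 0" using ker[OF m] p2.lin_diff[OF l2 V] xy D by (simp add: subset_iff)
    then have "\<phi> x = \<phi> y" using p1.lin_diff[OF l1 V] xy D by (simp add: subset_iff)
    then show "x = y" using D xy by (meson inj_onD)
  qed
  have ind: "p2.vs2.independent (\<psi> ` D)"
  proof
    assume "p2.vs2.dependent (\<psi> ` D)"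
    then obtain u v where u: "v \<in> \<psi> ` D" "u v \<noteq> 0" "(\<Sum>x\<in>\<psi> ` D. t2 (u x) x) = 0"
      using p2.vs2.dependent_finite[of "\<psi> ` D"] fD by auto
    have "(\<Sum>x\<in>D. t2 (u (\<psi> x)) (\<psi> x)) = 0"
      using u(3) sum.reindex[OF inj, of "\<lambda>x. t2 (u x) x"] by simp
    then have "\<psi> (\<Sum>x\<in>D. s (u (\<psi> x)) x) = 0"
      using p2.lin_sum[OF l2 V, of D "\<lambda>x. x" "\<lambda>x. u (\<psi> x)", OF subsetD[OF D(1)]] by simp
    moreover have "(\<Sum>x\<in>D. s (u (\<psi> x)) x) \<in> V"
      using D(1) by (auto intro!: p1.vs1.subspace_sum[OF V] p1.vs1.subspace_scale[OF V])
    ultimately have "\<phi> (\<Sum>x\<in>D. s (u (\<psi> x)) x) = 0" using ker by blast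
    then have "(\<Sum>x\<in>D. t1 (u (\<psi> x)) (\<phi> x)) = 0"
      using p1.lin_sum[OF l1 V, of D "\<lambda>x. x" "\<lambda>x. u (\<psi> x)", OF subsetD[OF D(1)]] by simp
    then have "\<forall>x\<in>D. u (\<psi> x) = 0"
      using p1.lin_lift_independent[OF l1 V fD D(1,2), of "\<lambda>x. u (\<psi> x)"] E(3) D(3) by blast
    then show False using u by blast
  qed
  have sub: "p2.vs2.subspace (\<psi> ` V)" using p2.lin_image_subspace[OF l2 V] .
  obtain B where B: "finite B" "p2.vs2.span B = \<psi> ` V" "card B = p2.vs2.dim (\<psi> ` V)"
    using p2.vs2.fin_basis[OF sub fd(2)] by blast
  have "card (\<psi> ` D) \<le> card B"
    using p2.vs2.independent_span_bound[OF B(1) ind] B(2) D(1) by blast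
  then show ?thesis using B E D card_image[OF D(2)] card_image[OF inj] by simp
qed

lemma vector_space_field: "vector_space ((*) :: 'k::field \<Rightarrow> 'k \<Rightarrow> 'k)"
  by unfold_locales (simp_all add: algebra_simps)

lemma dim_field_le: "vector_space.dim ((*) :: 'k::field \<Rightarrow> 'k \<Rightarrow> 'k) V \<le> 1"
proof -
  interpret v: vector_space "(*) :: 'k \<Rightarrow> 'k \<Rightarrow> 'k" by (rule vector_space_field)
  have "x \<in> v.span {1}" for x :: 'k using v.span_scale[OF v.span_base[of "1::'k" "{1}"], of x] by simp
  then have s: "V \<subseteq> v.span {1}" for V :: "'k set" by blast
  show "v.dim V \<le> 1" using v.dim_le_card[OF s] by simp
qed

section \<open>Bilinear forms and annihilators\<close>

definition bilinear_on ::
  "('k::field \<Rightarrow> 'v::ab_group_add \<Rightarrow> 'v) \<Rightarrow> 'v set \<Rightarrow> ('k \<Rightarrow> 'w::ab_group_add \<Rightarrow> 'w) \<Rightarrow> 'w set \<Rightarrow>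
   ('v \<Rightarrow> 'w \<Rightarrow> 'k) \<Rightarrow> bool" where
  "bilinear_on s V t W p \<longleftrightarrow> (\<forall>w\<in>W. linear_map_on s V (*) UNIV (\<lambda>v. p v w)) \<and>
     (\<forall>v\<in>V. linear_map_on t W (*) UNIV (p v))"

lemma bilinear_on_mono:
  "bilinear_on s V t W p \<Longrightarrow> V' \<subseteq> V \<Longrightarrow> W' \<subseteq> W \<Longrightarrow> bilinear_on s V' t W' p"
  unfolding bilinear_on_def semilinear_on_def by (meson subsetD)

text \<open>Each element of a finite basis of \<open>W\<close> imposes one linear condition on
  \<open>V\<close> and so lowers the dimension by at most 1.\<close>

lemma annihilator_dim:
  fixes s :: "'k::field \<Rightarrow> 'v::ab_group_add \<Rightarrow> 'v" and t :: "'k \<Rightarrow> 'w::ab_group_add \<Rightarrow> 'w"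
  assumes vs: "vector_space s" "vector_space t" and V: "subsp s V" "fin_dim s V"
    and W: "subsp t W" "fin_dim t W" and p: "bilinear_on s V t W p"
  shows "vector_space.dim s V \<le> vector_space.dim s {v\<in>V. \<forall>w\<in>W. p v w = 0} + vector_space.dim t W"
proof -
  interpret v: vector_space s by fact
  interpret w: vector_space t by fact
  interpret f: vector_space "(*) :: 'k \<Rightarrow> 'k \<Rightarrow> 'k" by (rule vector_space_field)
  interpret vf: vector_space_pair s "(*) :: 'k \<Rightarrow> 'k \<Rightarrow> 'k" ..
  interpret wf: vector_space_pair t "(*) :: 'k \<Rightarrow> 'k \<Rightarrow> 'k" ..
  obtain B where B: "finite B" "B \<subseteq> W" "w.span B = W" "card B = w.dim W" using w.fin_basis[OF W] by blast
  have cut: "subsp s {v\<in>V. \<forall>w\<in>A. p v w = 0} \<and> v.dim V \<le> v.dim {v\<in>V. \<forall>w\<in>A. p v w = 0} + card A"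
    if "finite A" "A \<subseteq> W" for A
    using that
  proof (induction A rule: finite_induct)
    case (insert b A)
    let ?U = "{v\<in>V. \<forall>w\<in>A. p v w = 0}"
    have U: "subsp s ?U" and d: "v.dim V \<le> v.dim ?U + card A" using insert by auto
    have fU: "fin_dim s ?U" using v.fin_dim_subspace(1)[OF U _ V] by blast
    have lin: "linear_map_on s ?U (*) UNIV (\<lambda>v. p v b)"
      using p insert.prems unfolding bilinear_on_def semilinear_on_def by auto
    have e: "{x\<in>?U. p x b = 0} = {v\<in>V. \<forall>w\<in>insert b A. p v w = 0}" by blast
    have "v.dim ?U \<le> v.dim {v\<in>V. \<forall>w\<in>insert b A. p v w = 0} + 1"
      using vf.rank_nullity[OF lin U fU] dim_field_le[of "(\<lambda>v. p v b) ` ?U"] unfolding e by simp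
    then show ?case using d vf.lin_kernel_subspace[OF lin U] insert unfolding e by simp
  qed (use V in auto)
  have "{v\<in>V. \<forall>w\<in>B. p v w = 0} = {v\<in>V. \<forall>w\<in>W. p v w = 0}"
  proof -
    have "p v w = 0" if v: "v \<in> V" "\<forall>w\<in>B. p v w = 0" and w: "w \<in> W" for v w
    proof -
      have "w.span B \<subseteq> {x\<in>W. p v x = 0}"
        using p v B(2) by (intro w.span_minimal wf.lin_kernel_subspace[OF _ W(1)]) (auto simp: bilinear_on_def)
      then show ?thesis using w B(3) by blast
    qed
    then show ?thesis using B(2) by blast
  qed
  then show ?thesis using cut[OF B(1,2)] B(4) by simp
qed

lemma nondegenerate_dim_le:
  fixes s :: "'k::field \<Rightarrow> 'v::ab_group_add \<Rightarrow> 'v" and t :: "'k \<Rightarrow> 'w::ab_group_add \<Rightarrow> 'w"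
  assumes vs: "vector_space s" "vector_space t" and V: "subsp s V" "fin_dim s V"
    and W: "subsp t W" "fin_dim t W" and p: "bilinear_on s V t W p"
    and nd: "\<And>v. v \<in> V \<Longrightarrow> \<forall>w\<in>W. p v w = 0 \<Longrightarrow> v = 0"
  shows "vector_space.dim s V \<le> vector_space.dim t W"
proof -
  interpret v: vector_space s by fact
  interpret w: vector_space t by fact
  interpret vf: vector_space_pair s "(*) :: 'k \<Rightarrow> 'k \<Rightarrow> 'k"
    by (simp add: vector_space_pair_def vs vector_space_field)
  have "p 0 w = 0" if "w \<in> W" for w using p that vf.lin_zero[OF _ V(1)] by (auto simp: bilinear_on_def)
  then have "{v\<in>V. \<forall>w\<in>W. p v w = 0} = {0}" using nd v.subspace_0[OF V(1)] by auto
  then have "v.dim {v\<in>V. \<forall>w\<in>W. p v w = 0} = 0" using v.dim_span[of "{}"] v.dim_eq_card_independent[OF v.independent_empty] by simp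
  then show ?thesis using annihilator_dim[OF vs V W p] by simp
qed

text \<open>One inequality is the bound for annihilators. For the other, \<open>U\<close> is paired
  with a complement \<open>U'\<close>: an element of \<open>U\<close> that kills \<open>U'\<close>
  kills all of \<open>V\<close>, because it kills \<open>U\<close> anyway, so it is zero. The form
  is neither symmetric nor alternating by assumption; the annihilator is taken on the left.\<close>

lemma self_annihilator_dim:
  fixes s :: "'k::field \<Rightarrow> 'v::ab_group_add \<Rightarrow> 'v"
  assumes vs: "vector_space s" and V: "subsp s V" "fin_dim s V" and p: "bilinear_on s V s V p"
    and nd: "\<And>v. v \<in> V \<Longrightarrow> \<forall>w\<in>V. p v w = 0 \<Longrightarrow> v = 0"
    and U: "subsp s U" "U = {v\<in>V. \<forall>w\<in>U. p v w = 0}"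
  shows "vector_space.dim s V = 2 * vector_space.dim s U"
proof -
  interpret v: vector_space s by fact
  interpret vf: vector_space_pair s "(*) :: 'k \<Rightarrow> 'k \<Rightarrow> 'k"
    by (simp add: vector_space_pair_def vs vector_space_field)
  have sub: "U \<subseteq> V" using U(2) by blast
  have fU: "fin_dim s U" using v.fin_dim_subspace(1)[OF U(1) sub V] .
  have "v.dim V \<le> v.dim U + v.dim U"
    using annihilator_dim[OF vs vs V U(1) fU bilinear_on_mono[OF p subset_refl sub]] U(2) by simp
  moreover obtain U' where U': "subsp s U'" "U' \<subseteq> V" "v.dim U + v.dim U' = v.dim V"
    "\<forall>v\<in>V. \<exists>u\<in>U. \<exists>u'\<in>U'. v = u + u'"
    using v.complement_exists[OF U(1) sub V] by blast
  have "v.dim U \<le> v.dim U'"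
  proof (rule nondegenerate_dim_le[OF vs vs U(1) fU U'(1) v.fin_dim_subspace(1)[OF U'(1,2) V] bilinear_on_mono[OF p sub U'(2)]])
    fix v assume v: "v \<in> U" "\<forall>w\<in>U'. p v w = 0"
    have "p v w = 0" if w: "w \<in> V" for w
    proof -
      obtain u u' where u: "u \<in> U" "u' \<in> U'" "w = u + u'" using U'(4) w by blast
      have "linear_map_on s V (*) UNIV (p v)" using p v sub by (auto simp: bilinear_on_def)
      then have "p v w = p v u + p v u'" using linear_map_onD(2)[of s V "(*)" UNIV "p v" u u'] u sub U'(2) by auto
      moreover have "p v u = 0" using U(2) v(1) u(1) by blast
      ultimately show ?thesis using v u by simp
    qed
    then show "v = 0" using nd sub v by blast
  qed
  ultimately show ?thesis using U'(3) by linarith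
qed

section \<open>The duality pairing between extension spaces\<close>

text \<open>The 2-Calabi-Yau property in the form in which it is used from here on: a natural
  embedding of Ext^1(X,Y) into the dual of Ext^1(Y,X). The definition is free of the suspension, and
  non-degeneracy in the first argument is enough because it holds for both orders of the
  objects.\<close>

definition ext_pairing ::
  "('k::field, 'o, 'm::ab_group_add, 'e::ab_group_add) extri \<Rightarrow> ('o \<Rightarrow> 'o \<Rightarrow> 'e \<Rightarrow> 'e \<Rightarrow> 'k) \<Rightarrow> bool" where
  "ext_pairing C p \<longleftrightarrow>
     (\<forall>X\<in>Ob C. \<forall>Y\<in>Ob C. bilinear_on (escal C) (Ext C X Y) (escal C) (Ext C Y X) (p X Y)) \<and>
     (\<forall>X\<in>Ob C. \<forall>Y\<in>Ob C. \<forall>a\<in>Ext C X Y. (\<forall>b\<in>Ext C Y X. p X Y a b = 0) \<longrightarrow> a = 0) \<and>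
     (\<forall>X Y X' a b f. arr C f X' X \<longrightarrow> exte C a X Y \<longrightarrow> exte C b Y X' \<longrightarrow>
        p X' Y (pull C f a) b = p X Y a (push C f b)) \<and>
     (\<forall>X Y Y' a b g. arr C g Y Y' \<longrightarrow> exte C a X Y \<longrightarrow> exte C b Y' X \<longrightarrow>
        p X Y' (push C g a) b = p X Y a (pull C g b))"

locale calabi_yau_category = extriangulated_category +
  assumes frob: "frobenius C" and hom_finite: "stably_hom_finite C" and cy: "stably_2_calabi_yau C"

section \<open>Extensions as morphisms into the suspension\<close>

locale suspended_category = extriangulated_category +
  fixes \<Sigma> :: "'b \<Rightarrow> 'b" and \<epsilon> :: "'b \<Rightarrow> 'd"
  assumes frob: "frobenius C" and susp: "suspension C \<Sigma> \<epsilon>"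
begin

lemma susp_real:
  assumes "X \<in> Ob C" shows "\<exists>J x y. J \<in> injectives C \<and> Real C X J (\<Sigma> X) (\<epsilon> X) x y"
  using assms susp unfolding suspension_def by blast

lemma susp_exte: "X \<in> Ob C \<Longrightarrow> exte C (\<epsilon> X) (\<Sigma> X) X"
  using susp_real RealD(1) by metis

lemma susp_ob: "X \<in> Ob C \<Longrightarrow> \<Sigma> X \<in> Ob C"
  using susp_exte exte_ob by blast

lemma proj_inj: "projectives C = injectives C"
  using frob unfolding frobenius_def by blast

lemma exte_to_inj: "J \<in> injectives C \<Longrightarrow> exte C e X J \<Longrightarrow> e = 0"
  by (auto simp: injectives_def exte_def)

lemma exte_from_inj: "J \<in> injectives C \<Longrightarrow> exte C e J X \<Longrightarrow> e = 0"
  unfolding proj_inj[symmetric] by (auto simp: projectives_def exte_def)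

lemma susp_pull_exists:
  assumes "exte C a X Y" shows "\<exists>c. arr C c X (\<Sigma> Y) \<and> pull C c (\<epsilon> Y) = a"
proof -
  obtain J x y where "J \<in> injectives C" "Real C Y J (\<Sigma> Y) (\<epsilon> Y) x y"
    using susp_real exte_ob assms by blast
  then show ?thesis using ext_exists_pull assms exte_to_inj by blast
qed

lemma susp_push_exists:
  assumes "exte C a (\<Sigma> X) Y" "X \<in> Ob C" shows "\<exists>d. arr C d X Y \<and> push C d (\<epsilon> X) = a"
proof -
  obtain J x y where "J \<in> injectives C" "Real C X J (\<Sigma> X) (\<epsilon> X) x y"
    using susp_real assms by blast
  then show ?thesis using ext_exists_push assms exte_from_inj by blast
qed

lemma nullE:
  assumes "f \<in> null C X Y" "X \<in> Ob C" "Y \<in> Ob C"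
  obtains J g h where "J \<in> injectives C" "arr C g X J" "arr C h J Y" "f = h \<cdot> g"
  using assms unfolding factoring_def proj_inj by (auto simp: arr_def injectives_def)

lemma pull_null:
  assumes f: "f \<in> null C X Y" "X \<in> Ob C" "Y \<in> Ob C" and e: "exte C e Y W"
  shows "pull C f e = 0"
proof -
  obtain J g h where g: "J \<in> injectives C" "arr C g X J" "arr C h J Y" "f = h \<cdot> g"
    using nullE[OF f] .
  have "pull C h e = 0" using exte_from_inj[OF g(1) exte_pull[OF e g(3)]] .
  then show ?thesis using pull_pull[OF e g(3,2)] g(4) pull_zero[OF exte_ob(2)[OF e] g(2)] by simp
qed

lemma push_null:
  assumes f: "f \<in> null C X Y" "X \<in> Ob C" "Y \<in> Ob C" and e: "exte C e W X"
  shows "push C f e = 0"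
proof -
  obtain J g h where g: "J \<in> injectives C" "arr C g X J" "arr C h J Y" "f = h \<cdot> g"
    using nullE[OF f] .
  have "push C g e = 0" using exte_to_inj[OF g(1) exte_push[OF e g(2)]] .
  then show ?thesis using push_push[OF e g(2,3)] g(4) push_zero[OF exte_ob(1)[OF e] g(3)] by simp
qed

text \<open>A map to the suspension that pulls the chosen class back to 0 lifts to the injective
  middle term. Together with \<open>susp_pull_exists\<close> this identifies Ext^1(X,Y) with the
  stable morphisms from \<open>X\<close> to the suspension of \<open>Y\<close>.\<close>

lemma susp_pull_zero_iff:
  assumes c: "arr C c X (\<Sigma> Y)" and Y: "Y \<in> Ob C"
  shows "pull C c (\<epsilon> Y) = 0 \<longleftrightarrow> c \<in> null C X (\<Sigma> Y)"
proof
  assume z: "pull C c (\<epsilon> Y) = 0"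
  obtain J x y where J: "J \<in> injectives C" "Real C Y J (\<Sigma> Y) (\<epsilon> Y) x y"
    using susp_real Y by blast
  obtain g where "arr C g X J" "y \<cdot> g = c" using factor_deflation[OF J(2) c z] by blast
  then show "c \<in> null C X (\<Sigma> Y)"
    using J RealD[OF J(2)] unfolding factoring_def proj_inj by (auto simp: arr_def)
next
  assume "c \<in> null C X (\<Sigma> Y)"
  then show "pull C c (\<epsilon> Y) = 0" using pull_null susp_exte[OF Y] arr_ob[OF c] by blast
qed

text \<open>\<open>h\<close> is $\Sigma$ applied to the map $Y \to \Sigma X$ which classifies \<open>b\<close>.\<close>

definition dual_rep :: "'b \<Rightarrow> 'b \<Rightarrow> 'd \<Rightarrow> 'c \<Rightarrow> bool" where
  "dual_rep X Y b h \<longleftrightarrow> X \<in> Ob C \<and> Y \<in> Ob C \<and> arr C h (\<Sigma> Y) (\<Sigma> (\<Sigma> X)) \<and>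
     (\<exists>d. arr C d Y (\<Sigma> X) \<and> pull C d (\<epsilon> X) = b \<and> push C d (\<epsilon> Y) = pull C h (\<epsilon> (\<Sigma> X)))"

lemma dual_rep_exists:
  assumes b: "exte C b Y X" shows "\<exists>h. dual_rep X Y b h"
proof -
  have ob: "X \<in> Ob C" "Y \<in> Ob C" using exte_ob b by auto
  obtain d where d: "arr C d Y (\<Sigma> X)" "pull C d (\<epsilon> X) = b" using susp_pull_exists[OF b] by blast
  obtain h where "arr C h (\<Sigma> Y) (\<Sigma> (\<Sigma> X))" "pull C h (\<epsilon> (\<Sigma> X)) = push C d (\<epsilon> Y)"
    using susp_pull_exists[OF exte_push[OF susp_exte[OF ob(2)] d(1)]] by blast
  then show ?thesis unfolding dual_rep_def using d ob by force
qed

text \<open>The suspension is full. This is what non-degeneracy requires, since the given stable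
  duality tests against all morphisms between the suspensions and not only against those obtained
  from classes.\<close>

lemma dual_rep_surj:
  assumes g: "arr C g (\<Sigma> Y) (\<Sigma> (\<Sigma> X))" and ob: "X \<in> Ob C" "Y \<in> Ob C"
  shows "\<exists>b. exte C b Y X \<and> dual_rep X Y b g"
proof -
  obtain d where d: "arr C d Y (\<Sigma> X)" "push C d (\<epsilon> Y) = pull C g (\<epsilon> (\<Sigma> X))"
    using susp_push_exists[OF exte_pull[OF susp_exte[OF susp_ob[OF ob(1)]] g] ob(2)] by blast
  then have "dual_rep X Y (pull C d (\<epsilon> X)) g" unfolding dual_rep_def using g ob by blast
  then show ?thesis using exte_pull[OF susp_exte[OF ob(1)] d(1)] by blast
qed

lemma dual_rep_add:
  assumes "dual_rep X Y b h" "dual_rep X Y b' h'" shows "dual_rep X Y (b + b') (h + h')"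
proof -
  obtain d d' where d: "arr C d Y (\<Sigma> X)" "pull C d (\<epsilon> X) = b" "push C d (\<epsilon> Y) = pull C h (\<epsilon> (\<Sigma> X))"
    "arr C d' Y (\<Sigma> X)" "pull C d' (\<epsilon> X) = b'" "push C d' (\<epsilon> Y) = pull C h' (\<epsilon> (\<Sigma> X))"
    and o: "X \<in> Ob C" "Y \<in> Ob C" "arr C h (\<Sigma> Y) (\<Sigma> (\<Sigma> X))" "arr C h' (\<Sigma> Y) (\<Sigma> (\<Sigma> X))"
    using assms unfolding dual_rep_def by blast
  show ?thesis unfolding dual_rep_def
    using o arr_add[OF o(3,4)] arr_add[OF d(1,4)] pull_add_arr[OF susp_exte[OF o(1)] d(1,4)]
      push_add_arr[OF susp_exte[OF o(2)] d(1,4)] pull_add_arr[OF susp_exte[OF susp_ob[OF o(1)]] o(3,4)] d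
    by (intro conjI exI[of _ "d + d'"]) simp_all
qed

lemma dual_rep_scale:
  assumes "dual_rep X Y b h" shows "dual_rep X Y (escal C r b) (scal C r h)"
proof -
  obtain d where d: "arr C d Y (\<Sigma> X)" "pull C d (\<epsilon> X) = b" "push C d (\<epsilon> Y) = pull C h (\<epsilon> (\<Sigma> X))"
    and o: "X \<in> Ob C" "Y \<in> Ob C" "arr C h (\<Sigma> Y) (\<Sigma> (\<Sigma> X))"
    using assms unfolding dual_rep_def by blast
  show ?thesis unfolding dual_rep_def
    using o arr_scale[OF o(3)] arr_scale[OF d(1)] pull_scale_arr[OF susp_exte[OF o(1)] d(1)]
      push_scale_arr[OF susp_exte[OF o(2)] d(1)] pull_scale_arr[OF susp_exte[OF susp_ob[OF o(1)]] o(3)] d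
    by (intro conjI exI[of _ "scal C r d"]) simp_all
qed

lemma dual_rep_zero_null:
  assumes "dual_rep X Y 0 h" shows "h \<in> null C (\<Sigma> Y) (\<Sigma> (\<Sigma> X))"
proof -
  obtain d where d: "arr C d Y (\<Sigma> X)" "pull C d (\<epsilon> X) = 0" "push C d (\<epsilon> Y) = pull C h (\<epsilon> (\<Sigma> X))"
    and o: "X \<in> Ob C" "Y \<in> Ob C" "arr C h (\<Sigma> Y) (\<Sigma> (\<Sigma> X))"
    using assms unfolding dual_rep_def by blast
  have "d \<in> null C Y (\<Sigma> X)" using susp_pull_zero_iff[OF d(1) o(1)] d(2) by simp
  then have "pull C h (\<epsilon> (\<Sigma> X)) = 0" using push_null susp_exte d(3) o susp_ob by metis
  then show ?thesis using susp_pull_zero_iff[OF o(3) susp_ob[OF o(1)]] by simp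
qed

text \<open>A class determines its representative only up to maps that factor through projectives.
  The duality vanishes on these, so choosing a representative is harmless.\<close>

lemma dual_rep_diff:
  assumes "dual_rep X Y b h" "dual_rep X Y b h'" shows "h - h' \<in> null C (\<Sigma> Y) (\<Sigma> (\<Sigma> X))"
  using dual_rep_zero_null[of X Y "h - h'"] dual_rep_add[OF assms(1) dual_rep_scale[OF assms(2), of "- 1"]]
  by simp

lemma dual_rep_push:
  assumes b: "dual_rep X' Y b h" "exte C b Y X'" and f: "arr C f X' X"
    and v: "arr C v1 (\<Sigma> X') (\<Sigma> X)" "push C f (\<epsilon> X') = pull C v1 (\<epsilon> X)"
    and w: "arr C v2 (\<Sigma> (\<Sigma> X')) (\<Sigma> (\<Sigma> X))" "push C v1 (\<epsilon> (\<Sigma> X')) = pull C v2 (\<epsilon> (\<Sigma> X))"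
  shows "dual_rep X Y (push C f b) (v2 \<cdot> h)"
proof -
  obtain d where d: "arr C d Y (\<Sigma> X')" "pull C d (\<epsilon> X') = b" "push C d (\<epsilon> Y) = pull C h (\<epsilon> (\<Sigma> X'))"
    and o: "X' \<in> Ob C" "Y \<in> Ob C" "arr C h (\<Sigma> Y) (\<Sigma> (\<Sigma> X'))"
    using b unfolding dual_rep_def by blast
  have X: "X \<in> Ob C" using arr_ob f by blast
  have "pull C (v1 \<cdot> d) (\<epsilon> X) = push C f b"
    using pull_pull[OF susp_exte[OF X] v(1) d(1)] v(2) push_pull_commute[OF susp_exte[OF o(1)] f d(1)] d(2)
    by simp
  moreover have "push C (v1 \<cdot> d) (\<epsilon> Y) = push C v1 (pull C h (\<epsilon> (\<Sigma> X')))"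
    using push_push[OF susp_exte[OF o(2)] d(1) v(1)] d(3) by simp
  moreover have "\<dots> = pull C (v2 \<cdot> h) (\<epsilon> (\<Sigma> X))"
    using push_pull_commute[OF susp_exte[OF susp_ob[OF o(1)]] v(1) o(3)] w(2)
      pull_pull[OF susp_exte[OF susp_ob[OF X]] w(1) o(3)] by simp
  ultimately show ?thesis unfolding dual_rep_def
    using X o arr_comp[OF o(3) w(1)] arr_comp[OF d(1) v(1)] by (intro conjI exI[of _ "v1 \<cdot> d"]) simp_all
qed

lemma dual_rep_pull:
  assumes b: "dual_rep X Y' b h" and g: "arr C g Y Y'"
    and w: "arr C w (\<Sigma> Y) (\<Sigma> Y')" "push C g (\<epsilon> Y) = pull C w (\<epsilon> Y')"
  shows "dual_rep X Y (pull C g b) (h \<cdot> w)"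
proof -
  obtain d where d: "arr C d Y' (\<Sigma> X)" "pull C d (\<epsilon> X) = b" "push C d (\<epsilon> Y') = pull C h (\<epsilon> (\<Sigma> X))"
    and o: "X \<in> Ob C" "Y' \<in> Ob C" "arr C h (\<Sigma> Y') (\<Sigma> (\<Sigma> X))"
    using b unfolding dual_rep_def by blast
  have Y: "Y \<in> Ob C" using arr_ob g by blast
  have "pull C (d \<cdot> g) (\<epsilon> X) = pull C g b"
    using pull_pull[OF susp_exte[OF o(1)] d(1) g] d(2) by simp
  moreover have "push C (d \<cdot> g) (\<epsilon> Y) = push C d (pull C w (\<epsilon> Y'))"
    using push_push[OF susp_exte[OF Y] g d(1)] w(2) by simp
  moreover have "\<dots> = pull C (h \<cdot> w) (\<epsilon> (\<Sigma> X))"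
    using push_pull_commute[OF susp_exte[OF o(2)] d(1) w(1)] d(3)
      pull_pull[OF susp_exte[OF susp_ob[OF o(1)]] o(3) w(1)] by simp
  ultimately show ?thesis unfolding dual_rep_def
    using Y o arr_comp[OF w(1) o(3)] arr_comp[OF g d(1)] by (intro conjI exI[of _ "d \<cdot> g"]) simp_all
qed

text \<open>Maps through projectives pull the chosen class back to 0, so the pull-backs along
  finitely many stable generators span.\<close>

lemma ext_fin_dim:
  assumes hf: "stably_hom_finite C" and o: "X \<in> Ob C" "Y \<in> Ob C"
  shows "fin_dim (escal C) (Ext C X Y)"
proof -
  let ?\<phi> = "\<lambda>c. pull C c (\<epsilon> Y)"
  have SY: "\<Sigma> Y \<in> Ob C" using susp_ob o by blast
  obtain B where B: "finite B" "B \<subseteq> Hom C X (\<Sigma> Y)"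
    "Hom C X (\<Sigma> Y) \<subseteq> hom.span (B \<union> null C X (\<Sigma> Y))"
    using hf[unfolded stably_hom_finite_def, rule_format, OF o(1) SY] by blast
  have nsub: "null C X (\<Sigma> Y) \<subseteq> Hom C X (\<Sigma> Y)"
    using o SY comp_in unfolding factoring_def by (auto simp: projectives_def)
  let ?S = "{c \<in> Hom C X (\<Sigma> Y). ?\<phi> c \<in> ext.span (?\<phi> ` B)}"
  have e: "exte C (\<epsilon> Y) (\<Sigma> Y) Y" using susp_exte o by blast
  have arr: "c \<in> Hom C X (\<Sigma> Y) \<longleftrightarrow> arr C c X (\<Sigma> Y)" for c using o SY by (simp add: arr_def)
  have "hom.subspace ?S"
  proof (rule hom.subspaceI)
    show "0 \<in> ?S" using arr arr_zero[OF o(1) SY] pull_zero_arr[OF e o(1)] ext.span_zero by simp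
    show "x + y \<in> ?S" if "x \<in> ?S" "y \<in> ?S" for x y
      using that arr arr_add[of x X "\<Sigma> Y" y] pull_add_arr[OF e, of x X y] ext.span_add by simp
    show "scal C r x \<in> ?S" if "x \<in> ?S" for r x
      using that arr arr_scale[of x X "\<Sigma> Y" r] pull_scale_arr[OF e, of x X r] ext.span_scale by simp
  qed
  moreover have "B \<union> null C X (\<Sigma> Y) \<subseteq> ?S"
    using B(2) nsub pull_null[OF _ o(1) SY e] ext.span_zero ext.span_base by auto
  ultimately have S: "Hom C X (\<Sigma> Y) \<subseteq> ?S" using B(3) hom.span_minimal by blast
  have "Ext C X Y \<subseteq> ext.span (?\<phi> ` B)"
  proof
    fix a assume "a \<in> Ext C X Y"
    then have "exte C a X Y" using o by (simp add: exte_def)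
    then obtain c where "arr C c X (\<Sigma> Y)" "pull C c (\<epsilon> Y) = a" using susp_pull_exists by blast
    then show "a \<in> ext.span (?\<phi> ` B)" using S arr by blast
  qed
  moreover have "?\<phi> ` B \<subseteq> Ext C X Y"
    using B(2) arr exte_pull[OF e] by (auto simp: exte_def)
  ultimately show ?thesis using ext.fin_dimI[OF finite_imageI[OF B(1)]] by blast
qed

end

context calabi_yau_category
begin

lemma ext_fin_dim: "X \<in> Ob C \<Longrightarrow> Y \<in> Ob C \<Longrightarrow> fin_dim (escal C) (Ext C X Y)"
proof -
  obtain \<Sigma> \<epsilon> where "suspension C \<Sigma> \<epsilon>" using cy unfolding stably_2_calabi_yau_def by blast
  then interpret s: suspended_category C \<Sigma> \<epsilon> using frob by unfold_locales
  show "X \<in> Ob C \<Longrightarrow> Y \<in> Ob C \<Longrightarrow> fin_dim (escal C) (Ext C X Y)"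
    using s.ext_fin_dim hom_finite by blast
qed

text \<open>For \<open>a\<close> in Ext^1(X,Y) and \<open>b\<close> in Ext^1(Y,X) the value is
  \<beta> applied to the map from \<open>X\<close> to \<Sigma> Y that classifies \<open>a\<close>
  and to the suspension of the map from \<open>Y\<close> to \<Sigma> X that classifies
  \<open>b\<close>. Both arguments are unique up to null maps, on which \<beta> vanishes.\<close>

lemma ext_pairing_exists: "\<exists>p. ext_pairing C p"
proof -
  obtain \<Sigma> \<epsilon> and \<beta> :: "'b \<Rightarrow> 'b \<Rightarrow> 'c \<Rightarrow> 'c \<Rightarrow> 'a" where su: "suspension C \<Sigma> \<epsilon>" and
    b: "\<forall>X\<in>Ob C. \<forall>Y\<in>Ob C. let H = Hom C X Y; H' = Hom C Y (\<Sigma> (\<Sigma> X)) in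
        (\<forall>f\<in>H. linear_map_on (scal C) H' (*) UNIV (\<lambda>g. \<beta> X Y f g)) \<and>
        (\<forall>g\<in>H'. linear_map_on (scal C) H (*) UNIV (\<lambda>f. \<beta> X Y f g)) \<and>
        (\<forall>f\<in>H. \<forall>g\<in>null C Y (\<Sigma> (\<Sigma> X)). \<beta> X Y f g = 0) \<and>
        (\<forall>f\<in>H. (\<forall>g\<in>H'. \<beta> X Y f g = 0) \<longleftrightarrow> f \<in> null C X Y) \<and>
        (\<forall>\<phi>. linear_map_on (scal C) H' (*) UNIV \<phi> \<longrightarrow> (\<forall>g\<in>null C Y (\<Sigma> (\<Sigma> X)). \<phi> g = 0) \<longrightarrow>
           (\<exists>f\<in>H. \<forall>g\<in>H'. \<beta> X Y f g = \<phi> g))"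
    and n1: "\<forall>X\<in>Ob C. \<forall>Y\<in>Ob C. \<forall>Y'\<in>Ob C. \<forall>u\<in>Hom C Y Y'. \<forall>f\<in>Hom C X Y. \<forall>g\<in>Hom C Y' (\<Sigma> (\<Sigma> X)).
        \<beta> X Y' (u \<cdot> f) g = \<beta> X Y f (g \<cdot> u)"
    and n2: "\<forall>X\<in>Ob C. \<forall>X'\<in>Ob C. \<forall>Y\<in>Ob C. \<forall>v\<in>Hom C X' X. \<forall>f\<in>Hom C X Y. \<forall>g\<in>Hom C Y (\<Sigma> (\<Sigma> X')).
        \<forall>v1 v2. suspends C \<Sigma> \<epsilon> X' X v v1 \<longrightarrow> suspends C \<Sigma> \<epsilon> (\<Sigma> X') (\<Sigma> X) v1 v2 \<longrightarrow>
          \<beta> X' Y (f \<cdot> v) g = \<beta> X Y f (v2 \<cdot> g)"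
    using cy unfolding stably_2_calabi_yau_def by blast
  interpret s: suspended_category C \<Sigma> \<epsilon> using su frob by unfold_locales
  have add_r: "\<beta> X Y f (g + g') = \<beta> X Y f g + \<beta> X Y f g'"
    and scale_r: "\<beta> X Y f (scal C r g) = r * \<beta> X Y f g"
    if "arr C f X Y" "arr C g Y (\<Sigma> (\<Sigma> X))" "arr C g' Y (\<Sigma> (\<Sigma> X))" for X Y f g g' r
    using b that by (auto simp: Let_def arr_def semilinear_on_def)
  have add_l: "\<beta> X Y (f + f') g = \<beta> X Y f g + \<beta> X Y f' g"
    and scale_l: "\<beta> X Y (scal C r f) g = r * \<beta> X Y f g"
    if "arr C f X Y" "arr C f' X Y" "arr C g Y (\<Sigma> (\<Sigma> X))" for X Y f f' g r
    using b that by (auto simp: Let_def arr_def semilinear_on_def)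
  have null_r: "\<beta> X Y f g = 0" if "arr C f X Y" "g \<in> null C Y (\<Sigma> (\<Sigma> X))" for X Y f g
    using b that by (auto simp: Let_def arr_def)
  have null_l: "\<beta> X Y f g = 0" if "arr C f X Y" "f \<in> null C X Y" "arr C g Y (\<Sigma> (\<Sigma> X))" for X Y f g
    using b that by (auto simp: Let_def arr_def)
  have nondeg: "f \<in> null C X Y" if "arr C f X Y" "\<And>g. arr C g Y (\<Sigma> (\<Sigma> X)) \<Longrightarrow> \<beta> X Y f g = 0" for X Y f
  proof -
    have o: "X \<in> Ob C" "Y \<in> Ob C" "\<Sigma> (\<Sigma> X) \<in> Ob C" using arr_ob[OF that(1)] s.susp_ob by auto
    have "(\<forall>g\<in>Hom C Y (\<Sigma> (\<Sigma> X)). \<beta> X Y f g = 0) \<longleftrightarrow> f \<in> null C X Y"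
      using b o that(1) by (simp add: Let_def arr_def)
    then show ?thesis using that(2) o by (simp add: arr_def)
  qed
  define p where "p X Y a b' = \<beta> X (\<Sigma> Y) (SOME c. arr C c X (\<Sigma> Y) \<and> pull C c (\<epsilon> Y) = a) (SOME h. s.dual_rep X Y b' h)"
    for X Y a b'
  \<comment> \<open>Independence of the two choices in the definition of \<open>p\<close>;
    afterwards every clause may be checked on convenient representatives.\<close>
  have peq: "p X Y a b' = \<beta> X (\<Sigma> Y) c h"
    if c: "arr C c X (\<Sigma> Y)" "pull C c (\<epsilon> Y) = a" and h: "s.dual_rep X Y b' h" for X Y a b' c h
  proof -
    define c' where "c' = (SOME c. arr C c X (\<Sigma> Y) \<and> pull C c (\<epsilon> Y) = a)"
    define h' where "h' = (SOME h. s.dual_rep X Y b' h)"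
    have c': "arr C c' X (\<Sigma> Y)" "pull C c' (\<epsilon> Y) = a"
      using someI[of "\<lambda>c. arr C c X (\<Sigma> Y) \<and> pull C c (\<epsilon> Y) = a" c] c unfolding c'_def by auto
    have h': "s.dual_rep X Y b' h'" using someI[of "s.dual_rep X Y b'" h] h unfolding h'_def by auto
    have Y: "Y \<in> Ob C" and ah: "arr C h (\<Sigma> Y) (\<Sigma> (\<Sigma> X))" "arr C h' (\<Sigma> Y) (\<Sigma> (\<Sigma> X))"
      using h h' by (auto simp: s.dual_rep_def)
    have d: "arr C (c' - c) X (\<Sigma> Y)" using arr_diff c c' by blast
    have "pull C (c' - c) (\<epsilon> Y) = 0" using pull_diff_arr[OF s.susp_exte[OF Y] c'(1) c(1)] c c' by simp
    then have "\<beta> X (\<Sigma> Y) (c' - c) h' = 0" using s.susp_pull_zero_iff[OF d Y] null_l[OF d _ ah(2)] by blast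
    then have 1: "\<beta> X (\<Sigma> Y) c' h' = \<beta> X (\<Sigma> Y) c h'" using add_l[OF d c(1) ah(2)] by simp
    have "\<beta> X (\<Sigma> Y) c (h' - h) = 0" using null_r[OF c(1) s.dual_rep_diff[OF h' h]] .
    then have "\<beta> X (\<Sigma> Y) c h' = \<beta> X (\<Sigma> Y) c h"
      using add_r[OF c(1) arr_diff[OF ah(2,1)] ah(1)] by simp
    then show ?thesis using 1 unfolding p_def c'_def h'_def by simp
  qed
  have "ext_pairing C p"
    unfolding ext_pairing_def
  proof (intro conjI ballI allI impI)
    fix X Y assume o: "X \<in> Ob C" "Y \<in> Ob C"
    have eX: "exte C a X Y \<longleftrightarrow> a \<in> Ext C X Y" "exte C a Y X \<longleftrightarrow> a \<in> Ext C Y X" for a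
      using o by (auto simp: exte_def)
    show "bilinear_on (escal C) (Ext C X Y) (escal C) (Ext C Y X) (p X Y)"
      unfolding bilinear_on_def semilinear_on_def eX[symmetric]
    proof (intro conjI ballI allI)
      fix w x y r assume w: "w \<in> Ext C Y X" and x: "x \<in> Ext C X Y"
      obtain h where h: "s.dual_rep X Y w h" using s.dual_rep_exists[OF iffD2[OF eX(2) w]] by blast
      obtain c where c: "arr C c X (\<Sigma> Y)" "pull C c (\<epsilon> Y) = x" using s.susp_pull_exists[OF iffD2[OF eX(1) x]] by blast
      have ah: "arr C h (\<Sigma> Y) (\<Sigma> (\<Sigma> X))" using h by (auto simp: s.dual_rep_def)
      have e: "exte C (\<epsilon> Y) (\<Sigma> Y) Y" using s.susp_exte o by blast
      show "p X Y (escal C r x) w = id r * p X Y x w"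
        using peq[OF arr_scale[OF c(1)] _ h, of r "escal C r x"] pull_scale_arr[OF e c(1)] c
          peq[OF c h] scale_l[OF c(1,1) ah] by simp
      show "p X Y (x + y) w = p X Y x w + p X Y y w" if yy: "y \<in> Ext C X Y"
      proof -
        obtain c' where c': "arr C c' X (\<Sigma> Y)" "pull C c' (\<epsilon> Y) = y" using s.susp_pull_exists[OF iffD2[OF eX(1) yy]] by blast
        show ?thesis
          using peq[OF arr_add[OF c(1) c'(1)] _ h, of "x + y"] pull_add_arr[OF e c(1) c'(1)] c c'
            peq[OF c h] peq[OF c' h] add_l[OF c(1) c'(1) ah] by simp
      qed
    next
      fix v x y r assume v: "v \<in> Ext C X Y" and x: "x \<in> Ext C Y X"
      obtain h where h: "s.dual_rep X Y x h" using s.dual_rep_exists[OF iffD2[OF eX(2) x]] by blast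
      obtain c where c: "arr C c X (\<Sigma> Y)" "pull C c (\<epsilon> Y) = v" using s.susp_pull_exists[OF iffD2[OF eX(1) v]] by blast
      have ah: "arr C h (\<Sigma> Y) (\<Sigma> (\<Sigma> X))" using h by (auto simp: s.dual_rep_def)
      show "p X Y v (escal C r x) = id r * p X Y v x"
        using peq[OF c s.dual_rep_scale[OF h, of r]] peq[OF c h] scale_r[OF c(1) ah ah] by simp
      show "p X Y v (x + y) = p X Y v x + p X Y v y" if yy: "y \<in> Ext C Y X"
      proof -
        obtain h' where h': "s.dual_rep X Y y h'" using s.dual_rep_exists[OF iffD2[OF eX(2) yy]] by blast
        have ah': "arr C h' (\<Sigma> Y) (\<Sigma> (\<Sigma> X))" using h' by (auto simp: s.dual_rep_def)
        show ?thesis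
          using peq[OF c s.dual_rep_add[OF h h']] peq[OF c h] peq[OF c h'] add_r[OF c(1) ah ah'] by simp
      qed
    qed simp_all
    fix a assume a: "a \<in> Ext C X Y" "\<forall>b\<in>Ext C Y X. p X Y a b = 0"
    obtain c where c: "arr C c X (\<Sigma> Y)" "pull C c (\<epsilon> Y) = a" using s.susp_pull_exists[OF iffD2[OF eX(1) a(1)]] by blast
    have "\<beta> X (\<Sigma> Y) c g = 0" if gg: "arr C g (\<Sigma> Y) (\<Sigma> (\<Sigma> X))" for g
    proof -
      obtain b' where "exte C b' Y X" "s.dual_rep X Y b' g" using s.dual_rep_surj[OF gg o] by blast
      then show ?thesis using peq[OF c] a(2) eX by metis
    qed
    then have "c \<in> null C X (\<Sigma> Y)" using nondeg[OF c(1)] by blast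
    then show "a = 0" using s.susp_pull_zero_iff[OF c(1) o(2)] c(2) by simp
  next
    fix X Y X' a b' f assume f: "arr C f X' X" and a: "exte C a X Y" and b': "exte C b' Y X'"
    have o: "X \<in> Ob C" "X' \<in> Ob C" "Y \<in> Ob C" using arr_ob[OF f] exte_ob[OF a] by auto
    obtain h where h: "s.dual_rep X' Y b' h" using s.dual_rep_exists b' by blast
    obtain c where c: "arr C c X (\<Sigma> Y)" "pull C c (\<epsilon> Y) = a" using s.susp_pull_exists a by blast
    \<comment> \<open>\<open>v1\<close> and \<open>v2\<close> are the first and second suspension of
      \<open>f\<close>, as the naturality clause of \<beta> in its first object demands.\<close>
    obtain v1 where v1: "arr C v1 (\<Sigma> X') (\<Sigma> X)" "pull C v1 (\<epsilon> X) = push C f (\<epsilon> X')"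
      using s.susp_pull_exists[OF exte_push[OF s.susp_exte[OF o(2)] f]] by blast
    obtain v2 where v2: "arr C v2 (\<Sigma> (\<Sigma> X')) (\<Sigma> (\<Sigma> X))" "pull C v2 (\<epsilon> (\<Sigma> X)) = push C v1 (\<epsilon> (\<Sigma> X'))"
      using s.susp_pull_exists[OF exte_push[OF s.susp_exte[OF s.susp_ob[OF o(2)]] v1(1)]] by blast
    have "p X' Y (pull C f a) b' = \<beta> X' (\<Sigma> Y) (c \<cdot> f) h"
      using peq[OF arr_comp[OF f c(1)] _ h] pull_pull[OF s.susp_exte[OF o(3)] c(1) f] c(2) by simp
    also have "\<dots> = \<beta> X (\<Sigma> Y) c (v2 \<cdot> h)"
      using n2[rule_format, of X X' "\<Sigma> Y" f c h v1 v2] f c(1) h v1 v2 o by (auto simp: suspends_def arr_def s.dual_rep_def)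
    also have "\<dots> = p X Y a (push C f b')"
      using peq[OF c s.dual_rep_push[OF h b' f v1(1) v1(2)[symmetric] v2(1) v2(2)[symmetric]]] by simp
    finally show "p X' Y (pull C f a) b' = p X Y a (push C f b')" .
  next
    fix X Y Y' a b' g assume g: "arr C g Y Y'" and a: "exte C a X Y" and b': "exte C b' Y' X"
    have o: "X \<in> Ob C" "Y \<in> Ob C" "Y' \<in> Ob C" using arr_ob[OF g] exte_ob[OF a] by auto
    obtain h where h: "s.dual_rep X Y' b' h" using s.dual_rep_exists b' by blast
    obtain c where c: "arr C c X (\<Sigma> Y)" "pull C c (\<epsilon> Y) = a" using s.susp_pull_exists a by blast
    obtain w where w: "arr C w (\<Sigma> Y) (\<Sigma> Y')" "pull C w (\<epsilon> Y') = push C g (\<epsilon> Y)"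
      using s.susp_pull_exists[OF exte_push[OF s.susp_exte[OF o(2)] g]] by blast
    have "pull C (w \<cdot> c) (\<epsilon> Y') = push C g a"
      using pull_pull[OF s.susp_exte[OF o(3)] w(1) c(1)] w(2) c(2)
        push_pull_commute[OF s.susp_exte[OF o(2)] g c(1)] by simp
    then have "p X Y' (push C g a) b' = \<beta> X (\<Sigma> Y') (w \<cdot> c) h"
      using peq[OF arr_comp[OF c(1) w(1)] _ h] by simp
    also have "\<dots> = \<beta> X (\<Sigma> Y) c (h \<cdot> w)"
      using n1 c(1) w(1) h o by (auto simp: arr_def s.dual_rep_def)
    also have "\<dots> = p X Y a (pull C g b')"
      using peq[OF c s.dual_rep_pull[OF h g w(1) w(2)[symmetric]]] by simp
    finally show "p X Y' (push C g a) b' = p X Y a (pull C g b')" .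
  qed
  then show ?thesis by blast
qed

end

section \<open>Grothendieck groups\<close>

text \<open>Serves both the cluster-tilting subcategory and the finite-dimensional modules. As all
  terms of sequences lie in \<open>S\<close>, so do the supports of relations, and cosets can be
  compared through representatives.\<close>

locale grothendieck =
  fixes S :: "'x set" and E :: "('x \<times> 'x \<times> 'x) set"
  assumes seq_objects: "(A, B, Z) \<in> E \<Longrightarrow> A \<in> S \<and> B \<in> S \<and> Z \<in> S"
begin

abbreviation "Rel \<equiv> K0_relations S E"
abbreviation "cls \<equiv> K0_class S E"

lemma rel_subgroup: "subgroup Rel (free_Abelian_group S)"
  unfolding K0_relations_def
proof (rule group.generate_is_subgroup[OF group_free_Abelian_group])
  show "{frag_of B - frag_of A - frag_of Z |A B Z. (A, B, Z) \<in> E} \<subseteq> carrier (free_Abelian_group S)"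
  proof clarsimp
    fix A B Z x assume E: "(A, B, Z) \<in> E" and x: "x \<in> Poly_Mapping.keys (frag_of B - frag_of A - frag_of Z)"
    have "x \<in> {A, B, Z}"
      using x keys_diff[of "frag_of B - frag_of A" "frag_of Z"] keys_diff[of "frag_of B" "frag_of A"]
      by (auto simp: keys_frag_of)
    then show "x \<in> S" using seq_objects[OF E] by auto
  qed
qed

lemma rel_keys: "c \<in> Rel \<Longrightarrow> Poly_Mapping.keys c \<subseteq> S"
  using subgroup.mem_carrier[OF rel_subgroup] by simp

lemma rel_zero: "0 \<in> Rel"
  using subgroup.one_closed[OF rel_subgroup] by simp

lemma rel_add: "c \<in> Rel \<Longrightarrow> d \<in> Rel \<Longrightarrow> c + d \<in> Rel"
  using subgroup.m_closed[OF rel_subgroup, of c d] by simp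

lemma rel_neg: "c \<in> Rel \<Longrightarrow> - c \<in> Rel"
  using subgroup.m_inv_closed[OF rel_subgroup, of c] rel_keys by simp

lemma rel_diff: "c \<in> Rel \<Longrightarrow> d \<in> Rel \<Longrightarrow> c - d \<in> Rel"
  using rel_add[of c "- d"] rel_neg by simp

lemma rel_gen: "(A, B, Z) \<in> E \<Longrightarrow> frag_of B - frag_of A - frag_of Z \<in> Rel"
  unfolding K0_relations_def by (rule generate.incl) blast

lemma rel_normal: "Rel \<lhd> free_Abelian_group S"
  using rel_subgroup abelian_free_Abelian_group
  by (meson comm_group.axioms(2) comm_group.normal_iff_subgroup)

lemma class_mem:
  assumes "Poly_Mapping.keys c \<subseteq> S"
  shows "d \<in> cls c \<longleftrightarrow> Poly_Mapping.keys d \<subseteq> S \<and> d - c \<in> Rel"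
proof -
  have "d \<in> cls c \<longleftrightarrow> (\<exists>h\<in>Rel. d = h + c)" by (auto simp: K0_class_def r_coset_def)
  also have "\<dots> \<longleftrightarrow> d - c \<in> Rel" by (auto intro: bexI[of _ "d - c"])
  also have "\<dots> \<longleftrightarrow> Poly_Mapping.keys d \<subseteq> S \<and> d - c \<in> Rel"
    using keys_add[of "d - c" c] rel_keys[of "d - c"] assms by auto
  finally show ?thesis .
qed

lemma class_eq_iff:
  assumes "Poly_Mapping.keys c \<subseteq> S" "Poly_Mapping.keys d \<subseteq> S"
  shows "cls c = cls d \<longleftrightarrow> c - d \<in> Rel"
proof
  assume "cls c = cls d"
  then have "c \<in> cls d" using class_mem[OF assms(1), of c] rel_zero assms by simp
  then show "c - d \<in> Rel" using class_mem[OF assms(2)] by blast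
next
  assume "c - d \<in> Rel"
  then have "c \<in> cls d" using class_mem[OF assms(2)] assms by blast
  then show "cls c = cls d"
    using group.repr_independence[OF group_free_Abelian_group _ _ rel_subgroup, of c d] assms
    unfolding K0_class_def by simp
qed

lemma class_carrier: "Poly_Mapping.keys c \<subseteq> S \<Longrightarrow> cls c \<in> carrier (K0 S E)"
  unfolding K0_def K0_class_def by (auto simp: carrier_FactGroup)

lemma class_mult:
  "Poly_Mapping.keys c \<subseteq> S \<Longrightarrow> Poly_Mapping.keys d \<subseteq> S \<Longrightarrow> cls c \<otimes>\<^bsub>K0 S E\<^esub> cls d = cls (c + d)"
  unfolding K0_def K0_class_def using normal.rcos_sum[OF rel_normal, of c d] by simp

lemma K0_comm_group: "comm_group (K0 S E)"
  unfolding K0_def by (rule comm_group.abelian_FactGroup[OF abelian_free_Abelian_group rel_subgroup])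

lemma class_inv:
  assumes "Poly_Mapping.keys c \<subseteq> S" shows "inv\<^bsub>K0 S E\<^esub> (cls c) = cls (- c)"
proof -
  interpret g: comm_group "K0 S E" by (rule K0_comm_group)
  have k: "Poly_Mapping.keys (- c) \<subseteq> S" using assms by simp
  have "\<one>\<^bsub>K0 S E\<^esub> = cls 0"
    using class_mult[of 0 0] class_carrier[of 0] by (simp add: g.l_cancel_one)
  then have "cls (- c) \<otimes>\<^bsub>K0 S E\<^esub> cls c = \<one>\<^bsub>K0 S E\<^esub>"
    using class_mult[OF k assms] by simp
  then show ?thesis using g.inv_equality class_carrier k assms by blast
qed

lemma class_diff:
  assumes "Poly_Mapping.keys c \<subseteq> S" "Poly_Mapping.keys d \<subseteq> S"
  shows "cls c \<otimes>\<^bsub>K0 S E\<^esub> inv\<^bsub>K0 S E\<^esub> cls d = cls (c - d)"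
  using class_mult[OF assms(1), of "- d"] class_inv[OF assms(2)] assms by simp

end

definition frag_eval :: "('x \<Rightarrow> int) \<Rightarrow> ('x \<Rightarrow>\<^sub>0 int) \<Rightarrow> int" where
  "frag_eval f c = (\<Sum>x\<in>Poly_Mapping.keys c. Poly_Mapping.lookup c x * f x)"

lemma frag_eval_superset:
  assumes "finite A" "Poly_Mapping.keys c \<subseteq> A"
  shows "frag_eval f c = (\<Sum>x\<in>A. Poly_Mapping.lookup c x * f x)"
  unfolding frag_eval_def using assms by (intro sum.mono_neutral_left) (auto simp: in_keys_iff)

lemma frag_eval_add: "frag_eval f (c + d) = frag_eval f c + frag_eval f d"
proof -
  let ?A = "Poly_Mapping.keys c \<union> Poly_Mapping.keys d"
  show ?thesis
    using frag_eval_superset[of ?A c f] frag_eval_superset[of ?A d f]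
      frag_eval_superset[of ?A "c + d" f] keys_add[of c d]
    by (simp add: Poly_Mapping.lookup_add algebra_simps sum.distrib)
qed

lemma frag_eval_neg: "frag_eval f (- c) = - frag_eval f c"
  by (simp add: frag_eval_def sum_negf)

lemma frag_eval_diff: "frag_eval f (c - d) = frag_eval f c - frag_eval f d"
  using frag_eval_add[of f c "- d"] frag_eval_neg[of f d] by simp

lemma frag_eval_of [simp]: "frag_eval f (frag_of x) = f x"
  by (simp add: frag_eval_def keys_frag_of)

lemma frag_eval_zero [simp]: "frag_eval f 0 = 0"
  by (simp add: frag_eval_def)

text \<open>An additive function, extended linearly, kills the generating relations and hence is a
  functional on the Grothendieck group. It is applied to multiplicities of indecomposables and to
  dimension vectors.\<close>

lemma (in grothendieck) frag_eval_rel: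
  assumes "\<And>A B Z. (A, B, Z) \<in> E \<Longrightarrow> f B = f A + f Z" and "c \<in> Rel"
  shows "frag_eval f c = 0"
  using assms(2) unfolding K0_relations_def
proof (induction c rule: generate.induct)
  case (incl h)
  then show ?case using assms(1) by (auto simp: frag_eval_diff)
next
  case (inv h)
  then have "Poly_Mapping.keys h \<subseteq> S" using rel_gen rel_keys by blast
  then show ?case using inv assms(1) by (auto simp: frag_eval_diff frag_eval_neg)
qed (simp_all add: frag_eval_add)

section \<open>Cluster-tilting subcategories, index and coindex\<close>

context additive_category
begin

lemma biprod_iso:
  assumes S: "biprod C A B S i j p q" and b: "arr C b S S'" "arr C g S' S" "g \<cdot> b = idm C S" "b \<cdot> g = idm C S'"
  shows "biprod C A B S' (b \<cdot> i) (b \<cdot> j) (p \<cdot> g) (q \<cdot> g)"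
proof -
  note s = biprodD[OF S]
  have canc: "(r \<cdot> g) \<cdot> (b \<cdot> l) = r \<cdot> l" if "arr C l X S" "arr C r S Y" for l r X Y
    using assoc[OF arr_comp[OF that(1) b(1)] b(2) that(2)] assoc[OF that(1) b(1,2)] b(3) id_left[OF that(1)]
    by simp
  have "b \<cdot> i \<cdot> (p \<cdot> g) + b \<cdot> j \<cdot> (q \<cdot> g) = b \<cdot> ((i \<cdot> p) \<cdot> g) + b \<cdot> ((j \<cdot> q) \<cdot> g)"
    using assoc[OF arr_comp[OF b(2) s(3)] s(1) b(1)] assoc[OF arr_comp[OF b(2) s(4)] s(2) b(1)]
      assoc[OF b(2) s(3,1)] assoc[OF b(2) s(4,2)] by simp
  also have "\<dots> = b \<cdot> ((i \<cdot> p + j \<cdot> q) \<cdot> g)"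
    using comp_add_left[OF b(2) arr_comp[OF s(3,1)] arr_comp[OF s(4,2)]]
      comp_add_right[OF arr_comp[OF b(2) arr_comp[OF s(3,1)]] arr_comp[OF b(2) arr_comp[OF s(4,2)]] b(1)] by simp
  also have "\<dots> = idm C S'" using s(9) id_left[OF b(2)] b(4) by simp
  finally show ?thesis
    unfolding biprod_def using s canc arr_comp[OF s(1) b(1)] arr_comp[OF s(2) b(1)] arr_comp[OF b(2) s(3)]
      arr_comp[OF b(2) s(4)] by simp
qed

lemma direct_sum_iso:
  assumes "direct_sum C [A, B] S" "is_iso C S S' b" "S' \<in> Ob C"
  shows "direct_sum C [A, B] S'"
proof -
  obtain i j p q where S: "biprod C A B S i j p q" using direct_sum_imp_biprod[OF assms(1)] by blast
  obtain g where "arr C b S S'" "arr C g S' S" "g \<cdot> b = idm C S" "b \<cdot> g = idm C S'"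
    using is_isoD[OF assms(2) biprodD(12)[OF S] assms(3)] by blast
  then show ?thesis using biprod_imp_direct_sum[OF biprod_iso[OF S]] by blast
qed

text \<open>The complement is obtained by splitting the idempotent
  \<open>idm C S - s \<cdot> r\<close>; the mixed compositions vanish because this idempotent
  annihilates \<open>s\<close> and is annihilated by \<open>r\<close>.\<close>

lemma complement_biprod:
  assumes ic: "idempotent_complete C" and s: "arr C s X S" and r: "arr C r S X" and e: "r \<cdot> s = idm C X"
  shows "\<exists>Z s' r'. biprod C X Z S s s' r r'"
proof -
  have o: "X \<in> Ob C" "S \<in> Ob C" using arr_ob s by auto
  have sr: "arr C (s \<cdot> r) S S" using arr_comp[OF r s] .
  let ?e = "idm C S - s \<cdot> r"
  have ae: "arr C ?e S S" using arr_diff[OF arr_id[OF o(2)] sr] .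
  have srsr: "(s \<cdot> r) \<cdot> (s \<cdot> r) = s \<cdot> r"
    using assoc[OF sr r s] assoc[OF r s r] e id_left[OF r] by simp
  have "?e \<cdot> ?e = ?e"
    using comp_diff_left[OF ae arr_id[OF o(2)] sr] comp_diff_right[OF arr_id[OF o(2)] sr sr]
      id_left[OF ae] id_right[OF sr] srsr by simp
  then obtain Z r' s' where Z: "Z \<in> Ob C" "r' \<in> Hom C S Z" "s' \<in> Hom C Z S" "r' \<cdot> s' = idm C Z" "s' \<cdot> r' = ?e"
    using ic ae unfolding idempotent_complete_def arr_def by blast
  have r': "arr C r' S Z" and s': "arr C s' Z S" using Z o by (auto simp: arr_def)
  have "s' = (s' \<cdot> r') \<cdot> s'" using assoc[OF s' r' s'] Z(4) id_right[OF s'] by simp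
  also have "\<dots> = s' - s \<cdot> (r \<cdot> s')"
    using Z(5) comp_diff_left[OF s' arr_id[OF o(2)] sr] id_left[OF s'] assoc[OF s' r s] by simp
  finally have "s \<cdot> (r \<cdot> s') = 0" by simp
  then have "r \<cdot> (s \<cdot> (r \<cdot> s')) = 0" using comp_zero_right[OF Z(1) r] by simp
  then have rs': "r \<cdot> s' = 0"
    using assoc[OF arr_comp[OF s' r] s r] e id_left[OF arr_comp[OF s' r]] by simp
  have "r' = r' \<cdot> (s' \<cdot> r')" using assoc[OF r' s' r'] Z(4) id_left[OF r'] by simp
  also have "\<dots> = r' - (r' \<cdot> s) \<cdot> r"
    using Z(5) comp_diff_right[OF arr_id[OF o(2)] sr r'] id_right[OF r'] assoc[OF r s r'] by simp
  finally have "(r' \<cdot> s) \<cdot> r = 0" by simp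
  then have "((r' \<cdot> s) \<cdot> r) \<cdot> s = 0" using comp_zero_left[OF Z(1) s] by simp
  then have r's: "r' \<cdot> s = 0"
    using assoc[OF s r arr_comp[OF s r']] e id_right[OF arr_comp[OF s r']] by simp
  have "biprod C X Z S s s' r r'" unfolding biprod_def using s r s' r' e Z rs' r's by simp
  then show ?thesis by blast
qed

end

context extriangulated_category
begin

lemma split_direct_sum:
  assumes R: "Real C A B Z 0 x y" shows "direct_sum C [A, Z] B"
proof -
  note r = RealD[OF R]
  obtain S i j p q where S: "biprod C A Z S i j p q" using biprod_exists[OF r(4,6)] by blast
  obtain b where "is_iso C S B b" using real_middle_unique[OF real_split[OF S] R] by blast
  then show ?thesis using direct_sum_iso[OF biprod_imp_direct_sum[OF S]] r by blast
qed

end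

locale ct_category = extriangulated_category +
  fixes p :: "'b \<Rightarrow> 'b \<Rightarrow> 'd \<Rightarrow> 'd \<Rightarrow> 'a" and T :: "'b set"
  assumes pairing: "ext_pairing C p"
    and fin_dim_ext: "X \<in> Ob C \<Longrightarrow> Y \<in> Ob C \<Longrightarrow> fin_dim (escal C) (Ext C X Y)"
    and tilting: "cluster_tilting C T"
    and idem: "idempotent_complete C"
begin

text \<open>The opposite category exchanges the two naturality clauses of the pairing, while the
  first argument stays the one in which it is non-degenerate. Coresolution statements thus follow
  from those on resolutions.\<close>

lemma opp_ct: "ct_category (opp C) (\<lambda>X Y a b. p Y X a b) T"
proof (rule ct_category.intro[OF opp_extriangulated], unfold_locales)
  have 1: "\<forall>X\<in>Ob C. \<forall>Y\<in>Ob C. bilinear_on (escal C) (Ext C X Y) (escal C) (Ext C Y X) (p X Y)"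
    and 2: "\<forall>X\<in>Ob C. \<forall>Y\<in>Ob C. \<forall>a\<in>Ext C X Y. (\<forall>b\<in>Ext C Y X. p X Y a b = 0) \<longrightarrow> a = 0"
    and 3: "\<And>X Y X' a b f. arr C f X' X \<Longrightarrow> exte C a X Y \<Longrightarrow> exte C b Y X' \<Longrightarrow>
        p X' Y (pull C f a) b = p X Y a (push C f b)"
    and 4: "\<And>X Y Y' a b g. arr C g Y Y' \<Longrightarrow> exte C a X Y \<Longrightarrow> exte C b Y' X \<Longrightarrow>
        p X Y' (push C g a) b = p X Y a (pull C g b)"
    using pairing unfolding ext_pairing_def by blast+
  show "ext_pairing (opp C) (\<lambda>X Y a b. p Y X a b)"
    unfolding ext_pairing_def using 1 2 3 4 by simp
  show "fin_dim (escal (opp C)) (Ext (opp C) X Y)" if "X \<in> Ob (opp C)" "Y \<in> Ob (opp C)" for X Y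
    using that fin_dim_ext by simp
  show "cluster_tilting (opp C) T"
  proof -
    have "inflation (opp C) X L i = deflation C L X i" "deflation (opp C) X L i = inflation C L X i"
      "left_approximation (opp C) T X L i = right_approximation C T L X i"
      "right_approximation (opp C) T X L i = left_approximation C T L X i" for X L i
      by (auto simp: inflation_def deflation_def left_approximation_def right_approximation_def)
    then show ?thesis using tilting unfolding cluster_tilting_def by simp
  qed
  show "idempotent_complete (opp C)"
    using idem unfolding idempotent_complete_def by (simp; meson)
qed

lemma T_ob: "X \<in> T \<Longrightarrow> X \<in> Ob C"
  using tilting unfolding cluster_tilting_def by blast

lemma T_ext: "exte C e V X \<Longrightarrow> V \<in> T \<Longrightarrow> X \<in> T \<Longrightarrow> e = 0"
  using tilting unfolding cluster_tilting_def exte_def by blast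

lemma T_memI: "X \<in> Ob C \<Longrightarrow> (\<And>V e. V \<in> T \<Longrightarrow> exte C e V X \<Longrightarrow> e = 0) \<Longrightarrow> X \<in> T"
proof -
  assume X: "X \<in> Ob C" and z: "\<And>V e. V \<in> T \<Longrightarrow> exte C e V X \<Longrightarrow> e = 0"
  have "Ext C V X = {0}" if "V \<in> T" for V
    using z that T_ob[OF that] X ext.subspace_0[OF ext_subspace] by (auto simp: exte_def)
  then show "X \<in> T" using tilting X unfolding cluster_tilting_def by blast
qed

lemma T_extension:
  assumes R: "Real C A B Z d x y" and A: "A \<in> T" and Z: "Z \<in> T" shows "B \<in> T"
proof (rule T_memI)
  show "B \<in> Ob C" using RealD[OF R] by blast
  fix V e assume V: "V \<in> T" and e: "exte C e V B"
  have "push C y e = 0" using T_ext[OF exte_push[OF e RealD(3)[OF R]] V Z] .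
  then obtain e' where e': "exte C e' V A" "push C x e' = e" using ext_exact_middle_push[OF R e] by blast
  then show "e = 0" using T_ext[OF e'(1) V A] push_zero[OF exte_ob(1)[OF e] RealD(2)[OF R]] by simp
qed

lemma T_biprod:
  assumes S: "biprod C A B S i j q r" shows "S \<in> T \<longleftrightarrow> A \<in> T \<and> B \<in> T"
proof
  assume "A \<in> T \<and> B \<in> T" then show "S \<in> T" using T_extension[OF real_split[OF S]] by blast
next
  have *: "A \<in> T" if S: "biprod C A B S i j q r" "S \<in> T" for A B S i j q r
  proof (rule T_memI)
    note s = biprodD[OF S(1)]
    show "A \<in> Ob C" using s by blast
    fix V e assume V: "V \<in> T" and e: "exte C e V A"
    have "push C q (push C i e) = e" using push_push[OF e s(1,3)] s(5) push_ext_id[OF e] by simp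
    moreover have "push C i e = 0" using T_ext[OF exte_push[OF e s(1)] V S(2)] .
    ultimately show "e = 0" using push_zero[OF exte_ob(1)[OF e] s(3)] by simp
  qed
  assume "S \<in> T" then show "A \<in> T \<and> B \<in> T" using *[OF S] *[OF biprod_swap[OF S]] by blast
qed

lemma T_sums: "direct_sum C [A, B] S \<Longrightarrow> S \<in> T \<longleftrightarrow> A \<in> T \<and> B \<in> T"
  using direct_sum_imp_biprod[of C A B S] T_biprod by blast

sublocale K: grothendieck T "split_sequences C T"
  by unfold_locales (auto simp: split_sequences_def)

lemma split_rel: "A \<in> T \<Longrightarrow> Z \<in> T \<Longrightarrow> direct_sum C [A, Z] B \<Longrightarrow> frag_of B - frag_of A - frag_of Z \<in> K.Rel"
  using K.rel_gen[of A B Z] T_sums[of A Z B] by (auto simp: split_sequences_def)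

text \<open>The kernel of an approximation that is a deflation lies in \<open>T\<close>: a class of
  an object \<open>V\<close> of \<open>T\<close> by the kernel comes from a map from
  \<open>V\<close> to \<open>X\<close>, which factors through the approximation and so yields the
  class 0.\<close>

lemma right_resolution:
  assumes X: "X \<in> Ob C" shows "\<exists>K R d x y. K \<in> T \<and> R \<in> T \<and> Real C K R X d x y"
proof -
  obtain R y where R: "right_approximation C T R X y" "deflation C R X y"
    using tilting X unfolding cluster_tilting_def by blast
  then obtain K d x where K: "Real C K R X d x y" unfolding deflation_def conflation_def by blast
  note r = RealD[OF K]
  have RT: "R \<in> T" using R unfolding right_approximation_def by blast
  have "K \<in> T"
  proof (rule T_memI[OF r(4)])
    fix V e assume V: "V \<in> T" and e: "exte C e V K"
    have "push C x e = 0" using T_ext[OF exte_push[OF e r(2)] V RT] .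
    then obtain f where f: "arr C f V X" "pull C f d = e" using ext_exact_pull[OF K e] by blast
    obtain h where h: "h \<in> Hom C V R" "y \<cdot> h = f"
      using R(1) V f(1) unfolding right_approximation_def arr_def by blast
    have ah: "arr C h V R" using h r(5) T_ob[OF V] by (simp add: arr_def)
    have "e = pull C h (pull C y d)" using pull_pull[OF r(1,3) ah] h f by simp
    then show "e = 0" using real_pull_zero[OF K] pull_zero[OF r(4) ah] by simp
  qed
  then show ?thesis using K RT by blast
qed

lemma left_resolution:
  assumes X: "X \<in> Ob C" shows "\<exists>L D d x y. L \<in> T \<and> D \<in> T \<and> Real C X L D d x y"
proof -
  interpret op: ct_category "opp C" "\<lambda>X Y a b. p Y X a b" T by (rule opp_ct)
  show ?thesis using op.right_resolution[of X] X by simp blast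
qed

text \<open>A relation and not a function: it remembers a resolution and takes values in formal
  combinations, where equations hold only modulo \<open>K.Rel\<close>. This keeps the choice made in
  \<open>ind\<close> out of the computations.\<close>

definition is_ind :: "'b \<Rightarrow> ('b \<Rightarrow>\<^sub>0 int) \<Rightarrow> bool" where
  "is_ind X c \<longleftrightarrow> (\<exists>K R d x y. K \<in> T \<and> R \<in> T \<and> Real C K R X d x y \<and> c = frag_of R - frag_of K)"

definition is_coind :: "'b \<Rightarrow> ('b \<Rightarrow>\<^sub>0 int) \<Rightarrow> bool" where
  "is_coind X c \<longleftrightarrow> (\<exists>L D d x y. L \<in> T \<and> D \<in> T \<and> Real C X L D d x y \<and> c = frag_of L - frag_of D)"

lemma is_ind_exists: "X \<in> Ob C \<Longrightarrow> \<exists>c. is_ind X c"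
  unfolding is_ind_def using right_resolution by blast

lemma is_coind_exists: "X \<in> Ob C \<Longrightarrow> \<exists>c. is_coind X c"
  unfolding is_coind_def using left_resolution by blast

lemma frag_diff_keys: "A \<in> T \<Longrightarrow> B \<in> T \<Longrightarrow> Poly_Mapping.keys (frag_of A - frag_of B) \<subseteq> T"
  using keys_diff[of "frag_of A" "frag_of B"] by (auto simp: keys_frag_of)

lemma is_ind_keys: "is_ind X c \<Longrightarrow> Poly_Mapping.keys c \<subseteq> T"
  unfolding is_ind_def using frag_diff_keys by blast

lemma is_coind_keys: "is_coind X c \<Longrightarrow> Poly_Mapping.keys c \<subseteq> T"
  unfolding is_coind_def using frag_diff_keys by blast

text \<open>Schanuel's lemma: both middle terms are realisations of the same extension of \<open>X\<close> by
  \<open>K \<oplus> K'\<close>, up to automorphisms of the latter.\<close>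

lemma is_ind_unique:
  assumes "is_ind X c" "is_ind X c'" shows "c - c' \<in> K.Rel"
proof -
  obtain K R d x y where R: "K \<in> T" "R \<in> T" "Real C K R X d x y" "c = frag_of R - frag_of K"
    using assms(1) unfolding is_ind_def by blast
  obtain K' R' d' x' y' where R': "K' \<in> T" "R' \<in> T" "Real C K' R' X d' x' y'" "c' = frag_of R' - frag_of K'"
    using assms(2) unfolding is_ind_def by blast
  note r = RealD[OF R(3)] and r' = RealD[OF R'(3)]
  \<comment> \<open>As \<open>R\<close> and \<open>K'\<close> lie in \<open>T\<close>, the class
    \<open>d'\<close> is a push-out of \<open>d\<close>; conversely \<open>d\<close> is one of
    \<open>d'\<close>. The two maps are the entries of the shears below.\<close>
  obtain a where a: "arr C a K K'" "push C a d = d'"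
    using ext_exists_push[OF R(3) r'(1)] T_ext[OF _ R(2) R'(1)] by blast
  obtain a' where a': "arr C a' K' K" "push C a' d' = d"
    using ext_exists_push[OF R'(3) r(1)] T_ext[OF _ R'(2) R(1)] by blast
  obtain S i j s t where S: "biprod C K K' S i j s t" using biprod_exists[OF r(4) r'(4)] by blast
  note s = biprodD[OF S]
  obtain U ui uj us ut where U: "biprod C R K' U ui uj us ut" using biprod_exists[OF r(5) r'(4)] by blast
  obtain V vi vj vs vt where V: "biprod C K R' V vi vj vs vt" using biprod_exists[OF r(4) r'(5)] by blast
  obtain N0 where N0: "N0 \<in> Ob C" "idm C N0 = 0" using zero_object_exists by blast
  have z: "push C j (pull C 0 0) = 0" "push C i (pull C 0 0) = 0"
    using pull_zero[OF r'(4) arr_zero[OF r(6) N0(1)]] pull_zero[OF r(4) arr_zero[OF r(6) N0(1)]]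
      push_zero[OF r(6) s(2)] push_zero[OF r(6) s(1)] by auto
  have 1: "\<exists>x y. Real C S U X (push C i d) x y"
    using real_sum_biprod[OF R(3) real_trivial(1)[OF r'(4) N0] S U biprod_zero[OF r(6) N0]]
      z pull_ext_id[OF r(1)] by auto
  have 2: "\<exists>x y. Real C S V X (push C j d') x y"
    using real_sum_biprod[OF real_trivial(1)[OF r(4) N0] R'(3) S V biprod_swap[OF biprod_zero[OF r(6) N0]]]
      z pull_ext_id[OF r'(1)] by auto
  have unip: "is_iso C S S (idm C S + n)" if n: "arr C n S S" "n \<cdot> n = 0" for n
  proof -
    have i: "arr C (idm C S) S S" using arr_id s(12) .
    note p = arr_add[OF i n(1)] and m = arr_diff[OF i n(1)]
    have "(idm C S - n) \<cdot> (idm C S + n) = idm C S" "(idm C S + n) \<cdot> (idm C S - n) = idm C S"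
      using comp_diff_left[OF p i n(1)] comp_add_right[OF i n(1) n(1)] id_left[OF p]
        comp_add_left[OF m i n(1)] comp_diff_right[OF i n(1) n(1)] id_left[OF m] id_right[OF n(1)] n(2) by auto
    then show ?thesis using is_isoI[OF p m] by blast
  qed
  \<comment> \<open>These are the off-diagonal endomorphisms of the sum \<open>S\<close> of
    \<open>K\<close> and \<open>K'\<close>, of square 0. The shear with \<open>n1\<close> takes the
    class of the first conflation to the sum of both classes, and the shear with \<open>n2\<close>
    does so with the class of the second. Hence the sum of \<open>R\<close> and \<open>K'\<close>
    and that of \<open>K\<close> and \<open>R'\<close> realise the same class.\<close>
  define n1 where "n1 = j \<cdot> (a \<cdot> s)"
  define n2 where "n2 = i \<cdot> (a' \<cdot> t)"
  have as: "arr C (a \<cdot> s) S K'" and at: "arr C (a' \<cdot> t) S K"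
    using arr_comp[OF s(3) a(1)] arr_comp[OF s(4) a'(1)] by auto
  have n1: "arr C n1 S S" and n2: "arr C n2 S S"
    unfolding n1_def n2_def using arr_comp[OF as s(2)] arr_comp[OF at s(1)] by auto
  have as0: "(a \<cdot> s) \<cdot> j = 0" "(a' \<cdot> t) \<cdot> i = 0" "(a \<cdot> s) \<cdot> i = a" "(a' \<cdot> t) \<cdot> j = a'"
    using assoc[OF s(2) s(3) a(1)] assoc[OF s(1) s(4) a'(1)] assoc[OF s(1) s(3) a(1)] assoc[OF s(2) s(4) a'(1)]
      s comp_zero_right[OF s(11) a(1)] comp_zero_right[OF s(10) a'(1)] id_right[OF a(1)] id_right[OF a'(1)]
    by auto
  have "n1 \<cdot> n1 = j \<cdot> (((a \<cdot> s) \<cdot> j) \<cdot> (a \<cdot> s))" "n2 \<cdot> n2 = i \<cdot> (((a' \<cdot> t) \<cdot> i) \<cdot> (a' \<cdot> t))"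
    unfolding n1_def n2_def
    using assoc[OF arr_comp[OF as s(2)] as s(2)] assoc[OF as s(2) as]
      assoc[OF arr_comp[OF at s(1)] at s(1)] assoc[OF at s(1) at] by auto
  then have nn: "n1 \<cdot> n1 = 0" "n2 \<cdot> n2 = 0"
    using as0 comp_zero_left[OF s(11) as] comp_zero_left[OF s(10) at]
      comp_zero_right[OF s(12) s(2)] comp_zero_right[OF s(12) s(1)] by auto
  have ei: "exte C (push C i d) X S" and ej: "exte C (push C j d') X S"
    using exte_push[OF r(1) s(1)] exte_push[OF r'(1) s(2)] by auto
  have "n1 \<cdot> i = j \<cdot> a" "n2 \<cdot> j = i \<cdot> a'"
    unfolding n1_def n2_def using assoc[OF s(1) as s(2)] assoc[OF s(2) at s(1)] as0 by auto
  then have "push C n1 (push C i d) = push C j d'" "push C n2 (push C j d') = push C i d"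
    using push_push[OF r(1) s(1) n1] push_push[OF r'(1) s(2) n2] push_push[OF r(1) a(1) s(2)]
      push_push[OF r'(1) a'(1) s(1)] a(2) a'(2) by auto
  then have p: "push C (idm C S + n1) (push C i d) = push C i d + push C j d'"
    "push C (idm C S + n2) (push C j d') = push C i d + push C j d'"
    using push_add_arr[OF ei arr_id[OF s(12)] n1] push_add_arr[OF ej arr_id[OF s(12)] n2]
      push_ext_id[OF ei] push_ext_id[OF ej] by (auto simp: add.commute)
  obtain u v where "Real C S U X (push C i d + push C j d') u v"
    using 1 real_push_iso[OF _ unip[OF n1 nn(1)] s(12)] p(1) by metis
  moreover obtain u' v' where "Real C S V X (push C i d + push C j d') u' v'"
    using 2 real_push_iso[OF _ unip[OF n2 nn(2)] s(12)] p(2) by metis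
  ultimately obtain b where b: "is_iso C U V b" using real_middle_unique by blast
  have "direct_sum C [R, K'] V"
    using direct_sum_iso[OF biprod_imp_direct_sum[OF U] b biprodD(12)[OF V]] .
  then have e1: "frag_of V - frag_of R - frag_of K' \<in> K.Rel" using split_rel R R' by blast
  have e2: "frag_of V - frag_of K - frag_of R' \<in> K.Rel"
    using split_rel[OF R(1) R'(2) biprod_imp_direct_sum[OF V]] .
  have "c - c' = (frag_of V - frag_of K - frag_of R') - (frag_of V - frag_of R - frag_of K')"
    unfolding R(4) R'(4) by (simp add: algebra_simps)
  then show ?thesis using K.rel_diff[OF e2 e1] by simp
qed

end

lemma split_sequences_opp [simp]: "split_sequences (opp C) T = split_sequences C T"
  by (simp add: split_sequences_def)

context ct_category
begin

lemma is_ind_opp: "ct_category.is_ind (opp C) T X c \<longleftrightarrow> is_coind X c"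
proof -
  interpret op: ct_category "opp C" "\<lambda>X Y a b. p Y X a b" T by (rule opp_ct)
  show ?thesis unfolding op.is_ind_def is_coind_def by (simp; blast)
qed

lemma is_coind_unique: "is_coind X c \<Longrightarrow> is_coind X c' \<Longrightarrow> c - c' \<in> K.Rel"
proof -
  interpret op: ct_category "opp C" "\<lambda>X Y a b. p Y X a b" T by (rule opp_ct)
  show "is_coind X c \<Longrightarrow> is_coind X c' \<Longrightarrow> c - c' \<in> K.Rel"
    using op.is_ind_unique[of X c c'] by (simp add: is_ind_opp)
qed

text \<open>A resolution of \<open>N\<close> composed with the deflation to \<open>Y\<close> has as
  kernel an extension of \<open>L\<close> by the old kernel. It splits because both lie in
  \<open>T\<close>, so the index drops by exactly the class of \<open>L\<close>.\<close>

lemma is_ind_deflation: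
  assumes R: "Real C L N Y d x y" and L: "L \<in> T" and c: "is_ind N c"
  shows "\<exists>c'. is_ind Y c' \<and> c' - (c - frag_of L) \<in> K.Rel"
proof -
  obtain K0 R0 e u v where R0: "K0 \<in> T" "R0 \<in> T" "Real C K0 R0 N e u v" "c = frag_of R0 - frag_of K0"
    using c unfolding is_ind_def by blast
  obtain M d' e' \<epsilon> h where M: "Real C M R0 Y \<epsilon> h (y \<cdot> v)" "Real C K0 M L (pull C x e) e' d'"
    using deflation_octahedron[OF R R0(3)] by blast
  have MT: "M \<in> T" using T_extension[OF M(2) R0(1) L] .
  have "pull C x e = 0" using T_ext[OF RealD(1)[OF M(2)] L R0(1)] .
  then have "direct_sum C [K0, L] M" using split_direct_sum M(2) by simp
  then have s: "frag_of M - frag_of K0 - frag_of L \<in> K.Rel" using split_rel R0 L by blast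
  have eq: "(frag_of R0 - frag_of M) - (c - frag_of L) = - (frag_of M - frag_of K0 - frag_of L)"
    unfolding R0(4) by (simp add: algebra_simps)
  have "(frag_of R0 - frag_of M) - (c - frag_of L) \<in> K.Rel" unfolding eq by (rule K.rel_neg[OF s])
  moreover have "is_ind Y (frag_of R0 - frag_of M)" unfolding is_ind_def using M MT R0 by blast
  ultimately show ?thesis by blast
qed

lemma is_coind_inflation:
  assumes R: "Real C Y Z Q d x y" and Q: "Q \<in> T" and c: "is_coind Z c"
  shows "\<exists>c'. is_coind Y c' \<and> c' - (c - frag_of Q) \<in> K.Rel"
proof -
  interpret op: ct_category "opp C" "\<lambda>X Y a b. p Y X a b" T by (rule opp_ct)
  have "op.is_ind Z c" using c by (simp add: is_ind_opp)
  then show ?thesis using op.is_ind_deflation[of Q Z Y d y x c] R Q by (simp add: is_ind_opp)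
qed

section \<open>The difference of coindex and index\<close>

definition is_beta :: "'b \<Rightarrow> ('b \<Rightarrow>\<^sub>0 int) \<Rightarrow> bool" where
  "is_beta X c \<longleftrightarrow> (\<exists>a b. is_coind X a \<and> is_ind X b \<and> c = a - b)"

lemma is_beta_exists: "X \<in> Ob C \<Longrightarrow> \<exists>c. is_beta X c"
  unfolding is_beta_def using is_ind_exists is_coind_exists by blast

lemma is_beta_keys:
  assumes "is_beta X c" shows "Poly_Mapping.keys c \<subseteq> T"
proof -
  obtain a b where "is_coind X a" "is_ind X b" "c = a - b" using assms unfolding is_beta_def by blast
  then show ?thesis using is_ind_keys[of X b] is_coind_keys[of X a] keys_diff[of a b] by auto
qed

lemma is_beta_unique:
  assumes "is_beta X c" "is_beta X c'" shows "c - c' \<in> K.Rel"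
proof -
  obtain a b where a: "is_coind X a" "is_ind X b" "c = a - b" using assms(1) unfolding is_beta_def by blast
  obtain a' b' where a': "is_coind X a'" "is_ind X b'" "c' = a' - b'" using assms(2) unfolding is_beta_def by blast
  have "c - c' = (a - a') - (b - b')" using a a' by simp
  then show ?thesis using K.rel_diff[OF is_coind_unique[OF a(1) a'(1)] is_ind_unique[OF a(2) a'(2)]] by simp
qed

lemma is_beta_T: "X \<in> T \<Longrightarrow> is_beta X 0"
proof -
  assume X: "X \<in> T"
  obtain N0 where N0: "N0 \<in> Ob C" "idm C N0 = 0" using zero_object_exists by blast
  have "N0 \<in> T"
    using T_memI[OF N0(1)] arr_to_zero[OF N0(2)] push_ext_id N0(2) push_zero_arr N0(1) by metis
  then have "is_ind X (frag_of X - frag_of N0)" "is_coind X (frag_of X - frag_of N0)"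
    unfolding is_ind_def is_coind_def using X real_trivial[OF T_ob[OF X] N0] by blast+
  then show "is_beta X 0" unfolding is_beta_def by force
qed

text \<open>A summand in \<open>T\<close> contributes its class to the coindex and to the index
  alike.\<close>

lemma is_beta_add_T:
  assumes S: "biprod C X A S i j q r" and A: "A \<in> T" and c: "is_beta S c" and c': "is_beta X c'"
  shows "c - c' \<in> K.Rel"
proof -
  obtain a b where a: "is_coind S a" "is_ind S b" "c = a - b" using c unfolding is_beta_def by blast
  obtain a' where a': "is_coind X a'" "a' - (a - frag_of A) \<in> K.Rel"
    using is_coind_inflation[OF real_split[OF S] A a(1)] by blast
  obtain b' where b': "is_ind X b'" "b' - (b - frag_of A) \<in> K.Rel"
    using is_ind_deflation[OF real_split[OF biprod_swap[OF S]] A a(2)] by blast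
  have "is_beta X (a' - b')" unfolding is_beta_def using a' b' by blast
  then have d: "(a' - b') - c' \<in> K.Rel" using is_beta_unique c' by blast
  have eq: "c - c' = ((a' - b') - c') - ((a' - (a - frag_of A)) - (b' - (b - frag_of A)))"
    unfolding a(3) by (simp add: algebra_simps)
  show ?thesis unfolding eq by (rule K.rel_diff[OF d K.rel_diff[OF a'(2) b'(2)]])
qed

text \<open>The first two conditions on extension classes say that \<open>f\<close> induces an
  isomorphism of restricted extension functors. Since \<open>g \<cdot> f - idm C X\<close> kills the
  class \<open>d\<close>, it factors through \<open>P\<close>. This makes \<open>X\<close> a summand
  of the sum of \<open>Y\<close> and \<open>P\<close>, via \<open>m\<close> with components
  \<open>f\<close>, \<open>x\<close> and the retraction with components \<open>g\<close>,
  \<open>- b\<close>. The complement lies in \<open>T\<close>, and summands in \<open>T\<close> do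
  not matter.\<close>

lemma is_beta_iso:
  assumes f: "arr C f X Y" and g: "arr C g Y X"
    and gf: "\<And>V e. V \<in> T \<Longrightarrow> exte C e V X \<Longrightarrow> push C g (push C f e) = e"
    and inj: "\<And>V e. V \<in> T \<Longrightarrow> exte C e V Y \<Longrightarrow> push C g e = 0 \<Longrightarrow> e = 0"
    and c: "is_beta X c" and c': "is_beta Y c'"
  shows "c - c' \<in> K.Rel"
proof -
  have o: "X \<in> Ob C" "Y \<in> Ob C" using arr_ob f by auto
  obtain P Q d x y where P: "P \<in> T" "Q \<in> T" "Real C X P Q d x y" using left_resolution[OF o(1)] by blast
  note r = RealD[OF P(3)]
  have n: "arr C (g \<cdot> f - idm C X) X X" using arr_diff[OF arr_comp[OF f g] arr_id[OF o(1)]] .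
  have "push C (g \<cdot> f - idm C X) d = 0"
    using push_diff_arr[OF r(1) arr_comp[OF f g] arr_id[OF o(1)]] push_push[OF r(1) f g] gf[OF P(2) r(1)]
      push_ext_id[OF r(1)] by simp
  then obtain b where b: "arr C b P X" "b \<cdot> x = g \<cdot> f - idm C X" using factor_inflation[OF P(3) n] by blast
  obtain S j1 j2 p1 p2 where S: "biprod C Y P S j1 j2 p1 p2" using biprod_exists[OF o(2) r(5)] by blast
  note s = biprodD[OF S]
  define m where "m = j1 \<cdot> f + j2 \<cdot> x"
  define t where "t = g \<cdot> p1 + (- b) \<cdot> p2"
  have m: "arr C m X S" "p1 \<cdot> m = f" "p2 \<cdot> m = x" unfolding m_def using biprod_map_in[OF S f r(2)] by auto
  have t: "arr C t S X" unfolding t_def using biprod_map_out(1)[OF S g arr_neg[OF b(1)]] .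
  have tl: "t \<cdot> l = g \<cdot> (p1 \<cdot> l) - b \<cdot> (p2 \<cdot> l)" if l: "arr C l W S" for l W
    unfolding t_def
    using comp_add_left[OF l arr_comp[OF s(3) g] arr_comp[OF s(4) arr_neg[OF b(1)]]]
      assoc[OF l s(3) g] assoc[OF l s(4) arr_neg[OF b(1)]] comp_neg_left[OF arr_comp[OF l s(4)] b(1)] by simp
  have "t \<cdot> m = idm C X" using tl[OF m(1)] m b(2) by simp
  then obtain Z' s' r' where Z': "biprod C X Z' S m s' t r'" using complement_biprod[OF idem m(1) t] by blast
  note z = biprodD[OF Z']
  \<comment> \<open>A class in the complement has no component in \<open>P\<close>, since
    \<open>P\<close> lies in \<open>T\<close>. Its component in \<open>Y\<close> is killed by
    \<open>g\<close>, because the retraction vanishes on the complement, and is therefore 0 by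
    \<open>inj\<close>.\<close>
  have "Z' \<in> T"
  proof (rule T_memI[OF z(11)])
    fix V e assume V: "V \<in> T" and e: "exte C e V Z'"
    have se: "exte C (push C s' e) V S" using exte_push[OF e z(2)] .
    have p2: "push C p2 (push C s' e) = 0" using T_ext[OF exte_push[OF se s(4)] V P(1)] .
    have "0 = push C (t \<cdot> s') e" using z(7) push_zero_arr[OF e o(1)] by simp
    also have "\<dots> = push C (g \<cdot> p1) (push C s' e) - push C (b \<cdot> p2) (push C s' e)"
      using tl[OF z(2)] push_diff_arr[OF e arr_comp[OF arr_comp[OF z(2) s(3)] g] arr_comp[OF arr_comp[OF z(2) s(4)] b(1)]]
        assoc[OF z(2) s(3) g] assoc[OF z(2) s(4) b(1)] push_push[OF e z(2) arr_comp[OF s(3) g]]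
        push_push[OF e z(2) arr_comp[OF s(4) b(1)]] by simp
    also have "\<dots> = push C g (push C p1 (push C s' e))"
      using push_push[OF se s(3) g] push_push[OF se s(4) b(1)] p2 push_zero[OF exte_ob(1)[OF e] b(1)] by simp
    finally have p1: "push C p1 (push C s' e) = 0" using inj[OF V exte_push[OF se s(3)]] by simp
    have "push C s' e = push C (j1 \<cdot> p1 + j2 \<cdot> p2) (push C s' e)" using s(9) push_ext_id[OF se] by simp
    also have "\<dots> = push C j1 (push C p1 (push C s' e)) + push C j2 (push C p2 (push C s' e))"
      using push_add_arr[OF se arr_comp[OF s(3,1)] arr_comp[OF s(4,2)]] push_push[OF se s(3,1)] push_push[OF se s(4,2)]
      by simp
    also have "\<dots> = 0" using p1 p2 push_zero[OF exte_ob(1)[OF e] s(1)] push_zero[OF exte_ob(1)[OF e] s(2)] by simp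
    finally have "push C r' (push C s' e) = 0" using push_zero[OF exte_ob(1)[OF e] z(4)] by simp
    then show "e = 0" using push_push[OF e z(2,4)] z(6) push_ext_id[OF e] by simp
  qed
  moreover obtain c0 where c0: "is_beta S c0" using is_beta_exists s(12) by blast
  ultimately have 1: "c0 - c \<in> K.Rel" using is_beta_add_T[OF Z' _ c0 c] by blast
  have 2: "c0 - c' \<in> K.Rel" using is_beta_add_T[OF S P(1) c0 c'] .
  have "c - c' = (c0 - c') - (c0 - c)" by simp
  then show ?thesis using K.rel_diff[OF 2 1] by simp
qed

text \<open>A morphism of functors between restricted extension functors is induced by the image of
  the universal extension.\<close>

lemma ext_functor_full:
  assumes o: "X \<in> Ob C" "Y \<in> Ob C"
    and \<phi>: "\<And>V e. V \<in> T \<Longrightarrow> exte C e V X \<Longrightarrow> exte C (\<phi> V e) V Y"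
    and nat: "\<And>V W h e. V \<in> T \<Longrightarrow> W \<in> T \<Longrightarrow> arr C h V W \<Longrightarrow> exte C e W X \<Longrightarrow> \<phi> V (pull C h e) = pull C h (\<phi> W e)"
    and zero: "\<And>V. V \<in> T \<Longrightarrow> \<phi> V 0 = 0"
  shows "\<exists>f. arr C f X Y \<and> (\<forall>V\<in>T. \<forall>e. exte C e V X \<longrightarrow> \<phi> V e = push C f e)"
proof -
  obtain P Q d x y where P: "P \<in> T" "Q \<in> T" "Real C X P Q d x y" using left_resolution[OF o(1)] by blast
  note r = RealD[OF P(3)]
  have e: "exte C (\<phi> Q d) Q Y" using \<phi>[OF P(2) r(1)] .
  have "pull C y (\<phi> Q d) = \<phi> P (pull C y d)" using nat[OF P(1,2) r(3,1)] by simp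
  also have "\<dots> = 0" using real_pull_zero[OF P(3)] zero[OF P(1)] by simp
  finally obtain f where f: "arr C f X Y" "push C f d = \<phi> Q d" using ext_exact_push[OF P(3) e] by blast
  have "\<phi> V a = push C f a" if V: "V \<in> T" and a: "exte C a V X" for V a
  proof -
    obtain h where h: "arr C h V Q" "pull C h d = a"
      using ext_exists_pull[OF P(3) a] T_ext[OF _ V P(1)] by blast
    show ?thesis using nat[OF V P(2) h(1) r(1)] h f push_pull_commute[OF r(1) f(1) h(1)] by simp
  qed
  then show ?thesis using f by blast
qed

text \<open>\<open>N\<close> is the kernel of the deflation \<open>R \<rightarrow> Z \<rightarrow> Q\<close>; its extension functor is isomorphic
  to that of \<open>X\<close>.\<close>

lemma is_beta_exact:
  assumes f: "arr C f X Y"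
    and inj: "\<And>V e. V \<in> T \<Longrightarrow> exte C e V X \<Longrightarrow> push C f e = 0 \<Longrightarrow> e = 0"
    and c: "is_beta X cX" "is_beta Y cY"
  shows "\<exists>Z g cZ. arr C g Y Z \<and> is_beta Z cZ \<and> cY - cX - cZ \<in> K.Rel \<and>
     (\<forall>V\<in>T. \<forall>e. exte C e V Z \<longrightarrow> (\<exists>e'. exte C e' V Y \<and> push C g e' = e)) \<and>
     (\<forall>V\<in>T. \<forall>e. exte C e V X \<longrightarrow> push C g (push C f e) = 0) \<and>
     (\<forall>V\<in>T. \<forall>e. exte C e V Y \<longrightarrow> push C g e = 0 \<longrightarrow> (\<exists>e'. exte C e' V X \<and> push C f e' = e))"
proof -
  have o: "X \<in> Ob C" "Y \<in> Ob C" using arr_ob f by auto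
  obtain P Q d x y where P: "P \<in> T" "Q \<in> T" "Real C X P Q d x y" using left_resolution[OF o(1)] by blast
  note r = RealD[OF P(3)]
  \<comment> \<open>The cokernel object. Every class of an object of \<open>T\<close> by
    \<open>X\<close> is a pull-back of \<open>d\<close>, so its image in \<open>Y\<close> becomes 0
    in \<open>Z\<close>; the map to \<open>Z\<close> is onto on classes because Ext(V,Q) =
    0.\<close>
  obtain Z g h where Z: "Real C Y Z Q (push C f d) g h" using realise[OF exte_push[OF r(1) f]] by blast
  note z = RealD[OF Z]
  have surj: "\<exists>e'. exte C e' V Y \<and> push C g e' = e" if V: "V \<in> T" and e: "exte C e V Z" for V e
    using ext_exact_middle_push[OF Z e T_ext[OF exte_push[OF e z(3)] V P(2)]] .
  have ker: "\<exists>e'. exte C e' V X \<and> push C f e' = e" if V: "V \<in> T" and e: "exte C e V Y" "push C g e = 0" for V e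
  proof -
    obtain k where k: "arr C k V Q" "pull C k (push C f d) = e" using ext_exact_pull[OF Z e] by blast
    then show ?thesis using push_pull_commute[OF r(1) f k(1)] exte_pull[OF r(1) k(1)] by metis
  qed
  have comp: "push C g (push C f e) = 0" if V: "V \<in> T" and e: "exte C e V X" for V e
  proof -
    obtain k where k: "arr C k V Q" "pull C k d = e" using ext_exists_pull[OF P(3) e] T_ext[OF _ V P(1)] by blast
    have fd: "exte C (push C f d) Q Y" using exte_push[OF r(1) f] .
    have "push C g (push C f e) = pull C k (push C g (push C f d))"
      using push_pull_commute[OF r(1) f k(1)] push_pull_commute[OF fd z(2) k(1)] k(2) by simp
    then show ?thesis using real_push_zero[OF Z] pull_zero[OF z(5) k(1)] by simp
  qed
  obtain a b where a: "is_coind Z a" and b: "is_ind Z b"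
    using is_coind_exists[OF z(5)] is_ind_exists[OF z(5)] by blast
  obtain L R e u v where R: "L \<in> T" "R \<in> T" "Real C L R Z e u v" "b = frag_of R - frag_of L"
    using b unfolding is_ind_def by blast
  obtain N n w \<epsilon> l where N: "arr C n N Y" "Real C N R Q \<epsilon> l (h \<cdot> v)" "Real C L N Y (pull C g e) w n"
    "push C n \<epsilon> = push C f d"
    using deflation_octahedron[OF Z R(3)] by blast
  note nn = RealD[OF N(2)]
  \<comment> \<open>The kernel of the map to classes by \<open>Y\<close> comes from classes by
    \<open>L\<close>, and those vanish since \<open>L\<close> lies in \<open>T\<close>.\<close>
  have ninj: "e = 0" if V: "V \<in> T" and e: "exte C e V N" "push C n e = 0" for V e
  proof -
    obtain e' where e': "exte C e' V L" "push C w e' = e" using ext_exact_middle_push[OF N(3) e] by blast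
    then show ?thesis using T_ext[OF e'(1) V R(1)] push_zero[OF T_ob[OF V] RealD(2)[OF N(3)]] by simp
  qed
  have cN: "is_coind N (frag_of R - frag_of Q)" unfolding is_coind_def using N(2) R(2) P(2) by blast
  obtain bN where bN: "is_ind N bN" using is_ind_exists[OF nn(4)] by blast
  \<comment> \<open>\<open>X\<close> and \<open>N\<close> have the same image in the classes by
    \<open>Y\<close>: both images consist of the pull-backs of \<open>push C f d\<close>, which is
    also \<open>push C n \<epsilon>\<close>.\<close>
  have XN: "\<exists>e'. exte C e' V N \<and> push C n e' = push C f e" if V: "V \<in> T" and e: "exte C e V X" for V e
  proof -
    obtain k where k: "arr C k V Q" "pull C k d = e" using ext_exists_pull[OF P(3) e] T_ext[OF _ V P(1)] by blast
    have "push C n (pull C k \<epsilon>) = push C f e"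
      using push_pull_commute[OF nn(1) N(1) k(1)] N(4) push_pull_commute[OF r(1) f k(1)] k(2) by simp
    then show ?thesis using exte_pull[OF nn(1) k(1)] by blast
  qed
  have NX: "\<exists>e'. exte C e' V X \<and> push C f e' = push C n e" if V: "V \<in> T" and e: "exte C e V N" for V e
  proof -
    obtain k where k: "arr C k V Q" "pull C k \<epsilon> = e" using ext_exists_pull[OF N(2) e] T_ext[OF _ V R(2)] by blast
    have "push C f (pull C k d) = push C n e"
      using push_pull_commute[OF nn(1) N(1) k(1)] N(4) push_pull_commute[OF r(1) f k(1)] k(2) by simp
    then show ?thesis using exte_pull[OF r(1) k(1)] by blast
  qed
  have finj: "e = e'" if "V \<in> T" "exte C e V X" "exte C e' V X" "push C f e = push C f e'" for V e e'
    using inj[OF that(1) exte_diff[OF that(2,3)]] push_diff[OF that(2,3) f] that(4) by simp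
  have ninj': "e = e'" if "V \<in> T" "exte C e V N" "exte C e' V N" "push C n e = push C n e'" for V e e'
    using ninj[OF that(1) exte_diff[OF that(2,3)]] push_diff[OF that(2,3) N(1)] that(4) by simp
  define \<phi> where "\<phi> V e = (SOME e'. exte C e' V N \<and> push C n e' = push C f e)" for V e
  define \<psi> where "\<psi> V e = (SOME e'. exte C e' V X \<and> push C f e' = push C n e)" for V e
  have \<phi>: "exte C (\<phi> V e) V N \<and> push C n (\<phi> V e) = push C f e" if "V \<in> T" "exte C e V X" for V e
    unfolding \<phi>_def using XN[OF that] by (rule someI_ex)
  have \<psi>: "exte C (\<psi> V e) V X \<and> push C f (\<psi> V e) = push C n e" if "V \<in> T" "exte C e V N" for V e
    unfolding \<psi>_def using NX[OF that] by (rule someI_ex)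
  obtain s where s: "arr C s X N" "\<forall>V\<in>T. \<forall>e. exte C e V X \<longrightarrow> \<phi> V e = push C s e"
  proof (atomize_elim, rule ext_functor_full[OF o(1) nn(4)])
    show "exte C (\<phi> V e) V N" if "V \<in> T" "exte C e V X" for V e using \<phi>[OF that] by blast
    show "\<phi> V (pull C h e) = pull C h (\<phi> W e)" if t: "V \<in> T" "W \<in> T" "arr C h V W" "exte C e W X" for V W h e
      using ninj'[OF t(1) _ exte_pull[OF _ t(3)], of "\<phi> V (pull C h e)" "\<phi> W e"]
        \<phi>[OF t(1) exte_pull[OF t(4,3)]] \<phi>[OF t(2,4)]
        push_pull_commute[OF _ N(1) t(3), of "\<phi> W e"] push_pull_commute[OF t(4) f t(3)] by simp
    show "\<phi> V 0 = 0" if V: "V \<in> T" for V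
      using ninj[OF V, of "\<phi> V 0"] \<phi>[OF V exte_zero[OF T_ob[OF V] o(1)]] push_zero[OF T_ob[OF V] f] by simp
  qed
  obtain t where t: "arr C t N X" "\<forall>V\<in>T. \<forall>e. exte C e V N \<longrightarrow> \<psi> V e = push C t e"
  proof (atomize_elim, rule ext_functor_full[OF nn(4) o(1)])
    show "exte C (\<psi> V e) V X" if "V \<in> T" "exte C e V N" for V e using \<psi>[OF that] by blast
    show "\<psi> V (pull C h e) = pull C h (\<psi> W e)" if t: "V \<in> T" "W \<in> T" "arr C h V W" "exte C e W N" for V W h e
      using finj[OF t(1) _ exte_pull[OF _ t(3)], of "\<psi> V (pull C h e)" "\<psi> W e"]
        \<psi>[OF t(1) exte_pull[OF t(4,3)]] \<psi>[OF t(2,4)]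
        push_pull_commute[OF _ f t(3), of "\<psi> W e"] push_pull_commute[OF t(4) N(1) t(3)] by simp
    show "\<psi> V 0 = 0" if V: "V \<in> T" for V
      using inj[OF V, of "\<psi> V 0"] \<psi>[OF V exte_zero[OF T_ob[OF V] nn(4)]] push_zero[OF T_ob[OF V] N(1)] by simp
  qed
  have ts: "push C t (push C s e) = e" if V: "V \<in> T" and e: "exte C e V X" for V e
  proof -
    have 1: "push C s e = \<phi> V e" using s V e by simp
    have 2: "push C t (\<phi> V e) = \<psi> V (\<phi> V e)" using t V \<phi>[OF V e] by simp
    show ?thesis using finj[OF V _ e, of "\<psi> V (\<phi> V e)"] \<psi>[OF V, of "\<phi> V e"] \<phi>[OF V e] 1 2 by simp
  qed
  have tinj: "e = 0" if V: "V \<in> T" and e: "exte C e V N" "push C t e = 0" for V e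
    using ninj[OF V e(1)] \<psi>[OF V e(1)] t V e push_zero[OF T_ob[OF V] f] by simp
  have bN': "is_beta N (frag_of R - frag_of Q - bN)" unfolding is_beta_def using cN bN by blast
  have eq1: "cX - (frag_of R - frag_of Q - bN) \<in> K.Rel"
    by (rule is_beta_iso[OF s(1) t(1) _ _ c(1) bN']) (use ts tinj in blast)+
  obtain bY where bY: "is_ind Y bY" "bY - (bN - frag_of L) \<in> K.Rel"
    using is_ind_deflation[OF N(3) R(1) bN] by blast
  obtain aY where aY: "is_coind Y aY" "aY - (a - frag_of Q) \<in> K.Rel"
    using is_coind_inflation[OF Z P(2) a] by blast
  have "is_beta Y (aY - bY)" unfolding is_beta_def using aY bY by blast
  then have eq2: "cY - (aY - bY) \<in> K.Rel" using is_beta_unique c(2) by blast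
  \<comment> \<open>Modulo relations, coind Y = coind Z - [Q] and ind Y = ind N - [L], while coind N
    = [R] - [Q] and ind Z = [R] - [L]. The auxiliary classes cancel and leave the contribution of
    \<open>N\<close>, which is that of \<open>X\<close>.\<close>
  have eq: "cY - cX - (a - b) = (cY - (aY - bY)) + ((aY - (a - frag_of Q)) - (bY - (bN - frag_of L)))
      - (cX - (frag_of R - frag_of Q - bN))"
    unfolding R(4) by (simp add: algebra_simps)
  have "cY - cX - (a - b) \<in> K.Rel"
    unfolding eq by (intro K.rel_diff K.rel_add eq1 eq2 aY(2) bY(2))
  moreover have "is_beta Z (a - b)" unfolding is_beta_def using a b by blast
  ultimately show ?thesis using surj comp ker z(2) by blast
qed

section \<open>The dimension form\<close>

lemma pull_linear_map:
  assumes "A \<in> Ob C" "arr C c Z' Z"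
  shows "linear_map_on (escal C) (Ext C Z A) (escal C) (Ext C Z' A) (pull C c)"
  using pull_linear assms by (auto simp: arr_def)

sublocale ee: vector_space_pair "escal C" "escal C" ..

lemma pairing_bilinear:
  "X \<in> Ob C \<Longrightarrow> Y \<in> Ob C \<Longrightarrow> bilinear_on (escal C) (Ext C X Y) (escal C) (Ext C Y X) (p X Y)"
  using pairing unfolding ext_pairing_def by blast

lemma pairing_nondegenerate:
  assumes "exte C a X Y" "\<And>b. exte C b Y X \<Longrightarrow> p X Y a b = 0" shows "a = 0"
  using pairing assms unfolding ext_pairing_def exte_def by blast

lemma pairing_pull:
  "arr C f X' X \<Longrightarrow> exte C a X Y \<Longrightarrow> exte C b Y X' \<Longrightarrow> p X' Y (pull C f a) b = p X Y a (push C f b)"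
  using pairing unfolding ext_pairing_def by blast

lemma pairing_push:
  "arr C g Y Y' \<Longrightarrow> exte C a X Y \<Longrightarrow> exte C b Y' X \<Longrightarrow> p X Y' (push C g a) b = p X Y a (pull C g b)"
  using pairing unfolding ext_pairing_def by blast

text \<open>Non-degeneracy in the first argument gives one inequality; exchanging the objects gives
  the other.\<close>

lemma ext_dim_symmetric:
  assumes "X \<in> Ob C" "Y \<in> Ob C" shows "ext.dim (Ext C X Y) = ext.dim (Ext C Y X)"
proof -
  have "ext.dim (Ext C X Y) \<le> ext.dim (Ext C Y X)" if "X \<in> Ob C" "Y \<in> Ob C" for X Y
  proof (rule nondegenerate_dim_le[OF ext_vector_space ext_vector_space _ _ _ _ pairing_bilinear])
    show "v = 0" if "v \<in> Ext C X Y" "\<forall>w\<in>Ext C Y X. p X Y v w = 0" for v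
      using pairing_nondegenerate[of v X Y] that \<open>X \<in> Ob C\<close> \<open>Y \<in> Ob C\<close> by (auto simp: exte_def)
  qed (use that ext_subspace fin_dim_ext in auto)
  then show ?thesis using assms by (simp add: le_antisym)
qed

text \<open>Rank and nullity along Hom(Y,Y), Ext(Q,Y), Ext(P,Y), Ext(Y,Y). The image in the last
  term has half its dimension; the kernel of the middle map is the orbit of \<open>d\<close> under
  endomorphisms and remains as a correction.\<close>

lemma coresolution_dim:
  assumes P: "Real C Y P Q d x y" "P \<in> T" "Q \<in> T"
  shows "2 * int (ext.dim (Ext C P Y)) - 2 * int (ext.dim (Ext C Q Y)) =
     int (ext.dim (Ext C Y Y)) - 2 * int (ext.dim ((\<lambda>f. push C f d) ` Hom C Y Y))"
proof -
  note r = RealD[OF P(1)]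
  have e: "exte C a V W \<longleftrightarrow> a \<in> Ext C V W" if "V \<in> Ob C" "W \<in> Ob C" for a V W
    using that by (simp add: exte_def)
  let ?U = "pull C x ` Ext C P Y"
  have lx: "linear_map_on (escal C) (Ext C P Y) (escal C) (Ext C Y Y) (pull C x)"
    using pull_linear_map[OF r(4,2)] .
  have ly: "linear_map_on (escal C) (Ext C Q Y) (escal C) (Ext C P Y) (pull C y)"
    using pull_linear_map[OF r(4,3)] .
  have sP: "subsp (escal C) (Ext C P Y)" and sQ: "subsp (escal C) (Ext C Q Y)" and sY: "subsp (escal C) (Ext C Y Y)"
    using ext_subspace r by auto
  have "ext.dim (Ext C Q Y) = ext.dim {e\<in>Ext C Q Y. pull C y e = 0} + ext.dim (pull C y ` Ext C Q Y)"
    using ee.rank_nullity[OF ly sQ] fin_dim_ext r by blast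
  moreover have "{e\<in>Ext C Q Y. pull C y e = 0} = (\<lambda>f. push C f d) ` Hom C Y Y"
  proof (intro equalityI subsetI)
    fix a assume "a \<in> {e\<in>Ext C Q Y. pull C y e = 0}"
    then have "exte C a Q Y" "pull C y a = 0" using e[OF r(6,4)] by auto
    then obtain f where "arr C f Y Y" "push C f d = a" using ext_exact_push[OF P(1)] by blast
    then show "a \<in> (\<lambda>f. push C f d) ` Hom C Y Y" by (auto simp: arr_def)
  next
    fix a assume "a \<in> (\<lambda>f. push C f d) ` Hom C Y Y"
    then obtain f where f: "arr C f Y Y" "a = push C f d" using r by (auto simp: arr_def)
    then show "a \<in> {e\<in>Ext C Q Y. pull C y e = 0}"
      using exte_push[OF r(1) f(1)] e[OF r(6,4)] push_pull_commute[OF r(1) f(1) r(3)]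
        real_pull_zero[OF P(1)] push_zero[OF r(5) f(1)] by simp
  qed
  moreover have "ext.dim (Ext C P Y) = ext.dim {e\<in>Ext C P Y. pull C x e = 0} + ext.dim ?U"
    using ee.rank_nullity[OF lx sP] fin_dim_ext r by blast
  moreover have "{e\<in>Ext C P Y. pull C x e = 0} = pull C y ` Ext C Q Y"
  proof (intro equalityI subsetI)
    fix a assume "a \<in> {e\<in>Ext C P Y. pull C x e = 0}"
    then have "exte C a P Y" "pull C x a = 0" using e[OF r(5,4)] by auto
    then obtain f where "exte C f Q Y" "pull C y f = a" using ext_exact_middle_pull[OF P(1)] by blast
    then show "a \<in> pull C y ` Ext C Q Y" by (auto simp: exte_def)
  next
    fix a assume "a \<in> pull C y ` Ext C Q Y"
    then obtain f where f: "exte C f Q Y" "a = pull C y f" using r by (auto simp: exte_def)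
    then show "a \<in> {e\<in>Ext C P Y. pull C x e = 0}"
      using exte_pull[OF f(1) r(3)] e[OF r(5,4)] pull_pull[OF f(1) r(3,2)] real_comp_zero[OF P(1)]
        pull_zero_arr[OF f(1) r(4)] by simp
  qed
  moreover have "ext.dim (Ext C Y Y) = 2 * ext.dim ?U"
  proof (rule self_annihilator_dim[OF ext_vector_space sY fin_dim_ext[OF r(4,4)] pairing_bilinear[OF r(4,4)]])
    show "v = 0" if "v \<in> Ext C Y Y" "\<forall>w\<in>Ext C Y Y. p Y Y v w = 0" for v
      using pairing_nondegenerate[of v Y Y] that r by (auto simp: exte_def)
    show "subsp (escal C) ?U" using ee.lin_image_subspace[OF lx sP] .
    \<comment> \<open>An element of \<open>?U\<close> becomes 0 when pushed along \<open>x\<close>,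
      since Ext(P,P) = 0, and by adjunction it then kills \<open>?U\<close>. Conversely, an element
      that kills \<open>?U\<close> becomes 0 along \<open>x\<close>, so it is the pull-back of
      \<open>d\<close> along some \<open>h\<close>; as Ext(Q,Q) = 0, this \<open>h\<close> extends
      over \<open>P\<close>, which puts the element into \<open>?U\<close>.\<close>
    show "?U = {v\<in>Ext C Y Y. \<forall>w\<in>?U. p Y Y v w = 0}"
    proof (intro equalityI subsetI)
      fix v assume "v \<in> ?U"
      then obtain a where a: "exte C a P Y" "v = pull C x a" using r by (auto simp: exte_def)
      have v: "exte C v Y Y" using exte_pull[OF a(1) r(2)] a by simp
      have "push C x v = pull C x (push C x a)" using push_pull_commute[OF a(1) r(2,2)] a by simp
      also have "\<dots> = 0" using T_ext[OF exte_push[OF a(1) r(2)] P(2,2)] pull_zero[OF r(5,2)] by simp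
      finally have z: "push C x v = 0" .
      have "p Y Y v w = 0" if "w \<in> ?U" for w
      proof -
        obtain b where b: "exte C b P Y" "w = pull C x b" using \<open>w \<in> ?U\<close> r by (auto simp: exte_def)
        have z0: "p Y P 0 b = 0"
        proof -
          have "linear_map_on (escal C) (Ext C Y P) (*) UNIV (\<lambda>v. p Y P v b)"
            using pairing_bilinear[OF r(4,5)] b by (auto simp: bilinear_on_def exte_def)
          then show ?thesis
            using vector_space_pair.lin_zero[of "escal C" "(*)"] ext_subspace[OF r(4,5)] ext_vector_space vector_space_field
            by (auto simp: vector_space_pair_def)
        qed
        show ?thesis using pairing_push[OF r(2) v b(1)] z z0 b by simp
      qed
      then show "v \<in> {v\<in>Ext C Y Y. \<forall>w\<in>?U. p Y Y v w = 0}" using v by (simp add: exte_def)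
    next
      fix v assume "v \<in> {v\<in>Ext C Y Y. \<forall>w\<in>?U. p Y Y v w = 0}"
      then have v: "exte C v Y Y" "\<forall>w\<in>?U. p Y Y v w = 0" using r by (auto simp: exte_def)
      have "push C x v = 0"
      proof (rule pairing_nondegenerate[OF exte_push[OF v(1) r(2)]])
        fix b assume b: "exte C b P Y"
        then show "p Y P (push C x v) b = 0" using pairing_push[OF r(2) v(1) b] v(2) by (auto simp: exte_def)
      qed
      then obtain h where h: "arr C h Y Q" "pull C h d = v" using ext_exact_pull[OF P(1) v(1)] by blast
      have "push C h d = 0" using T_ext[OF exte_push[OF r(1) h(1)] P(3,3)] .
      then obtain k where k: "arr C k P Q" "k \<cdot> x = h" using factor_inflation[OF P(1) h(1)] by blast
      have "v = pull C x (pull C k d)" using pull_pull[OF r(1) k(1) r(2)] k h by simp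
      then show "v \<in> ?U" using exte_pull[OF r(1) k(1)] by (auto simp: exte_def)
    qed
  qed
  ultimately show ?thesis by simp
qed

text \<open>The coresolution formula in the opposite category computes Ext(Y,R) and Ext(Y,K);
  symmetry of dimensions turns them round, so that both formulas concern the same functor.\<close>

lemma resolution_dim:
  assumes R: "Real C K R Y d x y" "K \<in> T" "R \<in> T"
  shows "2 * int (ext.dim (Ext C R Y)) - 2 * int (ext.dim (Ext C K Y)) =
     int (ext.dim (Ext C Y Y)) - 2 * int (ext.dim ((\<lambda>f. pull C f d) ` Hom C Y Y))"
proof -
  interpret op: ct_category "opp C" "\<lambda>X Y a b. p Y X a b" T by (rule opp_ct)
  show ?thesis
    using op.coresolution_dim[of Y R K d y x] R ext_dim_symmetric[of R Y] ext_dim_symmetric[of K Y] T_ob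
      RealD[OF R(1)] by simp
qed

text \<open>The dimension vector of E Y takes the same value on the coindex and on the index of
  \<open>Y\<close>. The two formulas differ only in the ranks of the orbit maps of \<open>e\<close>
  and \<open>d\<close> on endomorphisms of \<open>Y\<close>. An endomorphism killed by either map
  factors through an object of \<open>T\<close>, and the vanishing of extensions within
  \<open>T\<close> then makes the other map kill it too.\<close>

lemma dim_form_alternating:
  assumes R: "Real C K R Y d x y" "K \<in> T" "R \<in> T" and P: "Real C Y P Q e u v" "P \<in> T" "Q \<in> T"
  shows "int (ext.dim (Ext C P Y)) - int (ext.dim (Ext C Q Y)) =
    int (ext.dim (Ext C R Y)) - int (ext.dim (Ext C K Y))"
proof -
  note r = RealD[OF R(1)] and q = RealD[OF P(1)]
  have sub: "subsp (scal C) (Hom C Y Y)" using hom_subspace q by blast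
  have l1: "linear_map_on (scal C) (Hom C Y Y) (escal C) (Ext C Q Y) (\<lambda>f. push C f e)"
    using push_linear_arrow q by (simp add: exte_def)
  have l2: "linear_map_on (scal C) (Hom C Y Y) (escal C) (Ext C Y K) (\<lambda>f. pull C f d)"
    using pull_linear_arrow r by (simp add: exte_def)
  interpret he: vector_space_pair "scal C" "escal C" ..
  have f1: "fin_dim (escal C) ((\<lambda>f. push C f e) ` Hom C Y Y)"
    using ext.fin_dim_subspace(1)[OF he.lin_image_subspace[OF l1 sub] _ ext_subspace fin_dim_ext, of Q Y]
      linear_map_onD(1)[OF l1] q by blast
  have f2: "fin_dim (escal C) ((\<lambda>f. pull C f d) ` Hom C Y Y)"
    using ext.fin_dim_subspace(1)[OF he.lin_image_subspace[OF l2 sub] _ ext_subspace fin_dim_ext, of Y K]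
      linear_map_onD(1)[OF l2] r by blast
  have 1: "push C f e = 0" if ff: "f \<in> Hom C Y Y" "pull C f d = 0" for f
  proof -
    have f: "arr C f Y Y" using ff q by (simp add: arr_def)
    obtain g where g: "arr C g Y R" "y \<cdot> g = f" using factor_deflation[OF R(1) f ff(2)] by blast
    have "push C g e = 0" using T_ext[OF exte_push[OF q(1) g(1)] P(3) R(3)] .
    then show ?thesis using push_push[OF q(1) g(1) r(3)] g(2) push_zero[OF q(6) r(3)] by simp
  qed
  have 2: "pull C f d = 0" if ff: "f \<in> Hom C Y Y" "push C f e = 0" for f
  proof -
    have f: "arr C f Y Y" using ff q by (simp add: arr_def)
    obtain g where g: "arr C g P Y" "g \<cdot> u = f" using factor_inflation[OF P(1) f ff(2)] by blast
    have "pull C g d = 0" using T_ext[OF exte_pull[OF r(1) g(1)] P(2) R(2)] .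
    then show ?thesis using pull_pull[OF r(1) g(1) q(2)] g(2) pull_zero[OF r(4) q(2)] by simp
  qed
  have "ext.dim ((\<lambda>f. push C f e) ` Hom C Y Y) = ext.dim ((\<lambda>f. pull C f d) ` Hom C Y Y)"
    using dim_image_le_of_kernel[OF hom_vector_space ext_vector_space ext_vector_space sub l1 l2 f1 f2 1]
      dim_image_le_of_kernel[OF hom_vector_space ext_vector_space ext_vector_space sub l2 l1 f2 f1 2] by simp
  then show ?thesis using coresolution_dim[OF P] resolution_dim[OF R] by linarith
qed

end

section \<open>Krull--Schmidt decompositions\<close>

context additive_category
begin

abbreviation "local_ob X \<equiv> X \<in> Ob C \<and> local_endomorphism_ring C X"

abbreviation "nonunit X f \<equiv> arr C f X X \<and> \<not> is_iso C X X f"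

lemma iso_inverse:
  assumes "is_iso C X Y f" "X \<in> Ob C" "Y \<in> Ob C"
  obtains g where "arr C f X Y" "arr C g Y X" "g \<cdot> f = idm C X" "f \<cdot> g = idm C Y" "is_iso C Y X g"
  using is_isoD[OF assms] is_isoI by metis

lemma isomorphic_refl: "X \<in> Ob C \<Longrightarrow> isomorphic C X X"
  unfolding isomorphic_def using iso_id by blast

lemma isomorphic_sym: "isomorphic C X Y \<Longrightarrow> X \<in> Ob C \<Longrightarrow> Y \<in> Ob C \<Longrightarrow> isomorphic C Y X"
  unfolding isomorphic_def using iso_inverse by metis

text \<open>\<open>s \<cdot> r\<close> is idempotent. In a local ring it or its complement is
  invertible, so it is the identity or 0, and 0 would make \<open>X\<close> zero.\<close>

lemma split_mono_local:
  assumes s: "arr C s X Y" and r: "arr C r Y X" and e: "r \<cdot> s = idm C X" and X: "idm C X \<noteq> 0"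
    and Y: "local_endomorphism_ring C Y"
  shows "is_iso C X Y s"
proof -
  have o: "X \<in> Ob C" "Y \<in> Ob C" using arr_ob s by auto
  have sr: "arr C (s \<cdot> r) Y Y" using arr_comp[OF r s] .
  have srs: "(s \<cdot> r) \<cdot> s = s" using assoc[OF s r s] e id_right[OF s] by simp
  have srsr: "(s \<cdot> r) \<cdot> (s \<cdot> r) = s \<cdot> r" using assoc[OF r s sr] srs by simp
  have "is_iso C Y Y (s \<cdot> r) \<or> is_iso C Y Y (idm C Y - s \<cdot> r)"
    using Y sr unfolding local_endomorphism_ring_def arr_def by blast
  then show ?thesis
  proof
    assume "is_iso C Y Y (s \<cdot> r)"
    then obtain g where g: "arr C g Y Y" "g \<cdot> (s \<cdot> r) = idm C Y" using iso_inverse o by metis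
    have "s \<cdot> r = (g \<cdot> (s \<cdot> r)) \<cdot> (s \<cdot> r)" using g id_left[OF sr] by simp
    also have "\<dots> = idm C Y" using assoc[OF sr sr g(1)] srsr g by simp
    finally show ?thesis using is_isoI[OF s r e] by blast
  next
    assume "is_iso C Y Y (idm C Y - s \<cdot> r)"
    then obtain g where g: "arr C g Y Y" "g \<cdot> (idm C Y - s \<cdot> r) = idm C Y" using iso_inverse o by metis
    have d: "arr C (idm C Y - s \<cdot> r) Y Y" using arr_diff[OF arr_id[OF o(2)] sr] .
    have "(idm C Y - s \<cdot> r) \<cdot> s = 0" using comp_diff_left[OF s arr_id[OF o(2)] sr] srs id_left[OF s] by simp
    then have "s = 0" using assoc[OF s d g(1)] g id_left[OF s] comp_zero_right[OF o(1) g(1)] by simp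
    then show ?thesis using e X comp_zero_right[OF o(1) r] by simp
  qed
qed

text \<open>Between objects with local endomorphism rings, a composite through \<open>Y\<close> can
  be invertible only if the first map is. This makes the non-units an ideal.\<close>

lemma split_mono_nonlocal:
  assumes s: "arr C s X Y" and r: "arr C r Y X" and e: "is_iso C X X (r \<cdot> s)" and X: "local_ob X"
    and Y: "local_endomorphism_ring C Y"
  shows "is_iso C X Y s"
proof -
  obtain g where g: "arr C g X X" "g \<cdot> (r \<cdot> s) = idm C X" using iso_inverse[OF e] X by metis
  have "(g \<cdot> r) \<cdot> s = idm C X" using assoc[OF s r g(1)] g by simp
  then show ?thesis
    using split_mono_local[OF s arr_comp[OF r g(1)] _ _ Y] X unfolding local_endomorphism_ring_def by blast
qed

lemma nonunit_comp_left: "nonunit X f \<Longrightarrow> arr C g X X \<Longrightarrow> local_ob X \<Longrightarrow> nonunit X (g \<cdot> f)"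
  using split_mono_nonlocal arr_comp by metis

lemma nonunit_comp_right:
  assumes f: "nonunit X f" and g: "arr C g X X" and X: "local_ob X" shows "nonunit X (f \<cdot> g)"
proof (rule conjI[OF arr_comp], rule g, use f in blast, rule notI)
  assume u: "is_iso C X X (f \<cdot> g)"
  have af: "arr C f X X" using f by blast
  have "is_iso C X X g" using split_mono_nonlocal[OF g af u X] X by blast
  then obtain h where h: "arr C h X X" "h \<cdot> g = idm C X" "g \<cdot> h = idm C X" "is_iso C X X h"
    using iso_inverse X by metis
  have "(f \<cdot> g) \<cdot> h = f" using assoc[OF h(1) g af] h id_right[OF af] by simp
  moreover have "is_iso C X X ((f \<cdot> g) \<cdot> h)" using iso_comp[OF h(4) u] X by blast
  ultimately show False using f by simp
qed

lemma nonunit_add: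
  assumes f: "nonunit X f" and g: "nonunit X g" and X: "local_ob X" shows "nonunit X (f + g)"
proof (intro conjI notI)
  show fg: "arr C (f + g) X X" using arr_add f g by blast
  assume "is_iso C X X (f + g)"
  then obtain u where u: "arr C u X X" "u \<cdot> (f + g) = idm C X" "is_iso C X X u" using iso_inverse X by metis
  have uf: "nonunit X (u \<cdot> f)" "nonunit X (u \<cdot> g)" using nonunit_comp_left f g u X by blast+
  have "u \<cdot> f + u \<cdot> g = idm C X" using comp_add_right[of f X X g u X] f g u by simp
  then have "u \<cdot> g = idm C X - u \<cdot> f" by (simp add: algebra_simps)
  then show False using uf X unfolding local_endomorphism_ring_def arr_def by metis
qed

lemma nonunit_neg: "nonunit X f \<Longrightarrow> local_ob X \<Longrightarrow> nonunit X (- f)"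
  using nonunit_comp_left[where X = X and f = f and g = "- idm C X"] arr_neg[OF arr_id] comp_neg_left[of f X X "idm C X" X] arr_id id_left
  by force

lemma nonunit_diff: "nonunit X f \<Longrightarrow> nonunit X g \<Longrightarrow> local_ob X \<Longrightarrow> nonunit X (f - g)"
  using nonunit_add[where X = X and f = f and g = "- g"] nonunit_neg by force

lemma nonunit_zero: "local_ob X \<Longrightarrow> nonunit X 0"
proof (intro conjI notI)
  assume X: "local_ob X"
  show z: "arr C 0 X X" using X arr_zero by blast
  assume "is_iso C X X 0"
  then obtain g where "arr C g X X" "g \<cdot> 0 = idm C X" using iso_inverse X by metis
  then show False using X comp_zero_right unfolding local_endomorphism_ring_def by metis
qed

lemma nonunit_sum: "local_ob X \<Longrightarrow> (\<And>i. i \<in> A \<Longrightarrow> nonunit X (f i)) \<Longrightarrow> nonunit X (sum f A)"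
proof (induction A rule: infinite_finite_induct)
  case (insert x F)
  have "nonunit X (f x)" "nonunit X (sum f F)" using insert by blast+
  then show ?case using nonunit_add insert by simp
qed (use nonunit_zero in auto)

lemma id_not_nonunit: "X \<in> Ob C \<Longrightarrow> \<not> nonunit X (idm C X)"
  using iso_id by blast

text \<open>Gaussian elimination modulo the radical of a local endomorphism ring.\<close>

lemma elimination:
  assumes X: "local_ob X" and "finite A" "finite B"
    and "\<And>i j. i \<in> A \<Longrightarrow> j \<in> B \<Longrightarrow> arr C (P i j) X X \<and> arr C (Q j i) X X"
    and "\<And>i i'. i \<in> A \<Longrightarrow> i' \<in> A \<Longrightarrow> nonunit X ((\<Sum>j\<in>B. P i j \<cdot> Q j i') - (if i = i' then idm C X else 0))"
  shows "card A \<le> card B"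
  using assms(2-5)
proof (induction "card B" arbitrary: A B P Q rule: less_induct)
  case (less B A P Q)
  have oX: "X \<in> Ob C" using X by blast
  show ?case
  proof (cases "A = {}")
    case False
    then obtain i0 where i0: "i0 \<in> A" by blast
    \<comment> \<open>A pivot: if all entries of row \<open>i0\<close> were non-units, so would be
      the diagonal entry of the product, which is the identity up to a non-unit.\<close>
    have "\<exists>j0\<in>B. is_iso C X X (P i0 j0)"
    proof (rule ccontr)
      assume ni: "\<not> ?thesis"
      have "nonunit X (P i0 j \<cdot> Q j i0)" if j: "j \<in> B" for j
        by (rule nonunit_comp_right[OF _ _ X]) (use ni less.prems(3)[OF i0 j] j in auto)
      then have "nonunit X (\<Sum>j\<in>B. P i0 j \<cdot> Q j i0)" by (rule nonunit_sum[OF X])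
      then have "nonunit X ((\<Sum>j\<in>B. P i0 j \<cdot> Q j i0) - ((\<Sum>j\<in>B. P i0 j \<cdot> Q j i0) - idm C X))"
        by (rule nonunit_diff[OF _ _ X]) (use less.prems(4)[OF i0 i0] in simp)
      then show False using id_not_nonunit oX by simp
    qed
    then obtain j0 where j0: "j0 \<in> B" "is_iso C X X (P i0 j0)" by blast
    obtain u where u: "arr C u X X" "u \<cdot> P i0 j0 = idm C X" using iso_inverse[OF j0(2)] oX by metis
    \<comment> \<open>Column \<open>j0\<close> of \<open>P\<close> is cleared by subtracting
      multiples of row \<open>i0\<close>, while \<open>Q\<close> is kept; then \<open>j0\<close>
      contributes nothing any more. The product changes by multiples of its own row
      \<open>i0\<close>, whose entries off the diagonal are non-units, so what remains is still the
      identity modulo the radical.\<close>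
    define P' where "P' i j = P i j - (P i j0 \<cdot> u) \<cdot> P i0 j" for i j
    have aP: "arr C (P i j) X X" "arr C (Q j i) X X" if "i \<in> A" "j \<in> B" for i j using less.prems(3) that by blast+
    have aPu: "arr C (P i j0 \<cdot> u) X X" if "i \<in> A" for i using arr_comp[OF u(1) aP(1)] that j0 by blast
    have aP': "arr C (P' i j) X X" if "i \<in> A" "j \<in> B" for i j
      unfolding P'_def using arr_diff[OF aP(1)[OF that] arr_comp[OF aP(1)[OF i0 that(2)] aPu[OF that(1)]]] .
    have "card (A - {i0}) \<le> card (B - {j0})"
    proof (rule less.hyps)
      show "card (B - {j0}) < card B" by (rule card_Diff1_less[OF less.prems(2) j0(1)])
      show "finite (A - {i0})" "finite (B - {j0})" using less.prems by auto
      show "arr C (P' i j) X X \<and> arr C (Q j i) X X" if "i \<in> A - {i0}" "j \<in> B - {j0}" for i j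
        using aP aP' that by blast
      fix i i' assume i: "i \<in> A - {i0}" "i' \<in> A - {i0}"
      then have iA: "i \<in> A" "i' \<in> A" by auto
      have "P' i j0 = 0" unfolding P'_def
        using assoc[OF aP(1)[OF i0 j0(1)] u(1) aP(1)[OF iA(1) j0(1)]] u(2) id_right[OF aP(1)[OF iA(1) j0(1)]] by simp
      then have "P' i j0 \<cdot> Q j0 i' = 0" using comp_zero_left[OF oX aP(2)[OF iA(2) j0(1)]] by simp
      then have "(\<Sum>j\<in>B - {j0}. P' i j \<cdot> Q j i') = (\<Sum>j\<in>B. P' i j \<cdot> Q j i')"
        using less.prems(2) j0(1) by (simp add: sum.remove[of B j0])
      also have "\<dots> = (\<Sum>j\<in>B. P i j \<cdot> Q j i' - (P i j0 \<cdot> u) \<cdot> (P i0 j \<cdot> Q j i'))"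
      proof (rule sum.cong[OF refl])
        fix j assume j: "j \<in> B"
        show "P' i j \<cdot> Q j i' = P i j \<cdot> Q j i' - (P i j0 \<cdot> u) \<cdot> (P i0 j \<cdot> Q j i')"
          unfolding P'_def
          using comp_diff_left[OF aP(2)[OF iA(2) j] aP(1)[OF iA(1) j] arr_comp[OF aP(1)[OF i0 j] aPu[OF iA(1)]]]
            assoc[OF aP(2)[OF iA(2) j] aP(1)[OF i0 j] aPu[OF iA(1)]] by simp
      qed
      also have "\<dots> = (\<Sum>j\<in>B. P i j \<cdot> Q j i') - (P i j0 \<cdot> u) \<cdot> (\<Sum>j\<in>B. P i0 j \<cdot> Q j i')"
        using comp_sum_right[OF oX aPu[OF iA(1)], of B "\<lambda>j. P i0 j \<cdot> Q j i'"]
          arr_comp[OF aP(2)[OF iA(2)] aP(1)[OF i0]] by (simp add: sum_subtractf)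
      finally have eq: "(\<Sum>j\<in>B - {j0}. P' i j \<cdot> Q j i') - (if i = i' then idm C X else 0) =
          ((\<Sum>j\<in>B. P i j \<cdot> Q j i') - (if i = i' then idm C X else 0)) - (P i j0 \<cdot> u) \<cdot> (\<Sum>j\<in>B. P i0 j \<cdot> Q j i')"
        by simp
      have ns: "nonunit X (\<Sum>j\<in>B. P i0 j \<cdot> Q j i')"
        using less.prems(4)[OF i0 iA(2)] i by (auto split: if_splits)
      show "nonunit X ((\<Sum>j\<in>B - {j0}. P' i j \<cdot> Q j i') - (if i = i' then idm C X else 0))"
        unfolding eq by (rule nonunit_diff[OF less.prems(4)[OF iA] nonunit_comp_left[OF ns aPu[OF iA(1)] X] X])
    qed
    moreover have "card B > 0" using j0 less.prems(2) by (auto simp: card_gt_0_iff)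
    ultimately show ?thesis using i0 j0 less.prems(1,2) by (simp add: card_Diff_singleton)
  qed simp
qed

text \<open>The copies of \<open>U\<close> among \<open>Xs\<close> give maps into and out of
  \<open>Z\<close> whose matrix of composites is the identity. Inserting the decomposition along
  \<open>Ys\<close> writes it as a product; summands not isomorphic to \<open>U\<close> contribute
  non-units only, so the elimination lemma applies to the remaining ones.\<close>

lemma multiplicity_le:
  assumes X: "direct_sum_via C Xs Z \<iota> \<pi>" and Y: "direct_sum_via C Ys Z \<iota>' \<pi>'"
    and lY: "\<forall>Y\<in>set Ys. local_endomorphism_ring C Y" and U: "local_ob U"
  shows "card {i. i < length Xs \<and> isomorphic C (Xs ! i) U} \<le> card {j. j < length Ys \<and> isomorphic C (Ys ! j) U}"
    (is "card ?A \<le> card ?B")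
proof -
  note x = direct_sum_viaD[OF X] and y = direct_sum_viaD[OF Y]
  have oU: "U \<in> Ob C" using U by blast
  have "\<forall>i\<in>?A. \<exists>a b. arr C a U (Xs ! i) \<and> arr C b (Xs ! i) U \<and> b \<cdot> a = idm C U"
  proof
    fix i assume i: "i \<in> ?A"
    then obtain f where f: "is_iso C (Xs ! i) U f" unfolding isomorphic_def by blast
    obtain g where "arr C f (Xs ! i) U" "arr C g U (Xs ! i)" "f \<cdot> g = idm C U"
      using iso_inverse[OF f x(2) oU] i by blast
    then show "\<exists>a b. arr C a U (Xs ! i) \<and> arr C b (Xs ! i) U \<and> b \<cdot> a = idm C U" by blast
  qed
  then obtain a b where ab: "\<And>i. i \<in> ?A \<Longrightarrow> arr C (a i) U (Xs ! i) \<and> arr C (b i) (Xs ! i) U \<and> b i \<cdot> a i = idm C U"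
    by metis
  have "\<forall>j\<in>?B. \<exists>c d. arr C c U (Ys ! j) \<and> arr C d (Ys ! j) U \<and> c \<cdot> d = idm C (Ys ! j)"
  proof
    fix i assume i: "i \<in> ?B"
    then obtain f where f: "is_iso C (Ys ! i) U f" unfolding isomorphic_def by blast
    obtain g where "arr C f (Ys ! i) U" "arr C g U (Ys ! i)" "g \<cdot> f = idm C (Ys ! i)"
      using iso_inverse[OF f y(2) oU] i by blast
    then show "\<exists>c d. arr C c U (Ys ! i) \<and> arr C d (Ys ! i) U \<and> c \<cdot> d = idm C (Ys ! i)" by blast
  qed
  then obtain c d where cd: "\<And>j. j \<in> ?B \<Longrightarrow> arr C (c j) U (Ys ! j) \<and> arr C (d j) (Ys ! j) U \<and> c j \<cdot> d j = idm C (Ys ! j)"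
    by metis
  define l where "l i = b i \<cdot> \<pi> i" for i
  define r where "r i = \<iota> i \<cdot> a i" for i
  have l: "arr C (l i) Z U" and r: "arr C (r i) U Z" if "i \<in> ?A" for i
    unfolding l_def r_def using arr_comp ab[OF that] x(3,4) that by blast+
  have lr: "l i \<cdot> r i' = (if i = i' then idm C U else 0)" if "i \<in> ?A" "i' \<in> ?A" for i i'
  proof -
    have "l i \<cdot> r i' = b i \<cdot> ((\<pi> i \<cdot> \<iota> i') \<cdot> a i')"
      unfolding l_def r_def
      using assoc[OF arr_comp[of "a i'" U "Xs ! i'" "\<iota> i'" Z] x(4)[of i], of "b i" U] assoc[of "a i'" U "Xs ! i'" "\<iota> i'" Z "\<pi> i" "Xs ! i"]
        ab that x(3,4) by auto
    then show ?thesis using x(5)[of i i'] that ab[OF that(1)] ab[OF that(2)] id_left comp_zero_left[OF x(2)]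
        comp_zero_right[OF oU] by auto
  qed
  show ?thesis
  proof (rule elimination[OF U, of ?A ?B "\<lambda>i j. (l i \<cdot> \<iota>' j) \<cdot> c j" "\<lambda>j i. d j \<cdot> (\<pi>' j \<cdot> r i)"])
    show "arr C ((l i \<cdot> \<iota>' j) \<cdot> c j) U U \<and> arr C (d j \<cdot> (\<pi>' j \<cdot> r i)) U U" if "i \<in> ?A" "j \<in> ?B" for i j
      using arr_comp cd[OF that(2)] l[OF that(1)] r[OF that(1)] y(3,4)[of j] that by blast
    fix i i' assume i: "i \<in> ?A" "i' \<in> ?A"
    have li: "arr C (l i \<cdot> \<iota>' j) (Ys ! j) U" and ri: "arr C (\<pi>' j \<cdot> r i') U (Ys ! j)" if "j < length Ys" for j
      using arr_comp[OF y(3)[OF that] l[OF i(1)]] arr_comp[OF r[OF i(2)] y(4)[OF that]] by auto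
    let ?t = "\<lambda>j. (l i \<cdot> \<iota>' j) \<cdot> (\<pi>' j \<cdot> r i')"
    have "((l i \<cdot> \<iota>' j) \<cdot> c j) \<cdot> (d j \<cdot> (\<pi>' j \<cdot> r i')) = ?t j" if j: "j \<in> ?B" for j
    proof -
      have jl: "j < length Ys" using j by blast
      have c: "arr C (c j) U (Ys ! j)" and d: "arr C (d j) (Ys ! j) U" and e: "c j \<cdot> d j = idm C (Ys ! j)"
        using cd[OF j] by auto
      show ?thesis
        using assoc[OF arr_comp[OF ri[OF jl] d] c li[OF jl]] assoc[OF ri[OF jl] d c] e id_left[OF ri[OF jl]] by simp
    qed
    then have "(\<Sum>j\<in>?B. ((l i \<cdot> \<iota>' j) \<cdot> c j) \<cdot> (d j \<cdot> (\<pi>' j \<cdot> r i'))) = (\<Sum>j\<in>?B. ?t j)"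
      by (intro sum.cong) auto
    moreover have "(\<Sum>j<length Ys. ?t j) = l i \<cdot> r i'"
    proof -
      have "l i = (\<Sum>j<length Ys. (l i \<cdot> \<iota>' j) \<cdot> \<pi>' j)" using direct_sum_decompose[OF Y l[OF i(1)]] .
      then have "l i \<cdot> r i' = (\<Sum>j<length Ys. ((l i \<cdot> \<iota>' j) \<cdot> \<pi>' j) \<cdot> r i')"
        using comp_sum_left[OF oU r[OF i(2)], of "{..<length Ys}" "\<lambda>j. (l i \<cdot> \<iota>' j) \<cdot> \<pi>' j"]
          arr_comp[OF y(4) li] by simp
      also have "\<dots> = (\<Sum>j<length Ys. ?t j)" using assoc[OF r[OF i(2)] y(4) li] by (intro sum.cong) auto
      finally show ?thesis by simp
    qed
    moreover have "(\<Sum>j<length Ys. ?t j) = (\<Sum>j\<in>?B. ?t j) + (\<Sum>j\<in>{..<length Ys} - ?B. ?t j)"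
      using sum.subset_diff[of ?B "{..<length Ys}" ?t] by (simp add: add.commute subset_iff)
    moreover have "nonunit U (\<Sum>j\<in>{..<length Ys} - ?B. ?t j)"
    proof (rule nonunit_sum[OF U])
      fix j assume j: "j \<in> {..<length Ys} - ?B"
      then have jl: "j < length Ys" and ni: "\<not> isomorphic C (Ys ! j) U" by auto
      have "\<not> is_iso C U U (?t j)"
      proof
        assume "is_iso C U U (?t j)"
        then have "is_iso C U (Ys ! j) (\<pi>' j \<cdot> r i')"
          using split_mono_nonlocal[OF ri[OF jl] li[OF jl] _ U] lY jl by simp
        then show False using ni isomorphic_sym[of U "Ys ! j"] oU y(2)[OF jl] unfolding isomorphic_def by blast
      qed
      then show "nonunit U (?t j)" using arr_comp[OF ri[OF jl] li[OF jl]] by blast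
    qed
    moreover have "s = s' \<Longrightarrow> t = w \<Longrightarrow> t = s' + v \<Longrightarrow> nonunit U v \<Longrightarrow> nonunit U (s - w)" for s s' t v w
      using nonunit_neg[OF _ U, of v] by (metis add_diff_cancel_left' minus_diff_eq)
    ultimately show "nonunit U ((\<Sum>j\<in>?B. ((l i \<cdot> \<iota>' j) \<cdot> c j) \<cdot> (d j \<cdot> (\<pi>' j \<cdot> r i'))) - (if i = i' then idm C U else 0))"
      unfolding lr[OF i] by blast
  qed auto
qed

lemma direct_sum_append:
  assumes S: "biprod C A B S i j p q" and X: "direct_sum_via C Xs A \<iota> \<pi>" and Y: "direct_sum_via C Ys B \<iota>' \<pi>'"
  shows "direct_sum C (Xs @ Ys) S"
proof -
  note s = biprodD[OF S] and x = direct_sum_viaD[OF X] and y = direct_sum_viaD[OF Y]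
  define n where "n = length Xs"
  define m where "m = length Ys"
  define k where "k l = (if l < n then i \<cdot> \<iota> l else j \<cdot> \<iota>' (l - n))" for l
  define r where "r l = (if l < n then \<pi> l \<cdot> p else \<pi>' (l - n) \<cdot> q)" for l
  have nth: "(Xs @ Ys) ! l = (if l < n then Xs ! l else Ys ! (l - n))" for l by (simp add: nth_append n_def)
  have "direct_sum_via C (Xs @ Ys) S k r"
    unfolding direct_sum_via_def
  proof (intro conjI allI impI)
    show "set (Xs @ Ys) \<subseteq> Ob C" using X Y by (auto simp: direct_sum_via_def)
    show "S \<in> Ob C" using s by blast
    fix l assume l: "l < length (Xs @ Ys)"
    have kl: "arr C (k l) ((Xs @ Ys) ! l) S" and rl: "arr C (r l) S ((Xs @ Ys) ! l)"
      using l arr_comp[OF x(3) s(1)] arr_comp[OF y(3) s(2)] arr_comp[OF s(3) x(4)] arr_comp[OF s(4) y(4)]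
      unfolding k_def r_def nth by (auto simp: n_def)
    then show "k l \<in> Hom C ((Xs @ Ys) ! l) S" "r l \<in> Hom C S ((Xs @ Ys) ! l)" by (auto simp: arr_def)
    fix l' assume l': "l' < length (Xs @ Ys)"
    have mid: "(f \<cdot> u) \<cdot> (v \<cdot> g) = f \<cdot> ((u \<cdot> v) \<cdot> g)"
      if "arr C g W D" "arr C v D S" "arr C u S E" "arr C f E G" for f g u v W D E G
      using assoc[OF arr_comp[OF that(1,2)] that(3,4)] assoc[OF that(1,2,3)] by simp
    show "r l \<cdot> k l' = (if l = l' then idm C ((Xs @ Ys) ! l) else 0)"
    proof (cases "l < n"; cases "l' < n")
      assume h: "l < n" "l' < n"
      then show ?thesis
        using mid[OF x(3) s(1) s(3) x(4), of l' l] s(5) id_left[OF x(3)] x(5) unfolding k_def r_def nth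
        by (simp add: n_def)
    next
      assume h: "l < n" "\<not> l' < n"
      have h2: "l' - n < length Ys" using l' h by (simp add: n_def)
      have "r l \<cdot> k l' = \<pi> l \<cdot> (0 \<cdot> \<iota>' (l' - n))"
        using mid[OF y(3)[OF h2] s(2) s(3) x(4), of l] s(7) h unfolding k_def r_def by (simp add: n_def)
      then show ?thesis using h comp_zero_left[OF s(10) y(3)[OF h2]] comp_zero_right[OF y(2)[OF h2] x(4), of l]
        by (auto simp: n_def)
    next
      assume h: "\<not> l < n" "l' < n"
      have h2: "l - n < length Ys" using l h by (simp add: n_def)
      have "r l \<cdot> k l' = \<pi>' (l - n) \<cdot> (0 \<cdot> \<iota> l')"
        using mid[OF x(3) s(1) s(4) y(4)[OF h2], of l'] s(8) h unfolding k_def r_def by (simp add: n_def)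
      then show ?thesis using h comp_zero_left[OF s(11) x(3), of l'] comp_zero_right[OF x(2) y(4)[OF h2], of l']
        by (auto simp: n_def)
    next
      assume h: "\<not> l < n" "\<not> l' < n"
      have h2: "l - n < length Ys" "l' - n < length Ys" using l l' h by (simp_all add: n_def)
      then show ?thesis
        using mid[OF y(3)[OF h2(2)] s(2) s(4) y(4)[OF h2(1)]] s(6) id_left[OF y(3)[OF h2(2)]] y(5)[OF h2] h
        unfolding k_def r_def nth by auto
    qed
  next
    have e1: "(\<Sum>l<n. (i \<cdot> \<iota> l) \<cdot> (\<pi> l \<cdot> p)) = i \<cdot> p"
    proof -
      have "(\<Sum>l<n. (i \<cdot> \<iota> l) \<cdot> (\<pi> l \<cdot> p)) = (\<Sum>l<n. ((i \<cdot> \<iota> l) \<cdot> \<pi> l) \<cdot> p)"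
        using assoc[OF s(3) x(4) arr_comp[OF x(3) s(1)]] by (intro sum.cong) (auto simp: n_def)
      also have "\<dots> = (\<Sum>l<n. (i \<cdot> \<iota> l) \<cdot> \<pi> l) \<cdot> p"
        using comp_sum_left[OF s(12) s(3), of "{..<n}" "\<lambda>l. (i \<cdot> \<iota> l) \<cdot> \<pi> l"] arr_comp[OF x(4) arr_comp[OF x(3) s(1)]]
        by (simp add: n_def)
      finally show ?thesis using direct_sum_decompose[OF X s(1)] by (simp add: n_def)
    qed
    have e2: "(\<Sum>l<m. (j \<cdot> \<iota>' l) \<cdot> (\<pi>' l \<cdot> q)) = j \<cdot> q"
    proof -
      have "(\<Sum>l<m. (j \<cdot> \<iota>' l) \<cdot> (\<pi>' l \<cdot> q)) = (\<Sum>l<m. ((j \<cdot> \<iota>' l) \<cdot> \<pi>' l) \<cdot> q)"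
        using assoc[OF s(4) y(4) arr_comp[OF y(3) s(2)]] by (intro sum.cong) (auto simp: m_def)
      also have "\<dots> = (\<Sum>l<m. (j \<cdot> \<iota>' l) \<cdot> \<pi>' l) \<cdot> q"
        using comp_sum_left[OF s(12) s(4), of "{..<m}" "\<lambda>l. (j \<cdot> \<iota>' l) \<cdot> \<pi>' l"] arr_comp[OF y(4) arr_comp[OF y(3) s(2)]]
        by (simp add: m_def)
      finally show ?thesis using direct_sum_decompose[OF Y s(2)] by (simp add: m_def)
    qed
    have "(\<Sum>l<n + m. k l \<cdot> r l) = (\<Sum>l<n. k l \<cdot> r l) + (\<Sum>l<m. k (n + l) \<cdot> r (n + l))"
      by (induction m) (simp_all add: add.assoc)
    also have "\<dots> = i \<cdot> p + j \<cdot> q" using e1 e2 by (simp add: k_def r_def)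
    finally show "(\<Sum>l<length (Xs @ Ys). k l \<cdot> r l) = idm C S" using s(9) by (simp add: n_def m_def)
  qed
  then show ?thesis unfolding direct_sum_def by blast
qed

text \<open>Idempotent completeness provides a complement of the first summand, and the remaining
  inclusions and projections, transported through it, present it as the sum of the tail. This allows
  induction along a list of summands.\<close>

lemma direct_sum_Cons:
  assumes ic: "idempotent_complete C" and X: "direct_sum_via C (A # Xs) S \<iota> \<pi>"
  shows "\<exists>Z j q. biprod C A Z S (\<iota> 0) j (\<pi> 0) q \<and> direct_sum_via C Xs Z (\<lambda>i. q \<cdot> \<iota> (Suc i)) (\<lambda>i. \<pi> (Suc i) \<cdot> j)"
proof -
  note x = direct_sum_viaD[OF X]
  have a0: "arr C (\<iota> 0) A S" "arr C (\<pi> 0) S A" "\<pi> 0 \<cdot> \<iota> 0 = idm C A"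
    using x(3)[of 0] x(4)[of 0] x(5)[of 0 0] by simp_all
  obtain Z j q where Z: "biprod C A Z S (\<iota> 0) j (\<pi> 0) q" using complement_biprod[OF ic a0] by blast
  note z = biprodD[OF Z]
  have xS: "arr C (\<iota> (Suc i)) (Xs ! i) S" "arr C (\<pi> (Suc i)) S (Xs ! i)" "Xs ! i \<in> Ob C" if "i < length Xs" for i
    using x(2)[of "Suc i"] x(3)[of "Suc i"] x(4)[of "Suc i"] that by simp_all
  have qi: "arr C (q \<cdot> \<iota> (Suc i)) (Xs ! i) Z" "arr C (\<pi> (Suc i) \<cdot> j) Z (Xs ! i)" if "i < length Xs" for i
    using arr_comp[OF xS(1) z(4)] arr_comp[OF z(2) xS(2)] that by auto
  have jq: "j \<cdot> q = idm C S - \<iota> 0 \<cdot> \<pi> 0" using z(9) by (simp add: algebra_simps)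
  have "direct_sum_via C Xs Z (\<lambda>i. q \<cdot> \<iota> (Suc i)) (\<lambda>i. \<pi> (Suc i) \<cdot> j)"
    unfolding direct_sum_via_def
  proof (intro conjI allI impI)
    show "set Xs \<subseteq> Ob C" "Z \<in> Ob C" using X z by (auto simp: direct_sum_via_def)
    fix i assume i: "i < length Xs"
    show "q \<cdot> \<iota> (Suc i) \<in> Hom C (Xs ! i) Z" "\<pi> (Suc i) \<cdot> j \<in> Hom C Z (Xs ! i)"
      using qi[OF i] by (auto simp: arr_def)
    fix i' assume i': "i' < length Xs"
    have e: "j \<cdot> (q \<cdot> \<iota> (Suc i')) = \<iota> (Suc i')"
    proof -
      have "j \<cdot> (q \<cdot> \<iota> (Suc i')) = (idm C S - \<iota> 0 \<cdot> \<pi> 0) \<cdot> \<iota> (Suc i')"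
        using assoc[OF xS(1)[OF i'] z(4) z(2)] jq by simp
      also have "\<dots> = \<iota> (Suc i') - \<iota> 0 \<cdot> (\<pi> 0 \<cdot> \<iota> (Suc i'))"
        using comp_diff_left[OF xS(1)[OF i'] arr_id[OF x(1)] arr_comp[OF a0(2,1)]] id_left[OF xS(1)[OF i']]
          assoc[OF xS(1)[OF i'] a0(2,1)] by simp
      finally show ?thesis using x(5)[of 0 "Suc i'"] i' comp_zero_right[OF xS(3)[OF i'] a0(1)] by simp
    qed
    have "(\<pi> (Suc i) \<cdot> j) \<cdot> (q \<cdot> \<iota> (Suc i')) = \<pi> (Suc i) \<cdot> \<iota> (Suc i')"
      using assoc[OF qi(1)[OF i'] z(2) xS(2)[OF i]] e by simp
    then show "(\<pi> (Suc i) \<cdot> j) \<cdot> (q \<cdot> \<iota> (Suc i')) = (if i = i' then idm C (Xs ! i) else 0)"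
      using x(5)[of "Suc i" "Suc i'"] i i' by simp
  next
    have qs: "arr C (q \<cdot> \<iota> (Suc i)) (Xs ! i) Z" if "i < length Xs" for i using qi that by blast
    have qd: "q = (\<Sum>i<Suc (length Xs). (q \<cdot> \<iota> i) \<cdot> \<pi> i)" using direct_sum_decompose[OF X z(4)] by simp
    also have "\<dots> = (q \<cdot> \<iota> 0) \<cdot> \<pi> 0 + (\<Sum>i<length Xs. (q \<cdot> \<iota> (Suc i)) \<cdot> \<pi> (Suc i))"
      by (rule sum.lessThan_Suc_shift)
    also have "\<dots> = (\<Sum>i<length Xs. (q \<cdot> \<iota> (Suc i)) \<cdot> \<pi> (Suc i))"
      using z(8) comp_zero_left[OF z(11) a0(2)] by simp
    finally have qd: "q = (\<Sum>i<length Xs. (q \<cdot> \<iota> (Suc i)) \<cdot> \<pi> (Suc i))" .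
    have "(\<Sum>i<length Xs. (q \<cdot> \<iota> (Suc i)) \<cdot> (\<pi> (Suc i) \<cdot> j)) = (\<Sum>i<length Xs. ((q \<cdot> \<iota> (Suc i)) \<cdot> \<pi> (Suc i)) \<cdot> j)"
      using assoc[OF z(2) xS(2) qs] by (intro sum.cong) auto
    also have "\<dots> = (\<Sum>i<length Xs. (q \<cdot> \<iota> (Suc i)) \<cdot> \<pi> (Suc i)) \<cdot> j"
      using comp_sum_left[OF z(11) z(2), of "{..<length Xs}" "\<lambda>i. (q \<cdot> \<iota> (Suc i)) \<cdot> \<pi> (Suc i)"] arr_comp[OF xS(2) qs] by simp
    finally show "(\<Sum>i<length Xs. (q \<cdot> \<iota> (Suc i)) \<cdot> (\<pi> (Suc i) \<cdot> j)) = idm C Z" using qd z(6) by simp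
  qed
  then show ?thesis using Z by blast
qed

lemma local_indecomposable:
  assumes "local_ob X" shows "indecomposable C X"
  unfolding indecomposable_def
proof (intro conjI allI impI)
  show o: "X \<in> Ob C" "idm C X \<noteq> 0" using assms unfolding local_endomorphism_ring_def by auto
  fix A B assume "direct_sum C [A, B] X"
  then obtain i j p q where S: "biprod C A B X i j p q" using direct_sum_imp_biprod[of C A B X] by blast
  note s = biprodD[OF S]
  have ip: "arr C (i \<cdot> p) X X" using arr_comp[OF s(3,1)] .
  show "idm C A = 0 \<or> idm C B = 0"
  proof (rule ccontr)
    assume n: "\<not> ?thesis"
    have "is_iso C X X (i \<cdot> p) \<or> is_iso C X X (idm C X - i \<cdot> p)"
      using assms ip unfolding local_endomorphism_ring_def arr_def by blast
    moreover have "idm C X - i \<cdot> p = j \<cdot> q" using s(9) by (simp add: algebra_simps)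
    moreover have "is_iso C X X (i' \<cdot> p') \<longrightarrow> idm C B' = 0" if S: "biprod C A' B' X i' j' p' q'" for A' B' i' j' p' q'
    proof
      note s = biprodD[OF S]
      assume "is_iso C X X (i' \<cdot> p')"
      then obtain g where g: "arr C g X X" "g \<cdot> (i' \<cdot> p') = idm C X" using iso_inverse o by metis
      have z: "(i' \<cdot> p') \<cdot> j' = 0" using assoc[OF s(2,3,1)] s(7) comp_zero_right[OF s(11,1)] by simp
      have "j' = g \<cdot> ((i' \<cdot> p') \<cdot> j')" using assoc[OF s(2) arr_comp[OF s(3,1)] g(1)] g id_left[OF s(2)] by simp
      then have "j' = 0" using z comp_zero_right[OF s(11) g(1)] by simp
      then show "idm C B' = 0" using s(6) comp_zero_right[OF s(11) s(4)] by simp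
    qed
    ultimately show False using n S biprod_swap[OF S] by metis
  qed
qed

lemma local_iso:
  assumes X: "local_ob X" and f: "is_iso C X Y f" and Y: "Y \<in> Ob C" shows "local_endomorphism_ring C Y"
proof -
  have oX: "X \<in> Ob C" using X by blast
  obtain g where g: "arr C f X Y" "arr C g Y X" "g \<cdot> f = idm C X" "f \<cdot> g = idm C Y" "is_iso C Y X g"
    using iso_inverse[OF f oX Y] .
  have conj: "is_iso C Y Y h" if h: "arr C h Y Y" "is_iso C X X (g \<cdot> (h \<cdot> f))" for h
  proof -
    have "is_iso C Y Y (f \<cdot> ((g \<cdot> (h \<cdot> f)) \<cdot> g))"
      using iso_comp[OF iso_comp[OF g(5) h(2) Y oX oX] f] Y oX by blast
    moreover have "f \<cdot> ((g \<cdot> (h \<cdot> f)) \<cdot> g) = (f \<cdot> g) \<cdot> (h \<cdot> (f \<cdot> g))"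
      using assoc[OF g(2) arr_comp[OF g(1) h(1)] g(2)] assoc[OF g(2,1) h(1)]
        assoc[OF arr_comp[OF arr_comp[OF g(2,1)] h(1)] g(2,1)] by simp
    ultimately show ?thesis using g(4) id_left[OF h(1)] id_right[OF h(1)] by simp
  qed
  have "is_iso C Y Y h \<or> is_iso C Y Y (idm C Y - h)" if "h \<in> Hom C Y Y" for h
  proof -
    have h: "arr C h Y Y" using that Y by (simp add: arr_def)
    have d: "arr C (idm C Y - h) Y Y" using arr_diff[OF arr_id[OF Y] h] .
    have "g \<cdot> ((idm C Y - h) \<cdot> f) = idm C X - g \<cdot> (h \<cdot> f)"
      using comp_diff_left[OF g(1) arr_id[OF Y] h] id_left[OF g(1)] comp_diff_right[OF g(1) arr_comp[OF g(1) h] g(2)] g(3)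
      by simp
    moreover have "arr C (g \<cdot> (h \<cdot> f)) X X" using arr_comp[OF arr_comp[OF g(1) h] g(2)] .
    ultimately show ?thesis using X conj[OF h] conj[OF d] unfolding local_endomorphism_ring_def arr_def by metis
  qed
  moreover have "idm C Y \<noteq> 0"
  proof
    assume "idm C Y = 0"
    then have "f = 0" using arr_to_zero g(1) by blast
    then show False using g(3) comp_zero_right[OF oX g(2)] X unfolding local_endomorphism_ring_def by simp
  qed
  ultimately show ?thesis unfolding local_endomorphism_ring_def by blast
qed

end

section \<open>Unique decomposition and the basis of the Grothendieck group\<close>

locale ks_category = ct_category +
  fixes I :: "'b set"
  assumes ks: "krull_schmidt C" and reps: "indec_representatives C T I"
begin

lemma I_sub: "U \<in> I \<Longrightarrow> U \<in> T" "U \<in> I \<Longrightarrow> U \<in> Ob C"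
  using reps T_ob unfolding indec_representatives_def by blast+

lemma decomposition: "X \<in> Ob C \<Longrightarrow> \<exists>Xs. direct_sum C Xs X \<and> (\<forall>Y\<in>set Xs. local_endomorphism_ring C Y)"
  using ks unfolding krull_schmidt_def by blast

text \<open>The complement of the first summand of a Krull-Schmidt decomposition is zero, so
  \<open>X\<close> is isomorphic to that summand.\<close>

lemma indecomposable_local:
  assumes X: "indecomposable C X" shows "local_ob X"
proof -
  have o: "X \<in> Ob C" "idm C X \<noteq> 0" using X unfolding indecomposable_def by auto
  obtain Xs \<iota> \<pi> where Xs: "direct_sum_via C Xs X \<iota> \<pi>" "\<forall>Y\<in>set Xs. local_endomorphism_ring C Y"
    using decomposition[OF o(1)] unfolding direct_sum_def by blast
  show ?thesis
  proof (cases Xs)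
    case Nil
    then show ?thesis using direct_sum_viaD(6)[OF Xs(1)] o(2) by simp
  next
    case (Cons A Ys)
    obtain Z j q where Z: "biprod C A Z X (\<iota> 0) j (\<pi> 0) q" using direct_sum_Cons[OF idem Xs(1)[unfolded Cons]] by blast
    note z = biprodD[OF Z]
    have A: "local_endomorphism_ring C A" using Xs(2) Cons by simp
    then have "idm C A \<noteq> 0" unfolding local_endomorphism_ring_def by blast
    then have "idm C Z = 0" using X biprod_imp_direct_sum[OF Z] unfolding indecomposable_def by blast
    then have "q = 0" using arr_to_zero z(4) by blast
    then have "\<iota> 0 \<cdot> \<pi> 0 = idm C X" using z(9) comp_zero_right[OF z(12) z(2)] by simp
    then have "is_iso C A X (\<iota> 0)" using is_isoI[OF z(1,3,5)] by blast
    then show ?thesis using local_iso A z o by blast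
  qed
qed

lemma I_local: "U \<in> I \<Longrightarrow> local_ob U"
  using reps indecomposable_local unfolding indec_representatives_def by blast

lemma I_isomorphic_eq: "U \<in> I \<Longrightarrow> V \<in> I \<Longrightarrow> isomorphic C U V \<Longrightarrow> U = V"
proof -
  assume h: "U \<in> I" "V \<in> I" "isomorphic C U V"
  then have "\<exists>!Y. Y \<in> I \<and> isomorphic C U Y" using reps unfolding indec_representatives_def by blast
  then show ?thesis using h isomorphic_refl[OF I_sub(2)[OF h(1)]] by blast
qed

lemma direct_sum_members:
  assumes "direct_sum_via C Xs X \<iota> \<pi>" "X \<in> T" "Y \<in> set Xs" shows "Y \<in> T"
proof -
  obtain i where i: "i < length Xs" "Y = Xs ! i" using assms(3) in_set_conv_nth by metis
  note x = direct_sum_viaD[OF assms(1)]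
  obtain Z s r where "biprod C Y Z X (\<iota> i) s (\<pi> i) r"
    using complement_biprod[OF idem x(3)[OF i(1)] x(4)[OF i(1)]] x(5)[OF i(1) i(1)] i(2) by auto
  then show ?thesis using T_biprod assms(2) by blast
qed

lemma T_decompose:
  assumes X: "X \<in> T" shows "\<exists>Xs \<iota> \<pi>. set Xs \<subseteq> I \<and> direct_sum_via C Xs X \<iota> \<pi>"
proof -
  obtain Xs \<iota> \<pi> where Xs: "direct_sum_via C Xs X \<iota> \<pi>" "\<forall>Y\<in>set Xs. local_endomorphism_ring C Y"
    using decomposition[OF T_ob[OF X]] unfolding direct_sum_def by blast
  note x = direct_sum_viaD[OF Xs(1)]
  have "\<forall>i<length Xs. \<exists>Y a b. Y \<in> I \<and> arr C a Y (Xs ! i) \<and> arr C b (Xs ! i) Y \<and> b \<cdot> a = idm C Y \<and> a \<cdot> b = idm C (Xs ! i)"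
  proof (intro allI impI)
    fix i assume i: "i < length Xs"
    have "Xs ! i \<in> T" using direct_sum_members[OF Xs(1) X] i by simp
    moreover have "indecomposable C (Xs ! i)" using local_indecomposable Xs(2) x(2) i by simp
    ultimately obtain Y where Y: "Y \<in> I" "isomorphic C (Xs ! i) Y"
      using reps unfolding indec_representatives_def by blast
    then obtain b where "is_iso C (Xs ! i) Y b" unfolding isomorphic_def by blast
    then show "\<exists>Y a b. Y \<in> I \<and> arr C a Y (Xs ! i) \<and> arr C b (Xs ! i) Y \<and> b \<cdot> a = idm C Y \<and> a \<cdot> b = idm C (Xs ! i)"
      using iso_inverse x(2)[OF i] I_sub(2)[OF Y(1)] Y(1) by metis
  qed
  then obtain Y a b where Y: "\<And>i. i < length Xs \<Longrightarrow> Y i \<in> I \<and> arr C (a i) (Y i) (Xs ! i) \<and> arr C (b i) (Xs ! i) (Y i) \<and>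
      b i \<cdot> a i = idm C (Y i) \<and> a i \<cdot> b i = idm C (Xs ! i)" by metis
  let ?Ys = "map Y [0..<length Xs]"
  have "direct_sum_via C ?Ys X (\<lambda>i. \<iota> i \<cdot> a i) (\<lambda>i. b i \<cdot> \<pi> i)"
    unfolding direct_sum_via_def
  proof (intro conjI allI impI)
    show "set ?Ys \<subseteq> Ob C" "X \<in> Ob C" using Y I_sub x(1) by auto
    fix i assume "i < length ?Ys"
    then have i: "i < length Xs" by simp
    show "\<iota> i \<cdot> a i \<in> Hom C (?Ys ! i) X" "b i \<cdot> \<pi> i \<in> Hom C X (?Ys ! i)"
      using arr_comp[of "a i" "Y i" "Xs ! i" "\<iota> i" X] arr_comp[of "\<pi> i" X "Xs ! i" "b i" "Y i"] Y[OF i] x(3)[OF i] x(4)[OF i] i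
      by (auto simp: arr_def)
    fix j assume "j < length ?Ys"
    then have j: "j < length Xs" by simp
    have aj: "arr C (a j) (Y j) (Xs ! j)" and bi: "arr C (b i) (Xs ! i) (Y i)" using Y i j by auto
    have "(b i \<cdot> \<pi> i) \<cdot> (\<iota> j \<cdot> a j) = b i \<cdot> ((\<pi> i \<cdot> \<iota> j) \<cdot> a j)"
      using assoc[OF arr_comp[OF aj x(3)[OF j]] x(4)[OF i] bi] assoc[OF aj x(3)[OF j] x(4)[OF i]] by simp
    then show "(b i \<cdot> \<pi> i) \<cdot> (\<iota> j \<cdot> a j) = (if i = j then idm C (?Ys ! i) else 0)"
      using x(5)[OF i j] Y[OF i] i id_left[OF aj] comp_zero_left[OF x(2)[OF i] aj] comp_zero_right[OF _ bi, of "Y j"] Y[OF j] I_sub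
      by auto
  next
    have "(\<iota> i \<cdot> a i) \<cdot> (b i \<cdot> \<pi> i) = \<iota> i \<cdot> \<pi> i" if i: "i < length Xs" for i
    proof -
      have ai: "arr C (a i) (Y i) (Xs ! i)" and bi: "arr C (b i) (Xs ! i) (Y i)" using Y i by auto
      show ?thesis
        using assoc[OF arr_comp[OF x(4)[OF i] bi] ai x(3)[OF i]] assoc[OF x(4)[OF i] bi ai] Y[OF i] id_left[OF x(4)[OF i]] by simp
    qed
    then show "(\<Sum>i<length ?Ys. (\<iota> i \<cdot> a i) \<cdot> (b i \<cdot> \<pi> i)) = idm C X" using x(6) by simp
  qed
  moreover have "set ?Ys \<subseteq> I" using Y by auto
  ultimately show ?thesis by blast
qed

text \<open>The number of summands of \<open>X\<close> isomorphic to \<open>U\<close>. Krull-Schmidt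
  uniqueness makes it well defined, and additivity makes it the coordinate functional at
  \<open>U\<close> on the Grothendieck group.\<close>

definition mult :: "'b \<Rightarrow> 'b \<Rightarrow> nat" where
  "mult U X = (THE n. \<exists>Xs. direct_sum C Xs X \<and> (\<forall>Y\<in>set Xs. local_endomorphism_ring C Y) \<and>
     n = card {i. i < length Xs \<and> isomorphic C (Xs ! i) U})"

lemma mult_eq:
  assumes U: "U \<in> I" and X: "direct_sum C Xs X" "\<forall>Y\<in>set Xs. local_endomorphism_ring C Y"
  shows "mult U X = card {i. i < length Xs \<and> isomorphic C (Xs ! i) U}"
  unfolding mult_def
proof (rule the_equality)
  fix n assume "\<exists>Xs. direct_sum C Xs X \<and> (\<forall>Y\<in>set Xs. local_endomorphism_ring C Y) \<and> n = card {i. i < length Xs \<and> isomorphic C (Xs ! i) U}"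
  then obtain Ys where Ys: "direct_sum C Ys X" "\<forall>Y\<in>set Ys. local_endomorphism_ring C Y" "n = card {i. i < length Ys \<and> isomorphic C (Ys ! i) U}"
    by blast
  obtain \<iota> \<pi> \<iota>' \<pi>' where "direct_sum_via C Xs X \<iota> \<pi>" "direct_sum_via C Ys X \<iota>' \<pi>'"
    using X(1) Ys(1) unfolding direct_sum_def by blast
  then show "n = card {i. i < length Xs \<and> isomorphic C (Xs ! i) U}"
    using multiplicity_le[OF _ _ _ I_local[OF U]] X(2) Ys(2,3) by (metis (no_types, lifting) le_antisym)
qed (use X in blast)

lemma mult_add:
  assumes U: "U \<in> I" and S: "direct_sum C [A, B] S" shows "mult U S = mult U A + mult U B"
proof -
  obtain i j p q where b: "biprod C A B S i j p q" using direct_sum_imp_biprod[OF S] by blast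
  obtain Xs \<iota> \<pi> where X: "direct_sum_via C Xs A \<iota> \<pi>" "\<forall>Y\<in>set Xs. local_endomorphism_ring C Y"
    using decomposition[OF biprodD(10)[OF b]] unfolding direct_sum_def by blast
  obtain Ys \<iota>' \<pi>' where Y: "direct_sum_via C Ys B \<iota>' \<pi>'" "\<forall>Y\<in>set Ys. local_endomorphism_ring C Y"
    using decomposition[OF biprodD(11)[OF b]] unfolding direct_sum_def by blast
  have S': "direct_sum C (Xs @ Ys) S" using direct_sum_append[OF b X(1) Y(1)] .
  have XA: "direct_sum C Xs A" and YB: "direct_sum C Ys B" using X Y unfolding direct_sum_def by blast+
  let ?c = "\<lambda>Zs. {i. i < length Zs \<and> isomorphic C (Zs ! i) U}"
  have "?c (Xs @ Ys) = ?c Xs \<union> (\<lambda>i. i + length Xs) ` ?c Ys"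
  proof (intro equalityI subsetI)
    fix i assume "i \<in> ?c (Xs @ Ys)"
    then show "i \<in> ?c Xs \<union> (\<lambda>i. i + length Xs) ` ?c Ys"
      by (cases "i < length Xs") (auto simp: nth_append intro!: image_eqI[of _ _ "i - length Xs"])
  qed (auto simp: nth_append)
  moreover have "?c Xs \<inter> (\<lambda>i. i + length Xs) ` ?c Ys = {}" by auto
  ultimately have "card (?c (Xs @ Ys)) = card (?c Xs) + card (?c Ys)"
    by (simp add: card_Un_disjoint card_image)
  then show ?thesis
    using mult_eq[OF U S'] mult_eq[OF U XA X(2)] mult_eq[OF U YB Y(2)] X(2) Y(2) by auto
qed

lemma mult_I:
  assumes U: "U \<in> I" and V: "V \<in> I" shows "mult U V = (if U = V then 1 else 0)"
proof -
  have "direct_sum_via C [V] V (\<lambda>_. idm C V) (\<lambda>_. idm C V)"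
    using I_sub(2)[OF V] id_left[OF arr_id] arr_id by (auto simp: direct_sum_via_def arr_def)
  then have "direct_sum C [V] V" unfolding direct_sum_def by blast
  then have "mult U V = card {i. i < length [V] \<and> isomorphic C ([V] ! i) U}"
    using mult_eq[OF U] I_local[OF V] by simp
  also have "{i. i < length [V] \<and> isomorphic C ([V] ! i) U} = (if U = V then {0} else {})"
    using I_isomorphic_eq[OF V U] isomorphic_refl[OF I_sub(2)[OF V]] by auto
  finally show ?thesis by (simp split: if_splits)
qed

lemma zero_rel: "idm C X = 0 \<Longrightarrow> X \<in> T \<Longrightarrow> frag_of X \<in> K.Rel"
proof -
  assume X: "idm C X = 0" "X \<in> T"
  have "frag_of X - frag_of X - frag_of X \<in> K.Rel"
    using split_rel[OF X(2,2) biprod_imp_direct_sum[OF biprod_zero[OF T_ob[OF X(2)] T_ob[OF X(2)] X(1)]]] .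
  then show ?thesis using K.rel_neg by fastforce
qed

lemma direct_sum_rel:
  assumes "direct_sum_via C Xs X \<iota> \<pi>" "X \<in> T" shows "frag_of X - (\<Sum>Y\<leftarrow>Xs. frag_of Y) \<in> K.Rel"
  using assms
proof (induction Xs arbitrary: X \<iota> \<pi>)
  case Nil
  then show ?case using zero_rel direct_sum_viaD(6)[OF Nil(1)] by simp
next
  case (Cons A Xs)
  obtain Z j q where Z: "biprod C A Z X (\<iota> 0) j (\<pi> 0) q"
    "direct_sum_via C Xs Z (\<lambda>i. q \<cdot> \<iota> (Suc i)) (\<lambda>i. \<pi> (Suc i) \<cdot> j)"
    using direct_sum_Cons[OF idem Cons.prems(1)] by blast
  have t: "A \<in> T" "Z \<in> T" using T_biprod[OF Z(1)] Cons.prems(2) by auto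
  have 1: "frag_of X - frag_of A - frag_of Z \<in> K.Rel" using split_rel[OF t biprod_imp_direct_sum[OF Z(1)]] .
  have 2: "frag_of Z - (\<Sum>Y\<leftarrow>Xs. frag_of Y) \<in> K.Rel" using Cons.IH[OF Z(2) t(2)] .
  have eq: "frag_of X - (\<Sum>Y\<leftarrow>A # Xs. frag_of Y) = (frag_of X - frag_of A - frag_of Z) + (frag_of Z - (\<Sum>Y\<leftarrow>Xs. frag_of Y))"
    by (simp add: algebra_simps)
  show ?case unfolding eq using 1 2 by (rule K.rel_add)
qed

lemma keys_sum_list: "set Xs \<subseteq> A \<Longrightarrow> Poly_Mapping.keys (\<Sum>Y\<leftarrow>Xs. frag_of Y) \<subseteq> A"
proof (induction Xs)
  case (Cons a Xs)
  then show ?case using keys_add[of "frag_of a" "\<Sum>Y\<leftarrow>Xs. frag_of Y"] by (auto simp: keys_frag_of)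
qed simp

lemma representative_exists:
  assumes "Poly_Mapping.keys c \<subseteq> T" shows "\<exists>b. Poly_Mapping.keys b \<subseteq> I \<and> b - c \<in> K.Rel"
  using assms
proof (induction c rule: frag_induction)
  case zero
  then show ?case using K.rel_zero by (intro exI[of _ 0]) simp
next
  case (one X)
  obtain Xs \<iota> \<pi> where X: "set Xs \<subseteq> I" "direct_sum_via C Xs X \<iota> \<pi>" using T_decompose[OF one] by blast
  have "(\<Sum>Y\<leftarrow>Xs. frag_of Y) - frag_of X \<in> K.Rel" using K.rel_neg[OF direct_sum_rel[OF X(2) one]] by simp
  then show ?case using keys_sum_list[OF X(1)] by blast
next
  case (diff a b)
  obtain a' b' where ab: "Poly_Mapping.keys a' \<subseteq> I" "a' - a \<in> K.Rel" "Poly_Mapping.keys b' \<subseteq> I" "b' - b \<in> K.Rel"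
    using diff by blast
  have eq: "(a' - b') - (a - b) = (a' - a) - (b' - b)" by simp
  have "(a' - b') - (a - b) \<in> K.Rel" unfolding eq using ab(2,4) by (rule K.rel_diff)
  then show ?case using keys_diff[of a' b'] ab by (intro exI[of _ "a' - b'"]) auto
qed

text \<open>Evaluating the multiplicity of \<open>U\<close>, which vanishes on relations, reads off
  the coefficient at \<open>U\<close> of a combination supported in \<open>I\<close>.\<close>

lemma representative_unique:
  assumes k: "Poly_Mapping.keys b \<subseteq> I" "Poly_Mapping.keys b' \<subseteq> I" and r: "b - b' \<in> K.Rel"
  shows "b = b'"
proof -
  have "Poly_Mapping.lookup (b - b') U = 0" for U
  proof (cases "U \<in> I")
    case True
    have sub: "Poly_Mapping.keys (b - b') \<subseteq> I" using keys_diff[of b b'] k by auto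
    have "0 = frag_eval (\<lambda>X. int (mult U X)) (b - b')"
      by (rule K.frag_eval_rel[OF _ r, symmetric]) (auto simp: split_sequences_def dest: mult_add[OF True])
    also have "\<dots> = (\<Sum>x\<in>Poly_Mapping.keys (b - b'). if x = U then Poly_Mapping.lookup (b - b') U else 0)"
      unfolding frag_eval_def using mult_I[OF True] sub by (intro sum.cong) auto
    also have "\<dots> = Poly_Mapping.lookup (b - b') U" by (simp add: sum.delta in_keys_iff)
    finally show ?thesis by simp
  next
    case False
    then show ?thesis using keys_diff[of b b'] k by (auto simp: in_keys_iff)
  qed
  then show ?thesis by (metis eq_iff_diff_eq_0 poly_mapping_eqI lookup_zero)
qed

text \<open>Existence and uniqueness of representatives supported in \<open>I\<close> justify the
  definite description in \<open>basis_coefficients\<close>.\<close>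

lemma basis_coefficients_class:
  assumes c: "Poly_Mapping.keys c \<subseteq> T"
  shows "Poly_Mapping.keys (basis_coefficients I (K.cls c)) \<subseteq> I" "basis_coefficients I (K.cls c) - c \<in> K.Rel"
proof -
  let ?P = "\<lambda>b. b \<in> K.cls c \<and> Poly_Mapping.keys b \<subseteq> I"
  have IT: "I \<subseteq> T" using I_sub by blast
  obtain b where b: "Poly_Mapping.keys b \<subseteq> I" "b - c \<in> K.Rel" using representative_exists[OF c] by blast
  have "?P b" using b K.class_mem[OF c] IT by blast
  moreover have "b' = b" if "?P b'" for b'
  proof -
    have "b' - c \<in> K.Rel" using that K.class_mem[OF c] by blast
    then have "(b' - c) - (b - c) \<in> K.Rel" using K.rel_diff b by blast
    then show ?thesis using representative_unique that b by simp
  qed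
  ultimately have "basis_coefficients I (K.cls c) = b" unfolding basis_coefficients_def by (rule the_equality)
  then show "Poly_Mapping.keys (basis_coefficients I (K.cls c)) \<subseteq> I" "basis_coefficients I (K.cls c) - c \<in> K.Rel"
    using b by auto
qed

end

section \<open>Finite-dimensional modules\<close>

locale tmodule = ks_category +
  fixes emb :: "'a \<Rightarrow> 'f::field" and s :: "'f \<Rightarrow> 'v::ab_group_add \<Rightarrow> 'v" and M :: "('b, 'c, 'v) tmod"
  assumes is_mod: "is_module C T emb s M"
begin

sublocale vs: vector_space s
  using is_mod unfolding is_module_def by blast

lemma val_subspace: "X \<in> T \<Longrightarrow> vs.subspace (Val M X)"
  using is_mod unfolding is_module_def by blast

lemma act_lin:
  "X \<in> T \<Longrightarrow> Y \<in> T \<Longrightarrow> arr C f X Y \<Longrightarrow> linear_map_on s (Val M Y) s (Val M X) (Act M f)"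
  using is_mod unfolding is_module_def arr_def by blast

lemma act_in: "X \<in> T \<Longrightarrow> Y \<in> T \<Longrightarrow> arr C f X Y \<Longrightarrow> v \<in> Val M Y \<Longrightarrow> Act M f v \<in> Val M X"
  using linear_map_onD(1)[OF act_lin] .

lemma act_add: "X \<in> T \<Longrightarrow> Y \<in> T \<Longrightarrow> arr C f X Y \<Longrightarrow> v \<in> Val M Y \<Longrightarrow> w \<in> Val M Y \<Longrightarrow>
    Act M f (v + w) = Act M f v + Act M f w"
  using linear_map_onD(2)[OF act_lin] .

lemma act_semilinear:
  "X \<in> T \<Longrightarrow> Y \<in> T \<Longrightarrow> v \<in> Val M Y \<Longrightarrow> semilinear_on emb (scal C) (Hom C X Y) s (Val M X) (\<lambda>f. Act M f v)"
  using is_mod unfolding is_module_def by blast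

lemma act_add_arr: "X \<in> T \<Longrightarrow> Y \<in> T \<Longrightarrow> arr C f X Y \<Longrightarrow> arr C g X Y \<Longrightarrow> v \<in> Val M Y \<Longrightarrow>
    Act M (f + g) v = Act M f v + Act M g v"
  using act_semilinear[of X Y v] unfolding semilinear_on_def arr_def by blast

lemma act_scale_arr: "X \<in> T \<Longrightarrow> Y \<in> T \<Longrightarrow> arr C f X Y \<Longrightarrow> v \<in> Val M Y \<Longrightarrow>
    Act M (scal C a f) v = s (emb a) (Act M f v)"
  using act_semilinear[of X Y v] unfolding semilinear_on_def arr_def by blast

lemma act_id: "X \<in> T \<Longrightarrow> v \<in> Val M X \<Longrightarrow> Act M (idm C X) v = v"
  using is_mod unfolding is_module_def by blast

lemma act_comp: "X \<in> T \<Longrightarrow> Y \<in> T \<Longrightarrow> Z \<in> T \<Longrightarrow> arr C f X Y \<Longrightarrow> arr C g Y Z \<Longrightarrow> v \<in> Val M Z \<Longrightarrow>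
    Act M (g \<cdot> f) v = Act M f (Act M g v)"
  using is_mod unfolding is_module_def arr_def by blast

lemma act_zero_arr: "X \<in> T \<Longrightarrow> Y \<in> T \<Longrightarrow> v \<in> Val M Y \<Longrightarrow> Act M 0 v = 0"
  using act_add_arr[of X Y 0 0 v] arr_zero[OF T_ob T_ob] by simp

lemma act_diff_arr: "X \<in> T \<Longrightarrow> Y \<in> T \<Longrightarrow> arr C f X Y \<Longrightarrow> arr C g X Y \<Longrightarrow> v \<in> Val M Y \<Longrightarrow>
    Act M (f - g) v = Act M f v - Act M g v"
  using act_add_arr[of X Y "f - g" g v] arr_diff by (simp add: algebra_simps)

lemma act_zero: "X \<in> T \<Longrightarrow> Y \<in> T \<Longrightarrow> arr C f X Y \<Longrightarrow> Act M f 0 = 0"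
  using act_add[of X Y f 0 0] vs.subspace_0[OF val_subspace] by simp

lemma act_sum_arr:
  assumes "X \<in> T" "Y \<in> T" "v \<in> Val M Y" "\<And>i. i \<in> A \<Longrightarrow> arr C (f i) X Y"
  shows "Act M (sum f A) v = (\<Sum>i\<in>A. Act M (f i) v)"
  using assms(4)
proof (induction A rule: infinite_finite_induct)
  case (insert i A)
  then show ?case
    using act_add_arr[OF assms(1,2) _ _ assms(3), of "f i" "sum f A"] arr_sum[OF T_ob[OF assms(1)] T_ob[OF assms(2)], of A f] by auto
qed (use act_zero_arr[OF assms(1,2,3)] in auto)

definition sub :: "('b \<Rightarrow> 'v set) \<Rightarrow> bool" where
  "sub W \<longleftrightarrow> (\<forall>X\<in>T. vs.subspace (W X) \<and> W X \<subseteq> Val M X) \<and>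
     (\<forall>X\<in>T. \<forall>Y\<in>T. \<forall>f v. arr C f X Y \<longrightarrow> v \<in> W Y \<longrightarrow> Act M f v \<in> W X)"

lemma sub_whole: "sub (Val M)"
  unfolding sub_def using val_subspace act_in by blast

lemma subD:
  assumes "sub W" "X \<in> T"
  shows "vs.subspace (W X)" "v \<in> W X \<Longrightarrow> v \<in> Val M X"
    "Y \<in> T \<Longrightarrow> arr C f X Y \<Longrightarrow> w \<in> W Y \<Longrightarrow> Act M f w \<in> W X"
  using assms unfolding sub_def by blast+

text \<open>An element is the sum of its components, each transported back along a projection; hence
  membership in a submodule can be tested on indecomposable summands.\<close>

lemma sub_decompose:
  assumes W: "sub W" and X: "X \<in> T" "set Xs \<subseteq> I" "direct_sum_via C Xs X \<iota> \<pi>" and v: "v \<in> Val M X"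
    and c: "\<And>i. i < length Xs \<Longrightarrow> Act M (\<iota> i) v \<in> W (Xs ! i)"
  shows "v \<in> W X"
proof -
  note x = direct_sum_viaD[OF X(3)]
  have m: "Xs ! i \<in> T" if "i < length Xs" for i using direct_sum_members[OF X(3,1)] that by simp
  have "v = Act M (\<Sum>i<length Xs. \<iota> i \<cdot> \<pi> i) v" using act_id[OF X(1) v] x(6) by simp
  also have "\<dots> = (\<Sum>i<length Xs. Act M (\<iota> i \<cdot> \<pi> i) v)"
    using act_sum_arr[OF X(1,1) v, of "{..<length Xs}" "\<lambda>i. \<iota> i \<cdot> \<pi> i"] arr_comp[OF x(4) x(3)] by simp
  also have "\<dots> = (\<Sum>i<length Xs. Act M (\<pi> i) (Act M (\<iota> i) v))"
    using act_comp[OF X(1) m X(1) x(4) x(3) v] by (intro sum.cong) auto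
  also have "\<dots> \<in> W X"
    using subD(3)[OF W X(1) m x(4) c] by (intro vs.subspace_sum[OF subD(1)[OF W X(1)]]) auto
  finally show ?thesis .
qed

lemma sub_eq_on_I:
  assumes W: "sub W" and W': "sub W'" and le: "\<And>U. U \<in> I \<Longrightarrow> W' U \<subseteq> W U" and X: "X \<in> T"
  shows "W' X \<subseteq> W X"
proof
  fix v assume v: "v \<in> W' X"
  obtain Xs \<iota> \<pi> where Xs: "set Xs \<subseteq> I" "direct_sum_via C Xs X \<iota> \<pi>" using T_decompose[OF X] by blast
  note x = direct_sum_viaD[OF Xs(2)]
  show "v \<in> W X"
  proof (rule sub_decompose[OF W X Xs subD(2)[OF W' X v]])
    fix i assume i: "i < length Xs"
    have iI: "Xs ! i \<in> I" using i Xs(1) by auto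
    show "Act M (\<iota> i) v \<in> W (Xs ! i)" using subD(3)[OF W' I_sub(1)[OF iI] X x(3)[OF i] v] le[OF iI] by blast
  qed
qed

lemma sub_zero: "sub (\<lambda>_. {0})"
  unfolding sub_def using vs.subspace_0[OF val_subspace] act_zero by auto

end

section \<open>Realising finite-dimensional modules by extension functors\<close>

locale mm_category = ks_category +
  assumes mm: "maximally_mutable C I"
begin

text \<open>The exchange conflation ends in an approximation of \<open>U\<close> by the other
  indecomposables. That it does not split excludes invertible endomorphisms of \<open>U\<close>
  which factor through it; radical endomorphisms that do not factor have to be treated separately
  later.\<close>

lemma mutable_approximation:
  assumes U: "U \<in> I" "U \<notin> projectives C"
  shows "\<exists>T' P d x q. Real C T' P U d x q \<and> P \<in> T \<and> (\<forall>g. arr C g U P \<longrightarrow> \<not> is_iso C U U (q \<cdot> g)) \<and>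
    (\<forall>V\<in>I. V \<noteq> U \<longrightarrow> (\<forall>f. arr C f V U \<longrightarrow> (\<exists>g. arr C g V P \<and> f = q \<cdot> g)))"
proof -
  let ?A = "add_closure C (I - {U})"
  obtain T' P x q where P: "conflation C T' P U x q" "\<not> split_conflation C T' P U x q" "right_approximation C ?A P U q"
    using mm U unfolding maximally_mutable_def mutable_in_def Let_def by blast
  obtain d where R: "Real C T' P U d x q" using P(1) unfolding conflation_def by blast
  note r = RealD[OF R]
  obtain N0 where N0: "N0 \<in> Ob C" "idm C N0 = 0" using zero_object_exists by blast
  have "P \<in> T"
  proof -
    have "P \<in> ?A" using P(3) unfolding right_approximation_def by blast
    then obtain Xs Y Z where Z: "set Xs \<subseteq> I - {U}" "direct_sum C Xs Z" "direct_sum C [P, Y] Z"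
      unfolding add_closure_def by blast
    obtain \<iota> \<pi> where Z': "direct_sum_via C Xs Z \<iota> \<pi>" using Z(2) unfolding direct_sum_def by blast
    note z = direct_sum_viaD[OF Z']
    have "Z \<in> T"
    proof (rule T_memI[OF z(1)])
      fix V e assume V: "V \<in> T" and e: "exte C e V Z"
      have comp: "push C (\<iota> i \<cdot> \<pi> i) e = 0" if i: "i < length Xs" for i
      proof -
        have "Xs ! i \<in> T" using Z(1) i I_sub by (meson DiffE nth_mem subsetD)
        then have "push C (\<pi> i) e = 0" using T_ext[OF exte_push[OF e z(4)[OF i]] V] by blast
        then show ?thesis using push_push[OF e z(4)[OF i] z(3)[OF i]] push_zero[OF exte_ob(1)[OF e] z(3)[OF i]] by simp
      qed
      have "push C (\<Sum>i<n. \<iota> i \<cdot> \<pi> i) e = 0" if "n \<le> length Xs" for n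
        using that
      proof (induction n)
        case (Suc n)
        have "arr C (\<Sum>i<n. \<iota> i \<cdot> \<pi> i) Z Z" using arr_sum[OF z(1,1), of "{..<n}"] arr_comp[OF z(4) z(3)] Suc by auto
        moreover have "arr C (\<iota> n \<cdot> \<pi> n) Z Z" using arr_comp[OF z(4) z(3)] Suc.prems by simp
        ultimately show ?case using push_add_arr[OF e, of "\<Sum>i<n. \<iota> i \<cdot> \<pi> i" Z "\<iota> n \<cdot> \<pi> n"] Suc comp[of n] by simp
      qed (use push_zero_arr[OF e z(1)] in simp)
      then show "e = 0" using z(6) push_ext_id[OF e] by (metis order_refl)
    qed
    then show ?thesis using T_sums[OF Z(3)] by blast
  qed
  moreover have "\<not> is_iso C U U (q \<cdot> g)" if g: "arr C g U P" for g
  proof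
    assume "is_iso C U U (q \<cdot> g)"
    then obtain h where h: "arr C h U U" "(q \<cdot> g) \<cdot> h = idm C U" using iso_inverse I_sub(2)[OF U(1)] by metis
    have "q \<cdot> (g \<cdot> h) = idm C U" using assoc[OF h(1) g r(3)] h by simp
    moreover have "g \<cdot> h \<in> Hom C U P" using arr_comp[OF h(1) g] by (simp add: arr_def)
    ultimately show False using P(1,2) unfolding split_conflation_def by blast
  qed
  moreover have "\<exists>g. arr C g V P \<and> f = q \<cdot> g" if V: "V \<in> I" "V \<noteq> U" and f: "arr C f V U" for V f
  proof -
    have o: "V \<in> Ob C" using I_sub V by blast
    have "direct_sum_via C [V] V (\<lambda>_. idm C V) (\<lambda>_. idm C V)"
      using o id_left[OF arr_id] arr_id by (auto simp: direct_sum_via_def arr_def)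
    then have 1: "direct_sum C [V] V" unfolding direct_sum_def by blast
    have 2: "direct_sum C [V, N0] V" using biprod_imp_direct_sum[OF biprod_zero[OF o N0]] .
    have "V \<in> ?A" unfolding add_closure_def using 1 2 o V by (intro CollectI conjI exI[of _ "[V]"] exI[of _ N0] exI[of _ V]) auto
    moreover have "f \<in> Hom C V U" using f by (simp add: arr_def)
    ultimately obtain g where "g \<in> Hom C V P" "q \<cdot> g = f" using P(3) unfolding right_approximation_def by blast
    then show ?thesis using o r by (auto simp: arr_def)
  qed
  ultimately show ?thesis using R by blast
qed

end

locale fd_tmodule = mm_category +
  fixes s :: "'a \<Rightarrow> 'v::ab_group_add \<Rightarrow> 'v" and M :: "('b, 'c, 'v) tmod"
  assumes fd: "is_fd_module C T I id s M"
begin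

sublocale tmodule C p T I id s M
  using fd by unfold_locales (simp add: is_fd_module_def)

text \<open>By linearity of the action in the arrow, the elements \<open>Act M f y\<close> already
  form a subspace, so this is the submodule generated by \<open>W\<close> and
  \<open>y\<close>.\<close>

lemma sub_generated:
  assumes W: "sub W" and V: "V \<in> T" and y: "y \<in> Val M V"
  shows "sub (\<lambda>X. {m + Act M f y | m f. m \<in> W X \<and> arr C f X V})"
  unfolding sub_def
proof (intro conjI ballI allI impI)
  fix X assume X: "X \<in> T"
  let ?G = "{m + Act M f y | m f. m \<in> W X \<and> arr C f X V}"
  note w = subD[OF W X]
  show "?G \<subseteq> Val M X" using w(2) act_in[OF X V _ y] vs.subspace_add[OF val_subspace[OF X]] by blast
  show "vs.subspace ?G"
  proof (rule vs.subspaceI)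
    have "0 = 0 + Act M 0 y" using act_zero_arr[OF X V y] by simp
    then show "0 \<in> ?G" using vs.subspace_0[OF w(1)] arr_zero[OF T_ob[OF X] T_ob[OF V]] by blast
  next
    fix a b assume "a \<in> ?G" "b \<in> ?G"
    then obtain m f m' f' where h: "a = m + Act M f y" "m \<in> W X" "arr C f X V" "b = m' + Act M f' y" "m' \<in> W X" "arr C f' X V"
      by blast
    have "a + b = (m + m') + Act M (f + f') y" using h act_add_arr[OF X V h(3,6) y] by (simp add: algebra_simps)
    then show "a + b \<in> ?G" using vs.subspace_add[OF w(1) h(2,5)] arr_add[OF h(3,6)] by blast
  next
    fix c a assume "a \<in> ?G"
    then obtain m f where h: "a = m + Act M f y" "m \<in> W X" "arr C f X V" by blast
    have "s c a = s c m + Act M (scal C c f) y"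
      using h(1) act_scale_arr[OF X V h(3) y] vs.scale_right_distrib by simp
    then show "s c a \<in> ?G" using vs.subspace_scale[OF w(1) h(2)] arr_scale[OF h(3)] by blast
  qed
next
  fix X Y f v assume X: "X \<in> T" and Y: "Y \<in> T" and f: "arr C f X Y"
    and "v \<in> {m + Act M f y | m f. m \<in> W Y \<and> arr C f Y V}"
  then obtain m g where h: "v = m + Act M g y" "m \<in> W Y" "arr C g Y V" by blast
  have "Act M f v = Act M f m + Act M (g \<cdot> f) y"
    using h(1) act_add[OF X Y f subD(2)[OF W Y h(2)] act_in[OF Y V h(3) y]] act_comp[OF X Y V f h(3) y] by simp
  then show "Act M f v \<in> {m + Act M f y | m f. m \<in> W X \<and> arr C f X V}"
    using subD(3)[OF W X Y f h(2)] arr_comp[OF f h(3)] by blast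
qed

definition supp :: "'b set" where "supp = {X\<in>I. Val M X \<noteq> {0}}"

text \<open>The induction measure. Only indecomposables in the finite support are counted, which is
  enough because a submodule is determined by its values on \<open>I\<close>.\<close>

definition tdim :: "('b \<Rightarrow> 'v set) \<Rightarrow> nat" where "tdim W = (\<Sum>U\<in>supp. vs.dim (W U))"

lemma supp: "finite supp" "U \<in> supp \<Longrightarrow> U \<in> I" "U \<in> supp \<Longrightarrow> U \<in> T" "U \<in> supp \<Longrightarrow> U \<notin> projectives C"
  "U \<in> I \<Longrightarrow> U \<notin> supp \<Longrightarrow> Val M U = {0}"
  using fd I_sub unfolding supp_def is_fd_module_def by auto

lemma val_fin: "X \<in> T \<Longrightarrow> fin_dim s (Val M X)"
  using fd unfolding is_fd_module_def by blast

lemma tdim_mono: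
  assumes W: "sub W" "sub W'" and le: "\<And>X. X \<in> T \<Longrightarrow> W X \<subseteq> W' X"
  shows "tdim W \<le> tdim W'"
    "tdim W' \<le> tdim W \<Longrightarrow> X \<in> T \<Longrightarrow> W' X = W X"
proof -
  have fW': "fin_dim s (W' U)" if "U \<in> T" for U
    using vs.fin_dim_subspace(1)[OF subD(1)[OF W(2) that] _ val_subspace[OF that] val_fin[OF that]] subD(2)[OF W(2) that] by blast
  have d: "vs.dim (W U) \<le> vs.dim (W' U)" if "U \<in> T" for U
    using vs.fin_dim_subspace(2)[OF subD(1)[OF W(1) that] le[OF that] subD(1)[OF W(2) that] fW'[OF that]] .
  show "tdim W \<le> tdim W'" unfolding tdim_def using d supp by (intro sum_mono) auto
  assume h: "tdim W' \<le> tdim W" and X: "X \<in> T"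
  have "W' U \<subseteq> W U" if U: "U \<in> I" for U
  proof (cases "U \<in> supp")
    case True
    have "vs.dim (W' U) \<le> vs.dim (W U)"
    proof (rule ccontr)
      assume "\<not> ?thesis"
      then have "tdim W < tdim W'" unfolding tdim_def
        using True supp(1,3) d by (intro sum_strict_mono_ex1) (auto intro!: bexI[of _ U])
      then show False using h by simp
    qed
    then show ?thesis using vs.subspace_eq_dim[OF subD(1)[OF W(1)] le subD(1)[OF W(2)] fW'] I_sub U by blast
  next
    case False
    then have "W' U \<subseteq> {0}" using supp(5)[OF U] subD(2)[OF W(2)] I_sub U by blast
    then show ?thesis using vs.subspace_0[OF subD(1)[OF W(1)]] I_sub U by blast
  qed
  then show "W' X = W X" using sub_eq_on_I[OF W _ X] le[OF X] by blast
qed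

abbreviation restr :: "('b \<Rightarrow> 'v set) \<Rightarrow> ('b, 'c, 'v) tmod" where
  "restr W \<equiv> \<lparr>Val = W, Act = Act M\<rparr>"

text \<open>\<open>\<alpha>\<close> is an isomorphism of modules from E X to the submodule
  \<open>W\<close>.\<close>

definition models :: "'b \<Rightarrow> ('b \<Rightarrow> 'v set) \<Rightarrow> ('b \<Rightarrow> 'd \<Rightarrow> 'v) \<Rightarrow> bool" where
  "models X W \<alpha> \<longleftrightarrow> X \<in> Ob C \<and>
    (\<forall>V\<in>T. bij_betw (\<alpha> V) (Ext C V X) (W V) \<and> linear_map_on (escal C) (Ext C V X) s (W V) (\<alpha> V)) \<and>
    (\<forall>V\<in>T. \<forall>V'\<in>T. \<forall>f e. arr C f V V' \<longrightarrow> exte C e V' X \<longrightarrow> \<alpha> V (pull C f e) = Act M f (\<alpha> V' e))"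

text \<open>A proper submodule of largest total dimension. Simplicity of the quotient is expressed
  through elements: any \<open>y\<close> outside \<open>W1\<close> generates everything modulo
  \<open>W1\<close>.\<close>

lemma maximal_submodule:
  assumes W: "sub W" and n: "tdim W > 0"
  shows "\<exists>W1. sub W1 \<and> (\<forall>X\<in>T. W1 X \<subseteq> W X) \<and> tdim W1 < tdim W \<and>
    (\<forall>V y. V \<in> T \<longrightarrow> y \<in> W V \<longrightarrow> y \<notin> W1 V \<longrightarrow>
       (\<forall>X\<in>T. \<forall>w\<in>W X. \<exists>m f. m \<in> W1 X \<and> arr C f X V \<and> w = m + Act M f y))"
proof -
  let ?P = "\<lambda>W1. sub W1 \<and> (\<forall>X\<in>T. W1 X \<subseteq> W X) \<and> tdim W1 < tdim W"
  have "vs.dim {0} = 0" using vs.dim_span[of "{}"] vs.dim_eq_card_independent[OF vs.independent_empty] by simp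
  then have "tdim (\<lambda>_. {0}) = 0" unfolding tdim_def by simp
  then have "?P (\<lambda>_. {0})" using n sub_zero vs.subspace_0[OF subD(1)[OF W]] by auto
  moreover have "\<forall>W1. ?P W1 \<longrightarrow> tdim W1 \<le> tdim W" by auto
  ultimately obtain W1 where W1: "?P W1" and max: "\<And>W2. ?P W2 \<Longrightarrow> tdim W2 \<le> tdim W1"
    using ex_has_greatest_nat[of ?P "\<lambda>_. {0}" tdim "Suc (tdim W)"] by (metis (no_types, lifting) less_Suc_eq_le less_imp_le_nat)
  have "\<exists>m f. m \<in> W1 X \<and> arr C f X V \<and> w = m + Act M f y"
    if V: "V \<in> T" and y: "y \<in> W V" "y \<notin> W1 V" and X: "X \<in> T" and w: "w \<in> W X" for V y X w
  proof -
    have yM: "y \<in> Val M V" using subD(2)[OF W V y(1)] .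
    define G where "G = (\<lambda>X. {m + Act M f y | m f. m \<in> W1 X \<and> arr C f X V})"
    have sW1: "sub W1" using W1 by blast
    have G: "sub G" unfolding G_def using sub_generated[OF _ V yM] W1 by blast
    have GW: "G X \<subseteq> W X" if X: "X \<in> T" for X
      using W1 X subD(3)[OF W X V _ y(1)] vs.subspace_add[OF subD(1)[OF W X]] unfolding G_def by blast
    have W1G: "W1 X \<subseteq> G X" if X: "X \<in> T" for X
    proof
      fix m assume "m \<in> W1 X"
      moreover have "m = m + Act M 0 y" using act_zero_arr[OF X V yM] by simp
      ultimately show "m \<in> G X" unfolding G_def using arr_zero[OF T_ob[OF X] T_ob[OF V]] by blast
    qed
    have "y = 0 + Act M (idm C V) y" using act_id[OF V yM] by simp
    then have "y \<in> G V" unfolding G_def using vs.subspace_0[OF subD(1)[OF sW1 V]] arr_id[OF T_ob[OF V]] by blast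
    then have "\<not> tdim G \<le> tdim W1" using tdim_mono(2)[OF sW1 G W1G _ V] y(2) by blast
    then have "\<not> tdim G < tdim W" using max[of G] G GW by blast
    then have "W X = G X" using tdim_mono(2)[OF G W GW _ X] by simp
    then show ?thesis using w unfolding G_def by blast
  qed
  then show ?thesis using W1 by blast
qed

text \<open>The element \<open>x\<close> gives a map from Hom(-,U) onto W/W1, whose kernel consists
  of the maps that send \<open>x\<close> into \<open>W1\<close>. A single deflation \<open>q\<close>
  covers this kernel: the exchange conflation accounts for the maps from other indecomposables, and
  finitely many endomorphisms of \<open>U\<close> are adjoined to it.\<close>

lemma simple_top_presentation:
  assumes W: "sub W" and W1: "sub W1" and U: "U \<in> supp" and x: "x \<in> W U" "x \<notin> W1 U"
    and gen: "\<And>V y X w. V \<in> T \<Longrightarrow> y \<in> W V \<Longrightarrow> y \<notin> W1 V \<Longrightarrow> X \<in> T \<Longrightarrow> w \<in> W X \<Longrightarrow>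
       \<exists>m f. m \<in> W1 X \<and> arr C f X V \<and> w = m + Act M f y"
  shows "\<exists>Y R d k q. Real C Y R U d k q \<and> R \<in> T \<and> Act M q x \<in> W1 R \<and>
    (\<forall>X\<in>T. \<forall>f. arr C f X U \<longrightarrow> Act M f x \<in> W1 X \<longrightarrow> (\<exists>g. arr C g X R \<and> f = q \<cdot> g))"
proof -
  note u = supp(2-4)[OF U]
  have loc: "local_ob U" using I_local[OF u(1)] .
  have oU: "U \<in> Ob C" using loc by blast
  have xM: "x \<in> Val M U" using subD(2)[OF W u(2) x(1)] .
  have iso_out: "\<not> is_iso C U U f" if f: "arr C f U U" "Act M f x \<in> W1 U" for f
  proof
    assume "is_iso C U U f"
    then obtain g where g: "arr C g U U" "f \<cdot> g = idm C U" using iso_inverse oU by metis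
    have "x = Act M g (Act M f x)" using act_comp[OF u(2,2,2) g(1) f(1) xM] g(2) act_id[OF u(2) xM] by simp
    then show False using subD(3)[OF W1 u(2,2) g(1) f(2)] x(2) by simp
  qed
  \<comment> \<open>Radical maps send \<open>x\<close> into \<open>W1\<close>. Otherwise the image
    would generate \<open>x\<close> modulo \<open>W1\<close>, giving \<open>g\<close> for which
    \<open>idm C U - f \<cdot> g\<close> sends \<open>x\<close> into \<open>W1\<close>; as
    \<open>f \<cdot> g\<close> is a non-unit, this map is invertible and would bring
    \<open>x\<close> itself into \<open>W1\<close>.\<close>
  have key: "Act M f x \<in> W1 V" if V: "V \<in> I" and f: "arr C f V U" and ni: "V = U \<Longrightarrow> \<not> is_iso C U U f" for V f
  proof (rule ccontr)
    assume n: "Act M f x \<notin> W1 V"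
    have VT: "V \<in> T" using I_sub V by blast
    have "Act M f x \<in> W V" using subD(3)[OF W VT u(2) f x(1)] .
    then obtain m g where mg: "m \<in> W1 U" "arr C g U V" "x = m + Act M g (Act M f x)"
      using gen[OF VT _ n u(2) x(1)] by blast
    have fg: "arr C (f \<cdot> g) U U" using arr_comp[OF mg(2) f] .
    have nu: "\<not> is_iso C U U (f \<cdot> g)"
    proof
      assume i: "is_iso C U U (f \<cdot> g)"
      then have "is_iso C U V g" using split_mono_nonlocal[OF mg(2) f i loc] I_local[OF V] by blast
      then have "U = V" using I_isomorphic_eq[OF u(1) V] unfolding isomorphic_def by blast
      moreover obtain h where h: "arr C h V U" "g \<cdot> h = idm C V" "is_iso C V U h"
        using iso_inverse[OF \<open>is_iso C U V g\<close> oU T_ob[OF VT]] by blast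
      have "(f \<cdot> g) \<cdot> h = f" using assoc[OF h(1) mg(2) f] h(2) id_right[OF f] by simp
      then have "is_iso C V U f" using iso_comp[OF h(3) i T_ob[OF VT] oU oU] by simp
      ultimately show False using ni by simp
    qed
    have "f \<cdot> g \<in> Hom C U U" using fg by (simp add: arr_def)
    then have "is_iso C U U (idm C U - f \<cdot> g)" using loc nu unfolding local_endomorphism_ring_def by blast
    moreover have "Act M (idm C U - f \<cdot> g) x = x - Act M g (Act M f x)"
      using act_diff_arr[OF u(2,2) arr_id[OF oU] fg xM] act_id[OF u(2) xM] act_comp[OF u(2) VT u(2) mg(2) f xM] by simp
    moreover have "x - Act M g (Act M f x) = m" using mg(3) by (metis add_diff_cancel_right')
    ultimately show False using iso_out[OF arr_diff[OF arr_id[OF oU] fg]] mg(1) by simp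
  qed
  obtain T' P d0 x0 q0 where P: "Real C T' P U d0 x0 q0" "P \<in> T" "\<And>g. arr C g U P \<Longrightarrow> \<not> is_iso C U U (q0 \<cdot> g)"
    "\<And>V f. V \<in> I \<Longrightarrow> V \<noteq> U \<Longrightarrow> arr C f V U \<Longrightarrow> \<exists>g. arr C g V P \<and> f = q0 \<cdot> g"
    using mutable_approximation[OF u(1,3)] by blast
  note r = RealD[OF P(1)]
  have q0: "Act M q0 x \<in> W1 P"
  proof -
    obtain Xs \<iota> \<pi> where Xs: "set Xs \<subseteq> I" "direct_sum_via C Xs P \<iota> \<pi>" using T_decompose[OF P(2)] by blast
    note z = direct_sum_viaD[OF Xs(2)]
    show ?thesis
    proof (rule sub_decompose[OF W1 P(2) Xs act_in[OF P(2) u(2) r(3) xM]])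
      fix i assume i: "i < length Xs"
      have iI: "Xs ! i \<in> I" using i Xs(1) by auto
      have "Act M (q0 \<cdot> \<iota> i) x \<in> W1 (Xs ! i)" using key[OF iI arr_comp[OF z(3)[OF i] r(3)]] P(3)[of "\<iota> i"] z(3)[OF i] by auto
      then show "Act M (\<iota> i) (Act M q0 x) \<in> W1 (Xs ! i)"
        using act_comp[OF I_sub(1)[OF iI] P(2) u(2) z(3)[OF i] r(3) xM] by simp
    qed
  qed
  \<comment> \<open>The endomorphisms in the kernel. Modulo those that factor through
    \<open>q0\<close> they embed into the finite-dimensional space Ext(U,T'), by pulling
    \<open>d0\<close> back, so a finite set \<open>F\<close> of them suffices.\<close>
  define N where "N = {f \<in> Hom C U U. Act M f x \<in> W1 U}"
  have NI: "f \<in> N \<longleftrightarrow> arr C f U U \<and> Act M f x \<in> W1 U" for f using oU by (simp add: N_def arr_def)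
  have Nsub: "hom.subspace N"
  proof (rule hom.subspaceI)
    show "0 \<in> N" using NI arr_zero[OF oU oU] act_zero_arr[OF u(2,2) xM] vs.subspace_0[OF subD(1)[OF W1 u(2)]] by simp
    show "f + g \<in> N" if "f \<in> N" "g \<in> N" for f g
      using that NI arr_add[of f U U g] act_add_arr[OF u(2,2) _ _ xM, of f g] vs.subspace_add[OF subD(1)[OF W1 u(2)]] by simp
    show "scal C c f \<in> N" if "f \<in> N" for c f
      using that NI arr_scale[of f U U c] act_scale_arr[OF u(2,2) _ xM, of f c] vs.subspace_scale[OF subD(1)[OF W1 u(2)]] by simp
  qed
  interpret he: vector_space_pair "scal C" "escal C" ..
  have lin: "linear_map_on (scal C) N (escal C) (Ext C U T') (\<lambda>c. pull C c d0)"
    using pull_linear_arrow[of U U T' d0] r(1) oU r(4) unfolding semilinear_on_def N_def exte_def by blast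
  obtain B where B: "finite B" "B \<subseteq> (\<lambda>c. pull C c d0) ` N" "ext.span B = (\<lambda>c. pull C c d0) ` N"
    using ext.fin_basis[OF he.lin_image_subspace[OF lin Nsub]]
      ext.fin_dim_subspace(1)[OF he.lin_image_subspace[OF lin Nsub] _ ext_subspace[OF oU r(4)] fin_dim_ext[OF oU r(4)]]
      linear_map_onD(1)[OF lin] by blast
  obtain F where F: "F \<subseteq> N" "finite F" "B = (\<lambda>c. pull C c d0) ` F"
    using finite_subset_image[OF B(1,2)] by metis
  \<comment> \<open>The elements of \<open>F\<close> are adjoined one by one; each enlarges the
    source of the deflation by a copy of \<open>U\<close>, and the earlier factorisations survive
    through the first summand.\<close>
  have ext_step: "\<exists>Y R d k q. Real C Y R U d k q \<and> R \<in> T \<and> Act M q x \<in> W1 R \<and> (\<exists>g. arr C g P R \<and> q0 = q \<cdot> g) \<and>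
      (\<forall>f\<in>F. \<exists>g. arr C g U R \<and> f = q \<cdot> g)" if "finite F" "F \<subseteq> N" for F
    using that
  proof (induction F rule: finite_induct)
    case empty
    have "q0 = q0 \<cdot> idm C P" using id_right[OF r(3)] by simp
    then show ?case using P(1,2) q0 arr_id[OF r(5)] by blast
  next
    case (insert f F)
    obtain Y R d k q where R: "Real C Y R U d k q" "R \<in> T" "Act M q x \<in> W1 R" "\<exists>g. arr C g P R \<and> q0 = q \<cdot> g"
      "\<forall>f\<in>F. \<exists>g. arr C g U R \<and> f = q \<cdot> g" using insert by blast
    have f: "arr C f U U" "Act M f x \<in> W1 U" using insert.prems NI by auto
    note rr = RealD[OF R(1)]
    obtain S i j a t where S: "biprod C R U S i j a t" using biprod_exists[OF rr(5) oU] by blast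
    note sb = biprodD[OF S]
    have ST: "S \<in> T" using T_biprod[OF S] R(2) u(2) by blast
    obtain Y' \<epsilon> h where Y': "Real C Y' S U \<epsilon> h (q \<cdot> a + f \<cdot> t)" using deflation_extend[OF R(1) f(1) S] by blast
    note mo = biprod_map_out[OF S rr(3) f(1)]
    have "Act M (q \<cdot> a + f \<cdot> t) x = Act M a (Act M q x) + Act M t (Act M f x)"
      using act_add_arr[OF ST u(2) arr_comp[OF sb(3) rr(3)] arr_comp[OF sb(4) f(1)] xM]
        act_comp[OF ST R(2) u(2) sb(3) rr(3) xM] act_comp[OF ST u(2,2) sb(4) f(1) xM] by simp
    then have 1: "Act M (q \<cdot> a + f \<cdot> t) x \<in> W1 S"
      using subD(3)[OF W1 ST R(2) sb(3) R(3)] subD(3)[OF W1 ST u(2) sb(4) f(2)] vs.subspace_add[OF subD(1)[OF W1 ST]] by simp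
    have fac: "\<exists>g'. arr C g' V S \<and> q \<cdot> g = (q \<cdot> a + f \<cdot> t) \<cdot> g'" if g: "arr C g V R" for g V
      using assoc[OF g sb(1) mo(1)] mo(2) arr_comp[OF g sb(1)] by metis
    have 2: "\<exists>g. arr C g P S \<and> q0 = (q \<cdot> a + f \<cdot> t) \<cdot> g" using R(4) fac by metis
    have 3: "\<exists>g. arr C g U S \<and> f' = (q \<cdot> a + f \<cdot> t) \<cdot> g" if "f' \<in> insert f F" for f'
      using that R(5) fac mo(3) sb(2) by (metis insert_iff)
    show ?case using Y' ST 1 2 3 by blast
  qed
  obtain Y R d k q where R: "Real C Y R U d k q" "R \<in> T" "Act M q x \<in> W1 R" "\<exists>g. arr C g P R \<and> q0 = q \<cdot> g"
    "\<forall>f\<in>F. \<exists>g. arr C g U R \<and> f = q \<cdot> g" using ext_step[OF F(2,1)] by blast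
  note rr = RealD[OF R(1)]
  obtain g0 where g0: "arr C g0 P R" "q0 = q \<cdot> g0" using R(4) by blast
  have via_P: "\<exists>g. arr C g V R \<and> q0 \<cdot> h = q \<cdot> g" if h: "arr C h V P" for h V
    using assoc[OF h g0(1) rr(3)] g0 arr_comp[OF h g0(1)] by metis
  have on_I: "\<exists>g. arr C g V R \<and> f = q \<cdot> g" if V: "V \<in> I" and f: "arr C f V U" "Act M f x \<in> W1 V" for V f
  proof (cases "V = U")
    case False
    then obtain h where h: "arr C h V P" "f = q0 \<cdot> h" using P(4)[OF V _ f(1)] by blast
    then show ?thesis using via_P[OF h(1)] by simp
  next
    case True
    \<comment> \<open>The pull-back of \<open>d0\<close> along \<open>f\<close> agrees with that
      along some \<open>q \<cdot> g\<close>, so the difference lifts along \<open>q0\<close>, and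
      \<open>q0\<close> itself factors through \<open>q\<close>.\<close>
    then have "f \<in> N" using f NI by simp
    then have "pull C f d0 \<in> ext.span B" using B(3) by blast
    then have "pull C f d0 \<in> ext.span ((\<lambda>c. pull C c d0) ` F)" using F(3) by simp
    moreover have "ext.span ((\<lambda>c. pull C c d0) ` F) \<subseteq> {pull C (q \<cdot> g) d0 | g. arr C g U R}"
    proof (rule ext.span_minimal)
      show "(\<lambda>c. pull C c d0) ` F \<subseteq> {pull C (q \<cdot> g) d0 | g. arr C g U R}"
      proof
        fix b assume "b \<in> (\<lambda>c. pull C c d0) ` F"
        then obtain f where "f \<in> F" "b = pull C f d0" by blast
        then show "b \<in> {pull C (q \<cdot> g) d0 | g. arr C g U R}" using R(5) by auto
      qed
      show "ext.subspace {pull C (q \<cdot> g) d0 | g. arr C g U R}"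
      proof (rule ext.subspaceI)
        have "0 = pull C (q \<cdot> 0) d0" using comp_zero_right[OF oU rr(3)] pull_zero_arr[OF r(1) oU] by simp
        then show "0 \<in> {pull C (q \<cdot> g) d0 | g. arr C g U R}" using arr_zero[OF oU rr(5)] by blast
      next
        fix a b assume "a \<in> {pull C (q \<cdot> g) d0 | g. arr C g U R}" "b \<in> {pull C (q \<cdot> g) d0 | g. arr C g U R}"
        then obtain g h where gh: "arr C g U R" "arr C h U R" "a = pull C (q \<cdot> g) d0" "b = pull C (q \<cdot> h) d0" by blast
        have "a + b = pull C (q \<cdot> (g + h)) d0"
          using gh comp_add_right[OF gh(1,2) rr(3)] pull_add_arr[OF r(1) arr_comp[OF gh(1) rr(3)] arr_comp[OF gh(2) rr(3)]] by simp
        then show "a + b \<in> {pull C (q \<cdot> g) d0 | g. arr C g U R}" using arr_add[OF gh(1,2)] by blast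
      next
        fix c a assume "a \<in> {pull C (q \<cdot> g) d0 | g. arr C g U R}"
        then obtain g where g: "arr C g U R" "a = pull C (q \<cdot> g) d0" by blast
        have "escal C c a = pull C (q \<cdot> scal C c g) d0"
          using g comp_scale_right[OF g(1) rr(3)] pull_scale_arr[OF r(1) arr_comp[OF g(1) rr(3)]] by simp
        then show "escal C c a \<in> {pull C (q \<cdot> g) d0 | g. arr C g U R}" using arr_scale[OF g(1)] by blast
      qed
    qed
    ultimately obtain g where g: "arr C g U R" "pull C f d0 = pull C (q \<cdot> g) d0" by blast
    have af: "arr C f U U" using f True by simp
    have qg: "arr C (q \<cdot> g) U U" using arr_comp[OF g(1) rr(3)] .
    have "pull C (f - q \<cdot> g) d0 = 0" using pull_diff_arr[OF r(1) af qg] g(2) by simp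
    then obtain h where h: "arr C h U P" "q0 \<cdot> h = f - q \<cdot> g" using factor_deflation[OF P(1) arr_diff[OF af qg]] by blast
    obtain g' where g': "arr C g' U R" "q0 \<cdot> h = q \<cdot> g'" using via_P[OF h(1)] by blast
    have "f = q \<cdot> (g + g')" using comp_add_right[OF g(1) g'(1) rr(3)] g'(2) h(2) by (simp add: diff_eq_eq add.commute)
    then show ?thesis using arr_add[OF g(1) g'(1)] True by blast
  qed
  have "\<exists>g. arr C g X R \<and> f = q \<cdot> g" if X: "X \<in> T" and f: "arr C f X U" "Act M f x \<in> W1 X" for X f
  proof -
    obtain Xs \<iota> \<pi> where Xs: "set Xs \<subseteq> I" "direct_sum_via C Xs X \<iota> \<pi>" using T_decompose[OF X] by blast
    note z = direct_sum_viaD[OF Xs(2)]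
    have "\<forall>i<length Xs. \<exists>g. arr C g (Xs ! i) R \<and> f \<cdot> \<iota> i = q \<cdot> g"
    proof (intro allI impI)
      fix i assume i: "i < length Xs"
      have iI: "Xs ! i \<in> I" using i Xs(1) by auto
      have "Act M (f \<cdot> \<iota> i) x \<in> W1 (Xs ! i)"
        using act_comp[OF I_sub(1)[OF iI] X u(2) z(3)[OF i] f(1) xM] subD(3)[OF W1 I_sub(1)[OF iI] X z(3)[OF i] f(2)] by simp
      then show "\<exists>g. arr C g (Xs ! i) R \<and> f \<cdot> \<iota> i = q \<cdot> g" using on_I[OF iI arr_comp[OF z(3)[OF i] f(1)]] by blast
    qed
    then obtain g where g: "\<And>i. i < length Xs \<Longrightarrow> arr C (g i) (Xs ! i) R \<and> f \<cdot> \<iota> i = q \<cdot> g i" by metis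
    have gi: "arr C (g i) (Xs ! i) R" if "i < length Xs" for i using g that by blast
    have gp: "arr C (g i \<cdot> \<pi> i) X R" if "i < length Xs" for i using arr_comp[OF z(4) gi] that by blast
    have "f = (\<Sum>i<length Xs. (f \<cdot> \<iota> i) \<cdot> \<pi> i)" using direct_sum_decompose[OF Xs(2) f(1)] .
    also have "\<dots> = (\<Sum>i<length Xs. q \<cdot> (g i \<cdot> \<pi> i))"
      using g assoc[OF z(4) gi rr(3)] by (intro sum.cong) auto
    also have "\<dots> = q \<cdot> (\<Sum>i<length Xs. g i \<cdot> \<pi> i)"
      using comp_sum_right[OF z(1) rr(3), of "{..<length Xs}" "\<lambda>i. g i \<cdot> \<pi> i"] gp by simp
    finally show ?thesis using arr_sum[OF z(1) rr(5), of "{..<length Xs}" "\<lambda>i. g i \<cdot> \<pi> i"] gp by auto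
  qed
  then show ?thesis using R by blast
qed

end

context fd_tmodule
begin

lemma models_bij:
  assumes "models X W \<alpha>" "V \<in> T"
  shows "exte C e V X \<Longrightarrow> \<alpha> V e \<in> W V" "exte C e V X \<Longrightarrow> exte C e' V X \<Longrightarrow> \<alpha> V e = \<alpha> V e' \<Longrightarrow> e = e'"
    "w \<in> W V \<Longrightarrow> \<exists>e. exte C e V X \<and> \<alpha> V e = w"
    "exte C e V X \<Longrightarrow> exte C e' V X \<Longrightarrow> \<alpha> V (e + e') = \<alpha> V e + \<alpha> V e'"
    "exte C e V X \<Longrightarrow> \<alpha> V (escal C a e) = s a (\<alpha> V e)"
proof -
  have b: "bij_betw (\<alpha> V) (Ext C V X) (W V)" and l: "linear_map_on (escal C) (Ext C V X) s (W V) (\<alpha> V)"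
    and X: "X \<in> Ob C" using assms unfolding models_def by auto
  show "exte C e V X \<Longrightarrow> \<alpha> V e \<in> W V" using linear_map_onD(1)[OF l] by (simp add: exte_def)
  show "exte C e V X \<Longrightarrow> exte C e' V X \<Longrightarrow> \<alpha> V e = \<alpha> V e' \<Longrightarrow> e = e'"
    using b by (auto simp: exte_def bij_betw_def inj_on_def)
  show "w \<in> W V \<Longrightarrow> \<exists>e. exte C e V X \<and> \<alpha> V e = w"
    using bij_betw_imp_surj_on[OF b] T_ob[OF assms(2)] X by (force simp: exte_def)
  show "exte C e V X \<Longrightarrow> exte C e' V X \<Longrightarrow> \<alpha> V (e + e') = \<alpha> V e + \<alpha> V e'"
    using linear_map_onD(2)[OF l] by (simp add: exte_def)
  show "exte C e V X \<Longrightarrow> \<alpha> V (escal C a e) = s a (\<alpha> V e)"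
    using linear_map_onD(3)[OF l] by (simp add: exte_def)
qed

lemma models_nat:
  "models X W \<alpha> \<Longrightarrow> V \<in> T \<Longrightarrow> V' \<in> T \<Longrightarrow> arr C f V V' \<Longrightarrow> exte C e V' X \<Longrightarrow> \<alpha> V (pull C f e) = Act M f (\<alpha> V' e)"
  unfolding models_def by blast

text \<open>The realising object is the kernel of the deflation \<open>Z \<rightarrow> R \<rightarrow> U\<close>, where \<open>Z\<close> is the
  extension of \<open>R\<close> by \<open>X1\<close> classified by the image of the generator \<open>x\<close>.\<close>

lemma models_extension:
  assumes W: "sub W" and W1: "sub W1" "\<And>X. X \<in> T \<Longrightarrow> W1 X \<subseteq> W X" and U: "U \<in> T" and x: "x \<in> W U"
    and R: "Real C Y R U d k q" "R \<in> T" "Act M q x \<in> W1 R"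
    and ker: "\<And>X f. X \<in> T \<Longrightarrow> arr C f X U \<Longrightarrow> Act M f x \<in> W1 X \<Longrightarrow> \<exists>g. arr C g X R \<and> f = q \<cdot> g"
    and gen: "\<And>X w. X \<in> T \<Longrightarrow> w \<in> W X \<Longrightarrow> \<exists>m f. m \<in> W1 X \<and> arr C f X U \<and> w = m + Act M f x"
    and m1: "models X1 W1 \<alpha>1"
  shows "\<exists>X \<alpha>. models X W \<alpha>"
proof -
  note r = RealD[OF R(1)]
  have oX1: "X1 \<in> Ob C" using m1 unfolding models_def by blast
  have xM: "x \<in> Val M U" using subD(2)[OF W U x] .
  obtain e where e: "exte C e R X1" "\<alpha>1 R e = Act M q x" using models_bij(3)[OF m1 R(2,3)] by blast
  obtain Z u v where Z: "Real C X1 Z R e u v" using realise[OF e(1)] by blast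
  obtain X d1 e1 \<epsilon> h where X: "arr C d1 X Y" "arr C e1 X1 X" "Real C X Z U \<epsilon> h (q \<cdot> v)"
    "Real C X1 X Y (pull C k e) e1 d1" "push C d1 \<epsilon> = d" "pull C q \<epsilon> = push C e1 e"
    using deflation_octahedron[OF R(1) Z] by blast
  note x3 = RealD[OF X(3)] and x4 = RealD[OF X(4)]
  have oX: "X \<in> Ob C" using x3 by blast
  \<comment> \<open>Pairs of a map \<open>f\<close> from \<open>V\<close> to \<open>U\<close> and a
    class \<open>m\<close> by \<open>X1\<close> parametrise both E X, through
    \<open>\<Theta>\<close>, and \<open>W\<close>, through \<open>\<Psi>\<close>. The isomorphism
    arises because both parametrisations are onto with the same kernel.\<close>
  define \<Theta> where "\<Theta> f m = pull C f \<epsilon> + push C e1 m" for f m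
  define \<Psi> where "\<Psi> V f m = Act M f x + \<alpha>1 V m" for V f m
  have Tin: "exte C (\<Theta> f m) V X" if "arr C f V U" "exte C m V X1" for f m V
    unfolding \<Theta>_def using exte_add[OF exte_pull[OF x3(1) that(1)] exte_push[OF that(2) X(2)]] .
  have Pin: "\<Psi> V f m \<in> W V" if "V \<in> T" "arr C f V U" "exte C m V X1" for f m V
    unfolding \<Psi>_def using vs.subspace_add[OF subD(1)[OF W that(1)] subD(3)[OF W that(1) U that(2) x]]
      W1(2)[OF that(1)] models_bij(1)[OF m1 that(1,3)] by blast
  have Tsurj: "\<exists>f m. arr C f V U \<and> exte C m V X1 \<and> \<Theta> f m = a" if V: "V \<in> T" and a: "exte C a V X" for V a
  proof -
    obtain f where f: "arr C f V U" "pull C f d = push C d1 a"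
      using ext_exists_pull[OF R(1) exte_push[OF a X(1)]] T_ext[OF _ V R(2)] by blast
    have fe: "exte C (pull C f \<epsilon>) V X" using exte_pull[OF x3(1) f(1)] .
    have "push C d1 (a - pull C f \<epsilon>) = 0"
      using push_diff[OF a fe X(1)] push_pull_commute[OF x3(1) X(1) f(1)] X(5) f(2) by simp
    then obtain m where m: "exte C m V X1" "push C e1 m = a - pull C f \<epsilon>"
      using ext_exact_middle_push[OF X(4) exte_diff[OF a fe]] by blast
    then show ?thesis using f(1) unfolding \<Theta>_def by (metis add.commute diff_add_cancel)
  qed
  have Psurj: "\<exists>f m. arr C f V U \<and> exte C m V X1 \<and> \<Psi> V f m = w" if V: "V \<in> T" and w: "w \<in> W V" for V w
  proof -
    obtain n f where f: "n \<in> W1 V" "arr C f V U" "w = n + Act M f x" using gen[OF V w] by blast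
    obtain m where "exte C m V X1" "\<alpha>1 V m = n" using models_bij(3)[OF m1 V f(1)] by blast
    then show ?thesis using f unfolding \<Psi>_def by (metis add.commute)
  qed
  have neg: "\<alpha>1 V (- m) = - \<alpha>1 V m" if "V \<in> T" "exte C m V X1" for V m
    using models_bij(5)[OF m1 that, of "- 1"] by simp
  have diffm: "\<alpha>1 V (m - m') = \<alpha>1 V m - \<alpha>1 V m'" if "V \<in> T" "exte C m V X1" "exte C m' V X1" for V m m'
    using models_bij(4)[OF m1 that(1,2) exte_neg[OF that(3)]] neg[OF that(1,3)] by simp
  have zero1: "\<alpha>1 V m = 0 \<Longrightarrow> m = 0" if "V \<in> T" "exte C m V X1" for V m
    using models_bij(2)[OF m1 that(1,2) exte_zero[OF T_ob[OF that(1)] oX1]] diffm[OF that that(2)] by simp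
  \<comment> \<open>In either case of vanishing, \<open>f\<close> factors as
    \<open>q \<cdot> g\<close>. Then both values are images of the single class
    \<open>pull C g e + m\<close>, and each of them vanishes exactly when this class does.\<close>
  have eq0: "\<Theta> f m = 0 \<longleftrightarrow> \<Psi> V f m = 0" if V: "V \<in> T" and f: "arr C f V U" and m: "exte C m V X1" for V f m
  proof -
    have oV: "V \<in> Ob C" using T_ob[OF V] .
    have both: "\<Theta> f m = 0 \<and> \<Psi> V f m = 0"
      if g: "arr C g V R" "f = q \<cdot> g" and h: "\<Theta> f m = 0 \<or> \<Psi> V f m = 0" for g
    proof -
      have ge: "exte C (pull C g e) V X1" using exte_pull[OF e(1) g(1)] .
      have sum: "exte C (pull C g e + m) V X1" using exte_add[OF ge m] .
      have t: "\<Theta> f m = push C e1 (pull C g e + m)"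
        unfolding \<Theta>_def using g(2) pull_pull[OF x3(1) r(3) g(1)] X(6) push_pull_commute[OF e(1) X(2) g(1)]
          push_add[OF ge m X(2)] by simp
      have p: "\<Psi> V f m = \<alpha>1 V (pull C g e + m)"
        unfolding \<Psi>_def using g(2) act_comp[OF V R(2) U g(1) r(3) xM] e(2) models_nat[OF m1 V R(2) g(1) e(1)]
          models_bij(4)[OF m1 V ge m] by simp
      have "pull C g e + m = 0" if "\<Theta> f m = 0"
      proof -
        have "push C e1 (pull C g e + m) = 0" using t that by simp
        from ext_exact_pull[OF X(4) sum this]
        \<comment> \<open>A class that dies in \<open>X\<close> comes from a map \<open>l\<close> to
          the kernel \<open>Y\<close> of \<open>q\<close>; its image in \<open>W1\<close> is then
          the action of \<open>q \<cdot> k \<cdot> l\<close> on \<open>x\<close>, which is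
          0.\<close>
        obtain l where l: "arr C l V Y" "pull C l (pull C k e) = pull C g e + m" by blast
        have kl: "arr C (k \<cdot> l) V R" using arr_comp[OF l(1) r(2)] .
        have "\<alpha>1 V (pull C g e + m) = Act M (k \<cdot> l) (Act M q x)"
          using l(2) pull_pull[OF e(1) r(2) l(1)] models_nat[OF m1 V R(2) kl e(1)] e(2) by simp
        also have "\<dots> = Act M ((q \<cdot> k) \<cdot> l) x"
          using act_comp[OF V R(2) U kl r(3) xM] assoc[OF l(1) r(2,3)] by simp
        also have "\<dots> = 0" using real_comp_zero[OF R(1)] comp_zero_left[OF r(6) l(1)] act_zero_arr[OF V U xM] by simp
        finally show ?thesis using zero1[OF V sum] by blast
      qed
      moreover have "pull C g e + m = 0" if "\<Psi> V f m = 0" using zero1[OF V sum] p that by simp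
      moreover have "\<Theta> f m = 0 \<and> \<Psi> V f m = 0" if "pull C g e + m = 0"
      proof -
        have "\<alpha>1 V 0 = 0" using models_bij(4)[OF m1 V exte_zero[OF oV oX1] exte_zero[OF oV oX1]] by simp
        then show ?thesis using t p that push_zero[OF oV X(2)] by simp
      qed
      ultimately show ?thesis using h by blast
    qed
    have "\<exists>g. arr C g V R \<and> f = q \<cdot> g" if "\<Theta> f m = 0"
    proof -
      have "push C d1 (push C e1 m) = 0"
        using push_push[OF m X(2,1)] real_comp_zero[OF X(4)] push_zero_arr[OF m r(4)] by simp
      then have "push C d1 (\<Theta> f m) = pull C f d"
        unfolding \<Theta>_def using push_add[OF exte_pull[OF x3(1) f] exte_push[OF m X(2)] X(1)]
          push_pull_commute[OF x3(1) X(1) f] X(5) by simp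
      then have "pull C f d = 0" using that push_zero[OF oV X(1)] by simp
      then show ?thesis using factor_deflation[OF R(1) f] by blast
    qed
    moreover have "\<exists>g. arr C g V R \<and> f = q \<cdot> g" if "\<Psi> V f m = 0"
    proof -
      have "Act M f x = \<alpha>1 V (- m)" using that neg[OF V m] unfolding \<Psi>_def by (metis add_eq_0_iff2)
      then have "Act M f x \<in> W1 V" using models_bij(1)[OF m1 V exte_neg[OF m]] by simp
      then show ?thesis using ker[OF V f] by blast
    qed
    ultimately have fac: "\<exists>g. arr C g V R \<and> f = q \<cdot> g" if "\<Theta> f m = 0 \<or> \<Psi> V f m = 0" using that by (elim disjE)
    have "\<Theta> f m = 0 \<and> \<Psi> V f m = 0" if z: "\<Theta> f m = 0 \<or> \<Psi> V f m = 0"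
    proof -
      obtain g where g: "arr C g V R" "f = q \<cdot> g" using fac[OF z] by (elim exE conjE)
      show ?thesis by (rule both[OF g z])
    qed
    then show ?thesis by argo
  qed
  have Tdiff: "\<Theta> (f - f') (m - m') = \<Theta> f m - \<Theta> f' m'"
    if "arr C f V U" "exte C m V X1" "arr C f' V U" "exte C m' V X1" for V f m f' m'
    unfolding \<Theta>_def using pull_diff_arr[OF x3(1) that(1,3)] push_diff[OF that(2,4) X(2)] by simp
  have Pdiff: "\<Psi> V (f - f') (m - m') = \<Psi> V f m - \<Psi> V f' m'"
    if "V \<in> T" "arr C f V U" "exte C m V X1" "arr C f' V U" "exte C m' V X1" for V f m f' m'
    unfolding \<Psi>_def using act_diff_arr[OF that(1) U that(2,4) xM] diffm[OF that(1,3,5)] by simp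
  have eq: "\<Theta> f m = \<Theta> f' m' \<longleftrightarrow> \<Psi> V f m = \<Psi> V f' m'"
    if V: "V \<in> T" and a: "arr C f V U" "exte C m V X1" "arr C f' V U" "exte C m' V X1" for V f m f' m'
    using eq0[OF V arr_diff[OF a(1,3)] exte_diff[OF a(2,4)]] Tdiff[OF a] Pdiff[OF V a] by simp
  \<comment> \<open>Well defined and injective by \<open>eq\<close>, which says that two pairs have
    equal images under \<open>\<Theta>\<close> if and only if they do under
    \<open>\<Psi>\<close>.\<close>
  define \<alpha> where "\<alpha> V a = (THE w. \<exists>f m. arr C f V U \<and> exte C m V X1 \<and> \<Theta> f m = a \<and> w = \<Psi> V f m)" for V a
  have \<alpha>: "\<alpha> V (\<Theta> f m) = \<Psi> V f m" if V: "V \<in> T" and a: "arr C f V U" "exte C m V X1" for V f m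
    unfolding \<alpha>_def
  proof (rule the_equality)
    show "\<exists>f' m'. arr C f' V U \<and> exte C m' V X1 \<and> \<Theta> f' m' = \<Theta> f m \<and> \<Psi> V f m = \<Psi> V f' m'" using a by blast
    fix w assume "\<exists>f' m'. arr C f' V U \<and> exte C m' V X1 \<and> \<Theta> f' m' = \<Theta> f m \<and> w = \<Psi> V f' m'"
    then show "w = \<Psi> V f m" using eq[OF V _ _ a] by blast
  qed
  have "models X W \<alpha>"
    unfolding models_def
  proof (intro conjI ballI allI impI)
    show "X \<in> Ob C" by (rule oX)
    fix V assume V: "V \<in> T"
    have E: "a \<in> Ext C V X \<longleftrightarrow> exte C a V X" for a using T_ob[OF V] oX by (simp add: exte_def)
    show "bij_betw (\<alpha> V) (Ext C V X) (W V)"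
      unfolding bij_betw_def
    proof (intro conjI equalityI subsetI)
      show "inj_on (\<alpha> V) (Ext C V X)"
      proof
        fix a b assume ab: "a \<in> Ext C V X" "b \<in> Ext C V X" "\<alpha> V a = \<alpha> V b"
        obtain f m where f: "arr C f V U" "exte C m V X1" "\<Theta> f m = a" using Tsurj[OF V iffD1[OF E ab(1)]] by blast
        obtain f' m' where f': "arr C f' V U" "exte C m' V X1" "\<Theta> f' m' = b" using Tsurj[OF V iffD1[OF E ab(2)]] by blast
        show "a = b" using eq[OF V f(1,2) f'(1,2)] \<alpha>[OF V f(1,2)] \<alpha>[OF V f'(1,2)] ab(3) f(3) f'(3) by simp
      qed
      fix w
      show "w \<in> W V" if ww: "w \<in> \<alpha> V ` Ext C V X"
      proof -
        obtain a where a: "exte C a V X" "w = \<alpha> V a" using ww E by auto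
        obtain f m where f: "arr C f V U" "exte C m V X1" "\<Theta> f m = a" using Tsurj[OF V a(1)] by blast
        show ?thesis using \<alpha>[OF V f(1,2)] Pin[OF V f(1,2)] a f by simp
      qed
      assume "w \<in> W V"
      then obtain f m where f: "arr C f V U" "exte C m V X1" "\<Psi> V f m = w" using Psurj[OF V] by blast
      show "w \<in> \<alpha> V ` Ext C V X" using \<alpha>[OF V f(1,2)] Tin[OF f(1,2)] f(3) E by (intro image_eqI[of _ _ "\<Theta> f m"]) auto
    qed
    show "linear_map_on (escal C) (Ext C V X) s (W V) (\<alpha> V)"
      unfolding semilinear_on_def
    proof (intro conjI ballI allI)
      fix a assume a: "a \<in> Ext C V X"
      obtain f m where f: "arr C f V U" "exte C m V X1" "\<Theta> f m = a" using Tsurj[OF V iffD1[OF E a]] by blast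
      show "\<alpha> V a \<in> W V" using \<alpha>[OF V f(1,2)] Pin[OF V f(1,2)] f by simp
      show "\<alpha> V (escal C c a) = s (id c) (\<alpha> V a)" for c
      proof -
        have "escal C c a = \<Theta> (scal C c f) (escal C c m)"
          unfolding f(3)[symmetric] \<Theta>_def
          using ext.scale_right_distrib pull_scale_arr[OF x3(1) f(1)] push_scale[OF f(2) X(2)] by simp
        moreover have "\<Psi> V (scal C c f) (escal C c m) = s c (\<Psi> V f m)"
          unfolding \<Psi>_def
          using vs.scale_right_distrib act_scale_arr[OF V U f(1) xM] models_bij(5)[OF m1 V f(2)] by simp
        ultimately show ?thesis using \<alpha>[OF V f(1,2)] \<alpha>[OF V arr_scale[OF f(1)] exte_scale[OF f(2)]] f(3) by simp
      qed
      fix b assume b: "b \<in> Ext C V X"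
      obtain f' m' where f': "arr C f' V U" "exte C m' V X1" "\<Theta> f' m' = b" using Tsurj[OF V iffD1[OF E b]] by blast
      have "a + b = \<Theta> (f + f') (m + m')"
        unfolding f(3)[symmetric] f'(3)[symmetric] \<Theta>_def
        using pull_add_arr[OF x3(1) f(1) f'(1)] push_add[OF f(2) f'(2) X(2)] by (simp add: algebra_simps)
      moreover have "\<Psi> V (f + f') (m + m') = \<Psi> V f m + \<Psi> V f' m'"
        unfolding \<Psi>_def using act_add_arr[OF V U f(1) f'(1) xM] models_bij(4)[OF m1 V f(2) f'(2)] by (simp add: algebra_simps)
      ultimately show "\<alpha> V (a + b) = \<alpha> V a + \<alpha> V b"
        using \<alpha>[OF V f(1,2)] \<alpha>[OF V f'(1,2)] \<alpha>[OF V arr_add[OF f(1) f'(1)] exte_add[OF f(2) f'(2)]] f(3) f'(3) by simp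
    qed
    fix V' g a assume V': "V' \<in> T" and g: "arr C g V V'" and a: "exte C a V' X"
    obtain f m where f: "arr C f V' U" "exte C m V' X1" "\<Theta> f m = a" using Tsurj[OF V' a] by blast
    have 1: "pull C g a = \<Theta> (f \<cdot> g) (pull C g m)"
      unfolding f(3)[symmetric] \<Theta>_def
      using pull_add[OF exte_pull[OF x3(1) f(1)] exte_push[OF f(2) X(2)] g] pull_pull[OF x3(1) f(1) g]
        push_pull_commute[OF f(2) X(2) g] by simp
    have aM: "\<alpha>1 V' m \<in> Val M V'" using models_bij(1)[OF m1 V' f(2)] subD(2)[OF W1(1) V'] by blast
    have 2: "\<Psi> V (f \<cdot> g) (pull C g m) = Act M g (\<Psi> V' f m)"
      unfolding \<Psi>_def
      using act_comp[OF V V' U g f(1) xM] models_nat[OF m1 V V' g f(2)] act_add[OF V V' g act_in[OF V' U f(1) xM] aM] by simp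
    show "\<alpha> V (pull C g a) = Act M g (\<alpha> V' a)"
      using \<alpha>[OF V' f(1,2)] \<alpha>[OF V arr_comp[OF g f(1)] exte_pull[OF f(2) g]] 1 2 f(3) by simp
  qed
  then show ?thesis by blast
qed

lemma models_exist: "sub W \<Longrightarrow> \<exists>X \<alpha>. models X W \<alpha>"
proof (induction "tdim W" arbitrary: W rule: less_induct)
  case (less W)
  show ?case
  proof (cases "tdim W = 0")
    case True
    have fW: "fin_dim s (W U)" if "U \<in> T" for U
      using vs.fin_dim_subspace(1)[OF subD(1)[OF less.prems that] _ val_subspace[OF that] val_fin[OF that]]
        subD(2)[OF less.prems that] by blast
    have WI: "W U \<subseteq> {0}" if U: "U \<in> I" for U
    proof (cases "U \<in> supp")
      case in_supp: True
      then have "vs.dim (W U) = 0" using True supp(1) unfolding tdim_def by simp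
      then show ?thesis using vs.dim_zero_iff[OF subD(1)[OF less.prems] fW] I_sub U by blast
    next
      case False
      then show ?thesis using supp(5)[OF U] subD(2)[OF less.prems] I_sub U by blast
    qed
    have W0: "W V = {0}" if V: "V \<in> T" for V
      using sub_eq_on_I[OF sub_zero less.prems WI V] vs.subspace_0[OF subD(1)[OF less.prems V]] by blast
    obtain N0 where N0: "N0 \<in> Ob C" "idm C N0 = 0" using zero_object_exists by blast
    have E0: "Ext C V N0 = {0}" if "V \<in> T" for V
    proof -
      have "e = 0" if "e \<in> Ext C V N0" for e
      proof -
        have "exte C e V N0" using that T_ob[OF \<open>V \<in> T\<close>] N0 by (simp add: exte_def)
        then show ?thesis using push_ext_id[of e V N0] push_zero_arr[of e V N0 N0] N0 by simp
      qed
      then show ?thesis using ext.subspace_0[OF ext_subspace[OF T_ob[OF that] N0(1)]] by blast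
    qed
    have "models N0 W (\<lambda>_ _. 0)"
      unfolding models_def semilinear_on_def using N0 E0 W0 act_zero by (auto simp: bij_betw_def)
    then show ?thesis by blast
  next
    case False
    obtain W1 where W1: "sub W1" "\<And>X. X \<in> T \<Longrightarrow> W1 X \<subseteq> W X" "tdim W1 < tdim W"
      and gen: "\<And>V y X w. V \<in> T \<Longrightarrow> y \<in> W V \<Longrightarrow> y \<notin> W1 V \<Longrightarrow> X \<in> T \<Longrightarrow> w \<in> W X \<Longrightarrow>
        \<exists>m f. m \<in> W1 X \<and> arr C f X V \<and> w = m + Act M f y"
      using maximal_submodule[OF less.prems] False by blast
    \<comment> \<open>The measure sees only the support, so its strict drop shows at one of the
      indecomposables there; by \<open>supp\<close> this one is not projective and hence
      mutable.\<close>
    have "\<exists>U\<in>supp. \<not> W U \<subseteq> W1 U"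
    proof (rule ccontr)
      assume n: "\<not> ?thesis"
      have "tdim W \<le> tdim W1"
        unfolding tdim_def
      proof (rule sum_mono)
        fix U assume "U \<in> supp"
        then have "W U = W1 U" using n W1(2)[OF supp(3)] by blast
        then show "vs.dim (W U) \<le> vs.dim (W1 U)" by simp
      qed
      then show False using W1(3) by simp
    qed
    then obtain U x where x: "U \<in> supp" "x \<in> W U" "x \<notin> W1 U" by blast
    have UT: "U \<in> T" using supp(3) x by blast
    obtain Y R d k q where R: "Real C Y R U d k q" "R \<in> T" "Act M q x \<in> W1 R"
      "\<And>X f. X \<in> T \<Longrightarrow> arr C f X U \<Longrightarrow> Act M f x \<in> W1 X \<Longrightarrow> \<exists>g. arr C g X R \<and> f = q \<cdot> g"
      using simple_top_presentation[OF less.prems W1(1) x gen] by blast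
    obtain X1 \<alpha>1 where m1: "models X1 W1 \<alpha>1" using less.hyps[OF W1(3,1)] by blast
    show ?thesis
      by (rule models_extension[OF less.prems W1(1,2) UT x(2) R(1,2,3) R(4) gen[OF UT x(2,3)] m1])
  qed
qed

end

section \<open>Extension of scalars\<close>

lemma vector_space_seq: "vector_space (seq_scale :: 'f::field \<Rightarrow> _)"
  by unfold_locales (simp_all add: seq_scale_def fun_eq_iff algebra_simps)

interpretation seq: vector_space "seq_scale :: 'f::field \<Rightarrow> (nat \<Rightarrow> 'f) \<Rightarrow> nat \<Rightarrow> 'f"
  by (rule vector_space_seq)

definition unit_seq :: "nat \<Rightarrow> nat \<Rightarrow> 'f::field" where
  "unit_seq i = (\<lambda>j. if j = i then 1 else 0)"

lemma affine_subspace: "seq.subspace (affine_space n)"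
  by (rule seq.subspaceI) (auto simp: affine_space_def seq_scale_def)

lemma sum_fun_apply: "(\<Sum>i\<in>A. f i) j = (\<Sum>i\<in>A. f i j)"
  by (induction A rule: infinite_finite_induct) simp_all

lemma affine_expansion:
  assumes "w \<in> affine_space n" shows "w = (\<Sum>i<n. seq_scale (w i) (unit_seq i))"
proof
  fix j
  have "(\<Sum>i<n. seq_scale (w i) (unit_seq i)) j = (\<Sum>i<n. if i = j then w i else 0)"
    unfolding sum_fun_apply by (intro sum.cong) (auto simp: seq_scale_def unit_seq_def)
  also have "\<dots> = w j" using assms by (auto simp: affine_space_def sum.delta)
  finally show "w j = (\<Sum>i<n. seq_scale (w i) (unit_seq i)) j" by simp
qed

lemma unit_basis: "is_basis seq_scale (unit_seq ` {..<n}) (affine_space n :: (nat \<Rightarrow> 'f::field) set)"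
  and inj_unit: "inj (unit_seq :: nat \<Rightarrow> nat \<Rightarrow> 'f)"
proof -
  show inj: "inj (unit_seq :: nat \<Rightarrow> nat \<Rightarrow> 'f)"
    by (rule injI) (metis unit_seq_def zero_neq_one)
  have "seq.independent (unit_seq ` {..<n} :: (nat \<Rightarrow> 'f) set)"
  proof
    assume "seq.dependent (unit_seq ` {..<n} :: (nat \<Rightarrow> 'f) set)"
    then obtain u :: "(nat \<Rightarrow> 'f) \<Rightarrow> 'f" and v where u: "v \<in> unit_seq ` {..<n}" "u v \<noteq> 0"
      "(\<Sum>v\<in>unit_seq ` {..<n}. seq_scale (u v) v) = 0"
      using seq.dependent_finite[of "unit_seq ` {..<n}"] by auto
    then obtain j where j: "j < n" "v = unit_seq j" by blast
    have "0 = (\<Sum>i<n. seq_scale (u (unit_seq i)) (unit_seq i)) j"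
      using u(3) sum.reindex[OF inj_on_subset[OF inj], of "{..<n}" "\<lambda>v. seq_scale (u v) v"] by simp
    also have "\<dots> = (\<Sum>i<n. if i = j then u (unit_seq i) else 0)"
      unfolding sum_fun_apply by (intro sum.cong) (auto simp: seq_scale_def unit_seq_def)
    also have "\<dots> = u v" using j by (simp add: sum.delta)
    finally show False using u by simp
  qed
  moreover have "affine_space n \<subseteq> seq.span (unit_seq ` {..<n} :: (nat \<Rightarrow> 'f) set)"
  proof
    fix w :: "nat \<Rightarrow> 'f" assume "w \<in> affine_space n"
    then have "w = (\<Sum>i<n. seq_scale (w i) (unit_seq i))" by (rule affine_expansion)
    also have "\<dots> \<in> seq.span (unit_seq ` {..<n})"
      by (intro seq.span_sum seq.span_scale seq.span_base) auto
    finally show "w \<in> seq.span (unit_seq ` {..<n})" .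
  qed
  moreover have "unit_seq ` {..<n} \<subseteq> (affine_space n :: (nat \<Rightarrow> 'f) set)" by (auto simp: affine_space_def unit_seq_def)
  ultimately show "is_basis seq_scale (unit_seq ` {..<n}) (affine_space n :: (nat \<Rightarrow> 'f) set)"
    unfolding is_basis_def by blast
qed

text \<open>A basis numbered by \<open>{..<n}\<close> together with coordinates written as
  sequences. Extension of scalars then means applying the embedding to every coordinate.\<close>

definition coordinates ::
  "('k::field \<Rightarrow> 'v::ab_group_add \<Rightarrow> 'v) \<Rightarrow> 'v set \<Rightarrow> nat \<Rightarrow> (nat \<Rightarrow> 'v) \<Rightarrow> ('v \<Rightarrow> nat \<Rightarrow> 'k) \<Rightarrow> bool" where
  "coordinates s V n e c \<longleftrightarrow> is_basis s (e ` {..<n}) V \<and> inj_on e {..<n} \<and>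
     (\<forall>v\<in>V. v = (\<Sum>i<n. s (c v i) (e i)) \<and> c v \<in> affine_space n) \<and>
     (\<forall>v\<in>V. \<forall>w\<in>V. c (v + w) = c v + c w) \<and> (\<forall>a. \<forall>v\<in>V. c (s a v) = seq_scale a (c v)) \<and>
     (\<forall>i<n. c (e i) = unit_seq i)"

lemma (in vector_space) coordinates_exist:
  assumes V: "subspace V" "fin_dim scale V" shows "\<exists>n e c. coordinates scale V n e c"
proof -
  obtain B where B: "finite B" "B \<subseteq> V" "independent B" "span B = V" using fin_basis[OF V] by blast
  obtain e where e: "bij_betw e {0..<card B} B" using ex_bij_betw_nat_finite[OF B(1)] by blast
  let ?n = "card B"
  have e': "e ` {..<?n} = B" "inj_on e {..<?n}" using e by (auto simp: bij_betw_def lessThan_atLeast0)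
  define c where "c v i = (if i < ?n then representation B v (e i) else 0)" for v i
  have "v = (\<Sum>i<?n. scale (c v i) (e i))" if "v \<in> V" for v
  proof -
    have "v = (\<Sum>b\<in>B. scale (representation B v b) b)"
      using sum_representation_eq[OF B(3) _ B(1) order_refl, of v] that B(4) by simp
    also have "\<dots> = (\<Sum>i<?n. scale (representation B v (e i)) (e i))"
      using sum.reindex[OF e'(2), of "\<lambda>b. scale (representation B v b) b"] e'(1) by simp
    finally show ?thesis by (simp add: c_def)
  qed
  moreover have "c v \<in> affine_space ?n" for v by (simp add: affine_space_def c_def)
  moreover have "c (v + w) = c v + c w" if "v \<in> V" "w \<in> V" for v w
    using representation_add[OF B(3)] that B(4) by (auto simp: c_def fun_eq_iff)
  moreover have "c (scale a v) = seq_scale a (c v)" if "v \<in> V" for a v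
    using representation_scale[OF B(3)] that B(4) by (auto simp: c_def fun_eq_iff seq_scale_def)
  moreover have "c (e i) = unit_seq i" if "i < ?n" for i
  proof
    fix j
    have "e i \<in> B" using e' that by blast
    then show "c (e i) j = unit_seq i j"
      using representation_basis[OF B(3), of "e i"] that e'(2) unfolding c_def unit_seq_def
      by (auto simp: inj_on_def)
  qed
  moreover have "is_basis scale (e ` {..<?n}) V" unfolding is_basis_def e'(1) using B by blast
  ultimately show ?thesis using e' unfolding coordinates_def by (intro exI[of _ ?n] exI[of _ e] exI[of _ c]) simp
qed

lemma coordinatesD:
  assumes "coordinates s V n e c"
  shows "is_basis s (e ` {..<n}) V" "inj_on e {..<n}" "v \<in> V \<Longrightarrow> v = (\<Sum>i<n. s (c v i) (e i))"
    "v \<in> V \<Longrightarrow> n \<le> i \<Longrightarrow> c v i = 0" "v \<in> V \<Longrightarrow> w \<in> V \<Longrightarrow> c (v + w) = c v + c w"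
    "v \<in> V \<Longrightarrow> c (s a v) = seq_scale a (c v)" "i < n \<Longrightarrow> c (e i) = unit_seq i" "i < n \<Longrightarrow> e i \<in> V"
  using assms by (auto simp: coordinates_def affine_space_def is_basis_def)

locale field_embedding =
  fixes emb :: "'k::field \<Rightarrow> 'f::field"
  assumes emb_add: "emb (a + b) = emb a + emb b" and emb_mult: "emb (a * b) = emb a * emb b"
    and emb_one: "emb 1 = 1"
begin

lemma emb_zero: "emb 0 = 0"
proof -
  have "emb 0 + emb 0 = emb 0 + 0" using emb_add[of 0 0] by (metis add.right_neutral)
  then show ?thesis by (rule add_left_imp_eq)
qed

lemma emb_eq_zero: "emb a = 0 \<longleftrightarrow> a = 0"
proof
  assume "emb a = 0"
  then show "a = 0" using emb_mult[of a "inverse a"] emb_one by (cases "a = 0") auto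
qed (simp add: emb_zero)

lemma emb_sum: "emb (\<Sum>i\<in>A. f i) = (\<Sum>i\<in>A. emb (f i))"
  by (induction A rule: infinite_finite_induct) (auto simp: emb_zero emb_add)

end

lemma field_embedding_id: "field_embedding id"
  by unfold_locales auto

lemma field_embedding_to_ac: "field_embedding (to_ac :: 'k::field \<Rightarrow> 'k alg_closure)"
  by unfold_locales simp_all

locale extendable_module = tmodule C p T I id s M + field_embedding emb'
  for C :: "('a::field, 'b, 'c::ab_group_add, 'd::ab_group_add) extri" (structure) and p T I
    and s :: "'a \<Rightarrow> 'v::ab_group_add \<Rightarrow> 'v" and M :: "('b, 'c, 'v) tmod" and emb' :: "'a \<Rightarrow> 'f::field" +
  assumes values_fin: "X \<in> T \<Longrightarrow> fin_dim s (Val M X)"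
begin

definition coords :: "'b \<Rightarrow> nat \<times> (nat \<Rightarrow> 'v) \<times> ('v \<Rightarrow> nat \<Rightarrow> 'a)" where
  "coords X = (SOME (n, e, c). coordinates s (Val M X) n e c)"

definition dm :: "'b \<Rightarrow> nat" where "dm X = fst (coords X)"
definition be :: "'b \<Rightarrow> nat \<Rightarrow> 'v" where "be X = fst (snd (coords X))"
definition co :: "'b \<Rightarrow> 'v \<Rightarrow> nat \<Rightarrow> 'a" where "co X = snd (snd (coords X))"

lemma co: "X \<in> T \<Longrightarrow> coordinates s (Val M X) (dm X) (be X) (co X)"
proof -
  assume X: "X \<in> T"
  have "\<exists>x. (\<lambda>(n, e, c). coordinates s (Val M X) n e c) x"
    using vs.coordinates_exist[OF val_subspace[OF X] values_fin[OF X]] by auto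
  then have "(\<lambda>(n, e, c). coordinates s (Val M X) n e c) (coords X)" unfolding coords_def by (rule someI_ex)
  then show "coordinates s (Val M X) (dm X) (be X) (co X)" by (simp add: dm_def be_def co_def case_prod_unfold)
qed

definition eta :: "'b \<Rightarrow> 'v \<Rightarrow> nat \<Rightarrow> 'f" where
  "eta X v = (\<lambda>i. emb' (co X v i))"

text \<open>The matrix of \<open>Act M f\<close> in the chosen bases, with embedded entries, applied
  to the coordinate vector \<open>w\<close>.\<close>

definition mat_act :: "'b \<Rightarrow> 'b \<Rightarrow> 'c \<Rightarrow> (nat \<Rightarrow> 'f) \<Rightarrow> nat \<Rightarrow> 'f" where
  "mat_act X Y f w = (\<lambda>j. \<Sum>i<dm Y. w i * eta X (Act M f (be Y i)) j)"

text \<open>A non-zero arrow determines its end points.\<close>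

definition ext_mod :: "('b, 'c, nat \<Rightarrow> 'f) tmod" where
  "ext_mod = \<lparr> Val = (\<lambda>X. affine_space (dm X)), Act = (\<lambda>f w. if f = 0 then 0 else
     case (SOME (X, Y). arr C f X Y) of (X, Y) \<Rightarrow> mat_act X Y f w) \<rparr>"

lemma eta_add: "X \<in> T \<Longrightarrow> v \<in> Val M X \<Longrightarrow> w \<in> Val M X \<Longrightarrow> eta X (v + w) = eta X v + eta X w"
  using coordinatesD(5)[OF co] by (simp add: eta_def fun_eq_iff emb_add)

lemma eta_scale: "X \<in> T \<Longrightarrow> v \<in> Val M X \<Longrightarrow> eta X (s a v) = seq_scale (emb' a) (eta X v)"
  using coordinatesD(6)[OF co] by (simp add: eta_def fun_eq_iff emb_mult seq_scale_def)

lemma eta_in: "X \<in> T \<Longrightarrow> v \<in> Val M X \<Longrightarrow> eta X v \<in> affine_space (dm X)"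
  using coordinatesD(4)[OF co] by (simp add: eta_def affine_space_def emb_zero)

lemma eta_zero: "X \<in> T \<Longrightarrow> eta X 0 = 0"
  using eta_add[of X 0 0] vs.subspace_0[OF val_subspace] by simp

lemma eta_sum:
  assumes "X \<in> T" "\<And>i. i \<in> A \<Longrightarrow> f i \<in> Val M X"
  shows "eta X (\<Sum>i\<in>A. s (a i) (f i)) = (\<Sum>i\<in>A. seq_scale (emb' (a i)) (eta X (f i)))"
  using assms(2)
proof (induction A rule: infinite_finite_induct)
  case (insert i A)
  have 1: "s (a i) (f i) \<in> Val M X" using insert vs.subspace_scale[OF val_subspace[OF assms(1)]] by simp
  have 2: "(\<Sum>i\<in>A. s (a i) (f i)) \<in> Val M X"
    by (rule vs.subspace_sum[OF val_subspace[OF assms(1)]])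
       (use insert vs.subspace_scale[OF val_subspace[OF assms(1)]] in simp)
  show ?case using insert eta_add[OF assms(1) 1 2] eta_scale[OF assms(1)] by simp
qed (use eta_zero[OF assms(1)] in auto)

lemma eta_basis: "X \<in> T \<Longrightarrow> i < dm X \<Longrightarrow> eta X (be X i) = unit_seq i"
  using coordinatesD(7)[OF co] by (auto simp: eta_def unit_seq_def emb_zero emb_one fun_eq_iff)

lemma ext_mod_val [simp]: "Val ext_mod X = affine_space (dm X)"
  by (simp add: ext_mod_def)

lemma ext_mod_act:
  assumes "X \<in> T" "Y \<in> T" "arr C f X Y" shows "Act ext_mod f w = mat_act X Y f w"
proof (cases "f = 0")
  case True
  have "Act M 0 (be Y i) = 0" if "i < dm Y" for i
    using act_zero_arr[OF assms(1,2) coordinatesD(8)[OF co[OF assms(2)] that]] .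
  then show ?thesis using True eta_zero[OF assms(1)] by (simp add: ext_mod_def mat_act_def fun_eq_iff)
next
  case False
  have "(case (SOME (X, Y). arr C f X Y) of (X, Y) \<Rightarrow> arr C f X Y)"
    by (rule someI_ex) (use assms(3) in auto)
  then have "(SOME (X, Y). arr C f X Y) = (X, Y)" using arr_unique[OF assms(3) _ False] by (auto split: prod.splits)
  then show ?thesis using False by (simp add: ext_mod_def)
qed

lemma eta_nat:
  assumes X: "X \<in> T" and Y: "Y \<in> T" and f: "arr C f X Y" and v: "v \<in> Val M Y"
  shows "eta X (Act M f v) = mat_act X Y f (eta Y v)"
proof -
  interpret pp: vector_space_pair s s ..
  have b: "be Y i \<in> Val M Y" if "i < dm Y" for i using coordinatesD(8)[OF co[OF Y] that] .
  have "Act M f v = Act M f (\<Sum>i<dm Y. s (co Y v i) (be Y i))" using coordinatesD(3)[OF co[OF Y] v] by simp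
  also have "\<dots> = (\<Sum>i<dm Y. s (co Y v i) (Act M f (be Y i)))"
    using pp.lin_sum[OF act_lin[OF X Y f] val_subspace[OF Y], of "{..<dm Y}" "be Y" "co Y v"] b by simp
  finally have "eta X (Act M f v) = (\<Sum>i<dm Y. seq_scale (emb' (co Y v i)) (eta X (Act M f (be Y i))))"
    using eta_sum[OF X, of "{..<dm Y}" "\<lambda>i. Act M f (be Y i)" "co Y v"] act_in[OF X Y f b] by simp
  then show ?thesis by (simp add: mat_act_def fun_eq_iff sum_fun_apply seq_scale_def eta_def)
qed

lemma ext_mod_is_module: "is_module C T emb' seq_scale ext_mod"
  unfolding is_module_def
proof (intro conjI ballI allI)
  show "vector_space (seq_scale :: 'f \<Rightarrow> _)" by (rule vector_space_seq)
  fix X assume X: "X \<in> T"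
  show "subsp seq_scale (Val ext_mod X)" using affine_subspace by simp
  show "Act ext_mod (idm C X) v = v" if "v \<in> Val ext_mod X" for v
  proof -
    have "Act ext_mod (idm C X) v = mat_act X X (idm C X) v" using ext_mod_act[OF X X arr_id[OF T_ob[OF X]]] .
    also have "\<dots> = (\<Sum>i<dm X. seq_scale (v i) (unit_seq i))"
      using eta_basis[OF X] act_id[OF X coordinatesD(8)[OF co[OF X]]]
      by (auto simp: mat_act_def fun_eq_iff sum_fun_apply seq_scale_def intro!: sum.cong)
    also have "\<dots> = v" using affine_expansion[of v "dm X"] that by simp
    finally show ?thesis .
  qed
  fix Y assume Y: "Y \<in> T"
  have b: "be Y i \<in> Val M Y" if "i < dm Y" for i using coordinatesD(8)[OF co[OF Y] that] .
  have aff: "mat_act X Y f w \<in> affine_space (dm X)" if "arr C f X Y" for f w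
    using eta_in[OF X act_in[OF X Y that b]] by (auto simp: mat_act_def affine_space_def)
  have arr: "f \<in> Hom C X Y \<longleftrightarrow> arr C f X Y" for f using T_ob X Y by (simp add: arr_def)
  show "linear_map_on seq_scale (Val ext_mod Y) seq_scale (Val ext_mod X) (Act ext_mod f)" if ff: "f \<in> Hom C X Y" for f
  proof -
    have f: "arr C f X Y" using ff arr by simp
    show ?thesis
      unfolding semilinear_on_def
    proof (intro conjI ballI allI)
      show "Act ext_mod f x \<in> Val ext_mod X" for x using ext_mod_act[OF X Y f] aff[OF f] by simp
      show "Act ext_mod f (x + y) = Act ext_mod f x + Act ext_mod f y" for x y
        using ext_mod_act[OF X Y f] by (simp add: mat_act_def fun_eq_iff algebra_simps sum.distrib)
      show "Act ext_mod f (seq_scale a x) = seq_scale (id a) (Act ext_mod f x)" for a x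
        using ext_mod_act[OF X Y f] by (simp add: mat_act_def fun_eq_iff seq_scale_def sum_distrib_left mult.assoc)
    qed
  qed
  show "semilinear_on emb' (scal C) (Hom C X Y) seq_scale (Val ext_mod X) (\<lambda>f. Act ext_mod f v)" for v
    unfolding semilinear_on_def arr
  proof (intro conjI allI ballI)
    fix f assume f0: "f \<in> Hom C X Y"
    then have f: "arr C f X Y" using arr by simp
    show "Act ext_mod f v \<in> Val ext_mod X" using ext_mod_act[OF X Y f] aff[OF f] by simp
    show "Act ext_mod (scal C a f) v = seq_scale (emb' a) (Act ext_mod f v)" for a
      using ext_mod_act[OF X Y f] ext_mod_act[OF X Y arr_scale[OF f]] act_scale_arr[OF X Y f b]
        eta_scale[OF X act_in[OF X Y f b]]
      by (auto simp: mat_act_def fun_eq_iff seq_scale_def sum_distrib_left algebra_simps intro!: sum.cong)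
    fix g assume "g \<in> Hom C X Y"
    then have g: "arr C g X Y" using arr by simp
    show "Act ext_mod (f + g) v = Act ext_mod f v + Act ext_mod g v"
    proof
      fix j
      have "eta X (Act M (f + g) (be Y i)) j = eta X (Act M f (be Y i)) j + eta X (Act M g (be Y i)) j" if "i < dm Y" for i
        using act_add_arr[OF X Y f g b[OF that]] eta_add[OF X act_in[OF X Y f b[OF that]] act_in[OF X Y g b[OF that]]] by simp
      then have "(\<Sum>i<dm Y. v i * eta X (Act M (f + g) (be Y i)) j) =
          (\<Sum>i<dm Y. v i * eta X (Act M f (be Y i)) j + v i * eta X (Act M g (be Y i)) j)"
        by (intro sum.cong) (simp_all add: distrib_left)
      then show "Act ext_mod (f + g) v j = (Act ext_mod f v + Act ext_mod g v) j"
        unfolding ext_mod_act[OF X Y f] ext_mod_act[OF X Y g] ext_mod_act[OF X Y arr_add[OF f g]]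
        by (simp add: mat_act_def sum.distrib)
    qed
  qed
  fix Z f g v assume Z: "Z \<in> T" and fg: "f \<in> Hom C X Y" "g \<in> Hom C Y Z" "v \<in> Val ext_mod Z"
  have f: "arr C f X Y" using fg(1) T_ob[OF X] T_ob[OF Y] by (simp add: arr_def)
  have g: "arr C g Y Z" using fg(2) T_ob[OF Y] T_ob[OF Z] by (simp add: arr_def)
  have bz: "be Z i \<in> Val M Z" if "i < dm Z" for i using coordinatesD(8)[OF co[OF Z] that] .
  have "Act ext_mod (g \<cdot> f) v = mat_act X Z (g \<cdot> f) v" using ext_mod_act[OF X Z arr_comp[OF f g]] .
  also have "\<dots> = (\<lambda>j. \<Sum>k<dm Z. v k * mat_act X Y f (eta Y (Act M g (be Z k))) j)"
  proof
    fix j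
    have "eta X (Act M (g \<cdot> f) (be Z k)) j = mat_act X Y f (eta Y (Act M g (be Z k))) j" if "k < dm Z" for k
      using act_comp[OF X Y Z f g bz[OF that]] eta_nat[OF X Y f act_in[OF Y Z g bz[OF that]]] by simp
    then show "mat_act X Z (g \<cdot> f) v j = (\<Sum>k<dm Z. v k * mat_act X Y f (eta Y (Act M g (be Z k))) j)"
      unfolding mat_act_def[of X Z] by (intro sum.cong) simp_all
  qed
  also have "\<dots> = mat_act X Y f (mat_act Y Z g v)"
  proof
    fix j
    let ?A = "\<lambda>k i. eta Y (Act M g (be Z k)) i" and ?B = "\<lambda>i. eta X (Act M f (be Y i)) j"
    have "(\<Sum>k<dm Z. v k * (\<Sum>i<dm Y. ?A k i * ?B i)) = (\<Sum>k<dm Z. \<Sum>i<dm Y. v k * ?A k i * ?B i)"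
      by (simp add: sum_distrib_left mult.assoc)
    also have "\<dots> = (\<Sum>i<dm Y. \<Sum>k<dm Z. v k * ?A k i * ?B i)" by (rule sum.swap)
    also have "\<dots> = (\<Sum>i<dm Y. (\<Sum>k<dm Z. v k * ?A k i) * ?B i)" by (simp add: sum_distrib_right)
    finally show "(\<Sum>k<dm Z. v k * mat_act X Y f (eta Y (Act M g (be Z k))) j) = mat_act X Y f (mat_act Y Z g v) j"
      unfolding mat_act_def .
  qed
  finally show "Act ext_mod (g \<cdot> f) v = Act ext_mod f (Act ext_mod g v)"
    using ext_mod_act[OF X Y f] ext_mod_act[OF Y Z g] by simp
qed

text \<open>Existence of a scalar extension, so that the one selected in
  \<open>quiver_grassmannian\<close> by an indefinite choice really is one.\<close>

lemma scalar_extension_ext_mod: "scalar_extension C T emb' s M ext_mod eta"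
  unfolding scalar_extension_def
proof (intro conjI ballI)
  show "is_module C T id s M" "is_module C T emb' seq_scale ext_mod" using is_mod ext_mod_is_module by auto
  fix X assume X: "X \<in> T"
  show "semilinear_on emb' s (Val M X) seq_scale (Val ext_mod X) (eta X)"
    unfolding semilinear_on_def using eta_in[OF X] eta_add[OF X] eta_scale[OF X] by simp
  have img: "eta X ` (be X ` {..<dm X}) = unit_seq ` {..<dm X}"
    unfolding image_image using eta_basis[OF X] by (intro image_cong) auto
  have "inj_on (eta X) (be X ` {..<dm X})"
  proof
    fix a b assume "a \<in> be X ` {..<dm X}" "b \<in> be X ` {..<dm X}" "eta X a = eta X b"
    then show "a = b" using eta_basis[OF X] inj_unit by (auto dest: injD)
  qed
  then show "\<exists>B. is_basis s B (Val M X) \<and> inj_on (eta X) B \<and> is_basis seq_scale (eta X ` B) (Val ext_mod X)"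
    using coordinatesD(1)[OF co[OF X]] unit_basis img by (intro exI[of _ "be X ` {..<dm X}"]) simp
  fix Y f v assume Y: "Y \<in> T" and f: "f \<in> Hom C X Y" and v: "v \<in> Val M Y"
  have "arr C f X Y" using f T_ob X Y by (simp add: arr_def)
  then show "eta X (Act M f v) = Act ext_mod f (eta Y v)"
    using eta_nat[OF X Y _ v] ext_mod_act[OF X Y] by simp
qed

text \<open>For the identity embedding the extension of scalars is an isomorphic copy with values in
  sequence spaces; this case provides sequence models of modules.\<close>

lemma eta_bij: "surj emb' \<Longrightarrow> X \<in> T \<Longrightarrow> bij_betw (eta X) (Val M X) (Val ext_mod X)"
proof -
  assume sj: "surj emb'" and X: "X \<in> T"
  note c = coordinatesD[OF co[OF X]]
  show "bij_betw (eta X) (Val M X) (Val ext_mod X)"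
    unfolding bij_betw_def
  proof (intro conjI equalityI subsetI)
    show "inj_on (eta X) (Val M X)"
    proof
      fix a b assume ab: "a \<in> Val M X" "b \<in> Val M X" "eta X a = eta X b"
      have "co X a i = co X b i" for i
      proof -
        have "emb' (co X a i - co X b i) + emb' (co X b i) = emb' (co X a i)" using emb_add[symmetric] by simp
        moreover have "emb' (co X a i) = emb' (co X b i)" using ab(3) by (auto simp: eta_def fun_eq_iff)
        ultimately show ?thesis using emb_eq_zero[of "co X a i - co X b i"] by simp
      qed
      then show "a = b" using c(3)[OF ab(1)] c(3)[OF ab(2)] by simp
    qed
    show "w \<in> Val ext_mod X" if "w \<in> eta X ` Val M X" for w using that eta_in[OF X] by auto
    fix w assume w: "w \<in> Val ext_mod X"
    define a where "a i = inv_into UNIV emb' (w i)" for i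
    have a: "emb' (a i) = w i" for i unfolding a_def using f_inv_into_f[of "w i" emb' UNIV] sj by simp
    have "eta X (\<Sum>i<dm X. s (a i) (be X i)) = (\<Sum>i<dm X. seq_scale (w i) (unit_seq i))"
      using eta_sum[OF X, of "{..<dm X}" "be X" a] c(8) a eta_basis[OF X] by simp
    also have "\<dots> = w" using affine_expansion[of w "dm X"] w by simp
    finally have "w = eta X (\<Sum>i<dm X. s (a i) (be X i))" by simp
    moreover have "(\<Sum>i<dm X. s (a i) (be X i)) \<in> Val M X"
      by (rule vs.subspace_sum[OF val_subspace[OF X]]) (use c(8) vs.subspace_scale[OF val_subspace[OF X]] in auto)
    ultimately show "w \<in> eta X ` Val M X" by blast
  qed
qed

end

lemma scalar_extension_dim:
  assumes "scalar_extension C T emb s M N \<eta>" "X \<in> T" "vector_space s"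
  shows "seq.dim (Val N X) = vector_space.dim s (Val M X)"
    "Val M X = {0} \<Longrightarrow> Val N X = {0}" "fin_dim s (Val M X) \<Longrightarrow> fin_dim seq_scale (Val N X)"
proof -
  interpret v: vector_space s by fact
  have "\<exists>B. is_basis s B (Val M X) \<and> inj_on (\<eta> X) B \<and> is_basis seq_scale (\<eta> X ` B) (Val N X)"
    using assms(1,2) by (simp add: scalar_extension_def)
  then obtain B where B: "is_basis s B (Val M X)" "inj_on (\<eta> X) B" "is_basis seq_scale (\<eta> X ` B) (Val N X)"
    by (elim exE conjE)
  have B1: "B \<subseteq> Val M X" "v.independent B" "Val M X \<subseteq> v.span B"
    and B2: "\<eta> X ` B \<subseteq> Val N X" "seq.independent (\<eta> X ` B)" "Val N X \<subseteq> seq.span (\<eta> X ` B)"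
    using B by (auto simp: is_basis_def)
  have "card B = v.dim (Val M X)" "card (\<eta> X ` B) = seq.dim (Val N X)"
    using v.basis_card_eq_dim[OF B1(1,3,2)] seq.basis_card_eq_dim[OF B2(1,3,2)] by auto
  then show "seq.dim (Val N X) = v.dim (Val M X)" using card_image[OF B(2)] by simp
  have N: "is_module C T emb seq_scale N" using assms(1) by (simp add: scalar_extension_def)
  have zN: "0 \<in> Val N X" using N assms(2) seq.subspace_0[of "Val N X"] by (simp add: is_module_def)
  show "Val N X = {0}" if "Val M X = {0}"
  proof -
    have "0 \<notin> B" using B1(2) v.dependent_zero[of B] by (rule contrapos_nn)
    moreover have "B \<subseteq> {0}" using B1(1) that by simp
    ultimately have "B = {}" by auto
    then show ?thesis using B2(3) zN by auto
  qed
  show "fin_dim seq_scale (Val N X)" if fd: "fin_dim s (Val M X)"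
  proof -
    obtain A where A: "finite A" "Val M X \<subseteq> v.span A" using fd by (auto simp: fin_dim_def)
    have "finite B" using v.independent_span_bound[OF A(1) B1(2)] A(2) B1(1) by blast
    then show ?thesis using seq.fin_dimI[of "\<eta> X ` B"] B2 by blast
  qed
qed

section \<open>Additivity of coindex minus index\<close>

context ct_category
begin

text \<open>A natural additive relation which is total and single-valued in both directions is an
  isomorphism of extension functors. Working with a relation suits diagram chases, where the
  correspondence is given by intermediate elements; the two functors are then compared by actual
  morphisms through fullness.\<close>

lemma is_beta_related:
  assumes o: "X \<in> Ob C" "Y \<in> Ob C"
    and dom: "\<And>V a b. V \<in> T \<Longrightarrow> R V a b \<Longrightarrow> exte C a V X \<and> exte C b V Y"
    and left: "\<And>V a. V \<in> T \<Longrightarrow> exte C a V X \<Longrightarrow> \<exists>b. R V a b"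
    and right: "\<And>V b. V \<in> T \<Longrightarrow> exte C b V Y \<Longrightarrow> \<exists>a. R V a b"
    and diff: "\<And>V a b a' b'. V \<in> T \<Longrightarrow> R V a b \<Longrightarrow> R V a' b' \<Longrightarrow> R V (a - a') (b - b')"
    and zero: "\<And>V b. V \<in> T \<Longrightarrow> R V 0 b \<Longrightarrow> b = 0" "\<And>V a. V \<in> T \<Longrightarrow> R V a 0 \<Longrightarrow> a = 0"
    and nat: "\<And>V W h a b. V \<in> T \<Longrightarrow> W \<in> T \<Longrightarrow> arr C h V W \<Longrightarrow> R W a b \<Longrightarrow> R V (pull C h a) (pull C h b)"
    and c: "is_beta X c" "is_beta Y c'"
  shows "c - c' \<in> K.Rel"
proof -
  have uni: "b = b'" if "V \<in> T" "R V a b" "R V a b'" for V a b b'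
    using zero(1)[OF that(1), of "b - b'"] diff[OF that] by simp
  have uni': "a = a'" if "V \<in> T" "R V a b" "R V a' b" for V a a' b
    using zero(2)[OF that(1), of "a - a'"] diff[OF that] by simp
  define \<phi> where "\<phi> V a = (SOME b. R V a b)" for V a
  define \<psi> where "\<psi> V b = (SOME a. R V a b)" for V b
  have \<phi>: "R V a (\<phi> V a)" if "V \<in> T" "exte C a V X" for V a unfolding \<phi>_def using left[OF that] by (rule someI_ex)
  have \<psi>: "R V (\<psi> V b) b" if "V \<in> T" "exte C b V Y" for V b unfolding \<psi>_def using right[OF that] by (rule someI_ex)
  obtain f where f: "arr C f X Y" "\<forall>V\<in>T. \<forall>e. exte C e V X \<longrightarrow> \<phi> V e = push C f e"
  proof (atomize_elim, rule ext_functor_full[OF o])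
    show "exte C (\<phi> V e) V Y" if "V \<in> T" "exte C e V X" for V e using dom[OF that(1) \<phi>[OF that]] by blast
    show "\<phi> V (pull C h e) = pull C h (\<phi> W e)" if t: "V \<in> T" "W \<in> T" "arr C h V W" "exte C e W X" for V W h e
      using uni[OF t(1) \<phi>[OF t(1) exte_pull[OF t(4,3)]] nat[OF t(1,2,3) \<phi>[OF t(2,4)]]] .
    show "\<phi> V 0 = 0" if V: "V \<in> T" for V using zero(1)[OF V \<phi>[OF V exte_zero[OF T_ob[OF V] o(1)]]] .
  qed
  obtain g where g: "arr C g Y X" "\<forall>V\<in>T. \<forall>e. exte C e V Y \<longrightarrow> \<psi> V e = push C g e"
  proof (atomize_elim, rule ext_functor_full[OF o(2,1)])
    show "exte C (\<psi> V e) V X" if "V \<in> T" "exte C e V Y" for V e using dom[OF that(1) \<psi>[OF that]] by blast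
    show "\<psi> V (pull C h e) = pull C h (\<psi> W e)" if t: "V \<in> T" "W \<in> T" "arr C h V W" "exte C e W Y" for V W h e
      using uni'[OF t(1) \<psi>[OF t(1) exte_pull[OF t(4,3)]] nat[OF t(1,2,3) \<psi>[OF t(2,4)]]] .
    show "\<psi> V 0 = 0" if V: "V \<in> T" for V using zero(2)[OF V \<psi>[OF V exte_zero[OF T_ob[OF V] o(2)]]] .
  qed
  show ?thesis
  proof (rule is_beta_iso[OF f(1) g(1) _ _ c])
    fix V e assume V: "V \<in> T" and e: "exte C e V X"
    have fe: "exte C (\<phi> V e) V Y" using dom[OF V \<phi>[OF V e]] by blast
    have "push C g (push C f e) = \<psi> V (\<phi> V e)" using f(2) g(2) V e fe by simp
    also have "\<dots> = e" using uni'[OF V \<psi>[OF V fe] \<phi>[OF V e]] .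
    finally show "push C g (push C f e) = e" .
  next
    fix V e assume V: "V \<in> T" and e: "exte C e V Y" and z: "push C g e = 0"
    have "\<psi> V e = 0" using g(2) V e z by simp
    then show "e = 0" using zero(1)[OF V] \<psi>[OF V e] by simp
  qed
qed

lemma E_module_is_module:
  assumes X: "X \<in> Ob C" shows "is_module C T id (escal C) (E_module C X)"
  unfolding is_module_def E_module_def
proof (simp, intro conjI ballI)
  show "vector_space (escal C)" by (rule ext_vector_space)
  fix V assume V: "V \<in> T"
  note oV = T_ob[OF V]
  show "subsp (escal C) (Ext C V X)" using ext_subspace[OF oV X] .
  show "pull C (idm C V) v = v" if "v \<in> Ext C V X" for v using pull_id[OF oV X that] .
  fix W assume W: "W \<in> T"
  note oW = T_ob[OF W]
  show "linear_map_on (escal C) (Ext C W X) (escal C) (Ext C V X) (pull C f)" if "f \<in> Hom C V W" for f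
    using pull_linear[OF oW oV X that] .
  show "linear_map_on (scal C) (Hom C V W) (escal C) (Ext C V X) (\<lambda>f. pull C f v)" if "v \<in> Ext C W X" for v
    using pull_linear_arrow[OF oW oV X that] .
  fix Z f g v assume Z: "Z \<in> T" and f: "f \<in> Hom C V W" "g \<in> Hom C W Z" "v \<in> Ext C Z X"
  show "pull C (g \<cdot> f) v = pull C f (pull C g v)" using pull_comp[OF T_ob[OF Z] oW oV X f(3,2,1)] .
qed

lemma E_isoD:
  assumes iso: "module_isomorphic C T (escal C) (E_module C X) s M" and X: "X \<in> Ob C"
  shows "\<exists>\<alpha>. (\<forall>V\<in>T. (\<forall>e. exte C e V X \<longrightarrow> \<alpha> V e \<in> Val M V) \<and>
    (\<forall>e e'. exte C e V X \<longrightarrow> exte C e' V X \<longrightarrow> \<alpha> V (e - e') = \<alpha> V e - \<alpha> V e' \<and> (\<alpha> V e = \<alpha> V e' \<longrightarrow> e = e')) \<and>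
    (\<forall>m\<in>Val M V. \<exists>e. exte C e V X \<and> \<alpha> V e = m)) \<and>
    (\<forall>V\<in>T. \<forall>W\<in>T. \<forall>h e. arr C h V W \<longrightarrow> exte C e W X \<longrightarrow> \<alpha> V (pull C h e) = Act M h (\<alpha> W e))"
proof -
  obtain \<alpha> where \<alpha>: "module_hom C T (escal C) (E_module C X) s M \<alpha>" "\<forall>V\<in>T. bij_betw (\<alpha> V) (Ext C V X) (Val M V)"
    using iso unfolding module_isomorphic_def by (auto simp: E_module_def)
  have lin: "linear_map_on (escal C) (Ext C V X) s (Val M V) (\<alpha> V)" if "V \<in> T" for V
    using \<alpha>(1) that unfolding module_hom_def by (simp add: E_module_def)
  have E: "exte C e V X \<longleftrightarrow> e \<in> Ext C V X" if "V \<in> T" for V e using T_ob[OF that] X by (simp add: exte_def)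
  have diff: "\<alpha> V (e - e') = \<alpha> V e - \<alpha> V e'" if "V \<in> T" "e \<in> Ext C V X" "e' \<in> Ext C V X" for V e e'
  proof -
    have d: "e - e' \<in> Ext C V X" using ext.subspace_diff[OF ext_subspace[OF T_ob[OF that(1)] X] that(2,3)] .
    show ?thesis using linear_map_onD(2)[OF lin[OF that(1)] d that(3)] by simp
  qed
  show ?thesis
  proof (intro exI[of _ \<alpha>] conjI ballI allI impI)
    fix V assume V: "V \<in> T"
    fix e assume e: "exte C e V X"
    show "\<alpha> V e \<in> Val M V" using linear_map_onD(1)[OF lin[OF V]] e E[OF V] by blast
    fix e' assume e': "exte C e' V X"
    show "\<alpha> V (e - e') = \<alpha> V e - \<alpha> V e'" using diff[OF V] e e' E[OF V] by blast
    show "e = e'" if "\<alpha> V e = \<alpha> V e'"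
      using bij_betw_imp_inj_on[OF bspec[OF \<alpha>(2) V]] that e e' E[OF V] by (auto dest: inj_onD)
  next
    fix V m assume V: "V \<in> T" and m: "m \<in> Val M V"
    show "\<exists>e. exte C e V X \<and> \<alpha> V e = m"
      using bij_betw_imp_surj_on[OF bspec[OF \<alpha>(2) V]] m E[OF V] by (metis imageE)
  next
    fix V W h e assume V: "V \<in> T" and W: "W \<in> T" and h: "arr C h V W" and e: "exte C e W X"
    show "\<alpha> V (pull C h e) = Act M h (\<alpha> W e)"
      using \<alpha>(1) V W h e E[OF W] unfolding module_hom_def by (auto simp: E_module_def arr_def)
  qed
qed

text \<open>Classes by \<open>X\<close> and by \<open>Y\<close> are related if they have the same
  image in \<open>M\<close>.\<close>

lemma is_beta_module_iso:
  assumes X: "module_isomorphic C T (escal C) (E_module C X) s M" "X \<in> Ob C"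
    and Y: "module_isomorphic C T (escal C) (E_module C Y) s M" "Y \<in> Ob C"
    and c: "is_beta X c" "is_beta Y c'"
  shows "c - c' \<in> K.Rel"
proof -
  obtain \<alpha> where \<alpha>: "\<And>V e. V \<in> T \<Longrightarrow> exte C e V X \<Longrightarrow> \<alpha> V e \<in> Val M V"
    "\<And>V e e'. V \<in> T \<Longrightarrow> exte C e V X \<Longrightarrow> exte C e' V X \<Longrightarrow> \<alpha> V (e - e') = \<alpha> V e - \<alpha> V e'"
    "\<And>V e e'. V \<in> T \<Longrightarrow> exte C e V X \<Longrightarrow> exte C e' V X \<Longrightarrow> \<alpha> V e = \<alpha> V e' \<Longrightarrow> e = e'"
    "\<And>V m. V \<in> T \<Longrightarrow> m \<in> Val M V \<Longrightarrow> \<exists>e. exte C e V X \<and> \<alpha> V e = m"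
    "\<And>V W h e. V \<in> T \<Longrightarrow> W \<in> T \<Longrightarrow> arr C h V W \<Longrightarrow> exte C e W X \<Longrightarrow> \<alpha> V (pull C h e) = Act M h (\<alpha> W e)"
    using E_isoD[OF X] by blast
  obtain \<beta> where \<beta>: "\<And>V e. V \<in> T \<Longrightarrow> exte C e V Y \<Longrightarrow> \<beta> V e \<in> Val M V"
    "\<And>V e e'. V \<in> T \<Longrightarrow> exte C e V Y \<Longrightarrow> exte C e' V Y \<Longrightarrow> \<beta> V (e - e') = \<beta> V e - \<beta> V e'"
    "\<And>V e e'. V \<in> T \<Longrightarrow> exte C e V Y \<Longrightarrow> exte C e' V Y \<Longrightarrow> \<beta> V e = \<beta> V e' \<Longrightarrow> e = e'"
    "\<And>V m. V \<in> T \<Longrightarrow> m \<in> Val M V \<Longrightarrow> \<exists>e. exte C e V Y \<and> \<beta> V e = m"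
    "\<And>V W h e. V \<in> T \<Longrightarrow> W \<in> T \<Longrightarrow> arr C h V W \<Longrightarrow> exte C e W Y \<Longrightarrow> \<beta> V (pull C h e) = Act M h (\<beta> W e)"
    using E_isoD[OF Y] by blast
  have a0: "\<alpha> V 0 = 0" "\<beta> V 0 = 0" if "V \<in> T" for V
    using \<alpha>(2)[OF that exte_zero[OF T_ob[OF that] X(2)] exte_zero[OF T_ob[OF that] X(2)]]
      \<beta>(2)[OF that exte_zero[OF T_ob[OF that] Y(2)] exte_zero[OF T_ob[OF that] Y(2)]] by auto
  show ?thesis
  proof (rule is_beta_related[OF X(2) Y(2), of "\<lambda>V a b. exte C a V X \<and> exte C b V Y \<and> \<alpha> V a = \<beta> V b", OF _ _ _ _ _ _ _ c])
    show "\<exists>b. exte C a V X \<and> exte C b V Y \<and> \<alpha> V a = \<beta> V b" if "V \<in> T" "exte C a V X" for V a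
      using \<beta>(4)[OF that(1) \<alpha>(1)[OF that]] that by metis
    show "\<exists>a. exte C a V X \<and> exte C b V Y \<and> \<alpha> V a = \<beta> V b" if "V \<in> T" "exte C b V Y" for V b
      using \<alpha>(4)[OF that(1) \<beta>(1)[OF that]] that by metis
    show "exte C (a - a') V X \<and> exte C (b - b') V Y \<and> \<alpha> V (a - a') = \<beta> V (b - b')"
      if "V \<in> T" "exte C a V X \<and> exte C b V Y \<and> \<alpha> V a = \<beta> V b" "exte C a' V X \<and> exte C b' V Y \<and> \<alpha> V a' = \<beta> V b'"
      for V a b a' b'
      using that exte_diff \<alpha>(2)[OF that(1), of a a'] \<beta>(2)[OF that(1), of b b'] by auto
    show "b = 0" if "V \<in> T" "exte C 0 V X \<and> exte C b V Y \<and> \<alpha> V 0 = \<beta> V b" for V b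
      using that \<beta>(3)[OF that(1), of b 0] a0[OF that(1)] exte_zero[OF T_ob[OF that(1)] Y(2)] by auto
    show "a = 0" if "V \<in> T" "exte C a V X \<and> exte C 0 V Y \<and> \<alpha> V a = \<beta> V 0" for V a
      using that \<alpha>(3)[OF that(1), of a 0] a0[OF that(1)] exte_zero[OF T_ob[OF that(1)] X(2)] by auto
    show "exte C (pull C h a) V X \<and> exte C (pull C h b) V Y \<and> \<alpha> V (pull C h a) = \<beta> V (pull C h b)"
      if "V \<in> T" "W \<in> T" "arr C h V W" "exte C a W X \<and> exte C b W Y \<and> \<alpha> W a = \<beta> W b" for V W h a b
      using that exte_pull \<alpha>(5)[OF that(1-3), of a] \<beta>(5)[OF that(1-3), of b] by metis
  qed blast
qed

text \<open>By fullness the inclusion of \<open>L\<close> into \<open>M\<close> comes from a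
  morphism \<open>f\<close> from \<open>X\<close> to \<open>Y\<close>. \<open>is_beta_exact\<close>
  gives an object \<open>Z1\<close> whose extension functor is its cokernel. It is not
  \<open>Z\<close> itself, but both functors are the quotient of \<open>M\<close> by
  \<open>L\<close>, so they have the same invariant.\<close>

lemma is_beta_short_exact:
  assumes X: "module_isomorphic C T (escal C) (E_module C X) s L" "X \<in> Ob C"
    and Y: "module_isomorphic C T (escal C) (E_module C Y) s M" "Y \<in> Ob C"
    and Z: "module_isomorphic C T (escal C) (E_module C Z) s N" "Z \<in> Ob C"
    and mods: "is_module C T id s L" "is_module C T id s M" "is_module C T id s N"
    and ex: "short_exact C T s L M N"
    and c: "is_beta X cX" "is_beta Y cY" "is_beta Z cZ"
  shows "cY - cX - cZ \<in> K.Rel"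
proof -
  obtain \<alpha> where \<alpha>: "\<And>V e. V \<in> T \<Longrightarrow> exte C e V X \<Longrightarrow> \<alpha> V e \<in> Val L V"
    "\<And>V e e'. V \<in> T \<Longrightarrow> exte C e V X \<Longrightarrow> exte C e' V X \<Longrightarrow> \<alpha> V (e - e') = \<alpha> V e - \<alpha> V e'"
    "\<And>V e e'. V \<in> T \<Longrightarrow> exte C e V X \<Longrightarrow> exte C e' V X \<Longrightarrow> \<alpha> V e = \<alpha> V e' \<Longrightarrow> e = e'"
    "\<And>V m. V \<in> T \<Longrightarrow> m \<in> Val L V \<Longrightarrow> \<exists>e. exte C e V X \<and> \<alpha> V e = m"
    "\<And>V W h e. V \<in> T \<Longrightarrow> W \<in> T \<Longrightarrow> arr C h V W \<Longrightarrow> exte C e W X \<Longrightarrow> \<alpha> V (pull C h e) = Act L h (\<alpha> W e)"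
    using E_isoD[OF X] by blast
  obtain \<beta> where \<beta>: "\<And>V e. V \<in> T \<Longrightarrow> exte C e V Y \<Longrightarrow> \<beta> V e \<in> Val M V"
    "\<And>V e e'. V \<in> T \<Longrightarrow> exte C e V Y \<Longrightarrow> exte C e' V Y \<Longrightarrow> \<beta> V (e - e') = \<beta> V e - \<beta> V e'"
    "\<And>V e e'. V \<in> T \<Longrightarrow> exte C e V Y \<Longrightarrow> exte C e' V Y \<Longrightarrow> \<beta> V e = \<beta> V e' \<Longrightarrow> e = e'"
    "\<And>V m. V \<in> T \<Longrightarrow> m \<in> Val M V \<Longrightarrow> \<exists>e. exte C e V Y \<and> \<beta> V e = m"
    "\<And>V W h e. V \<in> T \<Longrightarrow> W \<in> T \<Longrightarrow> arr C h V W \<Longrightarrow> exte C e W Y \<Longrightarrow> \<beta> V (pull C h e) = Act M h (\<beta> W e)"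
    using E_isoD[OF Y] by blast
  obtain \<gamma> where \<gamma>: "\<And>V e. V \<in> T \<Longrightarrow> exte C e V Z \<Longrightarrow> \<gamma> V e \<in> Val N V"
    "\<And>V e e'. V \<in> T \<Longrightarrow> exte C e V Z \<Longrightarrow> exte C e' V Z \<Longrightarrow> \<gamma> V (e - e') = \<gamma> V e - \<gamma> V e'"
    "\<And>V e e'. V \<in> T \<Longrightarrow> exte C e V Z \<Longrightarrow> exte C e' V Z \<Longrightarrow> \<gamma> V e = \<gamma> V e' \<Longrightarrow> e = e'"
    "\<And>V m. V \<in> T \<Longrightarrow> m \<in> Val N V \<Longrightarrow> \<exists>e. exte C e V Z \<and> \<gamma> V e = m"
    "\<And>V W h e. V \<in> T \<Longrightarrow> W \<in> T \<Longrightarrow> arr C h V W \<Longrightarrow> exte C e W Z \<Longrightarrow> \<gamma> V (pull C h e) = Act N h (\<gamma> W e)"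
    using E_isoD[OF Z] by blast
  obtain i \<pi> where h: "module_hom C T s L s M i \<and> module_hom C T s M s N \<pi> \<and>
       (\<forall>V\<in>T. inj_on (i V) (Val L V) \<and> \<pi> V ` Val M V = Val N V \<and> i V ` Val L V = {v\<in>Val M V. \<pi> V v = 0})"
    using ex unfolding short_exact_def by (elim exE)
  have i: "module_hom C T s L s M i" and \<pi>: "module_hom C T s M s N \<pi>"
    and exact: "\<And>V. V \<in> T \<Longrightarrow> inj_on (i V) (Val L V)" "\<And>V. V \<in> T \<Longrightarrow> \<pi> V ` Val M V = Val N V"
    "\<And>V. V \<in> T \<Longrightarrow> i V ` Val L V = {v\<in>Val M V. \<pi> V v = 0}"
    using h by simp_all
  interpret ss: vector_space_pair s s
    using mods(1) by (simp add: vector_space_pair_def is_module_def)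
  have sL: "subsp s (Val L V)" and sM: "subsp s (Val M V)" if "V \<in> T" for V using mods that by (auto simp: is_module_def)
  have li: "linear_map_on s (Val L V) s (Val M V) (i V)" and lp: "linear_map_on s (Val M V) s (Val N V) (\<pi> V)"
    if "V \<in> T" for V using i \<pi> that by (auto simp: module_hom_def)
  have ni: "i V (Act L h v) = Act M h (i W v)" if "V \<in> T" "W \<in> T" "arr C h V W" "v \<in> Val L W" for V W h v
    using i that by (auto simp: module_hom_def arr_def)
  have np: "\<pi> V (Act M h v) = Act N h (\<pi> W v)" if "V \<in> T" "W \<in> T" "arr C h V W" "v \<in> Val M W" for V W h v
    using \<pi> that by (auto simp: module_hom_def arr_def)
  have a0: "\<alpha> V 0 = 0" "\<beta> V 0 = 0" "\<gamma> V 0 = 0" "i V 0 = 0" "\<pi> V 0 = 0" if "V \<in> T" for V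
    using \<alpha>(2)[OF that exte_zero[OF T_ob[OF that] X(2)] exte_zero[OF T_ob[OF that] X(2)]]
      \<beta>(2)[OF that exte_zero[OF T_ob[OF that] Y(2)] exte_zero[OF T_ob[OF that] Y(2)]]
      \<gamma>(2)[OF that exte_zero[OF T_ob[OF that] Z(2)] exte_zero[OF T_ob[OF that] Z(2)]]
      ss.lin_zero[OF li[OF that] sL[OF that]] ss.lin_zero[OF lp[OF that] sM[OF that]] by auto
  have iM: "i V m \<in> Val M V" if "V \<in> T" "m \<in> Val L V" for V m using linear_map_onD(1)[OF li[OF that(1)] that(2)] .
  define \<phi> where "\<phi> V e = (SOME e'. exte C e' V Y \<and> \<beta> V e' = i V (\<alpha> V e))" for V e
  have \<phi>: "exte C (\<phi> V e) V Y \<and> \<beta> V (\<phi> V e) = i V (\<alpha> V e)" if "V \<in> T" "exte C e V X" for V e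
    unfolding \<phi>_def using \<beta>(4)[OF that(1) iM[OF that(1) \<alpha>(1)[OF that]]] by (rule someI_ex)
  obtain f where f: "arr C f X Y" "\<forall>V\<in>T. \<forall>e. exte C e V X \<longrightarrow> \<phi> V e = push C f e"
  proof (atomize_elim, rule ext_functor_full[OF X(2) Y(2)])
    show "exte C (\<phi> V e) V Y" if "V \<in> T" "exte C e V X" for V e using \<phi>[OF that] by blast
    show "\<phi> V (pull C h e) = pull C h (\<phi> W e)" if t: "V \<in> T" "W \<in> T" "arr C h V W" "exte C e W X" for V W h e
    proof (rule \<beta>(3)[OF t(1)])
      have p: "exte C (pull C h e) V X" and q: "exte C (\<phi> W e) W Y" using exte_pull[OF t(4,3)] \<phi>[OF t(2,4)] by auto
      show "exte C (\<phi> V (pull C h e)) V Y" "exte C (pull C h (\<phi> W e)) V Y" using \<phi>[OF t(1) p] exte_pull[OF q t(3)] by auto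
      show "\<beta> V (\<phi> V (pull C h e)) = \<beta> V (pull C h (\<phi> W e))"
        using \<phi>[OF t(1) p] \<phi>[OF t(2,4)] \<beta>(5)[OF t(1-3) q] \<alpha>(5)[OF t] ni[OF t(1-3) \<alpha>(1)[OF t(2,4)]] by simp
    qed
    show "\<phi> V 0 = 0" if V: "V \<in> T" for V
      using \<beta>(3)[OF V _ exte_zero[OF T_ob[OF V] Y(2)], of "\<phi> V 0"] \<phi>[OF V exte_zero[OF T_ob[OF V] X(2)]] a0[OF V] by simp
  qed
  have bf: "\<beta> V (push C f e) = i V (\<alpha> V e)" if "V \<in> T" "exte C e V X" for V e using f(2) \<phi>[OF that] that by auto
  have inj: "e = 0" if V: "V \<in> T" and e: "exte C e V X" "push C f e = 0" for V e
  proof -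
    have "i V (\<alpha> V e) = i V 0" using bf[OF V e(1)] e(2) a0[OF V] by simp
    then have "\<alpha> V e = \<alpha> V 0"
      using inj_onD[OF exact(1)[OF V], of "\<alpha> V e" 0] \<alpha>(1)[OF V e(1)] ss.vs1.subspace_0[OF sL[OF V]] a0[OF V] by simp
    then show ?thesis using \<alpha>(3)[OF V e(1) exte_zero[OF T_ob[OF V] X(2)]] by simp
  qed
  have "\<exists>Z g cZ. arr C g Y Z \<and> is_beta Z cZ \<and> cY - cX - cZ \<in> K.Rel \<and>
     (\<forall>V\<in>T. \<forall>e. exte C e V Z \<longrightarrow> (\<exists>e'. exte C e' V Y \<and> push C g e' = e)) \<and>
     (\<forall>V\<in>T. \<forall>e. exte C e V X \<longrightarrow> push C g (push C f e) = 0) \<and>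
     (\<forall>V\<in>T. \<forall>e. exte C e V Y \<longrightarrow> push C g e = 0 \<longrightarrow> (\<exists>e'. exte C e' V X \<and> push C f e' = e))"
    by (rule is_beta_exact[OF f(1) _ c(1,2)]) (rule inj)
  then obtain Z1 g c1 where g: "arr C g Y Z1" "is_beta Z1 c1" "cY - cX - c1 \<in> K.Rel"
    and surj: "\<And>V e. V \<in> T \<Longrightarrow> exte C e V Z1 \<Longrightarrow> \<exists>e'. exte C e' V Y \<and> push C g e' = e"
    and comp: "\<And>V e. V \<in> T \<Longrightarrow> exte C e V X \<Longrightarrow> push C g (push C f e) = 0"
    and ker: "\<And>V e. V \<in> T \<Longrightarrow> exte C e V Y \<Longrightarrow> push C g e = 0 \<Longrightarrow> \<exists>e'. exte C e' V X \<and> push C f e' = e"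
    by blast
  have oZ1: "Z1 \<in> Ob C" using arr_ob g by blast
  \<comment> \<open>A class by \<open>Z1\<close> and a class by \<open>Z\<close> are related if a
    common class by \<open>Y\<close> lies over both.\<close>
  let ?R = "\<lambda>V a b. exte C b V Z \<and> (\<exists>e. exte C e V Y \<and> a = push C g e \<and> \<gamma> V b = \<pi> V (\<beta> V e))"
  have pN: "\<pi> V (\<beta> V e) \<in> Val N V" if "V \<in> T" "exte C e V Y" for V e
    using linear_map_onD(1)[OF lp[OF that(1)] \<beta>(1)[OF that]] .
  have "c1 - cZ \<in> K.Rel"
  proof (rule is_beta_related[OF oZ1 Z(2), of ?R, OF _ _ _ _ _ _ _ g(2) c(3)])
    show "exte C a V Z1 \<and> exte C b V Z" if "V \<in> T" "?R V a b" for V a b using that exte_push[OF _ g(1)] by blast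
    show "\<exists>b. ?R V a b" if V: "V \<in> T" and a: "exte C a V Z1" for V a
    proof -
      obtain e where e: "exte C e V Y" "push C g e = a" using surj[OF V a] by blast
      obtain b where "exte C b V Z" "\<gamma> V b = \<pi> V (\<beta> V e)" using \<gamma>(4)[OF V pN[OF V e(1)]] by blast
      then show ?thesis using e by blast
    qed
    show "\<exists>a. ?R V a b" if V: "V \<in> T" and b: "exte C b V Z" for V b
    proof -
      obtain m where m: "m \<in> Val M V" "\<pi> V m = \<gamma> V b" using exact(2)[OF V] \<gamma>(1)[OF V b] by (metis imageE)
      obtain e where "exte C e V Y" "\<beta> V e = m" using \<beta>(4)[OF V m(1)] by blast
      then show ?thesis using m b by metis
    qed
    show "?R V (a - a') (b - b')" if V: "V \<in> T" and r: "?R V a b" "?R V a' b'" for V a b a' b'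
    proof -
      obtain e e' where e: "exte C b V Z" "exte C e V Y" "a = push C g e" "\<gamma> V b = \<pi> V (\<beta> V e)"
        "exte C b' V Z" "exte C e' V Y" "a' = push C g e'" "\<gamma> V b' = \<pi> V (\<beta> V e')" using r by blast
      have "\<gamma> V (b - b') = \<pi> V (\<beta> V (e - e'))"
        using \<gamma>(2)[OF V e(1,5)] \<beta>(2)[OF V e(2,6)] ss.lin_diff[OF lp[OF V] sM[OF V] \<beta>(1)[OF V e(2)] \<beta>(1)[OF V e(6)]] e(4,8) by simp
      then show ?thesis using exte_diff[OF e(1,5)] exte_diff[OF e(2,6)] push_diff[OF e(2,6) g(1)] e(3,7) by metis
    qed
    show "b = 0" if V: "V \<in> T" and r: "?R V 0 b" for V b
    proof -
      obtain e where e: "exte C b V Z" "exte C e V Y" "push C g e = 0" "\<gamma> V b = \<pi> V (\<beta> V e)" using r by metis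
      obtain e' where e': "exte C e' V X" "push C f e' = e" using ker[OF V e(2,3)] by blast
      have "\<beta> V e = i V (\<alpha> V e')" using bf[OF V e'(1)] e'(2) by simp
      then have "\<pi> V (\<beta> V e) = 0" using exact(3)[OF V] \<alpha>(1)[OF V e'(1)] by blast
      then have "\<gamma> V b = \<gamma> V 0" using e(4) a0[OF V] by simp
      then show ?thesis using \<gamma>(3)[OF V e(1) exte_zero[OF T_ob[OF V] Z(2)]] by blast
    qed
    show "a = 0" if V: "V \<in> T" and r: "?R V a 0" for V a
    proof -
      obtain e where e: "exte C e V Y" "a = push C g e" "\<gamma> V 0 = \<pi> V (\<beta> V e)" using r by blast
      have "\<beta> V e \<in> {v\<in>Val M V. \<pi> V v = 0}" using e(3) a0[OF V] \<beta>(1)[OF V e(1)] by simp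
      then obtain l where l: "l \<in> Val L V" "\<beta> V e = i V l" using exact(3)[OF V] by blast
      obtain e' where e': "exte C e' V X" "\<alpha> V e' = l" using \<alpha>(4)[OF V l(1)] by blast
      have "\<beta> V (push C f e') = \<beta> V e" using bf[OF V e'(1)] e'(2) l(2) by simp
      then have "e = push C f e'" using \<beta>(3)[OF V exte_push[OF e'(1) f(1)] e(1)] by simp
      then show ?thesis using comp[OF V e'(1)] e(2) by simp
    qed
    show "?R V (pull C h a) (pull C h b)" if t: "V \<in> T" "W \<in> T" "arr C h V W" and r: "?R W a b" for V W h a b
    proof -
      obtain e where e: "exte C b W Z" "exte C e W Y" "a = push C g e" "\<gamma> W b = \<pi> W (\<beta> W e)" using r by blast
      have "\<gamma> V (pull C h b) = \<pi> V (\<beta> V (pull C h e))"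
        using \<gamma>(5)[OF t(1-3) e(1)] \<beta>(5)[OF t(1-3) e(2)] np[OF t(1-3) \<beta>(1)[OF t(2) e(2)]] e(4) by simp
      then show ?thesis
        using exte_pull[OF e(1) t(3)] exte_pull[OF e(2) t(3)] push_pull_commute[OF e(2) g(1) t(3)] e(3) by metis
    qed
  qed
  then have "(cY - cX - c1) + (c1 - cZ) \<in> K.Rel" using K.rel_add[OF g(3)] by blast
  then show ?thesis by simp
qed

text \<open>All resolutions give the same coset by Schanuel's lemma, so the choice made in
  \<open>ind\<close> may be replaced by any resolution at hand.\<close>

lemma ind_eq: "is_ind X c \<Longrightarrow> ind C T X = K.cls c"
proof -
  assume c: "is_ind X c"
  let ?P = "\<lambda>v. \<exists>K R x y. K \<in> T \<and> R \<in> T \<and> conflation C K R X x y \<and> v = K.cls (frag_of R - frag_of K)"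
  have "?P (K.cls c)" using c unfolding is_ind_def conflation_def by blast
  moreover have "v = K.cls c" if "?P v" for v
  proof -
    obtain K R x y where K: "K \<in> T" "R \<in> T" "conflation C K R X x y" "v = K.cls (frag_of R - frag_of K)" using \<open>?P v\<close> by blast
    have "is_ind X (frag_of R - frag_of K)" using K unfolding is_ind_def conflation_def by blast
    then show ?thesis using K.class_eq_iff[OF is_ind_keys is_ind_keys[OF c]] is_ind_unique[OF _ c] K(4) by blast
  qed
  ultimately show ?thesis unfolding ind_def by (rule someI2)
qed

lemma coind_eq: "is_coind X c \<Longrightarrow> coind C T X = K.cls c"
proof -
  assume c: "is_coind X c"
  let ?P = "\<lambda>v. \<exists>L D x y. L \<in> T \<and> D \<in> T \<and> conflation C X L D x y \<and> v = K.cls (frag_of L - frag_of D)"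
  have "?P (K.cls c)" using c unfolding is_coind_def conflation_def by blast
  moreover have "v = K.cls c" if "?P v" for v
  proof -
    obtain K R x y where K: "K \<in> T" "R \<in> T" "conflation C X K R x y" "v = K.cls (frag_of K - frag_of R)" using \<open>?P v\<close> by blast
    have "is_coind X (frag_of K - frag_of R)" using K unfolding is_coind_def conflation_def by blast
    then show ?thesis using K.class_eq_iff[OF is_coind_keys is_coind_keys[OF c]] is_coind_unique[OF _ c] K(4) by blast
  qed
  ultimately show ?thesis unfolding coind_def by (rule someI2)
qed

lemma beta_eq: "is_beta X c \<Longrightarrow> coind C T X \<otimes>\<^bsub>K0T C T\<^esub> inv\<^bsub>K0T C T\<^esub> ind C T X = K.cls c"
proof -
  assume "is_beta X c"
  then obtain a b where ab: "is_coind X a" "is_ind X b" "c = a - b" unfolding is_beta_def by blast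
  then show ?thesis using K.class_diff[OF is_coind_keys[OF ab(1)] is_ind_keys[OF ab(2)]] ind_eq coind_eq by simp
qed

end

section \<open>The Grothendieck group of finite-dimensional modules\<close>

lemma module_isomorphic_sym:
  assumes M: "is_module C T emb s M" and N: "is_module C T emb t N" and iso: "module_isomorphic C T s M t N"
  shows "module_isomorphic C T t N s M"
proof -
  obtain \<alpha> where \<alpha>: "module_hom C T s M t N \<alpha>" and b: "\<And>X. X \<in> T \<Longrightarrow> bij_betw (\<alpha> X) (Val M X) (Val N X)"
    using iso unfolding module_isomorphic_def by blast
  define \<beta> where "\<beta> X = inv_into (Val M X) (\<alpha> X)" for X
  have lin: "linear_map_on s (Val M X) t (Val N X) (\<alpha> X)" if "X \<in> T" for X
    using \<alpha> that by (simp add: module_hom_def)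
  have ba: "\<beta> X (\<alpha> X v) = v" if "X \<in> T" "v \<in> Val M X" for X v
    unfolding \<beta>_def using bij_betw_inv_into_left[OF b[OF that(1)] that(2)] .
  have surj: "\<exists>v\<in>Val M X. w = \<alpha> X v" if "X \<in> T" "w \<in> Val N X" for X w
    using bij_betw_imp_surj_on[OF b[OF that(1)]] that(2) by blast
  have sM: "subsp s (Val M X)" "vector_space s" if "X \<in> T" for X using M that by (auto simp: is_module_def)
  have "module_hom C T t N s M \<beta>"
    unfolding module_hom_def semilinear_on_def
  proof (intro conjI ballI allI)
    fix X x assume X: "X \<in> T" and x: "x \<in> Val N X"
    interpret v: vector_space s using sM[OF X] by blast
    obtain a where a: "a \<in> Val M X" "x = \<alpha> X a" using surj[OF X x] by blast
    show "\<beta> X x \<in> Val M X" using ba[OF X a(1)] a by simp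
    show "\<beta> X (t c x) = s (id c) (\<beta> X x)" for c
      using ba[OF X v.subspace_scale[OF sM(1)[OF X] a(1)]] ba[OF X a(1)] linear_map_onD(3)[OF lin[OF X] a(1)] a(2)
      by simp
    fix y assume y: "y \<in> Val N X"
    obtain b where b: "b \<in> Val M X" "y = \<alpha> X b" using surj[OF X y] by blast
    show "\<beta> X (x + y) = \<beta> X x + \<beta> X y"
      using ba[OF X v.subspace_add[OF sM(1)[OF X] a(1) b(1)]] ba[OF X a(1)] ba[OF X b(1)]
        linear_map_onD(2)[OF lin[OF X] a(1) b(1)] a(2) b(2) by simp
  next
    fix X Y f v assume X: "X \<in> T" and Y: "Y \<in> T" and f: "f \<in> Hom C X Y" and v: "v \<in> Val N Y"
    obtain a where a: "a \<in> Val M Y" "v = \<alpha> Y a" using surj[OF Y v] by blast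
    have "linear_map_on s (Val M Y) s (Val M X) (Act M f)" using M X Y f by (simp add: is_module_def)
    then have fa: "Act M f a \<in> Val M X" using linear_map_onD(1) a(1) by metis
    have "\<alpha> X (Act M f a) = Act N f (\<alpha> Y a)" using \<alpha> X Y f a(1) by (simp add: module_hom_def)
    then show "\<beta> X (Act N f v) = Act M f (\<beta> Y v)" using ba[OF X fa] ba[OF Y a(1)] a(2) by simp
  qed
  moreover have "bij_betw (\<beta> X) (Val N X) (Val M X)" if "X \<in> T" for X
    unfolding \<beta>_def using bij_betw_inv_into[OF b[OF that]] .
  ultimately show ?thesis unfolding module_isomorphic_def by blast
qed

lemma module_isomorphic_trans:
  assumes "module_isomorphic C T s M t N" "module_isomorphic C T t N u L"
  shows "module_isomorphic C T s M u L"
proof -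
  obtain \<alpha> where \<alpha>: "module_hom C T s M t N \<alpha>" "\<forall>X\<in>T. bij_betw (\<alpha> X) (Val M X) (Val N X)"
    using assms(1) unfolding module_isomorphic_def by blast
  obtain \<beta> where \<beta>: "module_hom C T t N u L \<beta>" "\<forall>X\<in>T. bij_betw (\<beta> X) (Val N X) (Val L X)"
    using assms(2) unfolding module_isomorphic_def by blast
  have "module_hom C T s M u L (\<lambda>X. \<beta> X \<circ> \<alpha> X)"
    using \<alpha>(1) \<beta>(1) unfolding module_hom_def semilinear_on_def by simp
  then show ?thesis
    unfolding module_isomorphic_def using \<alpha>(2) \<beta>(2) by (intro exI[of _ "\<lambda>X. \<beta> X \<circ> \<alpha> X"]) (auto intro: bij_betw_trans)
qed

lemma module_isomorphic_zero:
  assumes "module_isomorphic C T s M t N" "X \<in> T" "subsp s (Val M X)" "vector_space s" "vector_space t"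
  shows "Val M X = {0} \<Longrightarrow> Val N X = {0}" "fin_dim s (Val M X) \<Longrightarrow> fin_dim t (Val N X)"
    "fin_dim s (Val M X) \<Longrightarrow> vector_space.dim t (Val N X) = vector_space.dim s (Val M X)"
proof -
  obtain \<alpha> where \<alpha>: "linear_map_on s (Val M X) t (Val N X) (\<alpha> X)" "bij_betw (\<alpha> X) (Val M X) (Val N X)"
    using assms(1,2) unfolding module_isomorphic_def module_hom_def by blast
  interpret p: vector_space_pair s t using assms(4,5) by (simp add: vector_space_pair_def)
  have z: "\<alpha> X 0 = 0" using p.lin_zero[OF \<alpha>(1) assms(3)] .
  have im: "\<alpha> X ` Val M X = Val N X" using bij_betw_imp_surj_on[OF \<alpha>(2)] .
  show "Val M X = {0} \<Longrightarrow> Val N X = {0}" using im z by simp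
  show "fin_dim s (Val M X) \<Longrightarrow> fin_dim t (Val N X)" using p.lin_image_fin_dim[OF \<alpha>(1) assms(3)] im by simp
  have "x = 0" if "x \<in> Val M X" "\<alpha> X x = 0" for x
    using inj_onD[OF bij_betw_imp_inj_on[OF \<alpha>(2)] _ that(1) p.vs1.subspace_0[OF assms(3)]] z that(2) by simp
  then show "fin_dim s (Val M X) \<Longrightarrow> p.vs2.dim (Val N X) = p.vs1.dim (Val M X)"
    using p.dim_injective_image[OF \<alpha>(1) assms(3)] im by simp
qed

lemma fd_module_transport:
  assumes M: "is_fd_module C T I emb s M" and N: "is_module C T emb t N" and IT: "I \<subseteq> T"
    and iso: "module_isomorphic C T s M t N"
  shows "is_fd_module C T I emb t N"
proof -
  have m: "vector_space s" "vector_space t" "\<And>X. X \<in> T \<Longrightarrow> subsp s (Val M X)"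
    using M N by (auto simp: is_fd_module_def is_module_def)
  note z = module_isomorphic_zero[OF iso _ m(3) m(1,2)]
  have "{X \<in> I. Val N X \<noteq> {0}} \<subseteq> {X \<in> I. Val M X \<noteq> {0}}" using z(1) IT by blast
  then have "finite {X \<in> I. Val N X \<noteq> {0}}" using M finite_subset unfolding is_fd_module_def by blast
  moreover have "\<forall>P\<in>T \<inter> projectives C. Val N P = {0}" using M z(1) unfolding is_fd_module_def by blast
  moreover have "\<forall>X\<in>T. fin_dim t (Val N X)" using M z(2) unfolding is_fd_module_def by blast
  ultimately show ?thesis using N unfolding is_fd_module_def by blast
qed

lemma fd_grothendieck: "grothendieck (fd_modules C T I emb) (fd_sequences C T I emb)"
  by unfold_locales (auto simp: fd_sequences_def)

definition zero_module :: "('o, 'm, nat \<Rightarrow> 'f::field) tmod" where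
  "zero_module = \<lparr>Val = (\<lambda>_. {0}), Act = (\<lambda>_ _. 0)\<rparr>"

lemma zero_module: "zero_module \<in> fd_modules C T I emb"
proof -
  have "seq.subspace {0}" by (rule seq.subspaceI) auto
  moreover have "fin_dim seq_scale {0}" by (rule seq.fin_dimI[of "{}"]) auto
  ultimately show ?thesis
    unfolding fd_modules_def is_fd_module_def is_module_def zero_module_def semilinear_on_def
    using vector_space_seq by auto
qed

text \<open>An isomorphism is a short exact sequence with zero kernel, and the class of the zero
  module vanishes by the sequence all of whose terms are zero.\<close>

lemma iso_class:
  fixes emb :: "'k::field \<Rightarrow> 'f::field" and N :: "('a, 'b::ab_group_add, nat \<Rightarrow> 'f) tmod"
  assumes N: "N \<in> fd_modules C T I emb" "N' \<in> fd_modules C T I emb"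
    and iso: "module_isomorphic C T seq_scale N seq_scale N'"
  shows "frag_of N - frag_of N' \<in> K0_relations (fd_modules C T I emb) (fd_sequences C T I emb)"
proof -
  interpret g: grothendieck "fd_modules C T I emb" "fd_sequences C T I emb" by (rule fd_grothendieck)
  obtain \<alpha> where \<alpha>: "module_hom C T seq_scale N seq_scale N' \<alpha>" "\<forall>X\<in>T. bij_betw (\<alpha> X) (Val N X) (Val N' X)"
    using iso unfolding module_isomorphic_def by blast
  have m: "is_module C T emb seq_scale N" "is_module C T emb seq_scale N'" using N by (auto simp: fd_modules_def is_fd_module_def)
  have sub: "seq.subspace (Val N X)" "seq.subspace (Val N' X)" if "X \<in> T" for X using m that by (auto simp: is_module_def)
  interpret pp: vector_space_pair "seq_scale :: 'f \<Rightarrow> _" "seq_scale :: 'f \<Rightarrow> _" ..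
  have act0: "Act N f 0 = 0" if "X \<in> T" "Y \<in> T" "f \<in> Hom C X Y" for X Y f
    using pp.lin_zero[OF _ sub(1)[OF that(2)], of "Val N X" "Act N f"] m(1) that by (simp add: is_module_def)
  have inc: "module_hom C T seq_scale zero_module seq_scale N (\<lambda>_ _. 0)"
    unfolding module_hom_def semilinear_on_def using act0 seq.subspace_0[OF sub(1)] by (simp add: zero_module_def)
  have ker: "{v \<in> Val N X. \<alpha> X v = 0} = {0}" if X: "X \<in> T" for X
  proof -
    have lin: "linear_map_on seq_scale (Val N X) seq_scale (Val N' X) (\<alpha> X)" using \<alpha>(1) X by (simp add: module_hom_def)
    have z: "\<alpha> X 0 = 0" using pp.lin_zero[OF lin sub(1)[OF X]] .
    have "v = 0" if "v \<in> Val N X" "\<alpha> X v = 0" for v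
      using inj_onD[OF bij_betw_imp_inj_on[OF bspec[OF \<alpha>(2) X]] _ that(1) seq.subspace_0[OF sub(1)[OF X]]] z that(2) by simp
    then show ?thesis using seq.subspace_0[OF sub(1)[OF X]] z by auto
  qed
  have "short_exact C T seq_scale zero_module N N'"
    unfolding short_exact_def
  proof (intro exI conjI ballI)
    show "module_hom C T seq_scale zero_module seq_scale N (\<lambda>_ _. 0)" by (rule inc)
    show "module_hom C T seq_scale N seq_scale N' \<alpha>" by (rule \<alpha>(1))
    fix X assume X: "X \<in> T"
    show "inj_on (\<lambda>_. 0) (Val zero_module X)" by (simp add: zero_module_def)
    show "\<alpha> X ` Val N X = Val N' X" using bij_betw_imp_surj_on[OF bspec[OF \<alpha>(2) X]] .
    show "(\<lambda>_. 0) ` Val zero_module X = {v \<in> Val N X. \<alpha> X v = 0}" unfolding ker[OF X] by (simp add: zero_module_def)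
  qed
  then have "(zero_module, N, N') \<in> fd_sequences C T I emb"
    using N zero_module by (simp add: fd_sequences_def)
  then have 1: "frag_of N - frag_of zero_module - frag_of N' \<in> g.Rel" by (rule g.rel_gen)
  define z where "z = (zero_module :: ('a, 'b, nat \<Rightarrow> 'f) tmod)"
  have z: "z \<in> fd_modules C T I emb" unfolding z_def by (rule zero_module)
  have "short_exact C T seq_scale z z z"
    unfolding short_exact_def module_hom_def semilinear_on_def z_def zero_module_def
    by (intro exI[of _ "\<lambda>_ _. 0"]) simp
  then have "(z, z, z) \<in> fd_sequences C T I emb"
    using z by (simp add: fd_sequences_def)
  then have "frag_of z - frag_of z - frag_of z \<in> g.Rel" by (rule g.rel_gen)
  then have 2: "- frag_of zero_module \<in> g.Rel" by (simp add: z_def)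
  show ?thesis using g.rel_diff[OF 1 2] by simp
qed

lemma fd_class_eq:
  assumes M: "is_module C T emb s M" and N: "N \<in> fd_modules C T I emb"
    and iso: "module_isomorphic C T s M seq_scale N"
  shows "fd_class C T I emb s M = K0_class (fd_modules C T I emb) (fd_sequences C T I emb) (frag_of N)"
proof -
  interpret g: grothendieck "fd_modules C T I emb" "fd_sequences C T I emb" by (rule fd_grothendieck)
  have step: "v = g.cls (frag_of N)"
    if h: "\<exists>N'\<in>fd_modules C T I emb. module_isomorphic C T s M seq_scale N' \<and> v = g.cls (frag_of N')" for v
  proof -
    obtain N' where N': "N' \<in> fd_modules C T I emb" "module_isomorphic C T s M seq_scale N'" "v = g.cls (frag_of N')"
      using h by blast
    have m: "is_module C T emb seq_scale N'" using N'(1) by (simp add: fd_modules_def is_fd_module_def)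
    have "module_isomorphic C T seq_scale N' seq_scale N"
      using module_isomorphic_trans[OF module_isomorphic_sym[OF M m N'(2)] iso] .
    then show ?thesis using iso_class[OF N'(1) N] g.class_eq_iff[of "frag_of N'" "frag_of N"] N N' by (simp add: keys_frag_of)
  qed
  have "\<exists>N'\<in>fd_modules C T I emb. module_isomorphic C T s M seq_scale N' \<and> g.cls (frag_of N) = g.cls (frag_of N')"
    by (rule bexI[OF _ N], rule conjI[OF iso refl])
  then show ?thesis unfolding fd_class_def by (rule someI2) (rule step)
qed

lemma module_isomorphic_refl: "is_module C T emb s M \<Longrightarrow> module_isomorphic C T s M s M"
  unfolding module_isomorphic_def module_hom_def semilinear_on_def
  by (intro exI[of _ "\<lambda>_ v. v"]) (auto simp: bij_betw_def inj_on_def)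

lemma fd_class_self:
  assumes "N \<in> fd_modules C T I emb"
  shows "fd_class C T I emb seq_scale N = K0_class (fd_modules C T I emb) (fd_sequences C T I emb) (frag_of N)"
proof -
  have "is_module C T emb seq_scale N" using assms by (simp add: fd_modules_def is_fd_module_def)
  then show ?thesis using fd_class_eq[OF _ assms module_isomorphic_refl] by blast
qed

text \<open>Dimensions of values are additive on short exact sequences. This is how information
  passes from a submodule over the algebraic closure to a module over the ground field with the same
  extended class.\<close>

lemma fd_class_dim:
  fixes emb :: "'k::field \<Rightarrow> 'f::field"
  assumes N: "N \<in> fd_modules C T I emb" "N' \<in> fd_modules C T I emb"
    and eq: "fd_class C T I emb seq_scale N = fd_class C T I emb seq_scale N'" and X: "X \<in> T"
  shows "seq.dim (Val N X) = seq.dim (Val N' X)"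
proof -
  interpret g: grothendieck "fd_modules C T I emb" "fd_sequences C T I emb" by (rule fd_grothendieck)
  have r: "frag_of N - frag_of N' \<in> g.Rel"
    using eq fd_class_self[OF N(1)] fd_class_self[OF N(2)] g.class_eq_iff[of "frag_of N" "frag_of N'"] N by (simp add: keys_frag_of)
  have add: "int (seq.dim (Val B X)) = int (seq.dim (Val A X)) + int (seq.dim (Val Z X))"
    if "(A, B, Z) \<in> fd_sequences C T I emb" for A B Z
  proof -
    have m: "is_fd_module C T I emb seq_scale A" "is_fd_module C T I emb seq_scale B" and ex: "short_exact C T seq_scale A B Z"
      using that by (auto simp: fd_sequences_def fd_modules_def)
    obtain \<alpha> \<gamma> where ag: "module_hom C T seq_scale A seq_scale B \<alpha> \<and> module_hom C T seq_scale B seq_scale Z \<gamma> \<and>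
       (\<forall>V\<in>T. inj_on (\<alpha> V) (Val A V) \<and> \<gamma> V ` Val B V = Val Z V \<and> \<alpha> V ` Val A V = {v\<in>Val B V. \<gamma> V v = 0})"
      using ex unfolding short_exact_def by (elim exE)
    have h: "module_hom C T seq_scale A seq_scale B \<alpha>" "module_hom C T seq_scale B seq_scale Z \<gamma>"
      "inj_on (\<alpha> X) (Val A X)" "\<gamma> X ` Val B X = Val Z X" "\<alpha> X ` Val A X = {v\<in>Val B X. \<gamma> X v = 0}"
      using ag X by simp_all
    interpret pp: vector_space_pair "seq_scale :: 'f \<Rightarrow> _" "seq_scale :: 'f \<Rightarrow> _" ..
    have l: "linear_map_on seq_scale (Val A X) seq_scale (Val B X) (\<alpha> X)" "linear_map_on seq_scale (Val B X) seq_scale (Val Z X) (\<gamma> X)"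
      using h X by (auto simp: module_hom_def)
    have s: "seq.subspace (Val A X)" "seq.subspace (Val B X)" "fin_dim seq_scale (Val A X)" "fin_dim seq_scale (Val B X)"
      using m X by (auto simp: is_fd_module_def is_module_def)
    have "v = 0" if "v \<in> Val A X" "\<alpha> X v = 0" for v
      using inj_onD[OF h(3) _ that(1) seq.subspace_0[OF s(1)]] pp.lin_zero[OF l(1) s(1)] that(2) by simp
    then have "seq.dim (\<alpha> X ` Val A X) = seq.dim (Val A X)" using pp.dim_injective_image[OF l(1) s(1,3)] by blast
    then show ?thesis using pp.rank_nullity[OF l(2) s(2,4)] h(4,5) by simp
  qed
  have "frag_eval (\<lambda>N. int (seq.dim (Val N X))) (frag_of N - frag_of N') = 0"
    by (rule g.frag_eval_rel[OF add r])
  then show ?thesis by (simp add: frag_eval_diff)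
qed

context mm_category
begin

text \<open>Extension of scalars along the identity replaces arbitrary values by sequence spaces,
  where the Grothendieck group is formed.\<close>

lemma seq_model_exists:
  assumes M: "is_fd_module C T I id s M"
  shows "\<exists>N\<in>fd_modules C T I id. module_isomorphic C T s M seq_scale N"
proof -
  interpret f: field_embedding "id :: 'a \<Rightarrow> 'a" by (rule field_embedding_id)
  interpret e: extendable_module C p T I s M "id :: 'a \<Rightarrow> 'a"
    using M by unfold_locales (auto simp: is_fd_module_def)
  have "module_hom C T s M seq_scale e.ext_mod e.eta"
    using e.scalar_extension_ext_mod unfolding scalar_extension_def module_hom_def by blast
  then have iso: "module_isomorphic C T s M seq_scale e.ext_mod"
    unfolding module_isomorphic_def using e.eta_bij by (intro exI[of _ e.eta]) auto
  have IT: "I \<subseteq> T" using I_sub by blast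
  show ?thesis using fd_module_transport[OF M e.ext_mod_is_module IT iso] iso unfolding fd_modules_def by blast
qed

lemma fd_module_realised:
  assumes M: "is_fd_module C T I id s M"
  shows "\<exists>X\<in>Ob C. module_isomorphic C T (escal C) (E_module C X) s M"
proof -
  interpret m: fd_tmodule C p T I s M using M by unfold_locales
  obtain X \<alpha> where "m.models X (Val M) \<alpha>" using m.models_exist[OF m.sub_whole] by blast
  then have a: "X \<in> Ob C" "\<And>V. V \<in> T \<Longrightarrow> bij_betw (\<alpha> V) (Ext C V X) (Val M V)"
    "\<And>V. V \<in> T \<Longrightarrow> linear_map_on (escal C) (Ext C V X) s (Val M V) (\<alpha> V)"
    "\<And>V V' f e. V \<in> T \<Longrightarrow> V' \<in> T \<Longrightarrow> arr C f V V' \<Longrightarrow> exte C e V' X \<Longrightarrow> \<alpha> V (pull C f e) = Act M f (\<alpha> V' e)"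
    unfolding m.models_def by blast+
  have "module_hom C T (escal C) (E_module C X) s M \<alpha>"
    unfolding module_hom_def E_module_def using a T_ob by (auto simp: arr_def exte_def)
  then have "module_isomorphic C T (escal C) (E_module C X) s M"
    unfolding module_isomorphic_def using a(2) by (intro exI[of _ \<alpha>]) (simp add: E_module_def)
  then show ?thesis using a(1) by blast
qed

definition module_beta :: "('b, 'c, nat \<Rightarrow> 'a) tmod \<Rightarrow> ('b \<Rightarrow>\<^sub>0 int)" where
  "module_beta N = (SOME c. \<exists>X\<in>Ob C. module_isomorphic C T (escal C) (E_module C X) seq_scale N \<and> is_beta X c)"

lemma module_beta:
  assumes "N \<in> fd_modules C T I id"
  shows "\<exists>X\<in>Ob C. module_isomorphic C T (escal C) (E_module C X) seq_scale N \<and> is_beta X (module_beta N)"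
proof -
  obtain X where "X \<in> Ob C" "module_isomorphic C T (escal C) (E_module C X) seq_scale N"
    using fd_module_realised assms unfolding fd_modules_def by blast
  then have "\<exists>c. \<exists>X\<in>Ob C. module_isomorphic C T (escal C) (E_module C X) seq_scale N \<and> is_beta X c"
    using is_beta_exists by blast
  then show ?thesis unfolding module_beta_def by (rule someI_ex)
qed

text \<open>The coindex minus the index of a realising object is prescribed on each module, extended
  linearly to formal combinations, and descends to the quotient since it is additive on short exact
  sequences. Only then does the choice in the definition of \<open>beta\<close> have the intended
  property.\<close>

lemma beta_exists:
  "\<exists>b. b \<in> hom (K0fd C T I id) (K0T C T) \<and>
     (\<forall>X\<in>Ob C. is_fd_module C T I id (escal C) (E_module C X) \<longrightarrow>
        b (fd_class C T I id (escal C) (E_module C X)) =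
          coind C T X \<otimes>\<^bsub>K0T C T\<^esub> inv\<^bsub>K0T C T\<^esub> ind C T X)"
proof -
  let ?S = "fd_modules C T I (id :: 'a \<Rightarrow> 'a)" and ?E = "fd_sequences C T I (id :: 'a \<Rightarrow> 'a)"
  interpret g: grothendieck ?S ?E by (rule fd_grothendieck)
  let ?e = "frag_extend module_beta"
  have keys: "Poly_Mapping.keys (?e c) \<subseteq> T" if "Poly_Mapping.keys c \<subseteq> ?S" for c
  proof -
    have "Poly_Mapping.keys (module_beta N) \<subseteq> T" if "N \<in> ?S" for N using module_beta[OF that] is_beta_keys by blast
    then show ?thesis using keys_frag_extend[of module_beta c] that by blast
  qed
  define h where "h c = K.cls (?e c)" for c
  have "h \<in> hom (free_Abelian_group ?S) (K0T C T)"
  proof (rule homI)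
    show "h c \<in> carrier (K0T C T)" if "c \<in> carrier (free_Abelian_group ?S)" for c
      unfolding h_def using K.class_carrier[OF keys] that by simp
    show "h (c \<otimes>\<^bsub>free_Abelian_group ?S\<^esub> d) = h c \<otimes>\<^bsub>K0T C T\<^esub> h d"
      if "c \<in> carrier (free_Abelian_group ?S)" "d \<in> carrier (free_Abelian_group ?S)" for c d
      unfolding h_def using K.class_mult[OF keys keys, of c d] that by (simp add: frag_extend_add)
  qed
  moreover have rel: "?e c \<in> K.Rel" if "c \<in> g.Rel" for c
    using that unfolding K0_relations_def[of ?S ?E]
  proof (induction c rule: generate.induct)
    case one
    then show ?case using K.rel_zero by simp
  next
    have gen: "?e h \<in> K.Rel" if "h \<in> {frag_of B - frag_of A - frag_of Z |A B Z. (A, B, Z) \<in> ?E}" for h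
    proof -
      obtain L M N where h: "h = frag_of M - frag_of L - frag_of N" "(L, M, N) \<in> ?E" using \<open>h \<in> _\<close> by blast
      then have fd: "L \<in> ?S" "M \<in> ?S" "N \<in> ?S" "short_exact C T seq_scale L M N" by (auto simp: fd_sequences_def)
      obtain X Y Z where X: "X \<in> Ob C" "module_isomorphic C T (escal C) (E_module C X) seq_scale L" "is_beta X (module_beta L)"
        and Y: "Y \<in> Ob C" "module_isomorphic C T (escal C) (E_module C Y) seq_scale M" "is_beta Y (module_beta M)"
        and Z: "Z \<in> Ob C" "module_isomorphic C T (escal C) (E_module C Z) seq_scale N" "is_beta Z (module_beta N)"
        using module_beta[OF fd(1)] module_beta[OF fd(2)] module_beta[OF fd(3)] by blast
      have m: "is_module C T id seq_scale L" "is_module C T id seq_scale M" "is_module C T id seq_scale N"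
        using fd by (auto simp: fd_modules_def is_fd_module_def)
      show ?thesis
        using is_beta_short_exact[OF X(2,1) Y(2,1) Z(2,1) m fd(4) X(3) Y(3) Z(3)] h(1) by (simp add: frag_extend_diff)
    qed
    {
      case (incl h)
      then show ?case by (rule gen)
    next
      case (inv h)
      then have "Poly_Mapping.keys h \<subseteq> ?S" using g.rel_gen g.rel_keys by blast
      then show ?case using K.rel_neg[OF gen[OF inv]] by (simp add: frag_extend_minus)
    }
  next
    case (eng h1 h2)
    then show ?case using K.rel_add by (simp add: frag_extend_add)
  qed
  moreover have "h c = h d"
    if "c \<in> carrier (free_Abelian_group ?S)" "d \<in> carrier (free_Abelian_group ?S)"
      "g.Rel #>\<^bsub>free_Abelian_group ?S\<^esub> c = g.Rel #>\<^bsub>free_Abelian_group ?S\<^esub> d" for c d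
  proof -
    have k: "Poly_Mapping.keys c \<subseteq> ?S" "Poly_Mapping.keys d \<subseteq> ?S" using that by auto
    have "c - d \<in> g.Rel" using that(3) g.class_eq_iff[OF k] unfolding K0_class_def by blast
    then have "?e c - ?e d \<in> K.Rel" using rel[of "c - d"] by (simp add: frag_extend_diff)
    then show ?thesis unfolding h_def using K.class_eq_iff[OF keys[OF k(1)] keys[OF k(2)]] by blast
  qed
  ultimately obtain b where b: "b \<in> hom (K0fd C T I id) (K0T C T)"
    "\<And>c. c \<in> carrier (free_Abelian_group ?S) \<Longrightarrow> b (g.Rel #>\<^bsub>free_Abelian_group ?S\<^esub> c) = h c"
    using FactGroup_universal[OF _ g.rel_normal, of h "K0T C T"] unfolding K0_def[of ?S ?E] by metis
  have "b (fd_class C T I id (escal C) (E_module C X)) = coind C T X \<otimes>\<^bsub>K0T C T\<^esub> inv\<^bsub>K0T C T\<^esub> ind C T X"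
    if X: "X \<in> Ob C" and fd: "is_fd_module C T I id (escal C) (E_module C X)" for X
  proof -
    obtain N where N: "N \<in> ?S" "module_isomorphic C T (escal C) (E_module C X) seq_scale N"
      using seq_model_exists[OF fd] by blast
    obtain Y where Y: "Y \<in> Ob C" "module_isomorphic C T (escal C) (E_module C Y) seq_scale N" "is_beta Y (module_beta N)"
      using module_beta[OF N(1)] by blast
    obtain c where c: "is_beta X c" using is_beta_exists[OF X] by blast
    have "b (fd_class C T I id (escal C) (E_module C X)) = h (frag_of N)"
      using fd_class_eq[OF E_module_is_module[OF X] N] b(2)[of "frag_of N"] N(1) unfolding K0_class_def by simp
    also have "\<dots> = K.cls (module_beta N)" unfolding h_def by simp
    also have "\<dots> = K.cls c"
      using K.class_eq_iff[OF is_beta_keys[OF Y(3)] is_beta_keys[OF c]] is_beta_module_iso[OF Y(2,1) N(2) X Y(3) c] by blast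
    finally show ?thesis using beta_eq[OF c] by simp
  qed
  then show ?thesis using b(1) by blast
qed

text \<open>Replaces an abstract value of \<open>beta\<close> by the resolutions of a concrete
  object \<open>Y\<close>, to which the dimension formulas apply.\<close>

lemma beta_of_class:
  assumes N: "N \<in> fd_modules C T I id"
  shows "\<exists>Y c. Y \<in> Ob C \<and> module_isomorphic C T (escal C) (E_module C Y) seq_scale N \<and> is_beta Y c \<and>
    beta C T I (fd_class C T I id seq_scale N) = K.cls c"
proof -
  have m: "is_fd_module C T I id seq_scale N" using N by (simp add: fd_modules_def)
  obtain Y where Y: "Y \<in> Ob C" "module_isomorphic C T (escal C) (E_module C Y) seq_scale N"
    using fd_module_realised[OF m] by blast
  have mm: "is_module C T id seq_scale N" using m by (simp add: is_fd_module_def)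
  have IT: "I \<subseteq> T" using I_sub by blast
  have fd: "is_fd_module C T I id (escal C) (E_module C Y)"
    using fd_module_transport[OF m E_module_is_module[OF Y(1)] IT module_isomorphic_sym[OF E_module_is_module[OF Y(1)] mm Y(2)]] .
  obtain c where c: "is_beta Y c" using is_beta_exists[OF Y(1)] by blast
  have cl: "fd_class C T I id (escal C) (E_module C Y) = fd_class C T I id seq_scale N"
    using fd_class_eq[OF E_module_is_module[OF Y(1)] N Y(2)] fd_class_self[OF N] by simp
  have "beta C T I (fd_class C T I id (escal C) (E_module C Y)) = coind C T Y \<otimes>\<^bsub>K0T C T\<^esub> inv\<^bsub>K0T C T\<^esub> ind C T Y"
    using someI_ex[OF beta_exists] fd Y(1) unfolding beta_def[symmetric] by blast
  then show ?thesis using Y c cl beta_eq[OF c] by auto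
qed

end

section \<open>Proper Laurent property\<close>

sublocale field_embedding \<subseteq> fk: vector_space "\<lambda>a f. emb a * f"
  by unfold_locales (simp_all add: emb_add emb_mult emb_one algebra_simps)

text \<open>The space \<open>V'\<close> plays the role of the tensor product of \<open>V\<close>
  with the larger field: \<eta> carries a basis of \<open>V\<close> to a basis of
  \<open>V'\<close>.\<close>

locale extended_space = field_embedding emb
  for emb :: "'k::field \<Rightarrow> 'f::field" +
  fixes s :: "'k \<Rightarrow> 'v::ab_group_add \<Rightarrow> 'v" and V :: "'v set" and V' :: "(nat \<Rightarrow> 'f) set"
    and \<eta> :: "'v \<Rightarrow> nat \<Rightarrow> 'f" and B :: "'v set"
  assumes vector: "vector_space s" and sub: "subsp s V"
    and semi: "semilinear_on emb s V seq_scale V' \<eta>"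
    and basis: "is_basis s B V" "finite B" "inj_on \<eta> B" "is_basis seq_scale (\<eta> ` B) V'"
begin

sublocale vs: vector_space s by (rule vector)

lemma eta_add: "x \<in> V \<Longrightarrow> y \<in> V \<Longrightarrow> \<eta> (x + y) = \<eta> x + \<eta> y"
  and eta_scale: "x \<in> V \<Longrightarrow> \<eta> (s a x) = seq_scale (emb a) (\<eta> x)"
  and eta_in: "x \<in> V \<Longrightarrow> \<eta> x \<in> V'"
  using semi by (auto simp: semilinear_on_def)

lemma eta_zero: "\<eta> 0 = 0"
  using eta_add[of 0 0] vs.subspace_0[OF sub] by simp

lemma eta_sum:
  assumes "\<And>i. i \<in> A \<Longrightarrow> u i \<in> V"
  shows "\<eta> (\<Sum>i\<in>A. s (a i) (u i)) = (\<Sum>i\<in>A. seq_scale (emb (a i)) (\<eta> (u i)))"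
  using assms
proof (induction A rule: infinite_finite_induct)
  case (insert i A)
  have 1: "s (a i) (u i) \<in> V" using insert vs.subspace_scale[OF sub] by simp
  have 2: "(\<Sum>i\<in>A. s (a i) (u i)) \<in> V"
    by (rule vs.subspace_sum[OF sub]) (use insert vs.subspace_scale[OF sub] in simp)
  show ?case using insert eta_add[OF 1 2] eta_scale by simp
qed (use eta_zero in auto)

lemma basisD: "B \<subseteq> V" "vs.independent B" "V \<subseteq> vs.span B" "\<eta> ` B \<subseteq> V'" "seq.independent (\<eta> ` B)" "V' \<subseteq> seq.span (\<eta> ` B)"
  using basis by (auto simp: is_basis_def)

text \<open>The scalars of a tensor can be made linearly independent over the small field. Such an
  expression is tied to vectors of \<open>V\<close> alone, which lets statements about
  \<open>V\<close> pass to \<open>V'\<close>.\<close>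

lemma tensor_form:
  assumes w: "w \<in> V'"
  shows "\<exists>J u. finite J \<and> \<not> fk.dependent J \<and> (\<forall>f\<in>J. u f \<in> V) \<and> w = (\<Sum>f\<in>J. seq_scale f (\<eta> (u f)))"
proof -
  obtain c where "w = (\<Sum>v\<in>\<eta> ` B. seq_scale (c v) v)"
    using w basisD(6) seq.span_finite[of "\<eta> ` B"] basis(2) by auto
  then have c: "w = (\<Sum>b\<in>B. seq_scale (c (\<eta> b)) (\<eta> b))"
    using sum.reindex[OF basis(3), of "\<lambda>v. seq_scale (c v) v"] by simp
  \<comment> \<open>\<open>J\<close> is a maximal independent set, over the small field, among the
    coordinates of \<open>w\<close> in the extended basis; rewriting the coordinates in terms of
    \<open>J\<close> collects the vectors \<open>u f\<close>.\<close>
  obtain J where J: "J \<subseteq> (\<lambda>b. c (\<eta> b)) ` B" "\<not> fk.dependent J" "(\<lambda>b. c (\<eta> b)) ` B \<subseteq> fk.span J"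
    using fk.maximal_independent_subset[of "(\<lambda>b. c (\<eta> b)) ` B"] by metis
  have fJ: "finite J" using J(1) basis(2) finite_subset by blast
  have "\<forall>b\<in>B. \<exists>a. c (\<eta> b) = (\<Sum>f\<in>J. emb (a f) * f)"
  proof
    fix b assume "b \<in> B"
    then have "c (\<eta> b) \<in> fk.span J" using J(3) by blast
    then show "\<exists>a. c (\<eta> b) = (\<Sum>f\<in>J. emb (a f) * f)" using fk.span_finite[OF fJ] by auto
  qed
  then obtain a where a: "\<And>b. b \<in> B \<Longrightarrow> c (\<eta> b) = (\<Sum>f\<in>J. emb (a b f) * f)" by metis
  define u where "u f = (\<Sum>b\<in>B. s (a b f) b)" for f
  have u: "u f \<in> V" for f unfolding u_def
    by (rule vs.subspace_sum[OF sub]) (use basisD(1) vs.subspace_scale[OF sub] in blast)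
  have eu: "\<eta> (u f) = (\<Sum>b\<in>B. seq_scale (emb (a b f)) (\<eta> b))" for f
    unfolding u_def using eta_sum[of B "\<lambda>b. b" "\<lambda>b. a b f"] basisD(1) by auto
  have "w = (\<Sum>b\<in>B. \<Sum>f\<in>J. seq_scale (emb (a b f) * f) (\<eta> b))"
    unfolding c using a by (intro sum.cong) (simp_all add: seq.scale_sum_left)
  also have "\<dots> = (\<Sum>f\<in>J. \<Sum>b\<in>B. seq_scale (emb (a b f) * f) (\<eta> b))" by (rule sum.swap)
  also have "\<dots> = (\<Sum>f\<in>J. seq_scale f (\<eta> (u f)))"
    unfolding eu by (simp add: seq.scale_sum_right mult.commute)
  finally show ?thesis using fJ J(2) u by (intro exI[of _ J] exI[of _ u]) simp
qed

text \<open>Comparing coordinates in the extended basis gives linear relations among the scalars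
  with coefficients in the small field, and independence makes these trivial.\<close>

lemma tensor_zero:
  assumes J: "finite J" "\<not> fk.dependent J" "\<And>f. f \<in> J \<Longrightarrow> u f \<in> V"
    and z: "(\<Sum>f\<in>J. seq_scale f (\<eta> (u f))) = 0" and f: "f \<in> J"
  shows "u f = 0"
proof -
  have "\<forall>f\<in>J. \<exists>r. u f = (\<Sum>b\<in>B. s (r b) b)"
  proof
    fix f assume "f \<in> J"
    then have "u f \<in> vs.span B" using J(3) basisD(3) by blast
    then show "\<exists>r. u f = (\<Sum>b\<in>B. s (r b) b)" using vs.span_finite[OF basis(2)] by auto
  qed
  then obtain r where r: "\<And>f. f \<in> J \<Longrightarrow> u f = (\<Sum>b\<in>B. s (r f b) b)" by metis
  have eu: "\<eta> (u f) = (\<Sum>b\<in>B. seq_scale (emb (r f b)) (\<eta> b))" if "f \<in> J" for f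
    unfolding r[OF that] using eta_sum[of B "\<lambda>b. b" "r f"] basisD(1) by auto
  have "0 = (\<Sum>f\<in>J. \<Sum>b\<in>B. seq_scale (emb (r f b) * f) (\<eta> b))"
    unfolding z[symmetric] using eu by (intro sum.cong) (simp_all add: seq.scale_sum_right mult.commute)
  also have "\<dots> = (\<Sum>b\<in>B. \<Sum>f\<in>J. seq_scale (emb (r f b) * f) (\<eta> b))" by (rule sum.swap)
  also have "\<dots> = (\<Sum>b\<in>B. seq_scale (\<Sum>f\<in>J. emb (r f b) * f) (\<eta> b))" by (simp add: seq.scale_sum_left)
  also have "\<dots> = (\<Sum>v\<in>\<eta> ` B. seq_scale (\<Sum>f\<in>J. emb (r f (inv_into B \<eta> v)) * f) v)"
    using sum.reindex[OF basis(3), of "\<lambda>v. seq_scale (\<Sum>f\<in>J. emb (r f (inv_into B \<eta> v)) * f) v"] basis(3) by simp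
  finally have zero: "(\<Sum>v\<in>\<eta> ` B. seq_scale (\<Sum>f\<in>J. emb (r f (inv_into B \<eta> v)) * f) v) = 0" by simp
  have "r f b = 0" if b: "b \<in> B" for b
  proof -
    have "(\<Sum>g\<in>J. emb (r g (inv_into B \<eta> (\<eta> b))) * g) = 0"
      using seq.independentD[OF basisD(5) finite_imageI[OF basis(2)] subset_refl zero imageI[OF b]] .
    then have "(\<Sum>g\<in>J. emb (r g b) * g) = 0" using b basis(3) by simp
    then show ?thesis using J(2) fk.dependent_finite[OF J(1)] f by metis
  qed
  then show ?thesis using r[OF f] by simp
qed

lemma functional_extends:
  assumes \<psi>: "linear_map_on s V (*) UNIV \<psi>"
  shows "\<exists>\<psi>'. linear_map_on seq_scale V' (*) UNIV \<psi>' \<and> (\<forall>v\<in>V. \<psi>' (\<eta> v) = emb (\<psi> v))"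
proof -
  define \<psi>' where "\<psi>' w = (\<Sum>b\<in>B. seq.representation (\<eta> ` B) w (\<eta> b) * emb (\<psi> b))" for w
  have lin: "linear_map_on seq_scale V' (*) UNIV \<psi>'"
    unfolding semilinear_on_def \<psi>'_def
  proof (intro conjI ballI allI)
    fix x y assume xy: "x \<in> V'" "y \<in> V'"
    have sp: "x \<in> seq.span (\<eta> ` B)" "y \<in> seq.span (\<eta> ` B)" using xy basisD(6) by auto
    show "(\<Sum>b\<in>B. seq.representation (\<eta> ` B) (x + y) (\<eta> b) * emb (\<psi> b)) =
        (\<Sum>b\<in>B. seq.representation (\<eta> ` B) x (\<eta> b) * emb (\<psi> b)) + (\<Sum>b\<in>B. seq.representation (\<eta> ` B) y (\<eta> b) * emb (\<psi> b))"
      using seq.representation_add[OF basisD(5) sp(2,1)] by (simp add: distrib_right sum.distrib)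
  next
    fix a x assume x: "x \<in> V'"
    have sp: "x \<in> seq.span (\<eta> ` B)" using x basisD(6) by auto
    show "(\<Sum>b\<in>B. seq.representation (\<eta> ` B) (seq_scale a x) (\<eta> b) * emb (\<psi> b)) =
        id a * (\<Sum>b\<in>B. seq.representation (\<eta> ` B) x (\<eta> b) * emb (\<psi> b))"
      using seq.representation_scale[OF basisD(5) sp] by (simp add: sum_distrib_left mult.assoc)
  qed simp
  interpret sf: vector_space_pair seq_scale "(*) :: 'f \<Rightarrow> 'f \<Rightarrow> 'f"
    by (simp add: vector_space_pair_def vector_space_seq vector_space_field)
  interpret vf: vector_space_pair s "(*) :: 'k \<Rightarrow> 'k \<Rightarrow> 'k"
    by (simp add: vector_space_pair_def vector vector_space_field)
  have on_basis: "\<psi>' (\<eta> b) = emb (\<psi> b)" if b: "b \<in> B" for b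
  proof -
    have "\<psi>' (\<eta> b) = (\<Sum>b'\<in>B. (if b' = b then emb (\<psi> b) else 0))"
      unfolding \<psi>'_def
    proof (rule sum.cong[OF refl])
      fix b' assume b': "b' \<in> B"
      have "\<eta> b = \<eta> b' \<longleftrightarrow> b' = b" using basis(3) b b' by (auto simp: inj_on_def)
      then show "seq.representation (\<eta> ` B) (\<eta> b) (\<eta> b') * emb (\<psi> b') = (if b' = b then emb (\<psi> b) else 0)"
        using seq.representation_basis[OF basisD(5) imageI[OF b]] by auto
    qed
    also have "\<dots> = emb (\<psi> b)" using b basis(2) by simp
    finally show ?thesis .
  qed
  have lsum: "\<psi>' (\<Sum>b\<in>A. seq_scale (a b) (\<eta> b)) = (\<Sum>b\<in>A. a b * \<psi>' (\<eta> b))" if "A \<subseteq> B" for A a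
  proof -
    have sp: "(\<Sum>b\<in>A. seq_scale (a b) (\<eta> b)) \<in> seq.span (\<eta> ` B)" if A: "A \<subseteq> B" for A
    proof (rule seq.span_sum)
      fix b assume "b \<in> A"
      then have "\<eta> b \<in> \<eta> ` B" using A by blast
      then show "seq_scale (a b) (\<eta> b) \<in> seq.span (\<eta> ` B)" by (intro seq.span_scale seq.span_base)
    qed
    have radd: "\<psi>' (x + y) = \<psi>' x + \<psi>' y" if "x \<in> seq.span (\<eta> ` B)" "y \<in> seq.span (\<eta> ` B)" for x y
      unfolding \<psi>'_def using seq.representation_add[OF basisD(5) that(2,1)] by (simp add: distrib_right sum.distrib)
    have rsc: "\<psi>' (seq_scale c x) = c * \<psi>' x" if "x \<in> seq.span (\<eta> ` B)" for c x
      unfolding \<psi>'_def seq.representation_scale[OF basisD(5) that] sum_distrib_left mult.assoc ..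
    have z: "\<psi>' 0 = 0" using rsc[OF seq.span_zero, of 0] by simp
    have "finite A" by (rule finite_subset[OF that basis(2)])
    then show ?thesis using that
    proof (induction A rule: finite_induct)
      case (insert b A)
      have "\<eta> b \<in> \<eta> ` B" using insert.prems by blast
      then have b: "\<eta> b \<in> seq.span (\<eta> ` B)" by (rule seq.span_base)
      have A: "A \<subseteq> B" using insert.prems by blast
      show ?case unfolding sum.insert[OF insert.hyps] radd[OF seq.span_scale[OF b] sp[OF A]] rsc[OF b] insert.IH[OF A] ..
    qed (simp add: z)
  qed
  have "\<psi>' (\<eta> v) = emb (\<psi> v)" if v: "v \<in> V" for v
  proof -
    have "v \<in> vs.span B" using v basisD(3) by blast
    then obtain r where r: "v = (\<Sum>b\<in>B. s (r b) b)" using vs.span_finite[OF basis(2)] by auto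
    have bV: "\<And>b. b \<in> B \<Longrightarrow> b \<in> V" using basisD(1) by blast
    have "\<eta> v = (\<Sum>b\<in>B. seq_scale (emb (r b)) (\<eta> b))"
      unfolding r using eta_sum[of B "\<lambda>b. b" r] bV by simp
    then have "\<psi>' (\<eta> v) = (\<Sum>b\<in>B. emb (r b) * emb (\<psi> b))" using lsum[OF subset_refl, of "\<lambda>b. emb (r b)"] on_basis by simp
    also have "\<dots> = emb (\<Sum>b\<in>B. r b * \<psi> b)" by (simp add: emb_sum emb_mult)
    also have "(\<Sum>b\<in>B. r b * \<psi> b) = \<psi> v" unfolding r using vf.lin_sum[OF \<psi> sub, of B "\<lambda>b. b" r] bV by simp
    finally show ?thesis .
  qed
  then show ?thesis using lin by blast
qed

end

lemma (in ct_category) ext_dim_sum: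
  assumes S: "direct_sum C [A, B] S" and Y: "Y \<in> Ob C"
  shows "ext.dim (Ext C S Y) = ext.dim (Ext C A Y) + ext.dim (Ext C B Y)"
proof -
  obtain i j q r where b: "biprod C A B S i j q r" using direct_sum_imp_biprod[OF S] by blast
  note s = biprodD[OF b]
  have lj: "linear_map_on (escal C) (Ext C S Y) (escal C) (Ext C B Y) (pull C j)" using pull_linear_map[OF Y s(2)] .
  have lq: "linear_map_on (escal C) (Ext C A Y) (escal C) (Ext C S Y) (pull C q)" using pull_linear_map[OF Y s(3)] .
  have E: "e \<in> Ext C V Y \<longleftrightarrow> exte C e V Y" if "V \<in> Ob C" for e V using that Y by (simp add: exte_def)
  have dec: "e = pull C q (pull C i e) + pull C r (pull C j e)" if e: "exte C e S Y" for e
    using pull_add_arr[OF e arr_comp[OF s(3,1)] arr_comp[OF s(4,2)]] s(9) pull_ext_id[OF e]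
      pull_pull[OF e s(1,3)] pull_pull[OF e s(2,4)] by simp
  have iq: "pull C i (pull C q e) = e" if "exte C e A Y" for e using pull_pull[OF that s(3,1)] s(5) pull_ext_id[OF that] by simp
  have jq: "pull C j (pull C q e) = 0" if "exte C e A Y" for e
    using pull_pull[OF that s(3,2)] s(7) pull_zero_arr[OF that s(11)] by simp
  have jr: "pull C j (pull C r e) = e" if "exte C e B Y" for e using pull_pull[OF that s(4,2)] s(6) pull_ext_id[OF that] by simp
  have "pull C j ` Ext C S Y = Ext C B Y"
  proof (intro equalityI subsetI)
    fix e assume "e \<in> Ext C B Y"
    then have e: "exte C e B Y" using E[OF s(11)] by simp
    show "e \<in> pull C j ` Ext C S Y" using jr[OF e] exte_pull[OF e s(4)] E[OF s(12)] by (metis imageI)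
  qed (use linear_map_onD(1)[OF lj] in blast)
  moreover have "{e\<in>Ext C S Y. pull C j e = 0} = pull C q ` Ext C A Y"
  proof (intro equalityI subsetI)
    fix e assume "e \<in> {e\<in>Ext C S Y. pull C j e = 0}"
    then have e: "exte C e S Y" "pull C j e = 0" using E[OF s(12)] by auto
    have "e = pull C q (pull C i e)" using dec[OF e(1)] e(2) pull_zero[OF Y s(4)] by simp
    then show "e \<in> pull C q ` Ext C A Y" using exte_pull[OF e(1) s(1)] E[OF s(10)] by blast
  next
    fix e assume "e \<in> pull C q ` Ext C A Y"
    then obtain a where a: "exte C a A Y" "e = pull C q a" using E[OF s(10)] by auto
    show "e \<in> {e\<in>Ext C S Y. pull C j e = 0}" using jq[OF a(1)] exte_pull[OF a(1) s(3)] a(2) E[OF s(12)] by simp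
  qed
  moreover have "x = 0" if x: "x \<in> Ext C A Y" "pull C q x = 0" for x
  proof -
    have "exte C x A Y" using x(1) E[OF s(10)] by simp
    then show ?thesis using iq[of x] x(2) pull_zero[OF Y s(1)] by simp
  qed
  then have "ext.dim (pull C q ` Ext C A Y) = ext.dim (Ext C A Y)"
    using ee.dim_injective_image[OF lq ext_subspace[OF s(10) Y] fin_dim_ext[OF s(10) Y]] by blast
  ultimately show ?thesis
    using ee.rank_nullity[OF lj ext_subspace[OF s(12) Y] fin_dim_ext[OF s(12) Y]] by simp
qed

context mm_category
begin

text \<open>The functional \<open>\<psi>\<close> which pairs with the extension \<open>d\<close> vanishes on the image of
  \<open>Ext R Z\<close> in \<open>Ext K Z\<close>, but on no non-zero submodule.\<close>

lemma submodule_dim_less: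
  fixes emb :: "'a \<Rightarrow> 'g::field"
  assumes R: "Real C K R Z d x y" "K \<in> T" "R \<in> T" and rigid: "Ext C Z Z = {0}"
    and emb: "field_embedding emb"
    and N: "scalar_extension C T emb (escal C) (E_module C Z) N \<eta>"
    and W: "\<And>X. X \<in> T \<Longrightarrow> W X \<subseteq> Val N X" "is_module C T emb seq_scale \<lparr>Val = W, Act = Act N\<rparr>"
    and nz: "V \<in> T" "W V \<noteq> {0}"
  shows "seq.dim (W R) < seq.dim (W K)"
proof -
  interpret f: field_embedding emb by (rule emb)
  note r = RealD[OF R(1)]
  have oZ: "Z \<in> Ob C" using r by blast
  have "\<exists>B. is_basis (escal C) B (Ext C X Z) \<and> inj_on (\<eta> X) B \<and> is_basis seq_scale (\<eta> X ` B) (Val N X)" if "X \<in> T" for X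
    using N that by (simp add: scalar_extension_def E_module_def)
  then obtain B where B: "\<And>X. X \<in> T \<Longrightarrow> is_basis (escal C) (B X) (Ext C X Z) \<and> inj_on (\<eta> X) (B X) \<and>
      is_basis seq_scale (\<eta> X ` B X) (Val N X)" by metis
  have fB: "finite (B X)" if X: "X \<in> T" for X
  proof -
    obtain A where A: "finite A" "Ext C X Z \<subseteq> ext.span A" using fin_dim_ext[OF T_ob[OF X] oZ] by (auto simp: fin_dim_def)
    show ?thesis using ext.independent_span_bound[OF A(1), of "B X"] B[OF X] A(2) by (auto simp: is_basis_def)
  qed
  have es: "extended_space emb (escal C) (Ext C X Z) (Val N X) (\<eta> X) (B X)" if X: "X \<in> T" for X
  proof (intro extended_space.intro extended_space_axioms.intro)
    show "field_embedding emb" by (rule emb)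
    show "vector_space (escal C)" by (rule ext_vector_space)
    show "subsp (escal C) (Ext C X Z)" using ext_subspace[OF T_ob[OF X] oZ] .
    show "semilinear_on emb (escal C) (Ext C X Z) seq_scale (Val N X) (\<eta> X)"
      using N X by (simp add: scalar_extension_def E_module_def)
    show "is_basis (escal C) (B X) (Ext C X Z)" "inj_on (\<eta> X) (B X)" "is_basis seq_scale (\<eta> X ` B X) (Val N X)"
      using B[OF X] by auto
    show "finite (B X)" using fB[OF X] .
  qed
  have E: "e \<in> Ext C X Z \<longleftrightarrow> exte C e X Z" if "X \<in> T" for e X using T_ob[OF that] oZ by (simp add: exte_def)
  have nat: "\<eta> X (pull C h e) = Act N h (\<eta> Y e)" if "X \<in> T" "Y \<in> T" "arr C h X Y" "exte C e Y Z" for X Y h e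
    using N that E[OF that(2)] by (simp add: scalar_extension_def E_module_def arr_def)
  interpret ss: vector_space_pair "seq_scale :: 'g \<Rightarrow> _" "seq_scale :: 'g \<Rightarrow> _" ..
  have sN: "seq.subspace (Val N X)" if "X \<in> T" for X
    using N that by (simp add: scalar_extension_def is_module_def)
  have lN: "linear_map_on seq_scale (Val N Y) seq_scale (Val N X) (Act N h)" if "X \<in> T" "Y \<in> T" "arr C h X Y" for X Y h
    using N that by (simp add: scalar_extension_def is_module_def arr_def)
  have tensor: "Act N h (\<Sum>f\<in>J. seq_scale f (\<eta> Y (u f))) = (\<Sum>f\<in>J. seq_scale f (\<eta> X (pull C h (u f))))"
    if t: "X \<in> T" "Y \<in> T" "arr C h X Y" "\<And>f. f \<in> J \<Longrightarrow> exte C (u f) Y Z" for X Y h J u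
  proof -
    interpret eY: extended_space emb "escal C" "Ext C Y Z" "Val N Y" "\<eta> Y" "B Y" by (rule es[OF t(2)])
    have "\<eta> Y (u f) \<in> Val N Y" if "f \<in> J" for f using eY.eta_in t(4)[OF that] E[OF t(2)] by blast
    then have "Act N h (\<Sum>f\<in>J. seq_scale f (\<eta> Y (u f))) = (\<Sum>f\<in>J. seq_scale f (Act N h (\<eta> Y (u f))))"
      using ss.lin_sum[OF lN[OF t(1-3)] sN[OF t(2)], of J "\<lambda>f. \<eta> Y (u f)" "\<lambda>f. f"] by simp
    then show ?thesis using nat[OF t(1-3) t(4)] by simp
  qed
  interpret eK: extended_space emb "escal C" "Ext C K Z" "Val N K" "\<eta> K" "B K" by (rule es[OF R(2)])
  interpret eR: extended_space emb "escal C" "Ext C R Z" "Val N R" "\<eta> R" "B R" by (rule es[OF R(3)])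
  interpret eV: extended_space emb "escal C" "Ext C V Z" "Val N V" "\<eta> V" "B V" by (rule es[OF nz(1)])
  \<comment> \<open>Rigidity enters here: a class on \<open>R\<close> that dies on \<open>K\<close>
    comes from Ext(Z,Z).\<close>
  have pull_inj: "e = 0" if e: "exte C e R Z" "pull C x e = 0" for e
  proof -
    obtain e' where e': "exte C e' Z Z" "pull C y e' = e" using ext_exact_middle_pull[OF R(1) e] by blast
    then have "e' = 0" using rigid by (simp add: exte_def)
    then show ?thesis using e'(2) pull_zero[OF oZ r(3)] by simp
  qed
  \<comment> \<open>Injectivity passes to the scalar extension by writing \<open>w\<close> with
    independent scalars, so that each vector of the tensor is killed separately.\<close>
  have inj: "w = 0" if w: "w \<in> Val N R" "Act N x w = 0" for w
  proof -
    obtain J u where J: "finite J" "\<not> f.fk.dependent J" "\<And>f. f \<in> J \<Longrightarrow> exte C (u f) R Z" "w = (\<Sum>f\<in>J. seq_scale f (\<eta> R (u f)))"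
      using eR.tensor_form[OF w(1)] E[OF R(3)] by metis
    have z: "(\<Sum>f\<in>J. seq_scale f (\<eta> K (pull C x (u f)))) = 0" using tensor[OF R(2,3) r(2) J(3)] w(2) J(4) by simp
    have pu: "pull C x (u f) \<in> Ext C K Z" if "f \<in> J" for f using exte_pull[OF J(3)[OF that] r(2)] E[OF R(2)] by simp
    have "u f = 0" if "f \<in> J" for f
      using eK.tensor_zero[OF J(1,2), of "\<lambda>f. pull C x (u f)", OF pu z that] pull_inj[OF J(3)[OF that]] by blast
    then show ?thesis using J(4) eR.eta_zero by simp
  qed
  have mW: "seq.subspace (W X)" if "X \<in> T" for X using W(2) that by (simp add: is_module_def)
  have fW: "fin_dim seq_scale (W X)" if X: "X \<in> T" for X
  proof -
    have "fin_dim seq_scale (Val N X)"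
      using scalar_extension_dim(3)[OF N X ext_vector_space] fin_dim_ext[OF T_ob[OF X] oZ] by (simp add: E_module_def)
    then show ?thesis using seq.fin_dim_subspace(1)[OF mW[OF X] W(1)[OF X] sN[OF X]] by blast
  qed
  have lW: "linear_map_on seq_scale (W Y) seq_scale (W X) (Act N h)" if "X \<in> T" "Y \<in> T" "arr C h X Y" for X Y h
    using W(2) that by (simp add: is_module_def arr_def)
  have im: "seq.dim (Act N x ` W R) = seq.dim (W R)"
    using ss.dim_injective_image[OF lW[OF R(2,3) r(2)] mW[OF R(3)] fW[OF R(3)]] inj W(1)[OF R(3)] by blast
  have sub: "Act N x ` W R \<subseteq> W K" using linear_map_onD(1)[OF lW[OF R(2,3) r(2)]] by blast
  have ims: "seq.subspace (Act N x ` W R)" using ss.lin_image_subspace[OF lW[OF R(2,3) r(2)] mW[OF R(3)]] .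
  have "Act N x ` W R \<noteq> W K"
  proof
    assume onto: "Act N x ` W R = W K"
    obtain w where w: "w \<in> W V" "w \<noteq> 0" using nz(2) seq.subspace_0[OF mW[OF nz(1)]] by blast
    have "w \<in> Val N V" using W(1)[OF nz(1)] w(1) by blast
    then obtain J u where J: "finite J" "\<not> f.fk.dependent J" "\<And>f. f \<in> J \<Longrightarrow> exte C (u f) V Z" "w = (\<Sum>f\<in>J. seq_scale f (\<eta> V (u f)))"
      using eV.tensor_form E[OF nz(1)] by metis
    have "\<exists>f0\<in>J. u f0 \<noteq> 0"
    proof (rule ccontr)
      assume "\<not> ?thesis"
      then have "w = 0" using J(4) eV.eta_zero by simp
      then show False using w(2) by simp
    qed
    then obtain f0 where f0: "f0 \<in> J" "u f0 \<noteq> 0" by blast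
    let ?\<psi> = "\<lambda>e. p K Z e d"
    have dE: "d \<in> Ext C Z K" using r(1) by (simp add: exte_def)
    have lpsi: "linear_map_on (escal C) (Ext C K Z) (*) UNIV ?\<psi>"
      using pairing_bilinear[OF r(4) oZ] dE by (simp add: bilinear_on_def)
    \<comment> \<open>The test class \<open>b\<close> detects one vector of \<open>w\<close>, and it
      is a push-out of \<open>d\<close> along some \<open>h\<close> because Ext(R,V) = 0. By
      adjunction the functional is then non-zero on the pull-back of that vector along
      \<open>h\<close>.\<close>
    obtain b where b: "exte C b Z V" "p V Z (u f0) b \<noteq> 0" using pairing_nondegenerate[OF J(3)[OF f0(1)]] f0(2) by blast
    obtain h where h: "arr C h K V" "push C h d = b"
      using ext_exists_push[OF R(1) b(1)] T_ext[OF _ R(3) nz(1)] by blast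
    have psi: "?\<psi> (pull C h (u f0)) \<noteq> 0" using pairing_pull[OF h(1) J(3)[OF f0(1)] r(1)] h(2) b(2) by simp
    obtain \<psi>' where p': "linear_map_on seq_scale (Val N K) (*) UNIV \<psi>'" "\<forall>v\<in>Ext C K Z. \<psi>' (\<eta> K v) = emb (?\<psi> v)"
      using eK.functional_extends[OF lpsi] by blast
    interpret sf: vector_space_pair seq_scale "(*) :: 'g \<Rightarrow> 'g \<Rightarrow> 'g"
      by (simp add: vector_space_pair_def vector_space_seq vector_space_field)
    have ev: "\<psi>' (\<Sum>f\<in>A. seq_scale f (\<eta> K (t f))) = (\<Sum>f\<in>A. f * emb (?\<psi> (t f)))" if t: "\<And>f. f \<in> A \<Longrightarrow> exte C (t f) K Z" for A t
    proof -
      have "\<eta> K (t f) \<in> Val N K" if "f \<in> A" for f using eK.eta_in t[OF that] E[OF R(2)] by blast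
      then have "\<psi>' (\<Sum>f\<in>A. seq_scale f (\<eta> K (t f))) = (\<Sum>f\<in>A. f * \<psi>' (\<eta> K (t f)))"
        using sf.lin_sum[OF p'(1) sN[OF R(2)], of A "\<lambda>f. \<eta> K (t f)" "\<lambda>f. f"] by simp
      then show ?thesis using p'(2) t E[OF R(2)] by simp
    qed
    have "Act N h w \<in> W K" using linear_map_onD(1)[OF lW[OF R(2) nz(1) h(1)] w(1)] .
    then obtain w' where w': "w' \<in> W R" "Act N h w = Act N x w'" using onto by (metis imageE)
    have "w' \<in> Val N R" using W(1)[OF R(3)] w'(1) by blast
    then obtain J' u' where J': "finite J'" "\<And>f. f \<in> J' \<Longrightarrow> exte C (u' f) R Z" "w' = (\<Sum>f\<in>J'. seq_scale f (\<eta> R (u' f)))"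
      using eR.tensor_form E[OF R(3)] by metis
    have zero: "?\<psi> (pull C x (u' f)) = 0" if "f \<in> J'" for f
    proof -
      have "linear_map_on (escal C) (Ext C Z R) (*) UNIV (p R Z (u' f))"
        using pairing_bilinear[OF r(5) oZ] J'(2)[OF that] by (simp add: bilinear_on_def exte_def)
      then have "p R Z (u' f) 0 = 0"
        using vector_space_pair.lin_zero[of "escal C" "(*)"] ext_subspace[OF oZ r(5)] ext_vector_space vector_space_field
        by (auto simp: vector_space_pair_def)
      then show ?thesis using pairing_pull[OF r(2) J'(2)[OF that] r(1)] real_push_zero[OF R(1)] by simp
    qed
    have "(\<Sum>f\<in>J. f * emb (?\<psi> (pull C h (u f)))) = \<psi>' (Act N h w)"
      using ev[of J "\<lambda>f. pull C h (u f)"] exte_pull[OF J(3) h(1)] tensor[OF R(2) nz(1) h(1) J(3)] J(4) by simp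
    also have "\<dots> = (\<Sum>f\<in>J'. f * emb (?\<psi> (pull C x (u' f))))"
      using ev[of J' "\<lambda>f. pull C x (u' f)"] exte_pull[OF J'(2) r(2)] tensor[OF R(2,3) r(2) J'(2)] J'(3) w'(2) by simp
    also have "\<dots> = 0" using zero f.emb_zero by simp
    \<comment> \<open>The functional takes values in the ground field, so this is a linear relation
      over it among the scalars in \<open>J\<close>, with a non-zero coefficient at
      \<open>f0\<close>.\<close>
    finally have "(\<Sum>f\<in>J. emb (?\<psi> (pull C h (u f))) * f) = 0" by (simp add: mult.commute)
    then have "f.fk.dependent J"
      unfolding f.fk.dependent_finite[OF J(1)] using f0(1) psi by (intro exI[of _ "\<lambda>f. ?\<psi> (pull C h (u f))"]) auto
    then show False using J(2) by blast
  qed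
  then show ?thesis
    using seq.subspace_eq_dim[OF ims sub mW[OF R(2)] fW[OF R(2)]] im by linarith
qed

text \<open>Every geometric point of a Grassmannian makes its exponent properly Laurent. The
  exponent is tested with a non-negative additive function on \<open>T\<close> that takes a negative
  value on it.\<close>

lemma index_plus_beta_negative:
  fixes emb :: "'a \<Rightarrow> 'g::field"
  assumes Z: "Z \<in> Ob C" "Z \<notin> T" and rigid: "Ext C Z Z = {0}" and emb: "field_embedding emb"
    and N: "scalar_extension C T emb (escal C) (E_module C Z) N \<eta>"
    and W: "W \<in> grassmannian_points C T I emb N \<gamma>"
  shows "\<exists>S\<in>I. Poly_Mapping.lookup (basis_coefficients I (ind C T Z \<otimes>\<^bsub>K0T C T\<^esub> beta C T I \<gamma>)) S < 0"
proof -
  obtain K R d x y where R: "K \<in> T" "R \<in> T" "Real C K R Z d x y" using right_resolution[OF Z(1)] by blast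
  define a where "a = frag_of R - frag_of K"
  have a: "is_ind Z a" unfolding is_ind_def a_def using R by blast
  have W1: "\<And>X. X \<in> T \<Longrightarrow> W X \<subseteq> Val N X" "is_fd_module C T I emb seq_scale \<lparr>Val = W, Act = Act N\<rparr>"
    and "\<exists>L L' \<eta>. L \<in> fd_modules C T I id \<and> fd_class C T I id seq_scale L = \<gamma> \<and>
       scalar_extension C T emb seq_scale L L' \<eta> \<and>
       fd_class C T I emb seq_scale \<lparr>Val = W, Act = Act N\<rparr> = fd_class C T I emb seq_scale L'"
    using W by (simp_all add: grassmannian_points_def)
  then obtain L L' \<eta>' where L: "L \<in> fd_modules C T I id" "fd_class C T I id seq_scale L = \<gamma>"
    "scalar_extension C T emb seq_scale L L' \<eta>'"
    "fd_class C T I emb seq_scale \<lparr>Val = W, Act = Act N\<rparr> = fd_class C T I emb seq_scale L'" by blast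
  have fdL: "is_fd_module C T I id seq_scale L" using L(1) by (simp add: fd_modules_def)
  note sd = scalar_extension_dim[OF L(3) _ vector_space_seq]
  have "is_fd_module C T I emb seq_scale L'"
    unfolding is_fd_module_def
  proof (intro conjI ballI)
    show "is_module C T emb seq_scale L'" using L(3) by (simp add: scalar_extension_def)
    show "Val L' P = {0}" if "P \<in> T \<inter> projectives C" for P using sd(2) fdL that by (simp add: is_fd_module_def)
    show "fin_dim seq_scale (Val L' X)" if "X \<in> T" for X using sd(3)[OF that] fdL that by (simp add: is_fd_module_def)
    have "{X \<in> I. Val L' X \<noteq> {0}} \<subseteq> {X \<in> I. Val L X \<noteq> {0}}" using sd(2) I_sub by blast
    then show "finite {X \<in> I. Val L' X \<noteq> {0}}" using fdL finite_subset unfolding is_fd_module_def by blast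
  qed
  then have L': "L' \<in> fd_modules C T I emb" by (simp add: fd_modules_def)
  have Wfd: "\<lparr>Val = W, Act = Act N\<rparr> \<in> fd_modules C T I emb" using W1(2) by (simp add: fd_modules_def)
  obtain Y c where Y: "Y \<in> Ob C" "module_isomorphic C T (escal C) (E_module C Y) seq_scale L" "is_beta Y c"
    "beta C T I \<gamma> = K.cls c" using beta_of_class[OF L(1)] L(2) by blast
  \<comment> \<open>The dimension is carried along a chain: from \<open>W\<close> to
    \<open>L'\<close> by equality of classes, to \<open>L\<close> by extension of scalars, and to E
    Y by isomorphism.\<close>
  have dimW: "seq.dim (W X) = ext.dim (Ext C X Y)" if X: "X \<in> T" for X
  proof -
    have "seq.dim (W X) = seq.dim (Val L X)" using fd_class_dim[OF Wfd L' L(4) X] sd(1)[OF X] by simp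
    also have "\<dots> = ext.dim (Ext C X Y)"
      using module_isomorphic_zero(3)[OF Y(2) X _ ext_vector_space vector_space_seq] ext_subspace[OF T_ob[OF X] Y(1)]
        fin_dim_ext[OF T_ob[OF X] Y(1)] by (simp add: E_module_def)
    finally show ?thesis .
  qed
  have kac: "Poly_Mapping.keys (a + c) \<subseteq> T" using keys_add[of a c] is_ind_keys[OF a] is_beta_keys[OF Y(3)] by blast
  have v: "ind C T Z \<otimes>\<^bsub>K0T C T\<^esub> beta C T I \<gamma> = K.cls (a + c)"
    using ind_eq[OF a] Y(4) K.class_mult[OF is_ind_keys[OF a] is_beta_keys[OF Y(3)]] by simp
  define b where "b = basis_coefficients I (K.cls (a + c))"
  have b: "Poly_Mapping.keys b \<subseteq> I" "b - (a + c) \<in> K.Rel" using basis_coefficients_class[OF kac] by (auto simp: b_def)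
  \<comment> \<open>\<open>D\<close> is the dimension vector of E Y if \<open>W\<close> is non-zero
    and that of E Z otherwise.\<close>
  have "\<exists>D. (\<forall>A Q S. (A, S, Q) \<in> split_sequences C T \<longrightarrow> int (D S) = int (D A) + int (D Q)) \<and> frag_eval (\<lambda>X. int (D X)) (a + c) < 0"
  proof (cases "\<exists>V\<in>T. W V \<noteq> {0}")
    case True
    then obtain V where V: "V \<in> T" "W V \<noteq> {0}" by blast
    let ?D = "\<lambda>X. ext.dim (Ext C X Y)"
    have "is_module C T emb seq_scale \<lparr>Val = W, Act = Act N\<rparr>" using W1(2) by (simp add: is_fd_module_def)
    then have "seq.dim (W R) < seq.dim (W K)" using submodule_dim_less[OF R(3,1,2) rigid emb N W1(1) _ V] by blast
    then have "frag_eval (\<lambda>X. int (?D X)) a < 0" using dimW R(1,2) by (simp add: a_def frag_eval_diff)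
    moreover have "frag_eval (\<lambda>X. int (?D X)) c = 0"
    proof -
      obtain a1 a2 where c12: "is_coind Y a1" "is_ind Y a2" "c = a1 - a2" using Y(3) unfolding is_beta_def by blast
      obtain P Q e u v where P: "P \<in> T" "Q \<in> T" "Real C Y P Q e u v" "a1 = frag_of P - frag_of Q"
        using c12(1) unfolding is_coind_def by blast
      obtain K' R' e' u' v' where R': "K' \<in> T" "R' \<in> T" "Real C K' R' Y e' u' v'" "a2 = frag_of R' - frag_of K'"
        using c12(2) unfolding is_ind_def by blast
      show ?thesis using dim_form_alternating[OF R'(3,1,2) P(3,1,2)] unfolding c12(3) P(4) R'(4) by (simp add: frag_eval_diff)
    qed
    moreover have "int (?D S) = int (?D A) + int (?D Q)" if "(A, S, Q) \<in> split_sequences C T" for A Q S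
      using ext_dim_sum[OF _ Y(1), of A Q S] that by (simp add: split_sequences_def)
    ultimately show ?thesis by (intro exI[of _ ?D]) (simp add: frag_eval_add)
  next
    case False
    let ?D = "\<lambda>X. ext.dim (Ext C X Z)"
    have dimN: "seq.dim (Val N X) = ?D X" if "X \<in> T" for X
      using scalar_extension_dim(1)[OF N that ext_vector_space] by (simp add: E_module_def)
    \<comment> \<open>If \<open>W\<close> vanishes, so do all classes by \<open>Y\<close> of objects
      of \<open>T\<close>. The contribution of beta is then trivial, and the estimate is applied to
      the whole module E Z, which is non-zero as \<open>Z\<close> is not in
      \<open>T\<close>.\<close>
    have "Y \<in> T"
    proof (rule T_memI[OF Y(1)])
      fix V e assume V: "V \<in> T" and e: "exte C e V Y"
      have "W V = {0}" using False V by blast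
      then have "seq.dim (W V) = 0"
        using seq.dim_eq_card_independent[OF seq.independent_empty] seq.dim_span[of "{}"]
        by (metis card.empty seq.span_empty)
      then have "Ext C V Y = {0}"
        using dimW[OF V] ext.dim_zero_iff[OF ext_subspace fin_dim_ext] T_ob[OF V] Y(1) by simp
      then show "e = 0" using e by (simp add: exte_def)
    qed
    then have cR: "c \<in> K.Rel" using is_beta_unique[OF Y(3) is_beta_T] by simp
    have "\<exists>V\<in>T. \<exists>e. exte C e V Z \<and> e \<noteq> 0" using T_memI[OF Z(1)] Z(2) by blast
    then obtain V e where V: "V \<in> T" "exte C e V Z" "e \<noteq> 0" by blast
    have "Ext C V Z \<noteq> {0}" using V by (auto simp: exte_def)
    then have "?D V \<noteq> 0" using ext.dim_zero_iff[OF ext_subspace fin_dim_ext] T_ob[OF V(1)] Z(1) by blast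
    then have nz: "Val N V \<noteq> {0}"
      using dimN[OF V(1)] seq.dim_span[of "{}"] seq.dim_eq_card_independent[OF seq.independent_empty]
      by (metis card.empty seq.span_empty)
    have mN: "is_module C T emb seq_scale \<lparr>Val = Val N, Act = Act N\<rparr>"
      using N by (cases N) (simp add: scalar_extension_def)
    have "seq.dim (Val N R) < seq.dim (Val N K)"
      using submodule_dim_less[OF R(3,1,2) rigid emb N _ mN V(1) nz] by blast
    then have "frag_eval (\<lambda>X. int (?D X)) a < 0" using dimN R(1,2) by (simp add: a_def frag_eval_diff)
    moreover have add: "int (?D S) = int (?D A) + int (?D Q)" if "(A, S, Q) \<in> split_sequences C T" for A Q S
      using ext_dim_sum[OF _ Z(1), of A Q S] that by (simp add: split_sequences_def)
    moreover have "frag_eval (\<lambda>X. int (?D X)) c = 0" by (rule K.frag_eval_rel[OF add cR])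
    ultimately show ?thesis by (intro exI[of _ ?D]) (simp add: frag_eval_add)
  qed
  then obtain D where D: "\<And>A Q S. (A, S, Q) \<in> split_sequences C T \<Longrightarrow> int (D S) = int (D A) + int (D Q)"
    "frag_eval (\<lambda>X. int (D X)) (a + c) < 0" by blast
  have "frag_eval (\<lambda>X. int (D X)) (b - (a + c)) = 0" by (rule K.frag_eval_rel[OF D(1) b(2)])
  then have neg: "frag_eval (\<lambda>X. int (D X)) b < 0" using D(2) by (simp add: frag_eval_diff)
  have "\<exists>S\<in>I. Poly_Mapping.lookup b S < 0"
  proof (rule ccontr)
    assume n: "\<not> ?thesis"
    have "0 \<le> frag_eval (\<lambda>X. int (D X)) b"
      unfolding frag_eval_def
    proof (rule sum_nonneg)
      fix S assume "S \<in> Poly_Mapping.keys b"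
      then have "0 \<le> Poly_Mapping.lookup b S" using b(1) n by (auto simp: not_less)
      then show "0 \<le> Poly_Mapping.lookup b S * int (D S)" by simp
    qed
    then show False using neg by simp
  qed
  then show ?thesis unfolding v b_def .
qed

end

text \<open>Additivity is applied to the empty set and itself; the empty set is constructible as the
  zero locus of the constant 1.\<close>

lemma euler_poincare_empty:
  assumes "euler_poincare k \<chi>" "0 \<in> k" "1 \<in> k" shows "\<chi> {} = 0"
proof -
  have "{v \<in> affine_space 0. (1 :: 'a) = 0} \<in> constructible k 0"
    using constructible.locus[OF poly_functions.const[OF assms(3)], of 0] by simp
  then have "proj_constructible k 0 {}" unfolding proj_constructible_def by simp
  then have "\<chi> ({} \<union> {}) = \<chi> {} + \<chi> {}" using assms(1) unfolding euler_poincare_def by blast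
  then show ?thesis by simp
qed

theorem theorem5p30:
  fixes C :: "('k::field, 'o, 'm::ab_group_add, 'e::ab_group_add) extri"
    and T I :: "'o set"
    and Z :: 'o
    and \<chi> :: "(nat \<Rightarrow> 'k alg_closure) set set \<Rightarrow> int"
  assumes "perfect_field TYPE('k)"
    and "euler_poincare (range (to_ac :: 'k \<Rightarrow> 'k alg_closure)) \<chi>"
    and "cluster_category TYPE('o2 \<times> 'm2::ab_group_add \<times> 'e2::ab_group_add) C"
    and "krull_schmidt C"
    and "cluster_tilting C T"
    and "indec_representatives C T I"
    and "maximally_mutable C I"
    and "Z \<in> Ob C" and "Z \<notin> T" and "Ext C Z Z = {0}"
    and "CC_defined C T I Z"
  shows "proper_laurent C T I (CC C T I \<chi> Z)"
proof -
  have "calabi_yau_category C"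
    using assms(3) unfolding cluster_category_def calabi_yau_category_def calabi_yau_category_axioms_def by blast
  then interpret cy: calabi_yau_category C .
  obtain p where p: "ext_pairing C p" using cy.ext_pairing_exists by blast
  have idem: "idempotent_complete C" using assms(3) unfolding cluster_category_def by blast
  interpret mm_category C p T I
    by unfold_locales (use p cy.ext_fin_dim assms(4-7) idem in auto)
  let ?emb = "to_ac :: 'k \<Rightarrow> 'k alg_closure"
  interpret f: field_embedding ?emb by (rule field_embedding_to_ac)
  interpret e: extendable_module C p T I "escal C" "E_module C Z" ?emb
    by unfold_locales (use E_module_is_module[OF assms(8)] fin_dim_ext[OF T_ob assms(8)] in \<open>auto simp: E_module_def\<close>)
  obtain N \<eta> where some: "(SOME (N, \<eta>). scalar_extension C T ?emb (escal C) (E_module C Z) N \<eta>) = (N, \<eta>)" by fastforce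
  have N: "scalar_extension C T ?emb (escal C) (E_module C Z) N \<eta>"
  proof -
    have "\<exists>x. case x of (N, \<eta>) \<Rightarrow> scalar_extension C T ?emb (escal C) (E_module C Z) N \<eta>"
      using e.scalar_extension_ext_mod by blast
    from someI_ex[OF this] show ?thesis unfolding some by simp
  qed
  have chi0: "\<chi> {} = 0"
    using euler_poincare_empty[OF assms(2)] to_ac_0 to_ac_1 by (metis rangeI)
  show ?thesis
    unfolding proper_laurent_def
  proof (intro ballI impI)
    fix v assume "v \<in> carrier (K0T C T)" and nz: "CC C T I \<chi> Z v \<noteq> 0"
    \<comment> \<open>A non-zero coefficient is a non-empty sum, so some class contributes with
      non-zero characteristic. As the empty set has characteristic 0, its Grassmannian has a
      geometric point.\<close>
    then have "{\<gamma> \<in> carrier (K0fd C T I id). \<chi> (quiver_grassmannian C T I ?emb (escal C) (E_module C Z) \<gamma>) \<noteq> 0 \<and>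
        ind C T Z \<otimes>\<^bsub>K0T C T\<^esub> beta C T I \<gamma> = v} \<noteq> {}"
      unfolding CC_def Let_def by (metis (no_types, lifting) sum.empty)
    then obtain \<gamma> where \<gamma>: "\<chi> (quiver_grassmannian C T I ?emb (escal C) (E_module C Z) \<gamma>) \<noteq> 0"
      "ind C T Z \<otimes>\<^bsub>K0T C T\<^esub> beta C T I \<gamma> = v"
      by blast
    have "quiver_grassmannian C T I ?emb (escal C) (E_module C Z) \<gamma> \<noteq> {}" using \<gamma>(1) chi0 by auto
    then have "grassmannian_points C T I ?emb N \<gamma> \<noteq> {}"
      unfolding quiver_grassmannian_def some by (simp add: Let_def)
    then obtain W where "W \<in> grassmannian_points C T I ?emb N \<gamma>" by blast
    then show "\<exists>S\<in>I. Poly_Mapping.lookup (basis_coefficients I v) S < 0"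
      using index_plus_beta_negative[OF assms(8-10) f.field_embedding_axioms N] \<gamma>(2) by blast
  qed
qed

end
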